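(* Let $\widetilde{\mathrm{Ext}}_{A_2}(A_2(Sq^4,Sq^5Sq^1))$ denote $\mathrm{Ext}_{A_2}(A_2(Sq^4,Sq^5Sq^1))$ without the $\mathbb{Z}_2$ in $\mathrm{Ext}^{0,4}$ or the tower beginning in $\mathrm{Ext}^{1,11}$. There is an exact sequence $$\to\mathrm{Ext}_{A_2}^{s+2,t}(\Sigma^6M_7)\to\widetilde{\mathrm{Ext}}_{A_2}^{s+2,t}(A_2(Sq^4,Sq^5Sq^1))\to\mathrm{Ext}_{A_2}^{s,t}(\Sigma^{16}B)\to\mathrm{Ext}_{A_2}^{s+3,t}(\Sigma^6M_7)\to.$$
   Context: $A_2$ is the subalgebra of the mod 2 Steenrod algebra generated by $Sq^1,Sq^2,Sq^4$; $\mathbb{Z}_2=\mathbb{Z}/2$; $\mathrm{Ext}_{A_2}(M)$ means $\mathrm{Ext}_{A_2}(M,\mathbb{Z}_2)$. $A_2(Sq^4,Sq^5Sq^1)$ is the left ideal of $A_2$ generated by $Sq^4$ and $Sq^5Sq^1$. A "tower" is an infinite $h_0$-tower: a $\mathbb{Z}_2$ in each filtration $\ge s_0$ of a fixed stem $t-s$, connected by multiplication by $h_0\in\mathrm{Ext}^{1,1}$; the tower beginning in $\mathrm{Ext}^{1,11}$ is the one whose bottom class lies in $\mathrm{Ext}^{1,11}$. $M_7$ is the $A_2$-module whose only nonzero groups are $\mathbb{Z}_2$ in dimensions $0,4,6,7$, with $Sq^7\ne0$ on the bottom class (so $M_7=H^*(S^0\cup_\nu e^4\cup_\eta e^6\cup_2e^7;\mathbb{Z}_2)$).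 $bo_2$ is the $bo$-Brown–Gitler spectrum for which $H_*(bo_2;\mathbb{Z}_2)$ is the span of all monomials of weight $\le8$ in $H_*(bo;\mathbb{Z}_2)=\mathbb{Z}_2[\zeta_1^4,\zeta_2^2,\zeta_3,\zeta_4,\dots]$, where $\zeta_i$ are the conjugates of the usual generators of the dual Steenrod algebra and the multiplicative weight is $\mathrm{wt}(\zeta_i)=2^{i-1}$. Its cohomology has top dimension 15. $B$ is the $A_2$-module in a short exact sequence of $A_2$-modules $$0\to\Sigma^{17}\mathbb{Z}_2\to B\to H^*(bo_2)\to0,$$ with the new class in dimension 17 equal to $Sq^4Sq^6Sq^7\iota_0$, or equivalently $Sq^4Sq^2Sq^3\iota_8$ (it also equals $Sq^2$ of the top class of $H^*(bo_2)$), where $\iota_0,\iota_8$ are the $A_2$-module generators of dimension 0 and 8. *)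

theory Defs
  imports "HOL-Library.Z2" "HOL-Library.Poly_Mapping" "HOL-Library.Product_Plus"
    "HOL-Library.Function_Algebras" "HOL-Algebra.Coset"
begin

section \<open>The mod 2 Steenrod algebra and its dual\<close>

text \<open>
  The dual Steenrod algebra is the polynomial algebra over the field with two elements
  (type \<^typ>\<open>bit\<close>) on \<open>\<xi>\<^sub>1, \<xi>\<^sub>2, \<dots>\<close>. The variable with index \<open>i\<close> of a monomial is \<open>\<xi>\<close> with index
  \<open>i + 1\<close>, so that \<open>\<xi>\<close> with index \<open>0\<close> is the unit.
\<close>

type_synonym mono = "nat \<Rightarrow>\<^sub>0 nat"
type_synonym dual_steenrod = "mono \<Rightarrow>\<^sub>0 bit"

definition mdeg :: "mono \<Rightarrow> nat" where
  "mdeg m = (\<Sum>i\<in>Poly_Mapping.keys m. Poly_Mapping.lookup m i * (2 ^ (i + 1) - 1))"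

definition xi_mono :: "nat \<Rightarrow> nat \<Rightarrow> mono" where
  "xi_mono n e = (if n = 0 then 0 else Poly_Mapping.single (n - 1) e)"

definition xi :: "nat \<Rightarrow> dual_steenrod" where
  "xi n = Poly_Mapping.single (xi_mono n 1) 1"

text \<open>
  The tensor square of the dual is the monoid algebra on pairs of monomials. The coproduct is the
  algebra homomorphism with \<open>\<psi> \<xi>\<^sub>n = (\<Sum>i\<le>n. \<xi>\<^sub>n\<^sub>-\<^sub>i ^ 2 ^ i \<otimes> \<xi>\<^sub>i)\<close> (Milnor).
\<close>

type_synonym dual_steenrod2 = "(mono \<times> mono) \<Rightarrow>\<^sub>0 bit"

definition psi_xi :: "nat \<Rightarrow> dual_steenrod2" where
  "psi_xi n = (\<Sum>i\<le>n. Poly_Mapping.single (xi_mono (n - i) (2 ^ i), xi_mono i 1) 1)"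

definition psi_mono :: "mono \<Rightarrow> dual_steenrod2" where
  "psi_mono m = (\<Prod>i\<in>Poly_Mapping.keys m. psi_xi (i + 1) ^ Poly_Mapping.lookup m i)"

definition psi :: "dual_steenrod \<Rightarrow> dual_steenrod2" where
  "psi x = (\<Sum>m\<in>Poly_Mapping.keys x. psi_mono m)"

text \<open>The conjugates \<open>\<zeta>\<^sub>n\<close> of the \<open>\<xi>\<^sub>n\<close>, from the antipode identity
  \<open>(\<Sum>i\<le>n. \<xi>\<^sub>n\<^sub>-\<^sub>i ^ 2 ^ i * \<zeta>\<^sub>i) = 0\<close> for \<open>n > 0\<close>.\<close>

fun zeta :: "nat \<Rightarrow> dual_steenrod" where
  "zeta 0 = 1"
| "zeta (Suc n) = (\<Sum>i\<le>n. xi (Suc n - i) ^ (2 ^ i) * zeta i)"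

text \<open>
  The Steenrod algebra is the graded dual, with product dual to \<open>\<psi>\<close>: its elements are the functions
  on monomials of finite support, a function being identified with a linear functional through the
  monomial basis, and \<open>Sq\<^sup>n\<close> is dual to \<open>\<xi>\<^sub>1 ^ n\<close>. The type of all functions is its completion;
  the subalgebra \<open>A2\<close> below lies in the part of finite support. The pointwise product of functions
  plays no role here.
\<close>

type_synonym steenrod = "mono \<Rightarrow> bit"

definition st_mult :: "steenrod \<Rightarrow> steenrod \<Rightarrow> steenrod" (infixl \<open>\<star>\<close> 70) where
  "a \<star> b = (\<lambda>m. \<Sum>(p, q)\<in>Poly_Mapping.keys (psi_mono m). a p * b q)"

definition Sq :: "nat \<Rightarrow> steenrod" where
  "Sq n = (\<lambda>m. if m = xi_mono 1 n then 1 else 0)"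

definition st_homogeneous :: "nat \<Rightarrow> steenrod \<Rightarrow> bool" where
  "st_homogeneous k a \<longleftrightarrow> (\<forall>m. a m \<noteq> 0 \<longrightarrow> mdeg m = k)"

inductive_set A2 :: "steenrod set" where
  "Sq 0 \<in> A2"   \<comment> \<open>the unit\<close>
| "Sq 1 \<in> A2"
| "Sq 2 \<in> A2"
| "Sq 4 \<in> A2"
| "a \<in> A2 \<Longrightarrow> b \<in> A2 \<Longrightarrow> a + b \<in> A2"
| "a \<in> A2 \<Longrightarrow> b \<in> A2 \<Longrightarrow> a \<star> b \<in> A2"

definition augmentation :: "steenrod \<Rightarrow> bit" where
  "augmentation a = a 0"


section \<open>Graded left modules\<close>

text \<open>The underlying vector space is the internal direct sum of the subspaces \<open>gr M n\<close>. The values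
  of \<open>act\<close> outside \<open>A2\<close> and \<open>total M\<close> are irrelevant.\<close>

record 'a gmod =
  gr :: "int \<Rightarrow> 'a set"
  act :: "steenrod \<Rightarrow> 'a \<Rightarrow> 'a"

definition total :: "'a::ab_group_add gmod \<Rightarrow> 'a set" where
  "total M = {\<Sum>n\<in>N. f n |N f. finite N \<and> (\<forall>n\<in>N. f n \<in> gr M n)}"

definition A2_module :: "'a::ab_group_add gmod \<Rightarrow> bool" where
  "A2_module M \<longleftrightarrow>
     (\<forall>n. 0 \<in> gr M n \<and> (\<forall>x\<in>gr M n. \<forall>y\<in>gr M n. x + y \<in> gr M n)) \<and>
     (\<forall>x\<in>total M. x + x = 0) \<and>
     (\<forall>N f. finite N \<and> (\<forall>n\<in>N. f n \<in> gr M n) \<and> (\<Sum>n\<in>N. f n) = 0 \<longrightarrow> (\<forall>n\<in>N. f n = 0)) \<and>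
     (\<forall>k n. \<forall>a\<in>A2. \<forall>x\<in>gr M n. st_homogeneous k a \<longrightarrow> act M a x \<in> gr M (int k + n)) \<and>
     (\<forall>a\<in>A2. \<forall>x\<in>total M. \<forall>y\<in>total M. act M a (x + y) = act M a x + act M a y) \<and>
     (\<forall>a\<in>A2. \<forall>b\<in>A2. \<forall>x\<in>total M. act M (a + b) x = act M a x + act M b x) \<and>
     (\<forall>a\<in>A2. \<forall>b\<in>A2. \<forall>x\<in>total M. act M (a \<star> b) x = act M a (act M b x)) \<and>
     (\<forall>x\<in>total M. act M (Sq 0) x = x)"

definition A2_hom :: "'a::ab_group_add gmod \<Rightarrow> 'b::ab_group_add gmod \<Rightarrow> ('a \<Rightarrow> 'b) \<Rightarrow> bool" where
  "A2_hom M N f \<longleftrightarrow>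
     (\<forall>x\<in>total M. \<forall>y\<in>total M. f (x + y) = f x + f y) \<and>
     (\<forall>n. f ` gr M n \<subseteq> gr N n) \<and>
     (\<forall>a\<in>A2. \<forall>x\<in>total M. f (act M a x) = act N a (f x))"

definition short_exact ::
    "'a::ab_group_add gmod \<Rightarrow> ('a \<Rightarrow> 'b) \<Rightarrow> 'b::ab_group_add gmod \<Rightarrow> ('b \<Rightarrow> 'c) \<Rightarrow>
     'c::ab_group_add gmod \<Rightarrow> bool" where
  "short_exact L i M p N \<longleftrightarrow>
     A2_hom L M i \<and> A2_hom M N p \<and> inj_on i (total L) \<and>
     i ` total L = {x \<in> total M. p x = 0} \<and> p ` total M = total N"

definition susp :: "int \<Rightarrow> 'a gmod \<Rightarrow> 'a gmod" where
  "susp k M = \<lparr>gr = (\<lambda>n. gr M (n - k)), act = act M\<rparr>"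

definition trivial_module :: "bit gmod" where
  "trivial_module = \<lparr>gr = (\<lambda>n. if n = 0 then UNIV else {0}), act = (\<lambda>a x. augmentation a * x)\<rparr>"


section \<open>Ext over \<open>A2\<close> with coefficients in the field with two elements\<close>

text \<open>
  Ext is computed by the bar resolution, which is a resolution by free modules because we are over a
  field: homomorphisms from \<open>A2 \<otimes> (A2 \<otimes> \<dots> \<otimes> A2) \<otimes> M\<close> (with \<open>s\<close> factors in the parentheses) to
  the \<open>t\<close>-fold suspension of the trivial module are the multilinear functions of \<open>s\<close> elements of
  \<open>A2\<close> and an element of \<open>M\<close> that are concentrated in internal degree \<open>t\<close>. Such a function is \<open>0\<close>
  outside its domain. For \<open>s < 0\<close> only the zero function qualifies, hence Ext vanishes there.
\<close>

type_synonym 'a cochain = "steenrod list \<Rightarrow> 'a \<Rightarrow> bit"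

definition cochains :: "'a::ab_group_add gmod \<Rightarrow> int \<Rightarrow> int \<Rightarrow> 'a cochain set" where
  "cochains M s t = {\<phi>.
     (\<forall>as x. \<phi> as x \<noteq> 0 \<longrightarrow> int (length as) = s \<and> set as \<subseteq> A2 \<and> x \<in> total M) \<and>
     (\<forall>as a b x i. set as \<subseteq> A2 \<and> a \<in> A2 \<and> b \<in> A2 \<and> x \<in> total M \<and> i < length as \<longrightarrow>
        \<phi> (as[i := a + b]) x = \<phi> (as[i := a]) x + \<phi> (as[i := b]) x) \<and>
     (\<forall>as x y. set as \<subseteq> A2 \<and> x \<in> total M \<and> y \<in> total M \<longrightarrow>
        \<phi> as (x + y) = \<phi> as x + \<phi> as y) \<and>
     (\<forall>as ks x n. set as \<subseteq> A2 \<and> list_all2 st_homogeneous ks as \<and> x \<in> gr M n \<and> \<phi> as x \<noteq> 0 \<longrightarrow>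
        int (sum_list ks) + n = t)}"

definition coboundary_map :: "'a::ab_group_add gmod \<Rightarrow> 'a cochain \<Rightarrow> 'a cochain" where
  "coboundary_map M \<phi> = (\<lambda>as x.
     if as \<noteq> [] \<and> set as \<subseteq> A2 \<and> x \<in> total M then
       augmentation (hd as) * \<phi> (tl as) x
       + (\<Sum>i<length as - 1. \<phi> (take i as @ [as ! i \<star> as ! (i + 1)] @ drop (i + 2) as) x)
       + \<phi> (butlast as) (act M (last as) x)
     else 0)"

definition cocycles :: "'a::ab_group_add gmod \<Rightarrow> int \<Rightarrow> int \<Rightarrow> 'a cochain set" where
  "cocycles M s t = {\<phi> \<in> cochains M s t. coboundary_map M \<phi> = 0}"

definition coboundaries :: "'a::ab_group_add gmod \<Rightarrow> int \<Rightarrow> int \<Rightarrow> 'a cochain set" where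
  "coboundaries M s t = coboundary_map M ` cochains M (s - 1) t"

definition cocycle_group :: "'a::ab_group_add gmod \<Rightarrow> int \<Rightarrow> int \<Rightarrow> 'a cochain monoid" where
  "cocycle_group M s t = \<lparr>carrier = cocycles M s t, monoid.mult = (+), one = 0\<rparr>"

definition Ext :: "'a::ab_group_add gmod \<Rightarrow> int \<Rightarrow> int \<Rightarrow> 'a cochain set monoid" where
  "Ext M s t = cocycle_group M s t Mod coboundaries M s t"

text \<open>
  The class \<open>h\<^sub>0\<close> of the trivial module in bidegree \<open>(1, 1)\<close> is represented by the cochain that takes
  the coefficient of \<open>Sq\<^sup>1\<close>, i.e. evaluates at \<open>\<xi>\<^sub>1\<close>. In the bar construction the Yoneda product with
  it is concatenation on the left, at the end next to the coefficients.
\<close>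

definition h0_cochain :: "'a cochain \<Rightarrow> 'a cochain" where
  "h0_cochain \<phi> =
     (\<lambda>as x. if as \<noteq> [] \<and> hd as \<in> A2 then hd as (xi_mono 1 1) * \<phi> (tl as) x else 0)"

definition h0 :: "'a::ab_group_add gmod \<Rightarrow> int \<Rightarrow> int \<Rightarrow> 'a cochain set \<Rightarrow> 'a cochain set" where
  "h0 M s t X =
     (\<Union>\<phi>\<in>X. coboundaries M (s + 1) (t + 1) #>\<^bsub>cocycle_group M (s + 1) (t + 1)\<^esub> h0_cochain \<phi>)"

text \<open>An infinite \<open>h\<^sub>0\<close>-tower whose bottom class lies in bidegree \<open>(s, t)\<close>; the group of order 2
  in bidegree \<open>(s + i, t + i)\<close> is \<open>T i\<close>.\<close>

definition h0_tower ::
    "'a::ab_group_add gmod \<Rightarrow> int \<Rightarrow> int \<Rightarrow> (nat \<Rightarrow> 'a cochain set set) \<Rightarrow> bool" where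
  "h0_tower M s t T \<longleftrightarrow>
     (\<forall>i. subgroup (T i) (Ext M (s + int i) (t + int i)) \<and> card (T i) = 2 \<and>
          T (Suc i) = h0 M (s + int i) (t + int i) ` T i)"


section \<open>The modules\<close>

definition ideal_module :: "steenrod gmod" where
  "ideal_module =
     \<lparr>gr = (\<lambda>n. {a \<star> Sq 4 + b \<star> (Sq 5 \<star> Sq 1) |a b. a \<in> A2 \<and> b \<in> A2} \<inter>
                {c. \<forall>m. c m \<noteq> 0 \<longrightarrow> int (mdeg m) = n}),
      act = (\<star>)\<rparr>"

definition is_M7 :: "'a::ab_group_add gmod \<Rightarrow> bool" where
  "is_M7 M \<longleftrightarrow> A2_module M \<and>
     (\<forall>n. if n \<in> {0, 4, 6, 7} then card (gr M n) = 2 else gr M n = {0}) \<and>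
     (\<exists>x\<in>gr M 0. act M (Sq 7) x \<noteq> 0)"

text \<open>The homology of \<open>bo\<^sub>2\<close> as a subspace of the dual Steenrod algebra. The exponent with index
  \<open>i\<close> belongs to \<open>\<zeta>\<close> with index \<open>i + 1\<close>, which has weight \<open>2 ^ i\<close>.\<close>

definition H_bo2 :: "dual_steenrod set" where
  "H_bo2 = {\<Sum>x\<in>S. x |S. finite S \<and> S \<subseteq>
     {\<Prod>i\<in>Poly_Mapping.keys e. zeta (i + 1) ^ Poly_Mapping.lookup e i |e :: mono.
        4 dvd Poly_Mapping.lookup e 0 \<and> 2 dvd Poly_Mapping.lookup e 1 \<and>
        (\<Sum>i\<in>Poly_Mapping.keys e. Poly_Mapping.lookup e i * 2 ^ i) \<le> 8}}"

text \<open>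
  The cohomology is the graded dual of \<open>H_bo2\<close>, its elements being extended by \<open>0\<close> outside it. The
  coaction \<open>\<psi>\<close> makes \<open>H_bo2\<close> a left comodule, and \<open>a\<close> acts on a functional \<open>f\<close> by
  \<open>(a f) x = (\<Sum> a x' * f x'')\<close> where \<open>\<psi> x = (\<Sum> x' \<otimes> x'')\<close>.
\<close>

definition cap :: "steenrod \<Rightarrow> dual_steenrod \<Rightarrow> dual_steenrod" where
  "cap a x = (\<Sum>(p, q)\<in>Poly_Mapping.keys (psi x). Poly_Mapping.single q (a p))"

definition cohomology_bo2 :: "(dual_steenrod \<Rightarrow> bit) gmod" where
  "cohomology_bo2 =
     \<lparr>gr = (\<lambda>n. {f. (\<forall>x. f x \<noteq> 0 \<longrightarrow> x \<in> H_bo2) \<and>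
                     (\<forall>x\<in>H_bo2. \<forall>y\<in>H_bo2. f (x + y) = f x + f y) \<and>
                     (\<forall>x k. (\<forall>m\<in>Poly_Mapping.keys x. mdeg m = k) \<and> f x \<noteq> 0 \<longrightarrow> int k = n)}),
      act = (\<lambda>a f x. if x \<in> H_bo2 then f (cap a x) else 0)\<rparr>"

definition is_B :: "'a::ab_group_add gmod \<Rightarrow> bool" where
  "is_B B \<longleftrightarrow> A2_module B \<and>
     (\<exists>i p. short_exact (susp 17 trivial_module) i B p cohomology_bo2 \<and>
        (\<exists>\<iota>\<^sub>0\<in>gr B 0. \<iota>\<^sub>0 \<noteq> 0 \<and> i 1 = act B (Sq 4) (act B (Sq 6) (act B (Sq 7) \<iota>\<^sub>0))))"


section \<open>The reduced Ext of the ideal\<close>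

text \<open>Ext of \<open>ideal_module\<close> without (i.e. modulo) the whole group in bidegree \<open>(0, 4)\<close> and a given
  tower \<open>T\<close> beginning in bidegree \<open>(1, 11)\<close>.\<close>

definition Ext_tilde ::
    "(nat \<Rightarrow> steenrod cochain set set) \<Rightarrow> int \<Rightarrow> int \<Rightarrow> steenrod cochain set set monoid" where
  "Ext_tilde T s t = Ext ideal_module s t Mod
     (if s = 0 \<and> t = 4 then carrier (Ext ideal_module 0 4)
      else if 1 \<le> s \<and> t = s + 10 then T (nat (s - 1))
      else {\<one>\<^bsub>Ext ideal_module s t\<^esub>})"

end

theory Submission
  imports Defs
begin

text \<open>
  Let \<open>N = A2 Sq\<^sup>4\<close>, \<open>J = A2 Sq\<^sup>7\<close> and \<open>P = A2 Sq\<^sup>1\<close>, and let \<open>I\<close> be the ideal. Inclusions and right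
  multiplications give short exact sequences \<open>N \<rightarrow> I \<rightarrow> \<Sigma>\<^sup>6 M\<^sub>7\<close>, \<open>\<Sigma>\<^sup>4 J \<rightarrow> \<Sigma>\<^sup>4 A2 \<rightarrow> N\<close> and
  \<open>\<Sigma>\<^sup>1\<^sup>6 B \<rightarrow> \<Sigma>\<^sup>1\<^sup>0 P \<rightarrow> \<Sigma>\<^sup>4 J\<close> (by \<open>Sq\<^sup>4\<close> and \<open>Sq\<^sup>6\<close>, as \<open>Sq\<^sup>1 Sq\<^sup>6 = Sq\<^sup>7\<close> and \<open>Sq\<^sup>7 Sq\<^sup>4 = 0\<close>). The Ext of \<open>A2\<close>
  vanishes in positive filtration and that of \<open>P\<close> is a single \<open>h\<^sub>0\<close>-tower. Hence the composite of the two
  last connecting homomorphisms embeds the Ext of \<open>\<Sigma>\<^sup>1\<^sup>6 B\<close> into that of \<open>N\<close>, two filtrations higher, and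
  the cokernel consists of the class dual to \<open>Sq\<^sup>4\<close> and of a tower; all these classes are detected on
  the tuples \<open>(Sq\<^sup>1, \<dots>, Sq\<^sup>1; Sq\<^sup>6 Sq\<^sup>4)\<close> and lift to \<open>I\<close>. Dividing them out, the Ext of \<open>N\<close> may be
  replaced by that of \<open>\<Sigma>\<^sup>1\<^sup>6 B\<close> in the long exact sequence of the first short exact sequence.
\<close>

section \<open>Monoid algebras over the field with two elements\<close>

text \<open>The short exact sequences describe kernels of right multiplications on the
  64-dimensional algebra \<open>A2\<close>. Each kernel is certified by a linear operator that
  writes an element as an explicit multiple plus a term vanishing on the kernel, which leaves
  identities between coordinate rows to evaluate. For this, \<open>A2\<close> has to be known as the
  span of the Milnor basis elements dual to the monomials in \<open>box\<close>. The main obstacle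
  is the tower. Classes of N that come from the tower of P need not extend to the ideal a priori,
  since their connecting classes in the Ext of \<open>M7\<close> could be nonzero, and then they
  could not be divided out. An explicit cocycle settles this: in
  \<open>a \<star> Sq 4 + b \<star> (Sq 5 \<star> Sq 1)\<close> the components of \<open>a\<close>
  in degrees below 7 are well-defined, and the coefficient of \<open>Sq 7\<close> after one further
  multiplication gives the bottom class; concatenation gives the rest. Restricted to N, the same
  cocycles show that the tower of P is pulled back from J and hence vanishes on B; this makes the
  composite of connecting homomorphisms injective.\<close>

declare add_bit_eq_xor [simp del] mult_bit_eq_and [simp del]

lemma bit_add_self [simp]: "(x :: bit) + x = 0"
  by (cases x) simp_all

lemma char2_self [simp]: "(x :: 'a \<Rightarrow>\<^sub>0 bit) + x = 0"
  by (rule poly_mapping_eqI) (simp add: lookup_add)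

lemma char2_fun_self [simp]: "(x :: 'a \<Rightarrow> bit) + x = 0"
  by (rule ext) simp

abbreviation monom1 :: "'a \<Rightarrow> 'a \<Rightarrow>\<^sub>0 bit" where
  "monom1 m \<equiv> Poly_Mapping.single m 1"

definition lin_ext :: "('a \<Rightarrow> 'r::comm_monoid_add) \<Rightarrow> ('a \<Rightarrow>\<^sub>0 bit) \<Rightarrow> 'r" where
  "lin_ext f x = (\<Sum>m\<in>Poly_Mapping.keys x. f m)"

lemma lin_ext_0 [simp]: "lin_ext f 0 = 0"
  by (simp add: lin_ext_def)

lemma lin_ext_monom1 [simp]: "lin_ext f (monom1 m) = f m"
  by (simp add: lin_ext_def)

text \<open>A monomial occurring in both \<open>x\<close> and \<open>y\<close> is cancelled in
  \<open>x + y\<close>, so the two copies of \<open>f m\<close> must cancel as well; this is why the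
  target has to satisfy \<open>r + r = 0\<close>.\<close>

lemma lin_ext_add:
  assumes "\<And>r :: 'r::ab_group_add. r + r = 0"
  shows "lin_ext (f :: 'a \<Rightarrow> 'r) (x + y) = lin_ext f x + lin_ext f y"
proof -
  have *: "lin_ext f z = (\<Sum>m\<in>K. if Poly_Mapping.lookup z m = 0 then 0 else f m)"
    if "finite K" "Poly_Mapping.keys z \<subseteq> K" for z :: "'a \<Rightarrow>\<^sub>0 bit" and K
    unfolding lin_ext_def
    by (rule sum.mono_neutral_cong_left) (use that in \<open>auto simp: in_keys_iff\<close>)
  let ?K = "Poly_Mapping.keys x \<union> Poly_Mapping.keys y"
  have "lin_ext f (x + y) = (\<Sum>m\<in>?K. if Poly_Mapping.lookup (x + y) m = 0 then 0 else f m)"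
    by (rule *) (simp_all add: Poly_Mapping.keys_add)
  also have "\<dots> = (\<Sum>m\<in>?K. (if Poly_Mapping.lookup x m = 0 then 0 else f m) +
      (if Poly_Mapping.lookup y m = 0 then 0 else f m))"
    by (rule sum.cong) (auto simp: lookup_add assms)
  also have "\<dots> = lin_ext f x + lin_ext f y"
    by (simp add: sum.distrib *[of ?K x] *[of ?K y])
  finally show ?thesis .
qed

lemma lin_ext_sum:
  assumes "\<And>r :: 'r::ab_group_add. r + r = 0"
  shows "lin_ext (f :: 'a \<Rightarrow> 'r) (\<Sum>i\<in>I. x i) = (\<Sum>i\<in>I. lin_ext f (x i))"
  by (induction I rule: infinite_finite_induct) (simp_all add: lin_ext_add[OF assms])

lemma monom1_expand: "(\<Sum>m\<in>Poly_Mapping.keys x. monom1 m) = (x :: 'a \<Rightarrow>\<^sub>0 bit)"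
proof (rule poly_mapping_eqI)
  fix k
  have "Poly_Mapping.lookup (\<Sum>m\<in>Poly_Mapping.keys x. monom1 m) k =
      (\<Sum>m\<in>Poly_Mapping.keys x. if m = k then (1::bit) else 0)"
    by (simp add: lookup_sum lookup_single when_def)
  also have "\<dots> = Poly_Mapping.lookup x k"
    by (simp only: sum.delta' finite_keys sum.delta) (simp add: in_keys_iff)
  finally show "Poly_Mapping.lookup (\<Sum>m\<in>Poly_Mapping.keys x. monom1 m) k = Poly_Mapping.lookup x k" .
qed

text \<open>The ring homomorphisms below (embeddings into the tensor cube, iterated coproducts,
  reductions modulo variables) are linear extensions of multiplicative maps on monomials, or
  composites of such.\<close>

lemma lin_ext_mult:
  assumes char2: "\<And>r :: 'r::comm_ring_1. r + r = 0" and f: "\<And>m n. f (m + n) = f m * f n"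
  shows "lin_ext (f :: 'a::comm_monoid_add \<Rightarrow> 'r) (x * y) = lin_ext f x * lin_ext f y"
proof -
  have "x * y = (\<Sum>m\<in>Poly_Mapping.keys x. \<Sum>n\<in>Poly_Mapping.keys y. monom1 (m + n))"
    by (subst (1 2) monom1_expand[symmetric]) (simp add: sum_product mult_single)
  then show ?thesis
    by (simp add: lin_ext_sum[OF char2] f lin_ext_def[of f x] lin_ext_def[of f y] sum_product)
qed

lemma lin_ext_comp:
  assumes "\<And>r :: 'r::ab_group_add. r + r = 0"
  shows "lin_ext (f :: 'a \<Rightarrow> 'r) (lin_ext g x) = lin_ext (\<lambda>m. lin_ext f (g m)) x"
  unfolding lin_ext_def[of g] lin_ext_def[of "\<lambda>m. lin_ext f (g m)"] by (rule lin_ext_sum[OF assms])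

lemma lin_ext_cong: "(\<And>m. m \<in> Poly_Mapping.keys x \<Longrightarrow> f m = g m) \<Longrightarrow> lin_ext f x = lin_ext g x"
  by (simp add: lin_ext_def)

lemma monom1_power: "monom1 (m :: 'a::comm_monoid_add) ^ n = monom1 (\<Sum>i<n. m)"
  by (induction n) (simp_all add: mult_single add.commute del: sum_constant)

text \<open>The coproduct of \<open>xi n\<close> involves powers with exponents
  \<open>2 ^ i\<close>, which can therefore be taken term by term.\<close>

lemma frobenius_add:
  fixes x y :: "'a::comm_monoid_add \<Rightarrow>\<^sub>0 bit"
  shows "(x + y) ^ (2 ^ k) = x ^ (2 ^ k) + y ^ (2 ^ k)"
proof (induction k)
  case (Suc k)
  have "(u + v) ^ 2 = u ^ 2 + v ^ 2" for u v :: "'a \<Rightarrow>\<^sub>0 bit"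
  proof -
    have "(u + v) ^ 2 = u ^ 2 + v ^ 2 + (u * v + u * v)"
      unfolding power2_eq_square distrib_left distrib_right by (simp only: ac_simps)
    then show ?thesis by (simp only: char2_self add_0_right)
  qed
  then show ?case by (simp only: power_Suc2 power_mult Suc)
qed simp

lemma frobenius_sum:
  fixes x :: "'i \<Rightarrow> 'a::comm_monoid_add \<Rightarrow>\<^sub>0 bit"
  shows "(\<Sum>i\<in>I. x i) ^ (2 ^ k) = (\<Sum>i\<in>I. x i ^ (2 ^ k))"
  by (induction I rule: infinite_finite_induct) (simp_all add: frobenius_add zero_power)

section \<open>The coproduct\<close>

lemma xi_mono_0 [simp]: "xi_mono 0 e = 0" and xi_mono_e0 [simp]: "xi_mono n 0 = 0"
  by (simp_all add: xi_mono_def)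

lemma xi_mono_add: "xi_mono n a + xi_mono n b = xi_mono n (a + b)"
  by (simp add: xi_mono_def single_add)

lemma xi_mono_sum: "(\<Sum>i<k. xi_mono n e) = xi_mono n (k * e)"
  by (induction k) (simp_all add: xi_mono_add add.commute del: sum_constant)

lemma psi_mono_superset:
  assumes "finite K" "Poly_Mapping.keys m \<subseteq> K"
  shows "psi_mono m = (\<Prod>i\<in>K. psi_xi (i + 1) ^ Poly_Mapping.lookup m i)"
  unfolding psi_mono_def by (rule prod.mono_neutral_left) (use assms in \<open>auto simp: in_keys_iff\<close>)

lemma psi_mono_add: "psi_mono (m + n) = psi_mono m * psi_mono n"
proof -
  let ?K = "Poly_Mapping.keys m \<union> Poly_Mapping.keys n"
  show ?thesis
    using keys_add[of m n]
    by (simp add: psi_mono_superset[of ?K] lookup_add power_add prod.distrib)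
qed

lemma psi_mono_0 [simp]: "psi_mono 0 = 1"
  by (simp add: psi_mono_def)

lemma psi_xi_0 [simp]: "psi_xi 0 = 1"
  by (simp add: psi_xi_def single_one flip: zero_prod_def)

lemma psi_mono_xi_mono: "psi_mono (xi_mono n e) = psi_xi n ^ e"
  by (cases "n = 0") (auto simp: xi_mono_def psi_mono_superset[of "{n - 1}"])

lemma psi_eq: "psi = lin_ext psi_mono"
  by (rule ext) (simp add: psi_def lin_ext_def)

text \<open>Multiplicative functions on monomials are compared by adjoining one variable at a time;
  the measure is the total exponent.\<close>

lemma mono_induct [case_names 0 step]:
  assumes "P 0" "\<And>n m. n > 0 \<Longrightarrow> P m \<Longrightarrow> P (xi_mono n 1 + m)"
  shows "P (m :: mono)"
proof (induction "\<Sum>i\<in>Poly_Mapping.keys m. Poly_Mapping.lookup m i" arbitrary: m rule: less_induct)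
  case less
  show ?case
  proof (cases "m = 0")
    case False
    then obtain i where i: "i \<in> Poly_Mapping.keys m" by (metis poly_mapping_eqI in_keys_iff lookup_zero)
    define m' where "m' = m - xi_mono (i + 1) 1"
    have l: "Poly_Mapping.lookup m' j = (if j = i then Poly_Mapping.lookup m i - 1 else Poly_Mapping.lookup m j)" for j
      by (simp add: m'_def xi_mono_def lookup_minus lookup_single when_def)
    have m: "m = xi_mono (i + 1) 1 + m'"
      using i by (intro poly_mapping_eqI) (auto simp: l lookup_add xi_mono_def lookup_single when_def in_keys_iff)
    have "(\<Sum>j\<in>Poly_Mapping.keys m'. Poly_Mapping.lookup m' j) = (\<Sum>j\<in>Poly_Mapping.keys m. Poly_Mapping.lookup m' j)"
      by (rule sum.mono_neutral_left) (use i in \<open>auto simp: in_keys_iff l split: if_splits\<close>)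
    also have "\<dots> < (\<Sum>j\<in>Poly_Mapping.keys m. Poly_Mapping.lookup m j)"
      by (rule sum_strict_mono_ex1) (use i in \<open>auto simp: l in_keys_iff\<close>)
    finally show ?thesis using less assms(2)[of "i+1" m'] m by auto
  qed (use assms in simp)
qed

lemma mult_hom_eq:
  fixes f g :: "mono \<Rightarrow> 'r::comm_ring_1"
  assumes "\<And>m n. f (m + n) = f m * f n" "\<And>m n. g (m + n) = g m * g n" "f 0 = 1" "g 0 = 1"
    "\<And>n. n > 0 \<Longrightarrow> f (xi_mono n 1) = g (xi_mono n 1)"
  shows "f m = g m"
  by (induction m rule: mono_induct) (use assms(5) in \<open>simp_all add: assms(1-4)\<close>)

lemma mdeg_superset:
  assumes "finite K" "Poly_Mapping.keys m \<subseteq> K"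
  shows "mdeg m = (\<Sum>i\<in>K. Poly_Mapping.lookup m i * (2 ^ (i + 1) - 1))"
  unfolding mdeg_def by (rule sum.mono_neutral_left) (use assms in \<open>auto simp: in_keys_iff\<close>)

lemma mdeg_add [simp]: "mdeg (m + n) = mdeg m + mdeg n"
proof -
  let ?K = "Poly_Mapping.keys m \<union> Poly_Mapping.keys n"
  show ?thesis
    using keys_add[of m n]
    by (simp add: mdeg_superset[of ?K] lookup_add sum.distrib add_mult_distrib del: power_Suc One_nat_def)
qed

lemma mdeg_0 [simp]: "mdeg 0 = 0"
  by (simp add: mdeg_def)

lemma mdeg_xi_mono: "mdeg (xi_mono n e) = e * (2 ^ n - 1)"
  by (cases "n = 0") (auto simp: xi_mono_def mdeg_superset[of "{n - 1}"])

lemma mdeg_eq_0: "mdeg m = 0 \<longleftrightarrow> m = 0"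
proof
  assume "mdeg m = 0"
  then have *: "Poly_Mapping.lookup m i * (2 ^ (i + 1) - 1) = 0" if "i \<in> Poly_Mapping.keys m" for i
    using that by (simp add: mdeg_def)
  have "i \<notin> Poly_Mapping.keys m" for i
    using *[of i] one_less_power[of "2::nat" "i + 1"] by (auto simp: in_keys_iff)
  then have "Poly_Mapping.keys m = {}" by blast
  then show "m = 0" by simp
qed simp

lemma psi_mono_homogeneous:
  "(p, q) \<in> Poly_Mapping.keys (psi_mono m) \<Longrightarrow> mdeg p + mdeg q = mdeg m"
proof (induction m arbitrary: p q rule: mono_induct)
  case 0 then show ?case by (simp split: if_splits add: zero_prod_def)
next
  case (step n m)
  have x: "mdeg p + mdeg q = 2 ^ n - 1" if "(p, q) \<in> Poly_Mapping.keys (psi_xi n)" for p q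
  proof -
    have "(p, q) \<in> (\<Union>i\<le>n. {(xi_mono (n - i) (2 ^ i), xi_mono i 1)})"
      using that subset_trans[OF keys_sum[of "\<lambda>i. monom1 (xi_mono (n - i) (2 ^ i), xi_mono i 1)" "{..n}"]]
      by (auto simp: psi_xi_def)
    then obtain i where "i \<le> n" "p = xi_mono (n - i) (2 ^ i)" "q = xi_mono i 1" by auto
    then have "mdeg p + mdeg q = 2 ^ i * (2 ^ (n - i) - 1) + (2 ^ i - 1)" by (simp add: mdeg_xi_mono)
    also have "\<dots> = (2 ^ i * 2 ^ (n - i) - 2 ^ i) + (2 ^ i - 1)" by (simp add: right_diff_distrib')
    also have "2 ^ i * 2 ^ (n - i) = (2::nat) ^ n" using \<open>i \<le> n\<close> by (simp flip: power_add)
    also have "((2::nat) ^ n - 2 ^ i) + (2 ^ i - 1) = 2 ^ n - 1"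
      using \<open>i \<le> n\<close> power_increasing[of i n "2::nat"] by simp
    finally show ?thesis .
  qed
  have "(p, q) \<in> Poly_Mapping.keys (psi_xi n * psi_mono m)"
    using step.prems psi_mono_xi_mono[of n 1] by (simp add: psi_mono_add)
  then obtain p1 q1 p2 q2 where pq: "(p1, q1) \<in> Poly_Mapping.keys (psi_xi n)"
      "(p2, q2) \<in> Poly_Mapping.keys (psi_mono m)" "p = p1 + p2" "q = q1 + q2"
    using keys_mult[of "psi_xi n" "psi_mono m"] by fastforce
  have "mdeg p + mdeg q = (mdeg p1 + mdeg q1) + (mdeg p2 + mdeg q2)" by (simp add: pq)
  also have "\<dots> = (2 ^ n - 1) + mdeg m" by (simp only: x[OF pq(1)] step.IH[OF pq(2)])
  finally show ?case by (simp add: mdeg_xi_mono)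
qed

section \<open>The algebra structure\<close>

lemma st_mult_eq: "(a \<star> b) m = lin_ext (\<lambda>(p, q). a p * b q) (psi_mono m)"
  by (simp add: st_mult_def lin_ext_def)

lemma lin_ext_fun_add: "lin_ext (\<lambda>m. f m + g m) x = lin_ext f x + lin_ext g x"
  by (simp add: lin_ext_def sum.distrib)

lemma st_mult_add_left: "(a + b) \<star> c = a \<star> c + b \<star> c"
proof
  fix m
  have "(\<lambda>(p, q). (a + b) p * c q) = (\<lambda>x. (case x of (p, q) \<Rightarrow> a p * c q) + (case x of (p, q) \<Rightarrow> b p * c q))"
    by (auto simp: distrib_right)
  then show "((a + b) \<star> c) m = (a \<star> c + b \<star> c) m"
    by (simp add: st_mult_eq lin_ext_fun_add)
qed

lemma st_mult_add_right: "a \<star> (b + c) = a \<star> b + a \<star> c"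
proof
  fix m
  have "(\<lambda>(p, q). a p * (b + c) q) = (\<lambda>x. (case x of (p, q) \<Rightarrow> a p * b q) + (case x of (p, q) \<Rightarrow> a p * c q))"
    by (auto simp: distrib_left)
  then show "(a \<star> (b + c)) m = (a \<star> b + a \<star> c) m"
    by (simp add: st_mult_eq lin_ext_fun_add)
qed

lemma st_mult_0_left [simp]: "0 \<star> a = 0"
  using st_mult_add_left[of 0 0 a] by simp

lemma st_mult_0_right [simp]: "a \<star> 0 = 0"
  using st_mult_add_right[of a 0 0] by simp

type_synonym dual_steenrod3 = "(mono \<times> mono \<times> mono) \<Rightarrow>\<^sub>0 bit"

definition emb12 :: "dual_steenrod2 \<Rightarrow> dual_steenrod3" where
  "emb12 = lin_ext (\<lambda>(p, q). monom1 (p, q, 0))"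

definition emb23 :: "dual_steenrod2 \<Rightarrow> dual_steenrod3" where
  "emb23 = lin_ext (\<lambda>(p, q). monom1 (0, p, q))"

definition psi_l :: "dual_steenrod2 \<Rightarrow> dual_steenrod3" where
  "psi_l = lin_ext (\<lambda>(p, q). emb12 (psi_mono p) * monom1 (0, 0, q))"

definition psi_r :: "dual_steenrod2 \<Rightarrow> dual_steenrod3" where
  "psi_r = lin_ext (\<lambda>(p, q). monom1 (p, 0, 0) * emb23 (psi_mono q))"

lemma emb_mult: "emb12 (x * y) = emb12 x * emb12 y" "emb23 (x * y) = emb23 x * emb23 y"
  unfolding emb12_def emb23_def
  by (rule lin_ext_mult; auto simp: mult_single)+

lemma emb_1 [simp]: "emb12 1 = 1" "emb23 1 = 1"
  using lin_ext_monom1[of "\<lambda>(p, q). monom1 (p, q, 0 :: mono)" "0 :: mono \<times> mono"]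
    lin_ext_monom1[of "\<lambda>(p, q). monom1 (0 :: mono, p, q)" "0 :: mono \<times> mono"]
  by (simp_all add: emb12_def emb23_def zero_prod_def[symmetric] case_prod_beta)

lemma psi_lr_mult: "psi_l (x * y) = psi_l x * psi_l y" "psi_r (x * y) = psi_r x * psi_r y"
proof -
  have *: "monom1 (0, 0, q + q') = monom1 (0 :: mono, 0 :: mono, q) * monom1 (0, 0, q')"
    "monom1 (q + q', 0, 0) = monom1 (q, 0 :: mono, 0 :: mono) * monom1 (q', 0, 0)" for q q' :: mono
    by (simp_all add: mult_single)
  show "psi_l (x * y) = psi_l x * psi_l y" "psi_r (x * y) = psi_r x * psi_r y"
    unfolding psi_l_def psi_r_def
    by (rule lin_ext_mult; auto simp: psi_mono_add emb_mult * mult_ac)+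
qed

lemma psi_lr_1 [simp]: "psi_l 1 = 1" "psi_r 1 = 1"
  using lin_ext_monom1[of "\<lambda>(p, q). emb12 (psi_mono p) * monom1 (0, 0, q)" "0 :: mono \<times> mono"]
    lin_ext_monom1[of "\<lambda>(p, q). monom1 (p, 0, 0) * emb23 (psi_mono q)" "0 :: mono \<times> mono"]
  by (simp_all add: psi_l_def psi_r_def case_prod_beta zero_prod_def[symmetric])

lemma sum_pair: "(\<Sum>i\<in>I. (f i, g i)) = (\<Sum>i\<in>I. f i, \<Sum>i\<in>I. g i)"
  by (induction I rule: infinite_finite_induct) (simp_all add: zero_prod_def)

lemma psi_xi_frobenius:
  "psi_xi n ^ (2 ^ k) = (\<Sum>i\<le>n. monom1 (xi_mono (n - i) (2 ^ (i + k)), xi_mono i (2 ^ k)))"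
  unfolding psi_xi_def frobenius_sum
  by (rule sum.cong) (simp_all add: monom1_power sum_pair xi_mono_sum power_add mult.commute del: sum_constant)

text \<open>Both iterated coproducts are sums over \<open>i + j \<le> n\<close> of the same triple
  tensors: Frobenius turns the power of \<open>psi_xi (n - i)\<close> into a sum of powers, and
  \<open>k = i + j\<close> reindexes it.\<close>

lemma psi_coassoc_xi: "psi_l (psi_xi n) = psi_r (psi_xi n)"
proof -
  have "psi_l (psi_xi n) = (\<Sum>i\<le>n. emb12 (psi_xi (n - i) ^ (2 ^ i)) * monom1 (0, 0, xi_mono i 1))"
    unfolding psi_l_def psi_xi_def[of n] by (simp add: lin_ext_sum psi_mono_xi_mono)
  also have "\<dots> = (\<Sum>i\<le>n. \<Sum>j\<le>n - i. monom1 (xi_mono (n - i - j) (2 ^ (j + i)), xi_mono j (2 ^ i), xi_mono i 1))"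
    unfolding psi_xi_frobenius emb12_def by (simp add: lin_ext_sum sum_distrib_right mult_single)
  also have "\<dots> = (\<Sum>k\<le>n. \<Sum>i\<le>k. monom1 (xi_mono (n - k) (2 ^ k), xi_mono (k - i) (2 ^ i), xi_mono i 1))"
    unfolding sum.Sigma[OF finite_atMost ballI[OF finite_atMost]]
    by (rule sum.reindex_bij_witness[where i = "\<lambda>(k, i). (i, k - i)" and j = "\<lambda>(i, j). (i + j, i)"])
      (auto simp: add.commute)
  also have "\<dots> = (\<Sum>k\<le>n. monom1 (xi_mono (n - k) (2 ^ k), 0, 0) * emb23 (psi_xi k))"
    unfolding emb23_def psi_xi_def by (simp add: lin_ext_sum sum_distrib_left mult_single)
  also have "\<dots> = psi_r (psi_xi n)"
    unfolding psi_r_def psi_xi_def[of n] using psi_mono_xi_mono[of _ 1] by (simp add: lin_ext_sum)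
  finally show ?thesis .
qed

lemma psi_coassoc: "psi_l (psi_mono m) = psi_r (psi_mono m)"
  by (rule mult_hom_eq[where f = "\<lambda>m. psi_l (psi_mono m)" and g = "\<lambda>m. psi_r (psi_mono m)"])
    (use psi_mono_xi_mono[of _ 1] in \<open>simp_all add: psi_mono_add psi_lr_mult psi_coassoc_xi\<close>)

text \<open>Both products evaluate the functional \<open>a \<otimes> b \<otimes> c\<close> on an
  iterated coproduct of \<open>m\<close>, so they agree by coassociativity.\<close>

lemma st_mult_assoc: "(a \<star> b) \<star> c = a \<star> (b \<star> c)"
proof
  fix m
  let ?T = "lin_ext (\<lambda>(p, q, r). a p * b q * c r)"
  have l: "?T (emb12 x * monom1 (0, 0, r)) = lin_ext (\<lambda>(p, q). a p * b q) x * c r" for x r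
    unfolding emb12_def lin_ext_def[of "\<lambda>(p, q). monom1 (p, q, 0)"] lin_ext_def[of "\<lambda>(p, q). a p * b q"] sum_distrib_right
    by (simp add: lin_ext_sum) (rule sum.cong, auto simp: mult_single)
  have r: "?T (monom1 (p, 0, 0) * emb23 x) = a p * lin_ext (\<lambda>(p, q). b p * c q) x" for x p
    unfolding emb23_def lin_ext_def[of "\<lambda>(p, q). monom1 (0, p, q)"] lin_ext_def[of "\<lambda>(p, q). b p * c q"] sum_distrib_left
    by (simp add: lin_ext_sum) (rule sum.cong, auto simp: mult_single mult.assoc)
  have "((a \<star> b) \<star> c) m = ?T (psi_l (psi_mono m))"
    unfolding psi_l_def lin_ext_comp[OF bit_add_self] st_mult_eq[of "a \<star> b"]
    by (rule lin_ext_cong) (auto simp: l st_mult_eq)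
  also have "\<dots> = (a \<star> (b \<star> c)) m"
    unfolding psi_coassoc psi_r_def lin_ext_comp[OF bit_add_self] st_mult_eq[of a]
    by (rule lin_ext_cong) (auto simp: r st_mult_eq)
  finally show "((a \<star> b) \<star> c) m = (a \<star> (b \<star> c)) m" .
qed

lemma Sq_0: "Sq 0 m = (if m = 0 then 1 else 0)"
  by (simp add: Sq_def)

lemma psi_xi_split: "n > 0 \<Longrightarrow> psi_xi n = monom1 (xi_mono n 1, 0) + monom1 (0, xi_mono n 1) +
    (\<Sum>i\<in>{0<..<n}. monom1 (xi_mono (n - i) (2 ^ i), xi_mono i 1))"
proof -
  assume "n > 0"
  then have "{..n} = insert 0 (insert n {0<..<n})" by auto
  then show ?thesis using \<open>n > 0\<close> by (simp add: psi_xi_def)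
qed

lemma xi_mono_eq_0: "xi_mono n e = 0 \<longleftrightarrow> n = 0 \<or> e = 0"
  unfolding xi_mono_def by (metis lookup_single_eq lookup_zero single_zero)

lemma Sq_0_left [simp]: "Sq 0 \<star> b = b"
proof
  fix m
  \<comment> \<open>Applying the counit to the first factor is the ring homomorphism that keeps a
    tensor \<open>p \<otimes> q\<close> only for \<open>p = 0\<close>; of \<open>psi_xi n\<close>
    just the term with \<open>xi_mono n 1\<close> on the right survives.\<close>
  let ?f = "\<lambda>(p :: mono, q :: mono). if p = 0 then monom1 q else 0"
  have add0: "p + q = 0 \<longleftrightarrow> p = 0 \<and> q = 0" for p q :: mono
    using mdeg_eq_0[of p] mdeg_eq_0[of q] mdeg_eq_0[of "p + q"] by simp
  have mult: "?f (x + y) = ?f x * ?f y" for x y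
    by (cases x; cases y) (simp add: add0 mult_single)
  have "lin_ext ?f (psi_mono m) = monom1 m"
  proof (rule mult_hom_eq[where g = monom1 and f = "\<lambda>m. lin_ext ?f (psi_mono m)"])
    fix n :: nat assume n: "n > 0"
    show "lin_ext ?f (psi_mono (xi_mono n 1)) = monom1 (xi_mono n 1)"
      using n by (simp add: psi_mono_xi_mono psi_xi_split lin_ext_add lin_ext_sum xi_mono_eq_0)
  next
    show "lin_ext ?f (psi_mono 0) = 1"
      using lin_ext_monom1[of ?f 0] by (simp add: case_prod_beta)
  qed (simp_all only: psi_mono_add lin_ext_mult[OF char2_self mult], simp_all add: mult_single)
  moreover have "(Sq 0 \<star> b) m = lin_ext b (lin_ext ?f (psi_mono m))"
    unfolding lin_ext_comp[OF bit_add_self] st_mult_eq by (rule lin_ext_cong) (auto simp: Sq_0)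
  ultimately show "(Sq 0 \<star> b) m = b m" by simp
qed

lemma Sq_0_right [simp]: "b \<star> Sq 0 = b"
proof
  fix m
  let ?f = "\<lambda>(p :: mono, q :: mono). if q = 0 then monom1 p else 0"
  have add0: "p + q = 0 \<longleftrightarrow> p = 0 \<and> q = 0" for p q :: mono
    using mdeg_eq_0[of p] mdeg_eq_0[of q] mdeg_eq_0[of "p + q"] by simp
  have mult: "?f (x + y) = ?f x * ?f y" for x y
    by (cases x; cases y) (simp add: add0 mult_single)
  have "lin_ext ?f (psi_mono m) = monom1 m"
  proof (rule mult_hom_eq[where g = monom1 and f = "\<lambda>m. lin_ext ?f (psi_mono m)"])
    fix n :: nat assume n: "n > 0"
    show "lin_ext ?f (psi_mono (xi_mono n 1)) = monom1 (xi_mono n 1)"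
      using n by (simp add: psi_mono_xi_mono psi_xi_split lin_ext_add lin_ext_sum xi_mono_eq_0)
  next
    show "lin_ext ?f (psi_mono 0) = 1"
      using lin_ext_monom1[of ?f 0] by (simp add: case_prod_beta)
  qed (simp_all only: psi_mono_add lin_ext_mult[OF char2_self mult], simp_all add: mult_single)
  moreover have "(b \<star> Sq 0) m = lin_ext b (lin_ext ?f (psi_mono m))"
    unfolding lin_ext_comp[OF bit_add_self] st_mult_eq by (rule lin_ext_cong) (auto simp: Sq_0)
  ultimately show "(b \<star> Sq 0) m = b m" by simp
qed

lemma lin_ext_nonzero: "lin_ext f x \<noteq> 0 \<Longrightarrow> \<exists>m\<in>Poly_Mapping.keys x. f m \<noteq> 0"
  unfolding lin_ext_def by (meson sum.not_neutral_contains_not_neutral)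

lemma st_homogeneous_mult:
  assumes "st_homogeneous k a" "st_homogeneous l b"
  shows "st_homogeneous (k + l) (a \<star> b)"
  unfolding st_homogeneous_def
proof (intro allI impI)
  fix m assume "(a \<star> b) m \<noteq> 0"
  from lin_ext_nonzero[OF this[unfolded st_mult_eq]] obtain p q
    where pq: "(p, q) \<in> Poly_Mapping.keys (psi_mono m)" "a p * b q \<noteq> 0" by (metis case_prod_conv surj_pair)
  then have "a p \<noteq> 0" "b q \<noteq> 0" by auto
  with pq assms psi_mono_homogeneous[OF pq(1)] show "mdeg m = k + l"
    by (simp add: st_homogeneous_def)
qed

lemma augmentation_mult: "augmentation (a \<star> b) = augmentation a * augmentation b"
  using lin_ext_monom1[of "\<lambda>(p, q). a p * b q" 0]
  by (simp add: augmentation_def st_mult_eq case_prod_beta)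

section \<open>The span of the Milnor basis elements of the subalgebra\<close>

text \<open>The monomials outside \<open>box\<close> span the ideal generated by
  \<open>xi 1 ^ 8\<close>, \<open>xi 2 ^ 4\<close>, \<open>xi 3 ^ 2\<close> and all
  \<open>xi n\<close> with \<open>n \<ge> 4\<close>; for \<open>i \<ge> 3\<close> the truncated
  exponent \<open>3 - i\<close> leaves the bound 1.\<close>

definition box :: "mono set" where
  "box = {m. \<forall>i. Poly_Mapping.lookup m i < 2 ^ (3 - i)}"

definition Box :: "steenrod set" where
  "Box = {a. \<forall>m. a m \<noteq> 0 \<longrightarrow> m \<in> box}"

text \<open>Tensors in which every term has a factor in that ideal; functionals
  \<open>a \<otimes> b\<close> with both factors in \<open>Box\<close> vanish on them.\<close>

definition bad :: "dual_steenrod2 \<Rightarrow> bool" where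
  "bad X \<longleftrightarrow> (\<forall>(p, q)\<in>Poly_Mapping.keys X. p \<notin> box \<or> q \<notin> box)"

lemma box_add: "p + q \<in> box \<Longrightarrow> p \<in> box"
  unfolding box_def by (auto simp: lookup_add intro: le_less_trans[OF le_add1])

lemma bad_mult: "bad X \<Longrightarrow> bad (X * Y)"
  unfolding bad_def using keys_mult[of X Y] by (fastforce dest: box_add)

lemma xi_mono_notin_box: "n > 0 \<Longrightarrow> n + k \<ge> 4 \<Longrightarrow> xi_mono n (2 ^ k) \<notin> box"
proof -
  assume "n > 0" "n + k \<ge> 4"
  then have "(2::nat) ^ (3 - (n - 1)) \<le> 2 ^ k" by (intro power_increasing) auto
  then show ?thesis using \<open>n > 0\<close> by (auto simp: box_def xi_mono_def intro!: exI[of _ "n - 1"])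
qed

text \<open>In a left factor \<open>xi_mono (n - i) (2 ^ (i + k))\<close> the index and the
  logarithm of the exponent again add up to \<open>n + k\<close>, so it lies outside
  \<open>box\<close> unless \<open>i = n\<close>, and then the right factor does. Hence the ideal is
  a coideal and \<open>Box\<close> is closed under products.\<close>

lemma bad_psi_xi:
  assumes "n > 0" "n + k \<ge> 4"
  shows "bad (psi_xi n ^ (2 ^ k))"
  unfolding bad_def
proof clarify
  fix p q assume "(p, q) \<in> Poly_Mapping.keys (psi_xi n ^ (2 ^ k))" and pq: "p \<in> box" "q \<in> box"
  then have "(p, q) \<in> (\<Union>i\<le>n. {(xi_mono (n - i) (2 ^ (i + k)), xi_mono i (2 ^ k))})"
    using subsetD[OF keys_sum[of "\<lambda>i. monom1 (xi_mono (n - i) (2 ^ (i + k)), xi_mono i (2 ^ k))" "{..n}"]]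
    by (fastforce simp: psi_xi_frobenius)
  then obtain i where i: "i \<le> n" "p = xi_mono (n - i) (2 ^ (i + k))" "q = xi_mono i (2 ^ k)" by auto
  show False
  proof (cases "i = n")
    case True then show ?thesis using xi_mono_notin_box[OF assms] i pq by simp
  next
    case False then show ?thesis using xi_mono_notin_box[of "n - i" "i + k"] assms i pq by simp
  qed
qed

lemma bad_psi_mono: "m \<notin> box \<Longrightarrow> bad (psi_mono m)"
proof -
  assume "m \<notin> box"
  then obtain i where i: "2 ^ (3 - i) \<le> Poly_Mapping.lookup m i" by (auto simp: box_def not_less)
  define m' where "m' = m - xi_mono (i + 1) (2 ^ (3 - i))"
  have "m = xi_mono (i + 1) (2 ^ (3 - i)) + m'"
    by (rule poly_mapping_eqI) (use i in \<open>auto simp: m'_def lookup_add lookup_minus xi_mono_def lookup_single when_def\<close>)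
  then show ?thesis
    by (simp only: psi_mono_add psi_mono_xi_mono) (intro bad_mult bad_psi_xi, auto)
qed

lemma Box_mult: "a \<in> Box \<Longrightarrow> b \<in> Box \<Longrightarrow> a \<star> b \<in> Box"
  unfolding Box_def
proof clarify
  fix m assume *: "\<forall>m. a m \<noteq> 0 \<longrightarrow> m \<in> box" "\<forall>m. b m \<noteq> 0 \<longrightarrow> m \<in> box" and "(a \<star> b) m \<noteq> 0"
  from lin_ext_nonzero[OF this(3)[unfolded st_mult_eq]] obtain p q
    where pq: "(p, q) \<in> Poly_Mapping.keys (psi_mono m)" "a p * b q \<noteq> 0" by (metis case_prod_conv surj_pair)
  then have "p \<in> box" "q \<in> box" using * by auto
  then show "m \<in> box" using bad_psi_mono[of m] pq by (auto simp: bad_def)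
qed

lemma Box_add: "a \<in> Box \<Longrightarrow> b \<in> Box \<Longrightarrow> a + b \<in> Box"
  unfolding Box_def mem_Collect_eq plus_fun_apply by (metis add_0)

lemma Sq_in_Box: "n < 8 \<Longrightarrow> Sq n \<in> Box"
  by (auto simp: Box_def Sq_def box_def xi_mono_def lookup_single when_def)

lemma A2_subset_Box: "a \<in> A2 \<Longrightarrow> a \<in> Box"
proof (induction rule: A2.induct)
  case (5 a b) then show ?case by (intro Box_add)
next
  case (6 a b) then show ?case by (intro Box_mult)
qed (simp_all add: Sq_in_Box del: One_nat_def)

section \<open>Multiplication by the generators\<close>

definition tri :: "nat \<times> nat \<times> nat \<Rightarrow> mono" where
  "tri = (\<lambda>(a, b, c). xi_mono 1 a + xi_mono 2 b + xi_mono 3 c)"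

definition xi1_power :: "mono \<Rightarrow> bool" where
  "xi1_power p \<longleftrightarrow> p = xi_mono 1 (Poly_Mapping.lookup p 0)"

lemma xi1_power_add: "xi1_power (p + q) \<longleftrightarrow> xi1_power p \<and> xi1_power q"
  unfolding xi1_power_def xi_mono_def
  by (auto simp: poly_mapping_eq_iff fun_eq_iff lookup_add lookup_single when_def)

lemma xi1_power_xi_mono [simp]: "xi1_power (xi_mono n e) \<longleftrightarrow> n \<le> 1 \<or> e = 0"
  unfolding xi1_power_def xi_mono_def
  by (auto simp: poly_mapping_eq_iff fun_eq_iff lookup_single when_def)

lemma lookup_xi_mono_0 [simp]: "Poly_Mapping.lookup (xi_mono n e) 0 = (if n = 1 then e else 0)"
  by (auto simp: xi_mono_def lookup_single when_def)

text \<open>The monomials of \<open>(nat \<times> mono) \<Rightarrow>\<^sub>0 bit\<close> are \<open>t\<^sup>k \<otimes> q\<close>: the coefficient of \<open>t\<^sup>k\<close> in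
  \<open>lmap (psi_mono m)\<close> determines multiplication by \<open>Sq\<^sup>k\<close> on the left, and likewise \<open>rmap\<close> on the
  right.\<close>

definition lmap :: "dual_steenrod2 \<Rightarrow> (nat \<times> mono) \<Rightarrow>\<^sub>0 bit" where
  "lmap = lin_ext (\<lambda>(p, q). if xi1_power p then monom1 (Poly_Mapping.lookup p 0, q) else 0)"

definition rmap :: "dual_steenrod2 \<Rightarrow> (nat \<times> mono) \<Rightarrow>\<^sub>0 bit" where
  "rmap = lin_ext (\<lambda>(p, q). if xi1_power q then monom1 (Poly_Mapping.lookup q 0, p) else 0)"

definition tcoeff :: "nat \<Rightarrow> steenrod \<Rightarrow> ((nat \<times> mono) \<Rightarrow>\<^sub>0 bit) \<Rightarrow> bit" where
  "tcoeff n b = lin_ext (\<lambda>(k, q). if k = n then b q else 0)"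

lemma lmap_mult: "lmap (x * y) = lmap x * lmap y"
  unfolding lmap_def by (rule lin_ext_mult) (auto simp: xi1_power_add mult_single lookup_add)

lemma rmap_mult: "rmap (x * y) = rmap x * rmap y"
  unfolding rmap_def by (rule lin_ext_mult) (auto simp: xi1_power_add mult_single lookup_add)

lemma xi1_power_0 [simp]: "xi1_power 0"
  using xi1_power_xi_mono[of 0 0] by (simp del: xi1_power_xi_mono add: xi1_power_def)

lemma lmap_1 [simp]: "lmap 1 = 1" and rmap_1 [simp]: "rmap 1 = 1"
  using lin_ext_monom1[of "\<lambda>(p, q). if xi1_power p then monom1 (Poly_Mapping.lookup p 0, q) else 0" "0 :: mono \<times> mono"]
    lin_ext_monom1[of "\<lambda>(p, q). if xi1_power q then monom1 (Poly_Mapping.lookup q 0, p) else 0" "0 :: mono \<times> mono"]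
  by (simp_all add: lmap_def rmap_def case_prod_beta zero_prod_def[symmetric])

lemma lmap_power: "lmap (x ^ n) = lmap x ^ n" and rmap_power: "rmap (x ^ n) = rmap x ^ n"
  by (induction n) (simp_all add: lmap_mult rmap_mult)

lemma Sq_eq: "Sq n p = (if xi1_power p \<and> Poly_Mapping.lookup p 0 = n then 1 else 0)"
  by (auto simp: Sq_def xi1_power_def)

lemma Sq_mult_left: "(Sq n \<star> b) m = tcoeff n b (lmap (psi_mono m))"
  unfolding st_mult_eq tcoeff_def lmap_def lin_ext_comp[OF bit_add_self]
  by (rule lin_ext_cong) (auto simp: Sq_eq)

lemma Sq_mult_right: "(b \<star> Sq n) m = tcoeff n b (rmap (psi_mono m))"
  unfolding st_mult_eq tcoeff_def rmap_def lin_ext_comp[OF bit_add_self]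
  by (rule lin_ext_cong) (auto simp: Sq_eq)

lemma psi_xi_split_left: "n > 0 \<Longrightarrow> psi_xi n = monom1 (0, xi_mono n 1) +
    (monom1 (xi_mono 1 (2 ^ (n - 1)), xi_mono (n - 1) 1) + (\<Sum>i<n - 1. monom1 (xi_mono (n - i) (2 ^ i), xi_mono i 1)))"
proof -
  assume "n > 0"
  then have "{..n} = insert n (insert (n - 1) {..<n - 1})" by auto
  moreover have "n - (n - 1) = 1" "n \<notin> insert (n - 1) {..<n - 1}" "n - 1 \<notin> {..<n - 1}" using \<open>n > 0\<close> by auto
  ultimately show ?thesis by (simp add: psi_xi_def del: One_nat_def)
qed

lemma psi_xi_split_right: "n > 0 \<Longrightarrow> psi_xi n = monom1 (xi_mono n 1, 0) +
    (monom1 (xi_mono (n - 1) 2, xi_mono 1 1) + (\<Sum>i\<in>{2..n}. monom1 (xi_mono (n - i) (2 ^ i), xi_mono i 1)))"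
proof -
  assume "n > 0"
  then have "{..n} = insert 0 (insert 1 {2..n})" by auto
  then show ?thesis using \<open>n > 0\<close> by (simp add: psi_xi_def)
qed

text \<open>The left factor \<open>xi_mono (n - i) (2 ^ i)\<close> is a power of \<open>xi 1\<close>
  only for \<open>n - i \<le> 1\<close>, so two terms remain. For \<open>rmap\<close> it is the
  right factor that has to be such a power, which leaves \<open>i \<le> 1\<close>.\<close>

lemma lmap_psi_xi: "n > 0 \<Longrightarrow> lmap (psi_xi n) = monom1 (0, xi_mono n 1) + monom1 (2 ^ (n - 1), xi_mono (n - 1) 1)"
  unfolding lmap_def by (subst psi_xi_split_left) (auto simp: lin_ext_add lin_ext_sum intro!: sum.neutral)

lemma rmap_psi_xi: "n > 0 \<Longrightarrow> rmap (psi_xi n) = monom1 (0, xi_mono n 1) + monom1 (1, xi_mono (n - 1) 2)"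
  unfolding rmap_def by (subst psi_xi_split_right) (auto simp: lin_ext_add lin_ext_sum intro!: sum.neutral)

lemma lin_ext_single: "lin_ext (f :: _ \<Rightarrow> bit) (Poly_Mapping.single u c) = c * f u"
  by (cases c) simp_all

lemma monom1_binomial:
  "(monom1 (0, xi_mono n 1) + monom1 (d, xi_mono l e)) ^ r =
    (\<Sum>i\<le>r. Poly_Mapping.single (i * d, xi_mono n (r - i) + xi_mono l (i * e)) (of_nat (r choose i)))"
proof -
  have [simp]: "(1 :: (nat \<times> mono) \<Rightarrow>\<^sub>0 bit) = monom1 (0, 0)" by (simp add: zero_prod_def[symmetric])
  have "(monom1 (0, xi_mono n 1) + monom1 (d, xi_mono l e)) ^ r =
    (\<Sum>i\<le>r. of_nat (r choose i) * monom1 (d, xi_mono l e) ^ i * monom1 (0, xi_mono n 1) ^ (r - i))"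
    by (subst add.commute) (rule binomial_ring)
  also have "\<dots> = (\<Sum>i\<le>r. Poly_Mapping.single (i * d, xi_mono n (r - i) + xi_mono l (i * e)) (of_nat (r choose i)))"
  proof (rule sum.cong[OF refl])
    fix i
    have *: "monom1 (k, xi_mono a b) ^ j = monom1 (j * k, xi_mono a (j * b))" for k a b j
      by (simp only: monom1_power sum_pair xi_mono_sum) simp
    show "of_nat (r choose i) * monom1 (d, xi_mono l e) ^ i * monom1 (0, xi_mono n 1) ^ (r - i) =
        Poly_Mapping.single (i * d, xi_mono n (r - i) + xi_mono l (i * e)) (of_nat (r choose i))"
      by (simp add: * mult_single flip: single_of_nat) (simp add: add.commute zero_prod_def[symmetric] mult_single)
  qed
  finally show ?thesis .
qed

lemma tcoeff_sum: "tcoeff n b (\<Sum>i\<in>I. x i) = (\<Sum>i\<in>I. tcoeff n b (x i))"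
  by (simp add: tcoeff_def lin_ext_sum)

lemma tcoeff_single: "tcoeff n b (Poly_Mapping.single (k, q) c) = c * (if k = n then b q else 0)"
  by (simp add: tcoeff_def lin_ext_single)

lemma sum_product3: "sum f A * sum g B * sum h C = (\<Sum>i\<in>A. \<Sum>j\<in>B. \<Sum>k\<in>C. f i * g j * h k)"
  for f g h :: "_ \<Rightarrow> 'a::comm_semiring_0"
proof -
  have "f i * sum g B * sum h C = (\<Sum>j\<in>B. \<Sum>k\<in>C. f i * g j * h k)" for i
    by (subst mult.assoc, subst sum_product) (simp only: sum_distrib_left mult.assoc)
  then show ?thesis by (simp only: sum_distrib_right)
qed

text \<open>The images of \<open>psi_xi 1\<close>, \<open>psi_xi 2\<close> and
  \<open>psi_xi 3\<close> are binomials, so those of monomials expand by the binomial theorem;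
  \<open>i\<close>, \<open>j\<close>, \<open>k\<close> count the factors that contribute a power of
  the variable \<open>t\<close>.\<close>

lemma tri_ops:
  "(Sq n \<star> x) (tri (a, b, c)) = (\<Sum>i\<le>a. \<Sum>j\<le>b. \<Sum>k\<le>c. of_nat ((a choose i) * (b choose j) * (c choose k)) *
     (if i + 2 * j + 4 * k = n then x (tri (a - i + j, b - j + k, c - k)) else 0))" (is ?l)
  "(x \<star> Sq n) (tri (a, b, c)) = (\<Sum>i\<le>a. \<Sum>j\<le>b. \<Sum>k\<le>c. of_nat ((a choose i) * (b choose j) * (c choose k)) *
     (if i + j + k = n then x (tri (a - i + 2 * j, b - j + 2 * k, c - k)) else 0))" (is ?r)
proof -
  have l: "lmap (psi_xi 1) = monom1 (0, xi_mono 1 1) + monom1 (1, xi_mono 0 1)"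
      "lmap (psi_xi 2) = monom1 (0, xi_mono 2 1) + monom1 (2, xi_mono 1 1)"
      "lmap (psi_xi 3) = monom1 (0, xi_mono 3 1) + monom1 (4, xi_mono 2 1)"
    and r: "rmap (psi_xi 1) = monom1 (0, xi_mono 1 1) + monom1 (1, xi_mono 0 2)"
      "rmap (psi_xi 2) = monom1 (0, xi_mono 2 1) + monom1 (1, xi_mono 1 2)"
      "rmap (psi_xi 3) = monom1 (0, xi_mono 3 1) + monom1 (1, xi_mono 2 2)"
    using lmap_psi_xi[of 1] lmap_psi_xi[of 2] lmap_psi_xi[of 3]
      rmap_psi_xi[of 1] rmap_psi_xi[of 2] rmap_psi_xi[of 3] by simp_all
  have cong: "u = v \<Longrightarrow> k = l \<Longrightarrow> c * (if k = n then x u else 0) = c * (if l = n then x v else 0)" for u v k l c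
    by simp
  show ?l
    unfolding Sq_mult_left tri_def split psi_mono_add psi_mono_xi_mono lmap_mult lmap_power l
      monom1_binomial sum_product3 tcoeff_sum mult_single plus_prod_def fst_conv snd_conv tcoeff_single of_nat_mult
    by (intro sum.cong refl cong)
      (simp_all only: xi_mono_add[symmetric] ac_simps xi_mono_0 add_0_left add_0_right mult_1_left mult_1_right)
  show ?r
    unfolding Sq_mult_right tri_def split psi_mono_add psi_mono_xi_mono rmap_mult rmap_power r
      monom1_binomial sum_product3 tcoeff_sum mult_single plus_prod_def fst_conv snd_conv tcoeff_single of_nat_mult
    by (intro sum.cong refl cong)
      (simp_all only: xi_mono_add[symmetric] ac_simps xi_mono_0 add_0_left add_0_right mult_1_left mult_1_right)
qed

section \<open>Computations in coordinates\<close>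

text \<open>Lucas's theorem for \<open>r < 8\<close> and \<open>i \<le> 4\<close>: the binary digits
  of \<open>i\<close> must occur among those of \<open>r\<close>.\<close>

definition bino :: "nat \<Rightarrow> nat \<Rightarrow> bool" where
  "bino r i \<longleftrightarrow> i = 0 \<or> i = 1 \<and> odd r \<or> i = 2 \<and> r mod 4 \<ge> 2 \<or> i = 3 \<and> r mod 4 = 3 \<or> i = 4 \<and> r \<ge> 4"

lemma odd_choose: "r < 8 \<Longrightarrow> i \<le> 4 \<Longrightarrow> odd (r choose i) \<longleftrightarrow> bino r i"
proof -
  have "list_all (\<lambda>r. list_all (\<lambda>i. odd (r choose i) = bino r i) [0, 1, 2, 3, 4]) [0..<8]"
    by code_simp
  moreover assume "r < 8" "i \<le> 4"
  then have "r \<in> set [0..<8]" "i \<in> set [0, 1, 2, 3, 4]" by auto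
  ultimately show ?thesis unfolding list_all_iff by blast
qed

definition boxed :: "nat \<times> nat \<times> nat \<Rightarrow> bool" where
  "boxed = (\<lambda>(a, b, c). a < 8 \<and> b < 4 \<and> c < 2)"

lemma tri_box: "tri t \<in> box \<longleftrightarrow> boxed t"
proof -
  obtain a b c where t: "t = (a, b, c)" by (cases t)
  have l: "Poly_Mapping.lookup (tri t) i = (if i = 0 then a else if i = 1 then b else if i = 2 then c else 0)" for i
    by (auto simp: tri_def t lookup_add xi_mono_def lookup_single when_def)
  show ?thesis
  proof
    assume "tri t \<in> box"
    then have "Poly_Mapping.lookup (tri t) i < 2 ^ (3 - i)" for i by (simp add: box_def)
    from this[of 0] this[of 1] this[of 2] show "boxed t" by (simp add: l[unfolded t] boxed_def t del: One_nat_def)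
  qed (simp add: box_def l[unfolded t] boxed_def t)
qed

lemma box_tri: "m \<in> box \<Longrightarrow> \<exists>t. boxed t \<and> m = tri t"
proof -
  assume m: "m \<in> box"
  define t where "t = (Poly_Mapping.lookup m 0, Poly_Mapping.lookup m 1, Poly_Mapping.lookup m 2)"
  have "Poly_Mapping.lookup m i = 0" if "i \<ge> 3" for i
  proof -
    have "Poly_Mapping.lookup m i < 2 ^ (3 - i)" using m by (simp add: box_def)
    with that show ?thesis by simp
  qed
  then have "m = tri t"
    by (intro poly_mapping_eqI) (auto simp: t_def tri_def lookup_add xi_mono_def lookup_single when_def)
  with m tri_box show ?thesis by blast
qed

text \<open>The solutions of \<open>i + u * j + v * k = n\<close> with \<open>j \<le> 3\<close> and
  \<open>k \<le> 1\<close>, the bounds that \<open>box\<close> puts on the second and third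
  exponents. Left multiplication uses the weights 2 and 4, right multiplication 1 and 1.\<close>

definition solve :: "nat \<Rightarrow> nat \<Rightarrow> nat \<Rightarrow> (nat \<times> nat \<times> nat) list" where
  "solve u v n = map (\<lambda>(j, k). (n - u * j - v * k, j, k)) (filter (\<lambda>(j, k). u * j + v * k \<le> n)
     [(0, 0), (1, 0), (2, 0), (3, 0), (0, 1), (1, 1), (2, 1), (3, 1)])"

text \<open>A row of the matrix of left multiplication: the monomials over which \<open>x\<close> is
  summed to give the coordinate of \<open>Sq n \<star> x\<close>. Monomials outside the box are
  dropped, as elements of \<open>Box\<close> vanish there.\<close>

definition lrow :: "nat \<Rightarrow> nat \<times> nat \<times> nat \<Rightarrow> (nat \<times> nat \<times> nat) list" where
  "lrow n = (\<lambda>(a, b, c). filter boxed (map (\<lambda>(i, j, k). (a - i + j, b - j + k, c - k))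
     (filter (\<lambda>(i, j, k). bino a i \<and> bino b j \<and> bino c k) (solve 2 4 n))))"

definition rrow :: "nat \<Rightarrow> nat \<times> nat \<times> nat \<Rightarrow> (nat \<times> nat \<times> nat) list" where
  "rrow n = (\<lambda>(a, b, c). filter boxed (map (\<lambda>(i, j, k). (a - i + 2 * j, b - j + 2 * k, c - k))
     (filter (\<lambda>(i, j, k). bino a i \<and> bino b j \<and> bino c k) (solve 1 1 n))))"

definition ev :: "steenrod \<Rightarrow> (nat \<times> nat \<times> nat) list \<Rightarrow> bit" where
  "ev x l = sum_list (map (\<lambda>t. x (tri t)) l)"

lemma ev_simps [simp]: "ev x [] = 0" "ev x (t # l) = x (tri t) + ev x l" "ev x (l @ l') = ev x l + ev x l'"
  by (simp_all add: ev_def)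

lemma ev_filter_boxed: "x \<in> Box \<Longrightarrow> ev x (filter boxed l) = ev x l"
  using tri_box by (induction l) (auto simp: Box_def)

lemma bit_of_nat: "(of_nat n :: bit) = (if odd n then 1 else 0)"
  by (induction n) auto

lemma sum_solve:
  assumes "a < 8" "b < 4" "c < 2" "n \<le> 4" "x \<in> Box" "u > 0" "v > 0"
  shows "(\<Sum>i\<le>a. \<Sum>j\<le>b. \<Sum>k\<le>c. of_nat ((a choose i) * (b choose j) * (c choose k)) *
     (if i + u * j + v * k = n then x (tri (f i j k)) else 0)) =
    ev x (filter boxed (map (\<lambda>(i, j, k). f i j k)
     (filter (\<lambda>(i, j, k). bino a i \<and> bino b j \<and> bino c k) (solve u v n))))" (is "?l = _")
proof -
  let ?S = "{..a} \<times> {..b} \<times> {..c}"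
  let ?g = "\<lambda>(i, j, k). x (tri (f i j k))"
  let ?odd = "\<lambda>(i, j, k). odd (a choose i) \<and> odd (b choose j) \<and> odd (c choose k)"
  let ?bino = "\<lambda>(i, j, k). bino a i \<and> bino b j \<and> bino c k"
  have "?l = (\<Sum>t\<in>?S. if (case t of (i, j, k) \<Rightarrow> i + u * j + v * k = n) \<and> ?odd t then ?g t else 0)"
    unfolding sum.cartesian_product by (rule sum.cong) (auto simp: bit_of_nat)
  also have "\<dots> = (\<Sum>t\<in>{t \<in> ?S. (case t of (i, j, k) \<Rightarrow> i + u * j + v * k = n) \<and> ?odd t}. ?g t)"
    by (rule sum.inter_filter[symmetric]) simp
  also have "{t \<in> ?S. (case t of (i, j, k) \<Rightarrow> i + u * j + v * k = n) \<and> ?odd t} = set (filter ?bino (solve u v n))"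
  proof -
    have iff: "odd (a choose i) \<longleftrightarrow> bino a i" "odd (b choose i) \<longleftrightarrow> bino b i" "odd (c choose i) \<longleftrightarrow> bino c i" if "i \<le> 4" for i
      using odd_choose that assms by auto
    have le: "i \<le> r" if "odd (r choose i)" for i r
      using that by (metis binomial_eq_0 even_zero not_less)
    have st: "(i, j, k) \<in> set (solve u v n) \<longleftrightarrow> i + u * j + v * k = n \<and> j \<le> 3 \<and> k \<le> 1" for i j k
    proof -
      have "(i, j, k) \<in> set (map (\<lambda>(j, k). (n - u * j - v * k, j, k)) (filter (\<lambda>(j, k). u * j + v * k \<le> n) l)) \<longleftrightarrow>
          i + u * j + v * k = n \<and> (j, k) \<in> set l" for l
        by (induction l) auto
      moreover have "(j, k) \<in> set [(0, 0), (1, 0), (2, 0), (3, 0), (0, 1), (1, 1), (2, 1), (3, 1)] \<longleftrightarrow> j \<le> 3 \<and> k \<le> 1"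
        by auto
      ultimately show ?thesis unfolding solve_def by blast
    qed
    \<comment> \<open>As \<open>u\<close> and \<open>v\<close> are positive,
      \<open>n \<le> 4\<close> bounds all three indices by 4, the range in which \<open>bino\<close>
      is correct.\<close>
    have small: "i \<le> 4" "j \<le> 4" "k \<le> 4" if "i + u * j + v * k = n" for i j k
    proof -
      have "j \<le> u * j" "k \<le> v * k" using assms by auto
      then show "i \<le> 4" "j \<le> 4" "k \<le> 4" using that assms(4) by linarith+
    qed
    have *: "(i \<le> a \<and> j \<le> b \<and> k \<le> c) \<and> i + u * j + v * k = n \<and> odd (a choose i) \<and> odd (b choose j) \<and> odd (c choose k) \<longleftrightarrow>
        (i + u * j + v * k = n \<and> j \<le> 3 \<and> k \<le> 1) \<and> bino a i \<and> bino b j \<and> bino c k" for i j k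
    proof (cases "i + u * j + v * k = n")
      case True
      have "odd (a choose i) \<longleftrightarrow> bino a i" "odd (b choose j) \<longleftrightarrow> bino b j" "odd (c choose k) \<longleftrightarrow> bino c k"
        using iff small[OF True] by auto
      then show ?thesis using True le[of a i] le[of b j] le[of c k] assms(2,3) by linarith
    qed simp
    show ?thesis
    proof (rule Set.set_eqI)
      fix t show "t \<in> {t \<in> ?S. (case t of (i, j, k) \<Rightarrow> i + u * j + v * k = n) \<and> ?odd t} \<longleftrightarrow> t \<in> set (filter ?bino (solve u v n))"
        by (cases t) (simp only: set_filter st mem_Collect_eq mem_Sigma_iff atMost_iff split *)
    qed
  qed
  also have "(\<Sum>t\<in>set (filter ?bino (solve u v n)). ?g t) = sum_list (map ?g (filter ?bino (solve u v n)))"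
    by (rule sum.distinct_set_conv_list) (auto simp: solve_def)
  also have "\<dots> = ev x (map (\<lambda>(i, j, k). f i j k) (filter ?bino (solve u v n)))"
  proof -
    have "sum_list (map ?g l) = ev x (map (\<lambda>(i, j, k). f i j k) l)" for l
      by (induction l) auto
    then show ?thesis .
  qed
  finally show ?thesis by (simp add: ev_filter_boxed[OF assms(5)])
qed

lemma Sq_mult_coord:
  assumes "x \<in> Box" "n \<le> 4" "boxed t"
  shows "(Sq n \<star> x) (tri t) = ev x (lrow n t)" "(x \<star> Sq n) (tri t) = ev x (rrow n t)"
proof -
  obtain a b c where t: "t = (a, b, c)" by (cases t)
  have abc: "a < 8" "b < 4" "c < 2" using assms(3) by (auto simp: t boxed_def)
  show "(Sq n \<star> x) (tri t) = ev x (lrow n t)"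
    using sum_solve[OF abc assms(2,1), of 2 4 "\<lambda>i j k. (a - i + j, b - j + k, c - k)"]
    unfolding t tri_ops(1) lrow_def by simp
  show "(x \<star> Sq n) (tri t) = ev x (rrow n t)"
    using sum_solve[OF abc assms(2,1), of 1 1 "\<lambda>i j k. (a - i + 2 * j, b - j + 2 * k, c - k)"]
    unfolding t tri_ops(2) rrow_def by simp
qed

type_synonym trip = "nat \<times> nat \<times> nat"

text \<open>\<open>(a, b, c)\<close> stands for \<open>\<xi>\<^sub>1\<^sup>a \<xi>\<^sub>2\<^sup>b \<xi>\<^sub>3\<^sup>c\<close>, and lists stand for formal sums modulo 2.\<close>

fun cancel :: "'a list \<Rightarrow> 'a list" where
  "cancel [] = []"
| "cancel (t # l) = (let r = cancel l in if t \<in> set r then remove1 t r else t # r)"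

definition same :: "'a list \<Rightarrow> 'a list \<Rightarrow> bool" where
  "same l l' \<longleftrightarrow> cancel (l @ l') = []"

definition bind :: "'a list \<Rightarrow> ('a \<Rightarrow> 'b list) \<Rightarrow> 'b list" where
  "bind l h = concat (map h l)"

definition row :: "('a \<times> 'b list) list \<Rightarrow> 'a \<Rightarrow> 'b list" where
  "row d t = (case map_of d t of None \<Rightarrow> [] | Some l \<Rightarrow> l)"

definition trips :: "trip list" where
  "trips = [(a, b, c). c \<leftarrow> [0, 1], b \<leftarrow> [0, 1, 2, 3], a \<leftarrow> [0, 1, 2, 3, 4, 5, 6, 7]]"

definition rr :: "nat \<Rightarrow> trip list \<Rightarrow> trip list" where "rr n l = bind l (rrow n)"
definition ll :: "nat \<Rightarrow> trip list \<Rightarrow> trip list" where "ll n l = bind l (lrow n)"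
text \<open>Rows are transposed operators, so the last factor of
  \<open>Sq 1 \<star> Sq 2 \<star> Sq 4\<close> is applied to the list first.\<close>

definition rr7 :: "trip list \<Rightarrow> trip list" where "rr7 l = rr 1 (rr 2 (rr 4 l))"
definition rr151 :: "trip list \<Rightarrow> trip list" where "rr151 l = rr 1 (rr 4 (rr 1 l))"

definition tdeg :: "trip \<Rightarrow> nat" where "tdeg = (\<lambda>(a, b, c). a + 3 * b + 7 * c)"
definition elt :: "trip list \<Rightarrow> steenrod" where
  "elt l = (\<lambda>m. if m \<in> tri ` set l then 1 else 0)"
text \<open>Whether \<open>elt l\<close> takes the value 1 on the formal sum \<open>r\<close>:
  multiplicities count in \<open>r\<close> but not in \<open>l\<close>.\<close>

definition parity :: "trip list \<Rightarrow> trip list \<Rightarrow> bool" where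
  "parity l r \<longleftrightarrow> odd (length (filter (\<lambda>t. List.member l t) r))"
text \<open>The homotopy for right multiplication by \<open>Sq 1\<close>; it pairs the monomials
  whose first exponents are \<open>a\<close> and \<open>a + 1\<close> for even
  \<open>a\<close>.\<close>

definition pair1 :: "trip \<Rightarrow> trip list" where
  "pair1 = (\<lambda>(a, b, c). if even a then [(a + 1, b, c)] else [])"
definition apply_rows :: "(trip \<Rightarrow> trip list) \<Rightarrow> steenrod \<Rightarrow> steenrod" where
  "apply_rows h x = (\<lambda>m. if m \<in> box then
     ev x (h (Poly_Mapping.lookup m 0, Poly_Mapping.lookup m 1, Poly_Mapping.lookup m 2)) else 0)"
fun word :: "nat list \<Rightarrow> steenrod" where
  "word [] = Sq 0"
| "word (n # ns) = Sq n \<star> word ns"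
fun word_row :: "nat list \<Rightarrow> trip list \<Rightarrow> trip list" where
  "word_row [] l = l"
| "word_row (n # ns) l = word_row ns (ll n l)"

text \<open>
  The tables are certificates found by linear algebra. A table stands for the linear operator whose
  value at \<open>x\<close> has the coordinate \<open>ev x (row d t)\<close> at the monomial \<open>t\<close>. Denoting the operators like the
  tables, they satisfy
  \<open>x = x(1) 1 + Sq\<^sup>1 gen1(x) + Sq\<^sup>2 gen2(x) + Sq\<^sup>4 gen4(x)\<close>,
  \<open>x = div7(x) Sq\<^sup>7 + homotopy4(x Sq\<^sup>4)\<close> and
  \<open>y Sq\<^sup>1 = (\<Sum>d. kappa\<^sub>d(y) k\<^sub>d) + homotopy7(y Sq\<^sup>7)\<close>, where the \<open>k\<^sub>d\<close> are a basis of the kernel of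
  right multiplication by \<open>Sq\<^sup>6\<close> on \<open>A2 Sq\<^sup>1\<close>. The functionals \<open>f\<^sub>d\<close> vanish on \<open>A2 Sq\<^sup>4\<close> and are coordinates
  on the quotient of the ideal by it, and \<open>trunc\<close> recovers \<open>a\<close> from \<open>a Sq\<^sup>4 + b Sq\<^sup>5 Sq\<^sup>1\<close> in degrees
  less than 7.
\<close>

definition gen1_tab :: "((nat \<times> nat \<times> nat) \<times> (nat \<times> nat \<times> nat) list) list" where
  "gen1_tab = [((0,0,0), [(1,0,0)]), ((2,0,0), [(0,1,0), (3,0,0)]), ((4,0,0), [(5,0,0)]),
    ((6,0,0), [(0,0,1), (4,1,0), (7,0,0)]), ((0,1,0), [(1,1,0)]), ((2,1,0), [(3,1,0), (6,0,0)]),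
    ((4,1,0), [(5,1,0)]), ((6,1,0), [(4,2,0), (7,1,0)]), ((0,2,0), [(1,2,0)]),
    ((2,2,0), [(0,3,0), (3,2,0)]), ((4,2,0), [(5,2,0)]), ((6,2,0), [(0,2,1), (4,3,0), (7,2,0)]),
    ((0,3,0), [(1,3,0)]), ((2,3,0), [(3,3,0), (6,2,0)]), ((4,3,0), [(5,3,0)]),
    ((6,3,0), [(7,3,0)]), ((0,0,1), [(1,0,1)]), ((2,0,1), [(0,1,1), (3,0,1)]),
    ((4,0,1), [(5,0,1)]), ((6,0,1), [(4,1,1), (7,0,1)]), ((0,1,1), [(1,1,1)]),
    ((2,1,1), [(3,1,1), (6,0,1)]), ((4,1,1), [(5,1,1)]), ((6,1,1), [(7,1,1)]),
    ((0,2,1), [(1,2,1)]), ((2,2,1), [(0,3,1), (3,2,1)]), ((4,2,1), [(5,2,1)]),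
    ((6,2,1), [(4,3,1), (7,2,1)]), ((0,3,1), [(1,3,1)]), ((2,3,1), [(3,3,1), (6,2,1)]),
    ((4,3,1), [(5,3,1)]), ((6,3,1), [(7,3,1)])]"

definition gen2_tab :: "((nat \<times> nat \<times> nat) \<times> (nat \<times> nat \<times> nat) list) list" where
  "gen2_tab = [((0,0,0), [(2,0,0)]), ((1,0,0), [(0,1,0)]), ((3,0,0), [(2,1,0)]),
    ((4,0,0), [(0,2,0), (6,0,0)]), ((5,0,0), [(0,0,1), (4,1,0)]), ((7,0,0), [(6,1,0)]),
    ((0,2,0), [(2,2,0)]), ((1,2,0), [(0,3,0)]), ((3,2,0), [(2,3,0), (4,0,1)]),
    ((4,2,0), [(6,2,0)]), ((5,2,0), [(0,2,1), (4,3,0)]), ((7,2,0), [(6,3,0)]),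
    ((0,0,1), [(2,0,1)]), ((1,0,1), [(0,1,1)]), ((3,0,1), [(2,1,1)]), ((4,0,1), [(6,0,1)]),
    ((5,0,1), [(4,1,1)]), ((7,0,1), [(6,1,1)]), ((0,2,1), [(2,2,1)]), ((1,2,1), [(0,3,1)]),
    ((3,2,1), [(2,3,1)]), ((4,2,1), [(6,2,1)]), ((5,2,1), [(4,3,1)]), ((7,2,1), [(6,3,1)])]"

definition gen4_tab :: "((nat \<times> nat \<times> nat) \<times> (nat \<times> nat \<times> nat) list) list" where
  "gen4_tab = [((0,0,0), [(4,0,0)]), ((2,0,0), [(0,2,0)]), ((6,0,0), [(4,2,0)]), ((0,1,0), [(0,0,1)]),
    ((4,1,0), [(4,0,1)]), ((0,3,0), [(0,2,1)]), ((4,3,0), [(4,2,1)])]"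

definition div7_tab :: "((nat \<times> nat \<times> nat) \<times> (nat \<times> nat \<times> nat) list) list" where
  "div7_tab = [((0,0,0), [(7,0,0)]), ((2,0,0), [(6,1,0)]), ((3,0,0), [(7,1,0)]), ((4,0,0), [(5,2,0)]),
    ((6,0,0), [(4,3,0)]), ((7,0,0), [(5,3,0)]), ((6,1,0), [(6,1,1), (7,3,0)]),
    ((0,2,0), [(6,0,1)]), ((1,2,0), [(7,0,1)]), ((2,2,0), [(5,1,1)]), ((4,2,0), [(4,2,1)]),
    ((5,2,0), [(5,2,1)]), ((6,2,0), [(3,3,1)]), ((7,2,0), [(7,2,1)]), ((0,3,0), [(6,1,1)]),
    ((1,3,0), [(4,2,1), (7,1,1)]), ((4,3,0), [(4,3,1)]), ((5,3,0), [(5,3,1)]),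
    ((6,3,0), [(6,3,1)]), ((7,3,0), [(7,3,1)])]"

definition homotopy4_tab :: "((nat \<times> nat \<times> nat) \<times> (nat \<times> nat \<times> nat) list) list" where
  "homotopy4_tab = [((0,0,0), [(4,0,0)]), ((1,0,0), [(5,0,0)]), ((2,0,0), [(3,1,0)]), ((3,0,0), [(7,0,0)]),
    ((4,0,0), [(2,2,0)]), ((5,0,0), [(3,2,0)]), ((6,0,0), [(1,3,0)]), ((0,1,0), [(4,1,0)]),
    ((1,1,0), [(5,1,0)]), ((2,1,0), [(6,1,0)]), ((3,1,0), [(1,3,0), (7,1,0)]),
    ((4,1,0), [(2,3,0)]), ((5,1,0), [(2,1,1), (3,3,0)]), ((0,2,0), [(3,0,1)]),
    ((1,2,0), [(5,2,0)]), ((2,2,0), [(2,1,1)]), ((3,2,0), [(3,1,1), (4,3,0), (6,0,1)]),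
    ((4,2,0), [(1,2,1)]), ((6,2,0), [(0,3,1)]), ((7,2,0), [(1,3,1)]), ((0,3,0), [(4,3,0)]),
    ((1,3,0), [(5,3,0)]), ((2,3,0), [(6,3,0)]), ((3,3,0), [(0,3,1), (7,3,0)]),
    ((6,3,0), [(3,3,1), (6,2,1)]), ((0,0,1), [(4,0,1)]), ((1,0,1), [(5,0,1)]),
    ((2,0,1), [(6,0,1)]), ((3,0,1), [(1,2,1), (7,0,1)]), ((4,0,1), [(2,2,1)]),
    ((5,0,1), [(0,3,1), (3,2,1)]), ((0,1,1), [(4,1,1)]), ((1,1,1), [(5,1,1)]),
    ((2,1,1), [(0,3,1), (6,1,1)]), ((3,1,1), [(1,3,1), (7,1,1)]), ((4,1,1), [(2,3,1)]),
    ((0,2,1), [(4,2,1)]), ((1,2,1), [(5,2,1)]), ((2,2,1), [(6,2,1)]), ((3,2,1), [(7,2,1)]),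
    ((6,2,1), [(7,3,1)]), ((0,3,1), [(4,3,1)]), ((1,3,1), [(5,3,1)]), ((2,3,1), [(6,3,1)])]"

definition homotopy7_tab :: "((nat \<times> nat \<times> nat) \<times> (nat \<times> nat \<times> nat) list) list" where
  "homotopy7_tab = [((1,0,0), [(7,0,0)]), ((3,0,0), [(6,1,0)]), ((5,0,0), [(5,2,0)]), ((7,0,0), [(4,3,0)]),
    ((0,1,0), [(6,1,0)]), ((1,1,0), [(7,1,0)]), ((2,1,0), [(5,2,0)]), ((4,1,0), [(4,3,0)]),
    ((5,1,0), [(5,3,0)]), ((7,1,0), [(6,1,1), (7,3,0)]), ((1,2,0), [(6,0,1)]),
    ((3,2,0), [(5,1,1)]), ((5,2,0), [(4,2,1)]), ((7,2,0), [(3,3,1)]), ((0,3,0), [(5,1,1)]),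
    ((1,3,0), [(6,1,1)]), ((2,3,0), [(4,2,1)]), ((3,3,0), [(5,2,1)]), ((4,3,0), [(3,3,1)]),
    ((5,3,0), [(4,3,1), (7,2,1)]), ((7,3,0), [(6,3,1)]), ((0,0,1), [(6,0,1)]),
    ((1,0,1), [(7,0,1)]), ((2,0,1), [(5,1,1)]), ((4,0,1), [(4,2,1)]), ((5,0,1), [(5,2,1)]),
    ((6,0,1), [(3,3,1)]), ((7,0,1), [(7,2,1)]), ((0,1,1), [(6,1,1)]),
    ((1,1,1), [(4,2,1), (7,1,1)]), ((4,1,1), [(4,3,1)]), ((5,1,1), [(5,3,1)]),
    ((6,1,1), [(6,3,1)]), ((7,1,1), [(7,3,1)])]"

definition quot4_tab :: "((nat \<times> nat \<times> nat) \<times> (nat \<times> nat \<times> nat) list) list" where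
  "quot4_tab = [((6,2,0), [(4,2,0)]), ((7,2,0), [(4,0,1), (5,2,0)]), ((6,3,0), [(0,2,1), (4,3,0), (6,0,1)]),
    ((6,2,1), [(4,2,1)])]"

definition k_tab :: "(nat \<times> (nat \<times> nat \<times> nat) list) list" where
  "k_tab = [(0, [(3,1,0)]), (4, [(1,3,0), (3,0,1), (7,1,0)]), (6, [(2,1,1), (3,3,0)]), (7, [(3,1,1)]),
    (8, [(1,2,1), (5,3,0), (7,0,1)]), (10, [(0,3,1), (3,2,1), (6,1,1), (7,3,0)]),
    (11, [(1,3,1), (7,1,1)]), (12, [(2,3,1), (5,2,1)]), (13, [(3,3,1)]),
    (14, [(4,3,1), (7,2,1)]), (15, [(5,3,1)]), (17, [(7,3,1)])]"

definition kappa_tab :: "(nat \<times> (nat \<times> nat \<times> nat) list) list" where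
  "kappa_tab = [(0, [(2,1,0), (5,0,0)]), (4, [(2,0,1), (3,2,0)]), (6, [(2,3,0), (4,0,1)]),
    (7, [(2,1,1), (3,3,0), (5,0,1)]), (8, [(0,2,1)]), (10, [(2,2,1)]), (11, [(0,3,1), (3,2,1)]),
    (12, [(4,2,1)]), (13, [(2,3,1), (5,2,1)]), (14, [(6,2,1)]), (15, [(4,3,1), (7,2,1)]),
    (17, [(6,3,1)])]"

definition f_tab :: "(nat \<times> (nat \<times> nat \<times> nat) list) list" where
  "f_tab = [(6, [(3,1,0), (6,0,0)]), (10, [(3,0,1), (4,2,0)]), (12, [(2,1,1), (6,2,0)]),
    (13, [(3,1,1), (4,3,0), (6,0,1), (7,2,0)])]"

definition trunc_tab :: "((nat \<times> nat \<times> nat) \<times> (nat \<times> nat \<times> nat) list) list" where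
  "trunc_tab = [((0,0,0), [(4,0,0)]), ((1,0,0), [(5,0,0)]), ((2,0,0), [(6,0,0)]), ((3,0,0), [(7,0,0)]),
    ((4,0,0), [(2,2,0)]), ((5,0,0), [(3,2,0)]), ((6,0,0), [(1,3,0), (3,0,1), (4,2,0)]),
    ((0,1,0), [(4,1,0)]), ((1,1,0), [(5,1,0)]), ((2,1,0), [(6,1,0)]),
    ((3,1,0), [(1,3,0), (7,1,0)]), ((0,2,0), [(4,2,0)])]"

definition D_B :: "nat list" where "D_B = [0, 4, 6, 7, 8, 10, 11, 12, 13, 14, 15, 17]"

text \<open>A pair \<open>(n, d)\<close> records that \<open>Sq n\<close> sends the basis element of
  degree \<open>d\<close> to the one of degree \<open>d + n\<close>; for pairs not listed the
  product is 0. \<open>M7_tab\<close> is read in the same way.\<close>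

definition B_tab :: "(nat \<times> nat) list" where
  "B_tab = [(1, 6), (1, 10), (1, 12), (1, 14), (2, 4), (2, 8), (2, 11), (2, 12), (2, 15),
     (4, 0), (4, 6), (4, 7), (4, 8), (4, 13)]"

definition M7_tab :: "(nat \<times> nat) list" where "M7_tab = [(4, 0), (2, 4), (1, 6)]"

section \<open>Verification of the certificates\<close>

lemma gen_check: "list_all (\<lambda>t. t = (0, 0, 0) \<or> same [t] (bind (lrow 1 t) (row gen1_tab) @
    bind (lrow 2 t) (row gen2_tab) @ bind (lrow 4 t) (row gen4_tab))) trips"
  by code_simp

text \<open>The rows raise degrees by \<open>n\<close>, so the operators lower them; this makes the
  recursion that expresses elements through the generators terminate.\<close>

lemma gen_deg: "list_all (\<lambda>(n, d). list_all (\<lambda>(t, l). list_all (\<lambda>s. tdeg s = tdeg t + n) l) d)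
    [(1, gen1_tab), (2, gen2_tab), (4, gen4_tab)]"
  by code_simp

text \<open>With \<open>h\<close> the operator of \<open>pair1\<close>, this certifies that
  \<open>x\<close> equals \<open>h x \<star> Sq 1 + h (x \<star> Sq 1)\<close>: a contracting
  homotopy of the complex whose differential is right multiplication by \<open>Sq 1\<close>.\<close>

lemma ann1_check: "list_all (\<lambda>t. same [t] (bind (rr 1 [t]) pair1 @ rr 1 (pair1 t))) trips"
  by code_simp

lemma ann4_check: "list_all (\<lambda>t. same [t] (bind (rr7 [t]) (row div7_tab) @ rr 4 (row homotopy4_tab t))) trips"
  by code_simp

lemma k_span_check: "list_all (\<lambda>t. same (rr 1 [t])
    (bind D_B (\<lambda>d. if List.member (row k_tab d) t then row kappa_tab d else []) @ rr7 (row homotopy7_tab t))) trips"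
  by code_simp

lemma k_deg_check: "list_all (\<lambda>d. list_all (\<lambda>t. tdeg t = d + 6 \<and> boxed t) (row k_tab d) \<and> row k_tab d \<noteq> []) D_B"
  by code_simp

text \<open>Only monomials in the degree of the product are compared; elsewhere both sides vanish by
  homogeneity. The shift 6 is the degree of \<open>Sq 5 \<star> Sq 1\<close>, which is the element
  for \<open>d = 0\<close>.\<close>

lemma k_Sq_check: "list_all (\<lambda>d. list_all (\<lambda>n. list_all (\<lambda>t. tdeg t \<noteq> d + 6 + n \<or>
    parity (row k_tab d) (lrow n t) = (List.member B_tab (n, d) \<and> List.member (row k_tab (d + n)) t)) trips) [1, 2, 4]) D_B"
  by code_simp

text \<open>Annihilation by \<open>Sq 1\<close> and by \<open>Sq 2 \<star> Sq 4\<close> is enough,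
  since the other summand \<open>Sq 1 \<star> Sq 4 \<star> Sq 1\<close> of \<open>Sq 6\<close>
  begins with \<open>Sq 1\<close>.\<close>

lemma k_right_check: "list_all (\<lambda>d. list_all (\<lambda>t. \<not> parity (row k_tab d) (rrow 1 t) \<and>
    \<not> parity (row k_tab d) (rr 2 (rrow 4 t))) trips) D_B"
  by code_simp

text \<open>The functionals kill multiples of \<open>Sq 4\<close>, also after a generator has acted,
  and on multiples of \<open>Sq 5 \<star> Sq 1\<close> the generators transform them into each other
  as \<open>M7_tab\<close> prescribes.\<close>

lemma f_check: "list_all (\<lambda>d. same (rr 4 (row f_tab d)) [] \<and> list_all (\<lambda>n. same (rr 4 (ll n (row f_tab d))) [] \<and>
    same (rr151 (ll n (row f_tab d))) (if d \<ge> n \<and> List.member M7_tab (n, d - n - 6) then rr151 (row f_tab (d - n)) else [])) [1, 2, 4]) [6, 10, 12, 13]"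
  by code_simp

text \<open>Certifies that \<open>b \<star> (Sq 5 \<star> Sq 1)\<close> is a combination of the
  kernel elements with index 0, 4, 6, 7, which thus represent a basis of the quotient by
  \<open>A2 Sq 4\<close>, plus the multiple of \<open>Sq 4\<close> that \<open>quot4_tab\<close>
  supplies.\<close>

lemma quot_check: "list_all (\<lambda>t. same (rr151 [t])
    (bind [6, 10, 12, 13] (\<lambda>d. if List.member (row k_tab (d - 6)) t then rr151 (row f_tab d) else []) @
     bind (rr 4 [t]) (row quot4_tab))) trips"
  by code_simp

text \<open>In a relation \<open>a \<star> Sq 4 = b \<star> (Sq 5 \<star> Sq 1)\<close> all
  components of \<open>a\<close> have degree at least 7. Below this degree \<open>a\<close> is
  recovered from the sum of the two terms by a linear operator that ignores
  \<open>b\<close>.\<close>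

lemma trunc_check: "list_all (\<lambda>t. tdeg t \<ge> 7 \<or> list_all boxed (row trunc_tab t) \<and>
    same (rr 4 (row trunc_tab t)) [t] \<and> same (rr151 (row trunc_tab t)) []) trips"
  by code_simp

text \<open>Adem relations, compared on all Milnor monomials: the letters of a word are moved into
  the row one by one, and the remaining unit is evaluated by
  \<open>parity [(0, 0, 0)]\<close>.\<close>

lemma word_check: "list_all (\<lambda>t. (parity [(0,0,0)] (word_row [1,2,4] [t]) = (t = (7,0,0))) \<and>
    (parity [(0,0,0)] (word_row [2,4] [t] @ word_row [1,4,1] [t]) = (t = (6,0,0))) \<and>
    (parity [(0,0,0)] (word_row [1,4] [t]) = (t = (5,0,0))) \<and>
    \<not> parity [(0,0,0)] (word_row [1,4] [t] @ word_row [2,1,2] [t] @ word_row [4,1] [t]) \<and>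
    \<not> parity [(0,0,0)] (word_row [1,1] [t]) \<and> \<not> parity [(0,0,0)] (word_row [1,2,4,4] [t])) trips"
  by code_simp

section \<open>Evaluation of elements on formal sums of monomials\<close>

lemma set_trips: "set trips = {t. boxed t}"
proof -
  have comp: "set [(a, b, c). c \<leftarrow> C, b \<leftarrow> B, a \<leftarrow> A] = {(a, b, c). a \<in> set A \<and> b \<in> set B \<and> c \<in> set C}" for A B C :: "nat list"
    by auto
  have "a < 8 \<longleftrightarrow> a \<in> set [0, 1, 2, 3, 4, 5, 6, 7]" "b < 4 \<longleftrightarrow> b \<in> set [0, 1, 2, 3]" "c < 2 \<longleftrightarrow> c \<in> set [0, 1]" for a b c :: nat
    by auto
  then show ?thesis
    unfolding trips_def comp boxed_def by blast
qed

lemma all_trips: "list_all P trips \<Longrightarrow> boxed t \<Longrightarrow> P t"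
  unfolding list_all_iff set_trips by blast

lemma lookup_tri: "Poly_Mapping.lookup (tri (a, b, c)) 0 = a"
  "Poly_Mapping.lookup (tri (a, b, c)) 1 = b" "Poly_Mapping.lookup (tri (a, b, c)) 2 = c"
  by (simp_all add: tri_def lookup_add xi_mono_def lookup_single when_def)

lemma tri_inj: "tri s = tri t \<longleftrightarrow> s = t"
  by (cases s; cases t) (metis lookup_tri)

lemma mdeg_tri: "mdeg (tri t) = tdeg t"
  by (cases t) (simp add: tri_def tdeg_def mdeg_xi_mono)

lemma Box_eqI:
  assumes "x \<in> Box" "y \<in> Box" "\<And>t. boxed t \<Longrightarrow> x (tri t) = y (tri t)"
  shows "x = y"
proof
  fix m show "x m = y m"
  proof (cases "m \<in> box")
    case True then show ?thesis using box_tri assms(3) by blast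
  next
    case False then show ?thesis using assms(1,2) unfolding Box_def by (metis (mono_tags, lifting) mem_Collect_eq)
  qed
qed

lemma ev_remove1: "t \<in> set l \<Longrightarrow> ev x (remove1 t l) = x (tri t) + ev x l"
  by (induction l) (auto simp: add.left_commute[of "x (tri t)"] simp flip: add.assoc)

lemma ev_cancel: "ev x (cancel l) = ev x l"
proof (induction l)
  case (Cons t l)
  then show ?case
    by (simp add: Let_def ev_remove1)
qed simp

lemma bit_eq_iff_add: "(a :: bit) = b \<longleftrightarrow> a + b = 0"
  by (cases a; cases b) auto

lemma same_ev: "same l l' \<Longrightarrow> ev x l = ev x l'"
  using ev_cancel[of x "l @ l'"] bit_eq_iff_add by (auto simp: same_def)

lemma bind_simps [simp]: "bind [] h = []" "bind (t # l) h = h t @ bind l h"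
  by (simp_all add: bind_def)

lemma lrow_boxed: "list_all boxed (lrow n t)" and rrow_boxed: "list_all boxed (rrow n t)"
  by (cases t, simp add: lrow_def rrow_def list_all_iff)+

lemma ll_boxed [simp]: "list_all boxed (ll n l)" and rr_boxed [simp]: "list_all boxed (rr n l)"
  by (induction l) (auto simp: ll_def rr_def lrow_boxed rrow_boxed)

text \<open>Multiplication by \<open>Sq n\<close> is moved from the element to the list; iterating
  this turns identities between operators into finite identities between lists.\<close>

lemma ev_ll: "x \<in> Box \<Longrightarrow> n \<le> 4 \<Longrightarrow> list_all boxed l \<Longrightarrow> ev (Sq n \<star> x) l = ev x (ll n l)"
  by (induction l) (auto simp: ll_def Sq_mult_coord)

lemma ev_rr: "x \<in> Box \<Longrightarrow> n \<le> 4 \<Longrightarrow> list_all boxed l \<Longrightarrow> ev (x \<star> Sq n) l = ev x (rr n l)"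
  by (induction l) (auto simp: rr_def Sq_mult_coord)

lemma Sq_Box [simp]: "n < 8 \<Longrightarrow> Sq n \<in> Box"
  by (rule Sq_in_Box)

lemma Box_0 [simp]: "0 \<in> Box"
  by (simp add: Box_def)

lemma ev_0 [simp]: "ev 0 l = 0"
  by (induction l) auto

lemma ev_add: "ev (x + y) l = ev x l + ev y l"
  by (induction l) (auto simp: ac_simps)

lemma Box_sum: "(\<And>i. i \<in> I \<Longrightarrow> f i \<in> Box) \<Longrightarrow> (\<Sum>i\<in>I. f i) \<in> Box"
  by (induction I rule: infinite_finite_induct) (auto intro: Box_add)

lemma ev_sum: "ev (\<Sum>i\<in>I. f i) l = (\<Sum>i\<in>I. ev (f i) l)"
  by (induction I rule: infinite_finite_induct) (simp_all add: ev_add del: plus_fun_apply zero_fun_apply)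

lemma apply_rows_Box: "apply_rows h x \<in> Box"
  by (auto simp: apply_rows_def Box_def)

lemma apply_rows_tri: "boxed t \<Longrightarrow> apply_rows h x (tri t) = ev x (h t)"
  using tri_box[of t] by (cases t) (simp only: apply_rows_def lookup_tri if_True)

lemma ev_apply_rows: "list_all boxed l \<Longrightarrow> ev (apply_rows h x) l = ev x (bind l h)"
  by (induction l) (auto simp: apply_rows_tri)

lemma elt_tri: "elt l (tri t) = (if t \<in> set l then 1 else 0)"
  by (auto simp: elt_def tri_inj)

lemma elt_Box: "list_all boxed l \<Longrightarrow> elt l \<in> Box"
  using tri_box by (auto simp: elt_def Box_def list_all_iff)

lemma ev_elt: "ev (elt l) r = (if parity l r then 1 else 0)"
  by (induction r) (auto simp: parity_def elt_tri)

lemma elt_homogeneous: "(\<And>t. t \<in> set l \<Longrightarrow> tdeg t = d) \<Longrightarrow> st_homogeneous d (elt l)"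
  by (auto simp: st_homogeneous_def elt_def mdeg_tri)

lemma Sq_elt: "Sq n = elt [(n, 0, 0)]"
  by (rule ext) (simp add: Sq_def elt_def tri_def)

lemma Sq_homogeneous: "st_homogeneous n (Sq n)"
  by (auto simp: st_homogeneous_def Sq_def mdeg_xi_mono)

lemma word_Box: "set ns \<subseteq> {1, 2, 4} \<Longrightarrow> word ns \<in> Box"
  by (induction ns) (auto intro!: Box_mult Sq_in_Box)

lemma ev_word: "set ns \<subseteq> {1, 2, 4} \<Longrightarrow> list_all boxed l \<Longrightarrow>
    ev (word ns) l = (if parity [(0, 0, 0)] (word_row ns l) then 1 else 0)"
proof (induction ns arbitrary: l)
  case Nil show ?case unfolding word.simps word_row.simps Sq_elt by (rule ev_elt)
next
  case (Cons n ns) then show ?case by (auto simp: ev_ll[OF word_Box])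
qed

lemma ev_parity_append: "(if parity l (r @ r') then 1 else 0) = (if parity l r then 1 else 0 :: bit) + (if parity l r' then 1 else 0)"
  by (simp add: ev_elt[symmetric])

lemma coord_ev: "x (tri t) = ev x [t]"
  by simp

section \<open>Adem relations and generation by \<open>Sq 1\<close>, \<open>Sq 2\<close>,
  \<open>Sq 4\<close>\<close>

lemma word_eqs: "word [1, 2, 4] = Sq 7" "word [2, 4] + word [1, 4, 1] = Sq 6" "word [1, 4] = Sq 5"
  "word [1, 4] = word [2, 1, 2] + word [4, 1]" "word [1, 1] = 0" "word [1, 2, 4, 4] = 0"
proof -
  note c = all_trips[OF word_check]
  have S: "Sq n (tri t) = (if t = (n, 0, 0) then 1 else 0)" for n t by (auto simp: Sq_elt elt_tri)
  have W: "word ns (tri t) = (if parity [(0, 0, 0)] (word_row ns [t]) then 1 else 0)"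
    if "boxed t" "set ns \<subseteq> {1, 2, 4}" for t ns
    using that ev_word[of ns "[t]"] by simp
  show "word [1, 2, 4] = Sq 7"
  proof (rule Box_eqI)
    fix t assume t: "boxed t"
    have "word [1, 2, 4] (tri t) = (if parity [(0, 0, 0)] (word_row [1, 2, 4] [t]) then 1 else 0)" by (rule W[OF t]) auto
    then show "word [1, 2, 4] (tri t) = Sq 7 (tri t)" using c[OF t] by (simp only: S)
  qed (auto intro!: word_Box simp del: word.simps)
  show "word [2, 4] + word [1, 4, 1] = Sq 6"
  proof (rule Box_eqI)
    fix t assume t: "boxed t"
    have "(word [2, 4] + word [1, 4, 1]) (tri t) = (if parity [(0, 0, 0)] (word_row [2,4] [t] @ word_row [1,4,1] [t]) then 1 else 0)"
      unfolding ev_parity_append plus_fun_apply by (intro arg_cong2[of _ _ _ _ "(+)"] W t) auto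
    then show "(word [2, 4] + word [1, 4, 1]) (tri t) = Sq 6 (tri t)" using c[OF t] by (simp only: S)
  qed (auto intro!: Box_add word_Box simp del: word.simps)
  show "word [1, 4] = Sq 5"
  proof (rule Box_eqI)
    fix t assume t: "boxed t"
    have "word [1, 4] (tri t) = (if parity [(0, 0, 0)] (word_row [1, 4] [t]) then 1 else 0)" by (rule W[OF t]) auto
    then show "word [1, 4] (tri t) = Sq 5 (tri t)" using c[OF t] by (simp only: S)
  qed (auto intro!: word_Box simp del: word.simps)
  show "word [1, 4] = word [2, 1, 2] + word [4, 1]"
  proof (rule Box_eqI)
    fix t assume t: "boxed t"
    have "word [1, 4] (tri t) + (word [2, 1, 2] (tri t) + word [4, 1] (tri t)) =
        (if parity [(0, 0, 0)] (word_row [1,4] [t] @ word_row [2,1,2] [t] @ word_row [4,1] [t]) then 1 else 0)"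
      unfolding ev_parity_append plus_fun_apply by (intro arg_cong2[of _ _ _ _ "(+)"] W t) auto
    then show "word [1, 4] (tri t) = (word [2, 1, 2] + word [4, 1]) (tri t)"
      using c[OF t] by (simp only: bit_eq_iff_add[of "word [1, 4] (tri t)"] plus_fun_apply if_False)
  qed (auto intro!: Box_add word_Box simp del: word.simps)
  have *: "word ns = 0" if "set ns \<subseteq> {1, 2, 4}" "\<And>t. boxed t \<Longrightarrow> \<not> parity [(0, 0, 0)] (word_row ns [t])" for ns
    by (rule Box_eqI) (use that in \<open>simp_all only: W if_False zero_fun_apply word_Box Box_0\<close>)
  show "word [1, 1] = 0" "word [1, 2, 4, 4] = 0"
    by (rule *; use c in auto)+
qed

lemma Sq_relations:
  "Sq 7 = Sq 1 \<star> Sq 2 \<star> Sq 4" "Sq 6 = Sq 2 \<star> Sq 4 + Sq 1 \<star> Sq 4 \<star> Sq 1" "Sq 5 = Sq 1 \<star> Sq 4"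
  "Sq 1 \<star> Sq 4 = Sq 2 \<star> Sq 1 \<star> Sq 2 + Sq 4 \<star> Sq 1" "Sq 1 \<star> Sq 1 = 0" "Sq 7 \<star> Sq 4 = 0" "Sq 1 \<star> Sq 6 = Sq 7"
proof -
  note w = word_eqs[unfolded word.simps Sq_0_right]
  show *: "Sq 7 = Sq 1 \<star> Sq 2 \<star> Sq 4" "Sq 6 = Sq 2 \<star> Sq 4 + Sq 1 \<star> Sq 4 \<star> Sq 1" "Sq 5 = Sq 1 \<star> Sq 4"
    "Sq 1 \<star> Sq 4 = Sq 2 \<star> Sq 1 \<star> Sq 2 + Sq 4 \<star> Sq 1" and s: "Sq 1 \<star> Sq 1 = 0"
    unfolding st_mult_assoc w(2)[symmetric] by (fact w[symmetric] w refl)+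
  show "Sq 7 \<star> Sq 4 = 0" by (simp only: *(1) st_mult_assoc w(6))
  have "Sq 1 \<star> Sq 6 = Sq 7 + (Sq 1 \<star> Sq 1) \<star> (Sq 4 \<star> Sq 1)"
    by (simp only: *(1,2) st_mult_assoc st_mult_add_right)
  then show "Sq 1 \<star> Sq 6 = Sq 7" by (simp only: s st_mult_0_left add_0_right)
qed

lemma A2_0 [simp]: "0 \<in> A2"
  using A2.intros(5)[OF A2.intros(1,1)] by simp

text \<open>Every element of \<open>Box\<close> is a multiple of the unit plus \<open>Sq\<^sup>1 y\<^sub>1 + Sq\<^sup>2 y\<^sub>2 + Sq\<^sup>4 y\<^sub>4\<close> with \<open>y\<^sub>n\<close> of
  smaller degree.\<close>

lemma Box_subset_A2: "x \<in> Box \<Longrightarrow> x \<in> A2"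
proof -
  have "x \<in> Box \<Longrightarrow> (\<And>t. x (tri t) \<noteq> 0 \<Longrightarrow> tdeg t < d) \<Longrightarrow> x \<in> A2" for d
  proof (induction d arbitrary: x)
    case 0
    have "x = 0" by (rule Box_eqI[OF 0(1) Box_0]) (use 0(2) in \<open>metis not_less0 zero_fun_apply\<close>)
    show ?case unfolding \<open>x = 0\<close> by (rule A2_0)
  next
    case (Suc d)
    define y1 y2 y4 where y: "y1 = apply_rows (row gen1_tab) x" "y2 = apply_rows (row gen2_tab) x"
      "y4 = apply_rows (row gen4_tab) x"
    define x0 where "x0 = (if x (tri (0, 0, 0)) = 0 then 0 else Sq 0)"
    have low: "apply_rows (row tab) x \<in> A2" if tab: "list_all (\<lambda>(t, l). list_all (\<lambda>s. tdeg s = tdeg t + n) l) tab" "n > 0" for tab n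
    proof (rule Suc.IH[OF apply_rows_Box])
      fix t assume nz: "apply_rows (row tab) x (tri t) \<noteq> 0"
      then have "boxed t" using apply_rows_Box[of "row tab" x] tri_box[of t] by (auto simp: Box_def)
      with nz have "ev x (row tab t) \<noteq> 0" by (simp only: apply_rows_tri not_False_eq_True)
      moreover have "\<exists>s\<in>set l. x (tri s) \<noteq> 0" if "ev x l \<noteq> 0" for l
      proof (rule ccontr)
        assume "\<not> (\<exists>s\<in>set l. x (tri s) \<noteq> 0)"
        then have "ev x l = 0" by (induction l) auto
        with that show False by simp
      qed
      ultimately obtain s where s: "s \<in> set (row tab t)" "x (tri s) \<noteq> 0" by blast
      then have "tdeg s = tdeg t + n"
      proof (cases "map_of tab t")
        case (Some l)
        then have "(t, l) \<in> set tab" "s \<in> set l" using s by (auto simp: row_def dest: map_of_SomeD)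
        then show ?thesis using tab(1) by (fastforce simp: list_all_iff)
      qed (use s in \<open>simp add: row_def\<close>)
      with Suc.prems(2)[OF s(2)] \<open>n > 0\<close> show "tdeg t < d" by simp
    qed
    have yA: "y1 \<in> A2" "y2 \<in> A2" "y4 \<in> A2"
      unfolding y using gen_deg low[of 1 gen1_tab] low[of 2 gen2_tab] low[of 4 gen4_tab] by simp_all
    then have yB: "y1 \<in> Box" "y2 \<in> Box" "y4 \<in> Box" by (auto intro: A2_subset_Box)
    have "x = x0 + (Sq 1 \<star> y1 + (Sq 2 \<star> y2 + Sq 4 \<star> y4))"
    proof (rule Box_eqI[OF Suc.prems(1)])
      show "x0 + (Sq 1 \<star> y1 + (Sq 2 \<star> y2 + Sq 4 \<star> y4)) \<in> Box"
        unfolding x0_def using yB by (auto intro!: Box_add Box_mult)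
      fix t assume t: "boxed t"
      have eq: "ev (Sq 1 \<star> y1 + (Sq 2 \<star> y2 + Sq 4 \<star> y4)) [t] =
          ev x (bind (lrow 1 t) (row gen1_tab) @ bind (lrow 2 t) (row gen2_tab) @ bind (lrow 4 t) (row gen4_tab))"
        using t yB by (simp add: ev_add ev_ll y ev_apply_rows del: ev_simps(2)) (simp add: ll_def)
      show "x (tri t) = (x0 + (Sq 1 \<star> y1 + (Sq 2 \<star> y2 + Sq 4 \<star> y4))) (tri t)"
      proof (cases "t = (0, 0, 0)")
        case True
        \<comment> \<open>At the unit all three products have coordinate 0, so only
          \<open>x0\<close> contributes there.\<close>
        have "lrow n (0, 0, 0) = []" if "n = 1 \<or> n = 2 \<or> n = 4" for n
          using that by (auto simp: lrow_def solve_def bino_def)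
        then show ?thesis using eq True Sq_elt[of 0] by (simp add: x0_def elt_tri)
      next
        case False
        then have "x0 (tri t) = 0" using Sq_elt[of 0] by (simp add: x0_def elt_tri)
        moreover have "x (tri t) = ev x (bind (lrow 1 t) (row gen1_tab) @ bind (lrow 2 t) (row gen2_tab) @ bind (lrow 4 t) (row gen4_tab))"
          using all_trips[OF gen_check t] False same_ev[of "[t]" _ x] by simp
        ultimately show ?thesis using eq by simp
      qed
    qed
    moreover have "x0 \<in> A2" by (simp add: x0_def A2.intros)
    ultimately show ?case using yA by (metis A2.intros(2-6))
  qed
  moreover assume "x \<in> Box"
  \<comment> \<open>The top degree is 7 + 9 + 7 = 23; 32 is merely a round bound.\<close>
  moreover have "tdeg t < 32" if "x (tri t) \<noteq> 0" for t
    using \<open>x \<in> Box\<close> that tri_box[of t] by (cases t) (auto simp: Box_def boxed_def tdeg_def)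
  ultimately show ?thesis by blast
qed

lemma A2_Box: "A2 = Box"
  using A2_subset_Box Box_subset_A2 by blast

section \<open>Annihilators and quotients of left ideals\<close>

declare One_nat_def [simp del]

lemma f_deg_check: "list_all (\<lambda>d. list_all (\<lambda>t. tdeg t = d \<and> boxed t) (row f_tab d)) [6, 10, 12, 13]"
  by code_simp

lemma gens_A2 [simp]: "n = 0 \<or> n = 1 \<or> n = 2 \<or> n = 4 \<or> n = 5 \<or> n = 6 \<or> n = 7 \<Longrightarrow> Sq n \<in> A2"
  unfolding A2_Box by auto

lemma A2_mult [simp, intro]: "a \<in> A2 \<Longrightarrow> b \<in> A2 \<Longrightarrow> a \<star> b \<in> A2"
  and A2_add [simp, intro]: "a \<in> A2 \<Longrightarrow> b \<in> A2 \<Longrightarrow> a + b \<in> A2"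
  by (fact A2.intros)+

lemma A2_induct [consumes 1, case_names zero unit Sq_mult add]:
  assumes "a \<in> A2" "P 0" "P (Sq 0)"
    "\<And>n a. n \<in> {1, 2, 4} \<Longrightarrow> a \<in> A2 \<Longrightarrow> P a \<Longrightarrow> P (Sq n \<star> a)"
    "\<And>a b. a \<in> A2 \<Longrightarrow> b \<in> A2 \<Longrightarrow> P a \<Longrightarrow> P b \<Longrightarrow> P (a + b)"
  shows "P a"
proof -
  \<comment> \<open>Passing from \<open>a\<close> to left multiplication by \<open>a\<close> reduces
    a product to two successive multiplications by its factors.\<close>
  have "\<forall>c\<in>A2. P c \<longrightarrow> P (a \<star> c)"
    using assms(1)
  proof (induction rule: A2.induct)
    case (5 a b)
    then show ?case using assms(5) A2.intros(6) by (metis st_mult_add_left)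
  next
    case (6 a b)
    then show ?case using A2.intros(6) by (metis st_mult_assoc)
  qed (use assms(4) in auto)
  then show ?thesis using assms(3) A2.intros(1) by fastforce
qed

lemma A2_sum: "(\<And>i. i \<in> I \<Longrightarrow> f i \<in> A2) \<Longrightarrow> (\<Sum>i\<in>I. f i) \<in> A2"
  unfolding A2_Box by (rule Box_sum)

lemma apply_rows_A2: "apply_rows h x \<in> A2"
  using apply_rows_Box A2_Box by blast

lemma boxed_single: "boxed t \<Longrightarrow> list_all boxed [t]" by simp

lemma ev_rr7: "x \<in> A2 \<Longrightarrow> list_all boxed l \<Longrightarrow> ev (x \<star> Sq 7) l = ev x (rr7 l)"
  unfolding Sq_relations(1) st_mult_assoc[symmetric] rr7_def A2_Box
  by (simp add: ev_rr Box_mult)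

lemma ev_rr151: "x \<in> A2 \<Longrightarrow> list_all boxed l \<Longrightarrow> ev (x \<star> (Sq 5 \<star> Sq 1)) l = ev x (rr151 l)"
  unfolding Sq_relations(3) st_mult_assoc[symmetric] rr151_def A2_Box
  by (simp add: ev_rr Box_mult)

lemma A2_eqI: "x \<in> A2 \<Longrightarrow> y \<in> A2 \<Longrightarrow> (\<And>t. boxed t \<Longrightarrow> ev x [t] = ev y [t]) \<Longrightarrow> x = y"
  using Box_eqI by (simp add: A2_Box)

lemma map_of_boxed: "list_all (\<lambda>(t, l). list_all boxed l) tab \<Longrightarrow> list_all boxed (row tab t)"
proof (cases "map_of tab t")
  case (Some l)
  then have "(t, l) \<in> set tab" by (rule map_of_SomeD)
  moreover assume "list_all (\<lambda>(t, l). list_all boxed l) tab"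
  ultimately show ?thesis using Some by (fastforce simp: row_def list_all_iff)
qed (simp add: row_def)

lemma homotopy_boxed: "list_all boxed (row homotopy4_tab t)" "list_all boxed (row homotopy7_tab t)"
  by (rule map_of_boxed, code_simp)+

text \<open>The homotopy of \<open>pair1\<close> splits \<open>x\<close> into a multiple of
  \<open>Sq 1\<close> and a term that depends only on \<open>x \<star> Sq 1\<close>.\<close>

lemma ann_Sq1:
  assumes "x \<in> A2" "x \<star> Sq 1 = 0"
  shows "\<exists>y\<in>A2. x = y \<star> Sq 1"
proof
  show "x = apply_rows pair1 x \<star> Sq 1"
  proof (rule A2_eqI)
    fix t assume t: "boxed t"
    have p: "list_all boxed (pair1 t)" using t by (cases t) (auto simp: pair1_def boxed_def elim!: evenE)
    have "ev x [t] = ev (apply_rows pair1 x \<star> Sq 1) [t] + ev (x \<star> Sq 1) (pair1 t)"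
      using same_ev[OF all_trips[OF ann1_check t], of x] t p assms(1) apply_rows_A2
      by (simp add: ev_rr ev_apply_rows A2_Box del: ev_simps(2))
    then show "ev x [t] = ev (apply_rows pair1 x \<star> Sq 1) [t]" by (simp only: assms(2) ev_0 add_0_right)
  qed (use assms apply_rows_A2 in auto)
qed (rule apply_rows_A2)

text \<open>Here two different operators are needed: one divides by \<open>Sq 7\<close>, the other
  is applied to \<open>x \<star> Sq 4\<close> and drops out.\<close>

lemma ann_Sq4:
  assumes "x \<in> A2" "x \<star> Sq 4 = 0"
  shows "\<exists>y\<in>A2. x = y \<star> Sq 7"
proof
  show "x = apply_rows (row div7_tab) x \<star> Sq 7"
  proof (rule A2_eqI)
    fix t assume t: "boxed t"
    have "ev x [t] = ev (apply_rows (row div7_tab) x \<star> Sq 7) [t] + ev (x \<star> Sq 4) (row homotopy4_tab t)"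
      using same_ev[OF all_trips[OF ann4_check t], of x] t assms(1) homotopy_boxed apply_rows_A2
      by (simp add: ev_rr7 ev_apply_rows del: ev_simps(2)) (simp add: ev_apply_rows rr7_def ev_rr A2_Box del: ev_simps(2))
    then show "ev x [t] = ev (apply_rows (row div7_tab) x \<star> Sq 7) [t]" by (simp only: assms(2) ev_0 add_0_right)
  qed (use assms apply_rows_A2 in auto)
qed (rule apply_rows_A2)

text \<open>The image in \<open>A2\<close> of the basis element of B in degree
  \<open>d\<close>.\<close>

definition kel :: "nat \<Rightarrow> steenrod" where "kel d = elt (row k_tab d)"

lemma kel_props:
  assumes "d \<in> set D_B"
  shows "kel d \<in> A2" "st_homogeneous (d + 6) (kel d)" "kel d \<noteq> 0"
proof -
  have k: "\<And>t. t \<in> set (row k_tab d) \<Longrightarrow> tdeg t = d + 6 \<and> boxed t" "row k_tab d \<noteq> []"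
    using k_deg_check assms by (auto simp: list_all_iff)
  show "kel d \<in> A2" unfolding A2_Box kel_def by (rule elt_Box) (use k in \<open>auto simp: list_all_iff\<close>)
  show "st_homogeneous (d + 6) (kel d)" unfolding kel_def by (rule elt_homogeneous) (use k in auto)
  obtain t where "t \<in> set (row k_tab d)" using k(2) by (cases "row k_tab d") auto
  then have "kel d (tri t) = 1" by (simp add: kel_def elt_tri)
  then show "kel d \<noteq> 0" by auto
qed

lemma kel_Sq:
  assumes "d \<in> set D_B" "n \<in> {1, 2, 4}"
  shows "Sq n \<star> kel d = (if (n, d) \<in> set B_tab then kel (d + n) else 0)"
proof (rule A2_eqI)
  have B: "d + n \<in> set D_B" if "(n, d) \<in> set B_tab" using that by (auto simp: B_tab_def D_B_def)
  show "Sq n \<star> kel d \<in> A2" "(if (n, d) \<in> set B_tab then kel (d + n) else 0) \<in> A2"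
    using assms kel_props(1) B by (auto intro: A2.intros)
  fix t assume t: "boxed t"
  show "ev (Sq n \<star> kel d) [t] = ev (if (n, d) \<in> set B_tab then kel (d + n) else 0) [t]"
  proof (cases "tdeg t = d + 6 + n")
    case True
    have "parity (row k_tab d) (lrow n t) = (List.member B_tab (n, d) \<and> List.member (row k_tab (d + n)) t)"
      using k_Sq_check[unfolded list_all_iff, rule_format, of d n t] assms t True set_trips by simp
    moreover have "ev (Sq n \<star> kel d) [t] = ev (kel d) (lrow n t)"
      using kel_props(1)[OF assms(1)] assms t by (auto simp: Sq_mult_coord A2_Box)
    ultimately show ?thesis by (simp add: kel_def ev_elt elt_tri)
  next
    case False
    have "st_homogeneous (n + (d + 6)) (Sq n \<star> kel d)"
      by (rule st_homogeneous_mult[OF Sq_homogeneous kel_props(2)[OF assms(1)]])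
    moreover have "st_homogeneous (d + n + 6) (if (n, d) \<in> set B_tab then kel (d + n) else 0)"
      using B kel_props(2) by (auto simp: st_homogeneous_def)
    ultimately show ?thesis using False unfolding st_homogeneous_def
      by (metis (no_types, lifting) mdeg_tri coord_ev add.commute add.left_commute)
  qed
qed

lemma kel_right:
  assumes "d \<in> set D_B"
  shows "kel d \<star> Sq 1 = 0" "kel d \<star> Sq 6 = 0"
proof -
  note A = kel_props(1)[OF assms]
  have c: "\<not> parity (row k_tab d) (rrow 1 t)" "\<not> parity (row k_tab d) (rr 2 (rrow 4 t))" if "boxed t" for t
    using k_right_check[unfolded list_all_iff, rule_format, of d t] assms that set_trips by auto
  show *: "kel d \<star> Sq 1 = 0"
    by (rule A2_eqI) (use A c in \<open>auto simp: Sq_mult_coord A2_Box kel_def ev_elt intro!: Box_mult\<close>)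
  have "kel d \<star> Sq 2 \<star> Sq 4 = 0"
  proof (rule A2_eqI)
    fix t assume t: "boxed t"
    have "ev (kel d \<star> Sq 2 \<star> Sq 4) [t] = ev (kel d) (rr 2 (rrow 4 t))"
      using A t by (simp add: Sq_mult_coord A2_Box Box_mult ev_rr rrow_boxed)
    then show "ev (kel d \<star> Sq 2 \<star> Sq 4) [t] = ev 0 [t]" using c(2)[OF t] by (simp add: kel_def ev_elt)
  qed (use A in \<open>auto simp: A2_Box intro!: Box_mult\<close>)
  then show "kel d \<star> Sq 6 = 0"
    by (simp only: Sq_relations(2) st_mult_add_right st_mult_assoc[symmetric] * st_mult_0_left add_0_left)
qed

definition kappa :: "nat \<Rightarrow> steenrod \<Rightarrow> bit" where "kappa d y = ev y (row kappa_tab d)"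

lemma distinct_D_B: "distinct D_B"
  by (simp add: D_B_def)

lemma ev_bind: "ev x (bind l h) = sum_list (map (\<lambda>d. ev x (h d)) l)"
  by (induction l) auto

text \<open>As \<open>Sq 7 = Sq 1 \<star> Sq 6\<close>, the hypothesis says that
  \<open>y \<star> Sq 1\<close> lies in the kernel of right multiplication by \<open>Sq 6\<close>;
  it makes the homotopy term of the certificate vanish.\<close>

lemma k_span:
  assumes "y \<in> A2" "y \<star> Sq 7 = 0"
  shows "y \<star> Sq 1 = (\<Sum>d\<in>set D_B. if kappa d y = 0 then 0 else kel d)" (is "_ = ?s")
proof (rule A2_eqI)
  show "?s \<in> A2" by (rule A2_sum) (simp add: kel_props(1))
  fix t assume t: "boxed t"
  have "ev (y \<star> Sq 1) [t] = ev y (rr 1 [t])" using assms t by (simp add: ev_rr A2_Box del: ev_simps(2))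
  also have "\<dots> = ev y (bind D_B (\<lambda>d. if List.member (row k_tab d) t then row kappa_tab d else [])) + ev (y \<star> Sq 7) (row homotopy7_tab t)"
    using same_ev[OF all_trips[OF k_span_check t], of y] ev_rr7[OF assms(1) homotopy_boxed(2)] by simp
  also have "\<dots> = (\<Sum>d\<in>set D_B. ev y (if List.member (row k_tab d) t then row kappa_tab d else []))"
    unfolding assms(2) ev_0 ev_bind by (simp add: sum.distinct_set_conv_list[OF distinct_D_B])
  also have "\<dots> = ev ?s [t]"
    unfolding ev_sum by (rule sum.cong) (auto simp: kel_def elt_tri kappa_def)
  finally show "ev (y \<star> Sq 1) [t] = ev ?s [t]" .
qed (use assms in auto)

definition fun7 :: "nat \<Rightarrow> steenrod \<Rightarrow> bit" where "fun7 d y = ev y (row f_tab d)"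

abbreviation D_I :: "nat set" where "D_I \<equiv> {6, 10, 12, 13}"

lemma fun7_add: "fun7 d (x + y) = fun7 d x + fun7 d y"
  by (simp add: fun7_def ev_add)

lemma fun7_boxed: "d \<in> D_I \<Longrightarrow> list_all boxed (row f_tab d)"
  using f_deg_check by (auto simp: list_all_iff)

lemma fun7_degree: "d \<in> D_I \<Longrightarrow> fun7 d y \<noteq> 0 \<Longrightarrow> st_homogeneous k y \<Longrightarrow> k = d"
proof -
  assume d: "d \<in> D_I" "fun7 d y \<noteq> 0" and k: "st_homogeneous k y"
  have "\<exists>t\<in>set (row f_tab d). y (tri t) \<noteq> 0"
  proof (rule ccontr)
    assume "\<not> ?thesis"
    then have "ev y l = 0" if "set l \<subseteq> set (row f_tab d)" for l using that by (induction l) auto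
    with d(2) show False by (simp add: fun7_def)
  qed
  then obtain t where "t \<in> set (row f_tab d)" "y (tri t) \<noteq> 0" by blast
  moreover from this(1) have "tdeg t = d" using f_deg_check d(1) by (auto simp: list_all_iff)
  ultimately show "k = d" using k mdeg_tri[of t] by (auto simp: st_homogeneous_def)
qed

lemma fun7_Sq4: "d \<in> D_I \<Longrightarrow> a \<in> A2 \<Longrightarrow> fun7 d (a \<star> Sq 4) = 0"
proof -
  assume d: "d \<in> D_I" and a: "a \<in> A2"
  have "same (rr 4 (row f_tab d)) []" using f_check d by (auto simp: list_all_iff)
  from same_ev[OF this, of a] show ?thesis
    using a fun7_boxed[OF d] by (simp add: fun7_def ev_rr A2_Box)
qed

lemma fun7_Sq:
  assumes d: "d \<in> D_I" and n: "n \<in> {1, 2, 4}" and a: "a \<in> A2" and b: "b \<in> A2"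
  defines "y \<equiv> a \<star> Sq 4 + b \<star> (Sq 5 \<star> Sq 1)"
  shows "fun7 d (Sq n \<star> y) = (if d \<ge> n + 6 \<and> (n, d - n - 6) \<in> set M7_tab then fun7 (d - n) y else 0)"
proof -
  have c: "same (rr 4 (ll n (row f_tab d))) []"
    "same (rr151 (ll n (row f_tab d))) (if d \<ge> n \<and> List.member M7_tab (n, d - n - 6) then rr151 (row f_tab (d - n)) else [])"
    using f_check d n by (auto simp: list_all_iff)
  have y: "y \<in> A2" using a b by (simp add: y_def)
  have "fun7 d (Sq n \<star> y) = ev y (ll n (row f_tab d))"
    unfolding fun7_def by (rule ev_ll) (use y n fun7_boxed[OF d] A2_Box in auto)
  also have "\<dots> = ev b (rr151 (ll n (row f_tab d)))"
    using same_ev[OF c(1), of a] a ev_rr151[OF b ll_boxed] by (simp add: y_def ev_add ev_rr A2_Box)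
  also have "\<dots> = (if d \<ge> n \<and> (n, d - n - 6) \<in> set M7_tab then ev b (rr151 (row f_tab (d - n))) else 0)"
    using same_ev[OF c(2), of b] by simp
  also have "\<dots> = (if d \<ge> n + 6 \<and> (n, d - n - 6) \<in> set M7_tab then fun7 (d - n) y else 0)"
  \<comment> \<open>Truncated subtraction gives \<open>d - n - 6 = 0\<close> for
    \<open>d = 6\<close> and \<open>n = 4\<close>, where \<open>M7_tab\<close> does have an entry;
    the bound \<open>d \<ge> n + 6\<close> excludes this case, and the row of \<open>f_tab\<close>
    at \<open>d - n = 2\<close> is empty.\<close>
  proof (cases "d - n \<in> D_I")
    case True
    have "fun7 (d - n) y = ev b (rr151 (row f_tab (d - n)))"
      using fun7_Sq4[OF True a] ev_rr151[OF b fun7_boxed[OF True]] by (simp add: y_def fun7_add) (simp add: fun7_def)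
    moreover have "d \<ge> n + 6" using True by auto
    ultimately show ?thesis by auto
  next
    case False
    then have "map_of f_tab (d - n) = None" by (auto simp: f_tab_def)
    then have "rr151 (row f_tab (d - n)) = []" by (simp add: row_def rr151_def rr_def)
    moreover have "\<not> (d \<ge> n + 6 \<and> (n, d - n - 6) \<in> set M7_tab)"
      using False d n by (auto simp: M7_tab_def)
    ultimately show ?thesis by (simp only: if_False ev_simps if_cancel)
  qed
  finally show ?thesis .
qed

lemma Sq51_kel: "Sq 5 \<star> Sq 1 = kel 0"
proof (rule A2_eqI)
  fix t assume t: "boxed t"
  have "list_all (\<lambda>t. parity [(5,0,0)] (rrow 1 t) = List.member (row k_tab 0) t) trips" by code_simp
  from all_trips[OF this t] show "ev (Sq 5 \<star> Sq 1) [t] = ev (kel 0) [t]"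
    using t by (simp add: Sq_mult_coord kel_def elt_tri) (simp add: Sq_elt ev_elt)
qed (auto intro!: kel_props simp: D_B_def)

lemma fun7_bot: "fun7 6 (Sq 5 \<star> Sq 1) = 1"
  unfolding Sq51_kel fun7_def kel_def ev_elt
proof -
  have "parity (row k_tab 0) (row f_tab 6)" by code_simp
  then show "(if parity (row k_tab 0) (row f_tab 6) then 1 else 0) = (1 :: bit)" by simp
qed

lemma quot4:
  assumes "b \<in> A2"
  shows "\<exists>u\<in>A2. b \<star> (Sq 5 \<star> Sq 1) = (\<Sum>d\<in>D_I. if fun7 d (b \<star> (Sq 5 \<star> Sq 1)) = 0 then 0 else kel (d - 6)) + u \<star> Sq 4"
    (is "\<exists>u\<in>A2. ?y = ?s + _")
proof
  let ?u = "apply_rows (row quot4_tab) b"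
  have s: "?s \<in> A2" by (rule A2_sum) (auto simp: D_B_def intro!: kel_props(1))
  show "?y = ?s + ?u \<star> Sq 4"
  proof (rule A2_eqI)
    fix t assume t: "boxed t"
    have "ev ?y [t] = ev b (rr151 [t])" by (rule ev_rr151[OF assms boxed_single[OF t]])
    also have "\<dots> = ev b (bind [6, 10, 12, 13] (\<lambda>d. if List.member (row k_tab (d - 6)) t then rr151 (row f_tab d) else []))
        + ev b (bind (rr 4 [t]) (row quot4_tab))"
      using same_ev[OF all_trips[OF quot_check t], of b] by (simp only: ev_simps(3))
    also have "ev b (bind (rr 4 [t]) (row quot4_tab)) = ev (?u \<star> Sq 4) [t]"
      using t apply_rows_Box by (simp add: ev_rr ev_apply_rows del: ev_simps(2) bind_simps)
    also have "ev b (bind [6, 10, 12, 13] (\<lambda>d. if List.member (row k_tab (d - 6)) t then rr151 (row f_tab d) else []))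
        = (\<Sum>d\<in>set [6, 10, 12, 13]. ev b (if List.member (row k_tab (d - 6)) t then rr151 (row f_tab d) else []))"
      unfolding ev_bind by (rule sum.distinct_set_conv_list[symmetric]) simp
    also have "\<dots> = (\<Sum>d\<in>D_I. ev (if fun7 d ?y = 0 then 0 else kel (d - 6)) [t])"
    proof (rule sum.cong)
      fix d assume d: "d \<in> D_I"
      then have "fun7 d ?y = ev b (rr151 (row f_tab d))"
        by (simp add: fun7_def ev_rr151 assms fun7_boxed)
      then show "ev b (if List.member (row k_tab (d - 6)) t then rr151 (row f_tab d) else []) =
          ev (if fun7 d ?y = 0 then 0 else kel (d - 6)) [t]"
        by (auto simp: kel_def elt_tri)
    qed simp
    finally show "ev ?y [t] = ev (?s + ?u \<star> Sq 4) [t]" by (simp only: ev_add ev_sum)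
  qed (use assms s apply_rows_A2 in auto)
qed (rule apply_rows_A2)

lemma trunc:
  assumes "a \<in> A2" "b \<in> A2" "boxed t" "tdeg t < 7"
  shows "ev (a \<star> Sq 4 + b \<star> (Sq 5 \<star> Sq 1)) (row trunc_tab t) = a (tri t)"
proof -
  have c: "list_all boxed (row trunc_tab t)" "same (rr 4 (row trunc_tab t)) [t]" "same (rr151 (row trunc_tab t)) []"
    using all_trips[OF trunc_check assms(3)] assms(4) by auto
  show ?thesis
    using same_ev[OF c(2), of a] same_ev[OF c(3), of b] assms c(1) ev_rr151[OF assms(2) c(1)]
    by (simp add: ev_add ev_rr A2_Box)
qed

section \<open>Graded modules\<close>

lemma add_self_uminus: "(x :: 'a::ab_group_add) + x = 0 \<Longrightarrow> - x = x"
  by (metis add_eq_0_iff)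

lemma sum_in_total: "finite N \<Longrightarrow> (\<And>n. n \<in> N \<Longrightarrow> f n \<in> gr M n) \<Longrightarrow> (\<Sum>n\<in>N. f n) \<in> total M"
  by (auto simp: total_def)

lemma gr_total: "x \<in> gr M n \<Longrightarrow> x \<in> total M"
  using sum_in_total[of "{n}" "\<lambda>_. x"] by simp

locale module =
  fixes M :: "'a::ab_group_add gmod"
  assumes M: "A2_module M"
begin

lemma gr_0 [simp]: "0 \<in> gr M n" and gr_add: "x \<in> gr M n \<Longrightarrow> y \<in> gr M n \<Longrightarrow> x + y \<in> gr M n"
  using M by (auto simp: A2_module_def)

lemma total_self: "x \<in> total M \<Longrightarrow> x + x = 0"
  using M by (auto simp: A2_module_def)

lemma independent: "finite N \<Longrightarrow> (\<And>n. n \<in> N \<Longrightarrow> f n \<in> gr M n) \<Longrightarrow> (\<Sum>n\<in>N. f n) = 0 \<Longrightarrow> n \<in> N \<Longrightarrow> f n = 0"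
  using M unfolding A2_module_def by meson

lemma act_gr: "a \<in> A2 \<Longrightarrow> x \<in> gr M n \<Longrightarrow> st_homogeneous k a \<Longrightarrow> act M a x \<in> gr M (int k + n)"
  using M by (auto simp: A2_module_def)

lemma act_add: "a \<in> A2 \<Longrightarrow> x \<in> total M \<Longrightarrow> y \<in> total M \<Longrightarrow> act M a (x + y) = act M a x + act M a y"
  and add_act: "a \<in> A2 \<Longrightarrow> b \<in> A2 \<Longrightarrow> x \<in> total M \<Longrightarrow> act M (a + b) x = act M a x + act M b x"
  and act_act: "a \<in> A2 \<Longrightarrow> b \<in> A2 \<Longrightarrow> x \<in> total M \<Longrightarrow> act M (a \<star> b) x = act M a (act M b x)"
  and act_1: "x \<in> total M \<Longrightarrow> act M (Sq 0) x = x"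
  using M by (auto simp: A2_module_def)

lemma total_0 [simp]: "0 \<in> total M"
  by (rule gr_total[OF gr_0])

lemma common_support:
  assumes "finite N" "\<And>n. n \<in> N \<Longrightarrow> f n \<in> gr M n" "finite K" "N \<subseteq> K"
  shows "(\<Sum>n\<in>N. f n) = (\<Sum>n\<in>K. if n \<in> N then f n else 0)" "\<And>n. n \<in> K \<Longrightarrow> (if n \<in> N then f n else 0) \<in> gr M n"
  using assms by (simp_all add: sum.If_cases Int_absorb1)

lemma total_add: "x \<in> total M \<Longrightarrow> y \<in> total M \<Longrightarrow> x + y \<in> total M"
proof -
  assume "x \<in> total M" "y \<in> total M"
  then obtain N f K g where x: "x = (\<Sum>n\<in>N. f n)" "finite N" "\<And>n. n \<in> N \<Longrightarrow> f n \<in> gr M n"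
    and y: "y = (\<Sum>n\<in>K. g n)" "finite K" "\<And>n. n \<in> K \<Longrightarrow> g n \<in> gr M n"
    unfolding total_def by blast
  have "x + y = (\<Sum>n\<in>N \<union> K. (if n \<in> N then f n else 0) + (if n \<in> K then g n else 0))"
    unfolding x(1) y(1) sum.distrib
    using common_support(1)[OF x(2,3), of "N \<union> K"] common_support(1)[OF y(2,3), of "N \<union> K"] x(2) y(2) by simp
  also have "\<dots> \<in> total M"
    by (rule sum_in_total) (use x y gr_add in auto)
  finally show ?thesis .
qed

lemma total_sum: "(\<And>i. i \<in> I \<Longrightarrow> f i \<in> total M) \<Longrightarrow> (\<Sum>i\<in>I. f i) \<in> total M"
  by (induction I rule: infinite_finite_induct) (auto simp: total_add)

lemma gr_sum: "(\<And>i. i \<in> I \<Longrightarrow> f i \<in> gr M n) \<Longrightarrow> (\<Sum>i\<in>I. f i) \<in> gr M n"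
  by (induction I rule: infinite_finite_induct) (auto simp: gr_add)

lemma total_induct [consumes 1, case_names gr add]:
  assumes "x \<in> total M" "\<And>n x. x \<in> gr M n \<Longrightarrow> P x"
    "\<And>x y. x \<in> total M \<Longrightarrow> y \<in> total M \<Longrightarrow> P x \<Longrightarrow> P y \<Longrightarrow> P (x + y)"
  shows "P x"
proof -
  obtain N f where x: "x = (\<Sum>n\<in>N. f n)" and N: "finite N" "\<And>n. n \<in> N \<Longrightarrow> f n \<in> gr M n"
    using assms(1) unfolding total_def by blast
  have "(\<Sum>n\<in>N. f n) \<in> total M \<and> P (\<Sum>n\<in>N. f n)"
    using N
  proof (induction N rule: finite_induct)
    case empty show ?case using assms(2)[OF gr_0] by simp
  next
    case (insert n N)
    then have "f n \<in> total M" "P (f n)" using gr_total assms(2) by blast+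
    with insert show ?case by (simp add: total_add assms(3))
  qed
  then show ?thesis by (simp add: x)
qed

lemma act_Sq_total: "Sq n \<in> A2 \<Longrightarrow> x \<in> total M \<Longrightarrow> act M (Sq n) x \<in> total M"
  by (rotate_tac, induction rule: total_induct)
    (auto simp: act_add total_add intro: gr_total act_gr[OF _ _ Sq_homogeneous])

lemma zero_act: "x \<in> total M \<Longrightarrow> act M 0 x = 0"
  using add_act[of 0 0 x] by simp

lemma act_total: "a \<in> A2 \<Longrightarrow> x \<in> total M \<Longrightarrow> act M a x \<in> total M"
proof (induction arbitrary: x rule: A2_induct)
  case (Sq_mult n a)
  then have "Sq n \<in> A2" by auto
  with Sq_mult show ?case by (simp only: act_act act_Sq_total)
qed (simp_all only: zero_act total_0 act_1 add_act total_add)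

lemma act_0: "a \<in> A2 \<Longrightarrow> act M a 0 = 0"
  using act_add[of a 0 0] by simp

lemma cancel_self: "x \<in> total M \<Longrightarrow> x + (x + y) = y"
  using total_self[of x] by (simp flip: add.assoc)

lemma add_eq_0: "x \<in> total M \<Longrightarrow> y \<in> total M \<Longrightarrow> x + y = 0 \<Longrightarrow> x = y"
  using add_self_uminus[OF total_self] by (metis add_eq_0_iff)

text \<open>\<open>THE\<close> is well-defined by the uniqueness of decompositions.\<close>

definition comp :: "int \<Rightarrow> 'a \<Rightarrow> 'a" where
  "comp n x = (THE y. \<exists>N f. finite N \<and> (\<forall>i\<in>N. f i \<in> gr M i) \<and> x = (\<Sum>i\<in>N. f i) \<and> y = (if n \<in> N then f n else 0))"

lemma decomposition_unique:
  assumes N: "finite N" "\<And>n. n \<in> N \<Longrightarrow> f n \<in> gr M n" and K: "finite K" "\<And>n. n \<in> K \<Longrightarrow> g n \<in> gr M n"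
    and eq: "(\<Sum>n\<in>N. f n) = (\<Sum>n\<in>K. g n)"
  shows "(if n \<in> N then f n else 0) = (if n \<in> K then g n else 0)"
proof (cases "n \<in> N \<union> K")
  case True
  let ?h = "\<lambda>n. (if n \<in> N then f n else 0) + (if n \<in> K then g n else 0)"
  have "(\<Sum>n\<in>N \<union> K. ?h n) = (\<Sum>n\<in>N. f n) + (\<Sum>n\<in>K. g n)"
    unfolding sum.distrib
    using common_support(1)[OF N, of "N \<union> K"] common_support(1)[OF K, of "N \<union> K"] N(1) K(1) by simp
  also have "\<dots> = 0" unfolding eq by (rule total_self[OF sum_in_total[OF K]])
  finally have "(\<Sum>n\<in>N \<union> K. ?h n) = 0" .
  moreover have "?h n \<in> gr M n" for n using N K gr_add by auto
  ultimately have "?h n = 0"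
    using independent[of "N \<union> K" ?h n] N(1) K(1) True by blast
  moreover have "(if n \<in> N then f n else 0) \<in> total M" "(if n \<in> K then g n else 0) \<in> total M"
    using N(2)[THEN gr_total] K(2)[THEN gr_total] by auto
  ultimately show ?thesis using add_eq_0 by blast
qed auto

lemma comp_sum:
  assumes "finite N" "\<And>n. n \<in> N \<Longrightarrow> f n \<in> gr M n"
  shows "comp n (\<Sum>i\<in>N. f i) = (if n \<in> N then f n else 0)"
  unfolding comp_def
proof (rule the_equality)
  fix y assume "\<exists>K g. finite K \<and> (\<forall>i\<in>K. g i \<in> gr M i) \<and> (\<Sum>i\<in>N. f i) = (\<Sum>i\<in>K. g i) \<and> y = (if n \<in> K then g n else 0)"
  then obtain K g where K: "finite K" "\<And>i. i \<in> K \<Longrightarrow> g i \<in> gr M i" "(\<Sum>i\<in>N. f i) = (\<Sum>i\<in>K. g i)"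
    "y = (if n \<in> K then g n else 0)" by blast
  show "y = (if n \<in> N then f n else 0)"
    unfolding K(4) using decomposition_unique[OF assms K(1-3)] by simp
qed (use assms in blast)

lemma comp_gr: "x \<in> total M \<Longrightarrow> comp n x \<in> gr M n"
proof -
  assume "x \<in> total M"
  then obtain N f where "x = (\<Sum>n\<in>N. f n)" "finite N" "\<And>n. n \<in> N \<Longrightarrow> f n \<in> gr M n"
    unfolding total_def by blast
  then show ?thesis using comp_sum[of N f n] by auto
qed

lemma comp_homogeneous: "x \<in> gr M k \<Longrightarrow> comp n x = (if n = k then x else 0)"
  using comp_sum[of "{k}" "\<lambda>_. x" n] by simp

lemma comp_decomp: "x \<in> total M \<Longrightarrow> \<exists>N. finite N \<and> (\<forall>n. n \<notin> N \<longrightarrow> comp n x = 0) \<and> x = (\<Sum>n\<in>N. comp n x)"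
proof -
  assume "x \<in> total M"
  then obtain N f where N: "x = (\<Sum>n\<in>N. f n)" "finite N" "\<And>n. n \<in> N \<Longrightarrow> f n \<in> gr M n"
    unfolding total_def by blast
  have "comp n x = (if n \<in> N then f n else 0)" for n
    unfolding N(1) by (rule comp_sum[OF N(2,3)])
  then show ?thesis by (intro exI[of _ N]) (auto simp: N(2) intro!: trans[OF N(1)] sum.cong)
qed

lemma comp_add:
  assumes "x \<in> total M" "y \<in> total M"
  shows "comp n (x + y) = comp n x + comp n y"
proof -
  obtain N where N: "finite N" "\<And>n. n \<notin> N \<Longrightarrow> comp n x = 0" "x = (\<Sum>n\<in>N. comp n x)"
    using comp_decomp[OF assms(1)] by blast
  obtain K where K: "finite K" "\<And>n. n \<notin> K \<Longrightarrow> comp n y = 0" "y = (\<Sum>n\<in>K. comp n y)"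
    using comp_decomp[OF assms(2)] by blast
  have "x = (\<Sum>n\<in>N \<union> K. comp n x)"
    using N(3) sum.mono_neutral_left[of "N \<union> K" N "\<lambda>n. comp n x"] N K by auto
  moreover have "y = (\<Sum>n\<in>N \<union> K. comp n y)"
    using K(3) sum.mono_neutral_left[of "N \<union> K" K "\<lambda>n. comp n y"] N K by auto
  ultimately have "x + y = (\<Sum>n\<in>N \<union> K. comp n x + comp n y)"
    by (simp add: sum.distrib)
  then have "comp n (x + y) = (if n \<in> N \<union> K then comp n x + comp n y else 0)"
    using comp_sum[of "N \<union> K" "\<lambda>n. comp n x + comp n y" n] N(1) K(1) assms comp_gr gr_add by simp
  then show ?thesis using N(2) K(2) by auto
qed

end

definition gadd :: "'a::ab_group_add gmod \<Rightarrow> 'b::ab_group_add gmod \<Rightarrow> ('a \<Rightarrow> 'b) \<Rightarrow> bool" where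
  "gadd M N f \<longleftrightarrow> (\<forall>x\<in>total M. \<forall>y\<in>total M. f (x + y) = f x + f y) \<and> (\<forall>n. f ` gr M n \<subseteq> gr N n)"

lemma A2_hom_gadd: "A2_hom M N f \<Longrightarrow> gadd M N f"
  by (auto simp: A2_hom_def gadd_def)

context
  fixes M :: "'a::ab_group_add gmod" and N :: "'b::ab_group_add gmod" and f
  assumes M: "A2_module M" and N: "A2_module N" and f: "gadd M N f"
begin

interpretation M: module M by unfold_locales (fact M)
interpretation N: module N by unfold_locales (fact N)

lemma gadd_add: "x \<in> total M \<Longrightarrow> y \<in> total M \<Longrightarrow> f (x + y) = f x + f y"
  and gadd_gr: "x \<in> gr M n \<Longrightarrow> f x \<in> gr N n"
  using f unfolding gadd_def by blast+

lemma gadd_0: "f 0 = 0"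
  using gadd_add[of 0 0] by simp

lemma gadd_total: "x \<in> total M \<Longrightarrow> f x \<in> total N"
  by (induction rule: M.total_induct) (auto simp: gadd_add N.total_add intro: gr_total gadd_gr)

lemma gadd_sum: "(\<And>i. i \<in> I \<Longrightarrow> g i \<in> total M) \<Longrightarrow> f (\<Sum>i\<in>I. g i) = (\<Sum>i\<in>I. f (g i))"
  by (induction I rule: infinite_finite_induct) (auto simp: gadd_add gadd_0 M.total_sum)

lemma gadd_comp: "x \<in> total M \<Longrightarrow> module.comp N n (f x) = f (module.comp M n x)"
proof -
  assume x: "x \<in> total M"
  obtain K where K: "finite K" "\<And>n. n \<notin> K \<Longrightarrow> M.comp n x = 0" "x = (\<Sum>n\<in>K. M.comp n x)"
    using M.comp_decomp[OF x] by blast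
  have "f x = (\<Sum>n\<in>K. f (M.comp n x))"
    by (subst K(3)) (intro gadd_sum, use M.comp_gr[OF x] gr_total in blast)
  then show ?thesis
    using N.comp_sum[of K "\<lambda>n. f (M.comp n x)" n] K(1,2) M.comp_gr[OF x] gadd_gr gadd_0 by auto
qed

end

text \<open>\<open>A2\<close> is spanned by products of the three generators, so linearity has to be
  checked on these only.\<close>

lemma A2_homI:
  assumes M: "A2_module M" and N: "A2_module N" and f: "gadd M N f"
    and gens: "\<And>n x. n \<in> {1, 2, 4} \<Longrightarrow> x \<in> total M \<Longrightarrow> f (act M (Sq n) x) = act N (Sq n) (f x)"
  shows "A2_hom M N f"
proof -
  interpret M: module M by unfold_locales (fact M)
  interpret N: module N by unfold_locales (fact N)
  have "f (act M a x) = act N a (f x)" if "a \<in> A2" "x \<in> total M" for a x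
    using that
  proof (induction arbitrary: x rule: A2_induct)
    case (Sq_mult n a)
    then have n: "Sq n \<in> A2" by auto
    have "f (act M (Sq n \<star> a) x) = f (act M (Sq n) (act M a x))"
      using n Sq_mult by (simp only: M.act_act)
    also have "\<dots> = act N (Sq n) (act N a (f x))"
      using Sq_mult by (simp only: gens M.act_total)
    also have "\<dots> = act N (Sq n \<star> a) (f x)"
      using n Sq_mult gadd_total[OF M N f] by (simp only: N.act_act)
    finally show ?case .
  qed (simp_all add: M.zero_act N.zero_act M.act_1 N.act_1 gadd_total[OF M N f] gadd_0[OF M N f]
      M.add_act N.add_act gadd_add[OF M N f] M.act_total)
  then show ?thesis using f by (auto simp: A2_hom_def gadd_def)
qed

section \<open>Retractions\<close>

text \<open>Linear extension over the field with two elements, one new vector \<open>u\<close> at a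
  time, which is sent to 0. So no new values arise, and this keeps the extension within the intended
  degree later. Finiteness of \<open>W\<close> replaces the choice of a basis.\<close>

lemma extend_additive:
  fixes f :: "'a::ab_group_add \<Rightarrow> 'b::ab_group_add"
  assumes W: "finite W" "\<And>x y. x \<in> W \<Longrightarrow> y \<in> W \<Longrightarrow> x + y \<in> W" "\<And>x. x \<in> W \<Longrightarrow> x + x = 0"
    and "V \<subseteq> W" "0 \<in> V" "\<And>x y. x \<in> V \<Longrightarrow> y \<in> V \<Longrightarrow> x + y \<in> V" "\<And>x y. x \<in> V \<Longrightarrow> y \<in> V \<Longrightarrow> f (x + y) = f x + f y"
  shows "\<exists>g. (\<forall>x\<in>W. \<forall>y\<in>W. g (x + y) = g x + g y) \<and> (\<forall>x\<in>V. g x = f x) \<and> g ` W \<subseteq> f ` V"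
  using assms(4-)
proof (induction "card (W - V)" arbitrary: V f rule: less_induct)
  case less
  show ?case
  proof (cases "V = W")
    case True then show ?thesis using less by blast
  next
    case False
    then obtain u where u: "u \<in> W" "u \<notin> V" using less by blast
    have cancel: "u + (u + v) = v" for v using W(3)[OF u(1)] by (simp flip: add.assoc)
    define V' where "V' = V \<union> (+) u ` V"
    define f' where "f' v = (if v \<in> V then f v else f (u + v))" for v
    have notin: "u + v \<notin> V" if "v \<in> V" for v
    proof
      assume "u + v \<in> V"
      then have "u + v + v \<in> V" using less(4) that by blast
      moreover have "u + v + v = u" using W(3)[of v] that less(2) by (auto simp: add.assoc)
      ultimately show False using u by simp
    qed
    have f'1: "f' v = f v" if "v \<in> V" for v using that by (simp add: f'_def)
    have f'2: "f' (u + v) = f v" if "v \<in> V" for v using notin[OF that] by (simp add: f'_def cancel)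
    have e: "v + (u + w) = u + (v + w)" "u + v + (u + w) = v + w" for v w
      using cancel[of "v + w"] by (simp_all add: add_ac)
    have fd: "f v + (f v + z) = z" if "v \<in> V" for v z
    proof -
      have "f v + f v = f (v + v)" using less(5) that by simp
      also have "v + v = 0" using W(3) that less(2) by blast
      also have "f 0 = 0" using less(5)[OF less(3) less(3)] by simp
      finally show ?thesis by (simp flip: add.assoc)
    qed
    have "card (W - V') < card (W - V)"
      by (rule psubset_card_mono) (use W(1) u less(3) in \<open>auto simp: V'_def image_iff intro!: bexI[of _ 0]\<close>)
    moreover have "V' \<subseteq> W" using less(2) u W(2) by (auto simp: V'_def)
    moreover have "0 \<in> V'" using less(3) by (simp add: V'_def)
    moreover have "x + y \<in> V' \<and> f' (x + y) = f' x + f' y" if xy: "x \<in> V'" "y \<in> V'" for x y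
    proof -
      consider "x \<in> V" "y \<in> V" | w where "x \<in> V" "w \<in> V" "y = u + w" | v where "v \<in> V" "y \<in> V" "x = u + v"
        | v w where "v \<in> V" "w \<in> V" "x = u + v" "y = u + w"
        using xy by (auto simp: V'_def)
      then show ?thesis
      proof cases
        case 1 then show ?thesis using less(4,5) by (simp add: V'_def f'1)
      next
        case 2 then show ?thesis using less(4,5) by (simp add: V'_def e(1) f'1 f'2)
      next
        case 3 then show ?thesis using less(4,5) by (simp add: V'_def add.assoc f'1 f'2)
      next
        case 4 then show ?thesis using less(4,5) by (simp only: e(2) f'1 f'2) (simp add: V'_def)
      qed
    qed
    ultimately obtain g where g: "\<forall>x\<in>W. \<forall>y\<in>W. g (x + y) = g x + g y" "\<forall>x\<in>V'. g x = f' x" "g ` W \<subseteq> f' ` V'"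
      using less(1)[of V' f'] by blast
    have "f' ` V' \<subseteq> f ` V" by (auto simp: V'_def f'1 f'2)
    then show ?thesis using g by (intro exI[of _ g]) (auto simp: V'_def f'1)
  qed
qed

text \<open>The retraction is graded and additive but in general not \<open>A2\<close>-linear; its
  failure to be linear is what the connecting homomorphism measures. It is assembled from extensions
  in the single degrees, hence the finiteness of each \<open>gr M n\<close>.\<close>

lemma retraction:
  assumes L: "A2_module L" and M: "A2_module M" and i: "A2_hom L M i" "inj_on i (total L)"
    and fin: "\<And>n. finite (gr M n)"
  shows "\<exists>r. gadd M L r \<and> (\<forall>x\<in>total L. r (i x) = x)"
proof -
  interpret L: module L by unfold_locales (fact L)
  interpret M: module M by unfold_locales (fact M)
  note g = A2_hom_gadd[OF i(1)]
  define j where "j = the_inv_into (total L) i"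
  have j: "j (i x) = x" if "x \<in> total L" for x
    unfolding j_def by (rule the_inv_into_f_f[OF i(2) that])
  have "\<exists>h. (\<forall>x\<in>gr M n. \<forall>y\<in>gr M n. h (x + y) = h x + h y) \<and> (\<forall>x\<in>i ` gr L n. h x = j x) \<and> h ` gr M n \<subseteq> j ` i ` gr L n" for n
  proof (rule extend_additive[OF fin M.gr_add])
    show "x + x = 0" if "x \<in> gr M n" for x using M.total_self gr_total that by blast
    show "i ` gr L n \<subseteq> gr M n" using gadd_gr[OF L M g] by blast
    show "0 \<in> i ` gr L n" using gadd_0[OF L M g] L.gr_0 by (metis imageI)
    have *: "i x + i y = i (x + y)" if "x \<in> gr L n" "y \<in> gr L n" for x y
      using gadd_add[OF L M g gr_total gr_total] that by simp
    then show "x + y \<in> i ` gr L n" if "x \<in> i ` gr L n" "y \<in> i ` gr L n" for x y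
      using that L.gr_add by auto
    show "j (x + y) = j x + j y" if xy: "x \<in> i ` gr L n" "y \<in> i ` gr L n" for x y
    proof -
      obtain u v where uv: "u \<in> gr L n" "v \<in> gr L n" "x = i u" "y = i v" using xy by blast
      then have "j (x + y) = u + v" using * j L.gr_add gr_total by metis
      then show ?thesis using uv j gr_total by metis
    qed
  qed
  then obtain h where h: "\<And>n x y. x \<in> gr M n \<Longrightarrow> y \<in> gr M n \<Longrightarrow> h n (x + y) = h n x + h n y"
      "\<And>n x. x \<in> gr L n \<Longrightarrow> h n (i x) = x" "\<And>n x. x \<in> gr M n \<Longrightarrow> h n x \<in> gr L n"
  proof -
    assume a: "\<And>h. (\<And>n x y. x \<in> gr M n \<Longrightarrow> y \<in> gr M n \<Longrightarrow> h n (x + y) = h n x + h n y) \<Longrightarrow>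
      (\<And>n x. x \<in> gr L n \<Longrightarrow> h n (i x) = x) \<Longrightarrow> (\<And>n x. x \<in> gr M n \<Longrightarrow> h n x \<in> gr L n) \<Longrightarrow> thesis"
    assume "\<And>n. \<exists>h. (\<forall>x\<in>gr M n. \<forall>y\<in>gr M n. h (x + y) = h x + h y) \<and> (\<forall>x\<in>i ` gr L n. h x = j x) \<and> h ` gr M n \<subseteq> j ` i ` gr L n"
    then obtain h where *: "\<And>n. (\<forall>x\<in>gr M n. \<forall>y\<in>gr M n. h n (x + y) = h n x + h n y) \<and> (\<forall>x\<in>i ` gr L n. h n x = j x) \<and> h n ` gr M n \<subseteq> j ` i ` gr L n"
      by metis
    have ji: "j ` i ` gr L n = gr L n" for n using j gr_total by force
    show thesis
    proof (rule a[of h])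
      show "h n (i x) = x" if "x \<in> gr L n" for n x using *[of n] that j[OF gr_total[OF that]] by auto
      have "h n ` gr M n \<subseteq> gr L n" for n using *[of n] unfolding ji by (elim conjE)
      then show "h n x \<in> gr L n" if "x \<in> gr M n" for n x using that by (meson image_subset_iff)
      show "h n (x + y) = h n x + h n y" if "x \<in> gr M n" "y \<in> gr M n" for n x y
        using *[of n] that by (elim conjE) simp
    qed
  qed
  have h0: "h n 0 = 0" for n using h(1)[of 0 n 0] by simp
  define r where "r x = (\<Sum>n | M.comp n x \<noteq> 0. h n (M.comp n x))" for x
  have r: "r x = (\<Sum>n\<in>K. h n (M.comp n x))" if "finite K" "\<And>n. n \<notin> K \<Longrightarrow> M.comp n x = 0" for x K
    unfolding r_def by (rule sum.mono_neutral_left) (use that h0 in auto)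
  have "gadd M L r"
    unfolding gadd_def
  proof (intro conjI ballI allI image_subsetI)
    fix x y assume xy: "x \<in> total M" "y \<in> total M"
    obtain K K' where K: "finite K" "\<And>n. n \<notin> K \<Longrightarrow> M.comp n x = 0" and K': "finite K'" "\<And>n. n \<notin> K' \<Longrightarrow> M.comp n y = 0"
      using M.comp_decomp xy by meson
    have "r (x + y) = (\<Sum>n\<in>K \<union> K'. h n (M.comp n x) + h n (M.comp n y))"
      using K K' xy M.comp_gr by (subst r[of "K \<union> K'"]) (simp_all add: M.comp_add h(1))
    also have "\<dots> = r x + r y"
      using r[of "K \<union> K'" x] r[of "K \<union> K'" y] K K' by (simp add: sum.distrib)
    finally show "r (x + y) = r x + r y" .
  next
    fix n x assume "x \<in> gr M n"
    then show "r x \<in> gr L n" using r[of "{n}" x] h(3) by (simp add: M.comp_homogeneous)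
  qed
  moreover have "r (i x) = x" if x: "x \<in> total L" for x
  proof -
    obtain K where K: "finite K" "\<And>n. n \<notin> K \<Longrightarrow> L.comp n x = 0" "x = (\<Sum>n\<in>K. L.comp n x)"
      using L.comp_decomp[OF x] by blast
    have "r (i x) = (\<Sum>n\<in>K. h n (i (L.comp n x)))"
      using K(1,2) by (subst r[of K]) (simp_all add: gadd_comp[OF L M g x] gadd_0[OF L M g])
    also have "\<dots> = x" using L.comp_gr[OF x] by (subst K(3)) (simp add: h(2))
    finally show ?thesis .
  qed
  ultimately show ?thesis by blast
qed

declare plus_fun_apply [simp del] zero_fun_apply [simp del]

section \<open>The bar complex\<close>

text \<open>The coboundary without its augmentation term, by recursion on the first slot: either
  \<open>a\<close> is multiplied into its neighbour, or it stays and the rest is treated with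
  \<open>a\<close> fixed. This avoids index arithmetic on lists.\<close>

fun bdE :: "'a gmod \<Rightarrow> 'a cochain \<Rightarrow> 'a cochain" where
  "bdE M \<phi> [] x = 0"
| "bdE M \<phi> [a] x = \<phi> [] (act M a x)"
| "bdE M \<phi> (a # b # as) x = \<phi> ((a \<star> b) # as) x + bdE M (\<lambda>bs. \<phi> (a # bs)) (b # as) x"

lemma bdE_eq: "as \<noteq> [] \<Longrightarrow>
    (\<Sum>i<length as - 1. \<phi> (take i as @ [as ! i \<star> as ! (i + 1)] @ drop (i + 2) as) x)
      + \<phi> (butlast as) (act M (last as) x) = bdE M \<phi> as x"
proof (induction M \<phi> as x rule: bdE.induct)
  case (3 M \<phi> a b as x)
  have "length (a # b # as) - 1 = Suc (length (b # as) - 1)" by simp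
  then show ?case
    using 3 by (simp only: sum.lessThan_Suc_shift) (simp add: add.assoc)
qed auto

lemma coboundary_map_eq: "coboundary_map M \<phi> as x =
    (if as \<noteq> [] \<and> set as \<subseteq> A2 \<and> x \<in> total M then augmentation (hd as) * \<phi> (tl as) x + bdE M \<phi> as x else 0)"
  unfolding coboundary_map_def using bdE_eq[of as \<phi> x M] by (auto simp: add.assoc)

lemma coboundary_map_Cons: "a \<in> A2 \<Longrightarrow> set as \<subseteq> A2 \<Longrightarrow> x \<in> total M \<Longrightarrow>
    coboundary_map M \<phi> (a # as) x = augmentation a * \<phi> as x + bdE M \<phi> (a # as) x"
  by (simp add: coboundary_map_eq)

lemma bdE_add: "bdE M (\<lambda>as x. \<phi> as x + \<psi> as x) as x = bdE M \<phi> as x + bdE M \<psi> as x"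
proof (induction as arbitrary: \<phi> \<psi> rule: induct_list012)
  case (3 a b as)
  have "bdE M (\<lambda>bs x. \<phi> (a # bs) x + \<psi> (a # bs) x) (b # as) x =
      bdE M (\<lambda>bs. \<phi> (a # bs)) (b # as) x + bdE M (\<lambda>bs. \<psi> (a # bs)) (b # as) x"
    by (rule 3(2))
  then show ?case by (simp add: ac_simps)
qed simp_all

lemma bdE_scale: "bdE M (\<lambda>as x. c * \<phi> as x) as x = c * bdE M \<phi> as x"
  by (induction M \<phi> as x rule: bdE.induct) (simp_all add: distrib_left)

lemma bdE_zero: "bdE M (\<lambda>as x. 0) as x = 0"
  using bdE_scale[of M 0 "\<lambda>as x. 0"] by simp

text \<open>Identities between cochains are available only on tuples from \<open>A2\<close> and
  elements of \<open>total M\<close>; outside, the unrestricted formulas may differ.\<close>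

definition dom_eq :: "'a::ab_group_add gmod \<Rightarrow> 'a cochain \<Rightarrow> 'a cochain \<Rightarrow> bool" where
  "dom_eq M \<phi> \<psi> \<longleftrightarrow> (\<forall>as x. set as \<subseteq> A2 \<longrightarrow> x \<in> total M \<longrightarrow> \<phi> as x = \<psi> as x)"

definition multilinear :: "'a::ab_group_add gmod \<Rightarrow> 'a cochain \<Rightarrow> bool" where
  "multilinear M \<phi> \<longleftrightarrow> (\<forall>as a b bs x. set as \<subseteq> A2 \<and> a \<in> A2 \<and> b \<in> A2 \<and> set bs \<subseteq> A2 \<and> x \<in> total M \<longrightarrow>
     \<phi> (as @ (a + b) # bs) x = \<phi> (as @ a # bs) x + \<phi> (as @ b # bs) x) \<and>
   (\<forall>as x y. set as \<subseteq> A2 \<and> x \<in> total M \<and> y \<in> total M \<longrightarrow> \<phi> as (x + y) = \<phi> as x + \<phi> as y)"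

definition concentrated :: "'a::ab_group_add gmod \<Rightarrow> int \<Rightarrow> 'a cochain \<Rightarrow> bool" where
  "concentrated M t \<phi> \<longleftrightarrow> (\<forall>as ks x n. set as \<subseteq> A2 \<and> list_all2 st_homogeneous ks as \<and> x \<in> gr M n \<and> \<phi> as x \<noteq> 0 \<longrightarrow>
     int (sum_list ks) + n = t)"

definition supported :: "'a::ab_group_add gmod \<Rightarrow> int \<Rightarrow> 'a cochain \<Rightarrow> bool" where
  "supported M s \<phi> \<longleftrightarrow> (\<forall>as x. \<phi> as x \<noteq> 0 \<longrightarrow> int (length as) = s \<and> set as \<subseteq> A2 \<and> x \<in> total M)"

text \<open>Additivity in a slot is rephrased with the list split at this slot, which suits
  recursion better than list updates.\<close>

lemma cochains_iff: "\<phi> \<in> cochains M s t \<longleftrightarrow> supported M s \<phi> \<and> multilinear M \<phi> \<and> concentrated M t \<phi>"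
proof -
  have "(\<forall>as a b x i. set as \<subseteq> A2 \<and> a \<in> A2 \<and> b \<in> A2 \<and> x \<in> total M \<and> i < length as \<longrightarrow>
        \<phi> (as[i := a + b]) x = \<phi> (as[i := a]) x + \<phi> (as[i := b]) x) \<longleftrightarrow>
    (\<forall>as a b bs x. set as \<subseteq> A2 \<and> a \<in> A2 \<and> b \<in> A2 \<and> set bs \<subseteq> A2 \<and> x \<in> total M \<longrightarrow>
     \<phi> (as @ (a + b) # bs) x = \<phi> (as @ a # bs) x + \<phi> (as @ b # bs) x)" (is "?l \<longleftrightarrow> ?r")
  proof
    assume l: ?l
    show ?r
    proof (intro allI impI)
      fix as a b bs x assume *: "set as \<subseteq> A2 \<and> a \<in> A2 \<and> b \<in> A2 \<and> set bs \<subseteq> A2 \<and> x \<in> total M"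
      then have "\<phi> ((as @ a # bs)[length as := a + b]) x = \<phi> ((as @ a # bs)[length as := a]) x + \<phi> ((as @ a # bs)[length as := b]) x"
        by (intro l[rule_format]) auto
      then show "\<phi> (as @ (a + b) # bs) x = \<phi> (as @ a # bs) x + \<phi> (as @ b # bs) x" by (simp only: list_update_length)
    qed
  next
    assume r: ?r
    show ?l
    proof (intro allI impI)
      fix as a b x i assume *: "set as \<subseteq> A2 \<and> a \<in> A2 \<and> b \<in> A2 \<and> x \<in> total M \<and> i < length as"
      then have "set (take i as) \<subseteq> A2" "set (drop (Suc i) as) \<subseteq> A2"
        using set_take_subset[of i as] set_drop_subset[of "Suc i" as] by blast+
      with r[rule_format, of "take i as" a b "drop (Suc i) as" x] *
      show "\<phi> (as[i := a + b]) x = \<phi> (as[i := a]) x + \<phi> (as[i := b]) x"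
        by (simp only: upd_conv_take_nth_drop)
    qed
  qed
  then show ?thesis
    unfolding cochains_def supported_def multilinear_def concentrated_def mem_Collect_eq by argo
qed

lemma multilinear_slot: "multilinear M \<phi> \<Longrightarrow> set as \<subseteq> A2 \<Longrightarrow> a \<in> A2 \<Longrightarrow> b \<in> A2 \<Longrightarrow> set bs \<subseteq> A2 \<Longrightarrow> x \<in> total M \<Longrightarrow>
    \<phi> (as @ (a + b) # bs) x = \<phi> (as @ a # bs) x + \<phi> (as @ b # bs) x"
  and multilinear_add: "multilinear M \<phi> \<Longrightarrow> set as \<subseteq> A2 \<Longrightarrow> x \<in> total M \<Longrightarrow> y \<in> total M \<Longrightarrow> \<phi> as (x + y) = \<phi> as x + \<phi> as y"
  unfolding multilinear_def by blast+

lemma multilinear_Cons: "multilinear M \<phi> \<Longrightarrow> a \<in> A2 \<Longrightarrow> multilinear M (\<lambda>bs. \<phi> (a # bs))"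
  unfolding multilinear_def
  by (intro conjI allI impI, metis (no_types, lifting) append_Cons insert_subset list.simps(15), metis insert_subset list.simps(15))

lemma multilinear_0: "multilinear M \<phi> \<Longrightarrow> 0 \<in> total M \<Longrightarrow> set as \<subseteq> A2 \<Longrightarrow> \<phi> as 0 = 0"
  using multilinear_add[of M \<phi> as 0 0] by simp

lemma multilinear_slot_0: "multilinear M \<phi> \<Longrightarrow> set as \<subseteq> A2 \<Longrightarrow> set bs \<subseteq> A2 \<Longrightarrow> x \<in> total M \<Longrightarrow> \<phi> (as @ 0 # bs) x = 0"
  using multilinear_slot[of M \<phi> as 0 0 bs x] by simp

context module
begin

lemma bdE_cong:
  assumes "dom_eq M \<phi> \<psi>" "set as \<subseteq> A2" "x \<in> total M"
  shows "bdE M \<phi> as x = bdE M \<psi> as x"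
  using assms
proof (induction as arbitrary: \<phi> \<psi> rule: induct_list012)
  case (2 a) then show ?case by (simp add: dom_eq_def act_total)
next
  case (3 a b as)
  have "dom_eq M (\<lambda>bs. \<phi> (a # bs)) (\<lambda>bs. \<psi> (a # bs))" using 3 by (simp add: dom_eq_def)
  then have "bdE M (\<lambda>bs. \<phi> (a # bs)) (b # as) x = bdE M (\<lambda>bs. \<psi> (a # bs)) (b # as) x"
    using 3 by auto
  moreover have "\<phi> ((a \<star> b) # as) x = \<psi> ((a \<star> b) # as) x" using 3 by (simp add: dom_eq_def)
  ultimately show ?case by simp
qed simp

text \<open>Merging two disjoint pairs of neighbours in either order gives the same term, and
  merging three neighbours in either order agrees by associativity, so all terms cancel in
  pairs.\<close>

lemma bdE_bdE:
  assumes "a \<in> A2" "b \<in> A2" "set as \<subseteq> A2" "x \<in> total M"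
  shows "bdE M (bdE M \<phi>) (a # b # as) x = 0"
  using assms
proof (induction as arbitrary: \<phi> a b)
  case Nil
  then show ?case by (simp add: act_act)
next
  case (Cons c cs)
  let ?p = "\<lambda>bs. \<phi> (a # bs)"
  have "bdE M (bdE M ?p) (b # c # cs) x = 0" using Cons by simp
  then have IH: "bdE M ?p ((b \<star> c) # cs) x + bdE M (\<lambda>ds. bdE M ?p (b # ds)) (c # cs) x = 0"
    by simp
  have "bdE M (bdE M \<phi>) (a # b # c # cs) x = (\<phi> ((a \<star> b \<star> c) # cs) x + bdE M (\<lambda>ds. \<phi> ((a \<star> b) # ds)) (c # cs) x) +
      ((\<phi> ((a \<star> (b \<star> c)) # cs) x + bdE M ?p ((b \<star> c) # cs) x) +
       (bdE M (\<lambda>ds. \<phi> ((a \<star> b) # ds)) (c # cs) x + bdE M (\<lambda>ds. bdE M ?p (b # ds)) (c # cs) x))"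
  proof -
    have eq: "(\<lambda>ds. bdE M \<phi> (a # b # ds)) = (\<lambda>ds x. \<phi> ((a \<star> b) # ds) x + bdE M ?p (b # ds) x)"
      by (intro ext) simp
    show ?thesis unfolding bdE.simps(3) eq bdE_add by simp
  qed
  also have "\<dots> = (\<phi> ((a \<star> b \<star> c) # cs) x + \<phi> ((a \<star> b \<star> c) # cs) x) +
      (bdE M (\<lambda>ds. \<phi> ((a \<star> b) # ds)) (c # cs) x + bdE M (\<lambda>ds. \<phi> ((a \<star> b) # ds)) (c # cs) x) +
      (bdE M ?p ((b \<star> c) # cs) x + bdE M (\<lambda>ds. bdE M ?p (b # ds)) (c # cs) x)"
    unfolding st_mult_assoc by (simp only: ac_simps)
  finally show ?case by (simp only: IH bit_add_self add_0_left)
qed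

lemma coboundary_coboundary: "coboundary_map M (coboundary_map M \<phi>) = 0"
proof (intro ext)
  fix as x
  show "coboundary_map M (coboundary_map M \<phi>) as x = 0 as x"
  proof (cases "as \<noteq> [] \<and> set as \<subseteq> A2 \<and> x \<in> total M")
    case True
    then obtain a bs where as: "as = a # bs" by (cases as) auto
    show ?thesis
    proof (cases bs)
      case Nil
      then show ?thesis using True as by (simp add: coboundary_map_eq zero_fun_apply)
    next
      case (Cons b cs)
      let ?e = "\<lambda>l x. augmentation (hd l) * \<phi> (tl l) x"
      have ab: "a \<in> A2" "b \<in> A2" "set cs \<subseteq> A2" "x \<in> total M" using True as Cons by auto
      have ne: "bdE M (coboundary_map M \<phi>) (a # b # cs) x = bdE M (\<lambda>l x. ?e l x + bdE M \<phi> l x) (a # b # cs) x"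
      proof -
        have "dom_eq M (\<lambda>bs. coboundary_map M \<phi> (a # bs)) (\<lambda>bs x. ?e (a # bs) x + bdE M \<phi> (a # bs) x)"
          using ab by (simp add: dom_eq_def coboundary_map_Cons)
        from bdE_cong[OF this, of "b # cs" x] show ?thesis
          using ab by (simp add: coboundary_map_Cons)
      qed
      \<comment> \<open>The augmentation is multiplicative, so the term from merging
        \<open>a\<close> and \<open>b\<close> also carries the factor
        \<open>augmentation a\<close>.\<close>
      have "bdE M ?e (a # b # cs) x = augmentation a * (augmentation b * \<phi> cs x + bdE M \<phi> (b # cs) x)"
        by (simp add: bdE_scale augmentation_mult distrib_left mult.assoc)
      then have "bdE M (coboundary_map M \<phi>) (a # b # cs) x = augmentation a * (augmentation b * \<phi> cs x + bdE M \<phi> (b # cs) x)"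
        by (simp only: ne bdE_add bdE_bdE[OF ab] add_0_right)
      then show ?thesis using ab unfolding as Cons
        by (simp add: coboundary_map_Cons zero_fun_apply del: bdE.simps)
    qed
  qed (auto simp: coboundary_map_eq zero_fun_apply)
qed

lemma multilinear_bdE:
  assumes "multilinear M \<phi>"
  shows "multilinear M (bdE M \<phi>)"
proof -
  have slot: "bdE M \<phi> (as @ (a + b) # bs) x = bdE M \<phi> (as @ a # bs) x + bdE M \<phi> (as @ b # bs) x"
    if "multilinear M \<phi>" "set as \<subseteq> A2" "a \<in> A2" "b \<in> A2" "set bs \<subseteq> A2" "x \<in> total M" for \<phi> as a b bs x
    using that
  proof (induction as arbitrary: \<phi> rule: induct_list012)
    case 1
    show ?case
    proof (cases bs)
      case Nil
      then show ?thesis using 1 multilinear_add[of M \<phi> "[]" "act M a x" "act M b x"] by (simp add: add_act act_total)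
    next
      case (Cons c cs)
      have "dom_eq M (\<lambda>ds. \<phi> ((a + b) # ds)) (\<lambda>ds x. \<phi> (a # ds) x + \<phi> (b # ds) x)"
        using multilinear_slot[OF 1(1), of "[]"] 1 by (simp add: dom_eq_def)
      from bdE_cong[OF this, of "c # cs" x]
      have "bdE M (\<lambda>ds. \<phi> ((a + b) # ds)) (c # cs) x = bdE M (\<lambda>ds. \<phi> (a # ds)) (c # cs) x + bdE M (\<lambda>ds. \<phi> (b # ds)) (c # cs) x"
        using 1 Cons by (simp add: bdE_add)
      moreover have "\<phi> (((a + b) \<star> c) # cs) x = \<phi> ((a \<star> c) # cs) x + \<phi> ((b \<star> c) # cs) x"
        using multilinear_slot[OF 1(1), of "[]" "a \<star> c" "b \<star> c" cs x] 1 Cons by (simp add: st_mult_add_left)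
      ultimately show ?thesis by (simp add: Cons ac_simps)
    qed
  next
    case (2 d)
    have "bdE M (\<lambda>ds. \<phi> (d # ds)) ((a + b) # bs) x = bdE M (\<lambda>ds. \<phi> (d # ds)) (a # bs) x + bdE M (\<lambda>ds. \<phi> (d # ds)) (b # bs) x"
    proof (cases bs)
      case Nil
      then show ?thesis using 2 multilinear_add[of M \<phi> "[d]"] by (simp add: add_act act_total)
    next
      case (Cons c cs)
      have "dom_eq M (\<lambda>ds. \<phi> (d # (a + b) # ds)) (\<lambda>ds x. \<phi> (d # a # ds) x + \<phi> (d # b # ds) x)"
        using multilinear_slot[OF 2(1), of "[d]"] 2 by (simp add: dom_eq_def)
      from bdE_cong[OF this, of "c # cs" x]
      have "bdE M (\<lambda>ds. \<phi> (d # (a + b) # ds)) (c # cs) x = bdE M (\<lambda>ds. \<phi> (d # a # ds)) (c # cs) x + bdE M (\<lambda>ds. \<phi> (d # b # ds)) (c # cs) x"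
        using 2 Cons by (simp add: bdE_add)
      moreover have "\<phi> (d # ((a + b) \<star> c) # cs) x = \<phi> (d # (a \<star> c) # cs) x + \<phi> (d # (b \<star> c) # cs) x"
        using multilinear_slot[OF 2(1), of "[d]" "a \<star> c" "b \<star> c" cs x] 2 Cons by (simp add: st_mult_add_left)
      ultimately show ?thesis by (simp add: Cons ac_simps)
    qed
    moreover have "\<phi> ((d \<star> (a + b)) # bs) x = \<phi> ((d \<star> a) # bs) x + \<phi> ((d \<star> b) # bs) x"
      using multilinear_slot[OF 2(1), of "[]" "d \<star> a" "d \<star> b" bs x] 2 by (simp add: st_mult_add_right)
    ultimately show ?case by (simp add: ac_simps)
  next
    case (3 d e es)
    have "bdE M (\<lambda>ds. \<phi> (d # ds)) ((e # es) @ (a + b) # bs) x =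
        bdE M (\<lambda>ds. \<phi> (d # ds)) ((e # es) @ a # bs) x + bdE M (\<lambda>ds. \<phi> (d # ds)) ((e # es) @ b # bs) x"
      using 3 by (intro 3(2) multilinear_Cons) auto
    moreover have "\<phi> (((d \<star> e) # es) @ (a + b) # bs) x = \<phi> (((d \<star> e) # es) @ a # bs) x + \<phi> (((d \<star> e) # es) @ b # bs) x"
      using 3 by (intro multilinear_slot[OF 3(3)]) auto
    ultimately show ?case by (simp add: ac_simps)
  qed
  have add: "bdE M \<phi> as (x + y) = bdE M \<phi> as x + bdE M \<phi> as y"
    if "multilinear M \<phi>" "set as \<subseteq> A2" "x \<in> total M" "y \<in> total M" for \<phi> as x y
    using that
  proof (induction as arbitrary: \<phi> rule: induct_list012)
    case (2 a) then show ?case using multilinear_add[of M \<phi> "[]"] by (simp add: act_add act_total)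
  next
    case (3 a b as)
    then have "bdE M (\<lambda>bs. \<phi> (a # bs)) (b # as) (x + y) = bdE M (\<lambda>bs. \<phi> (a # bs)) (b # as) x + bdE M (\<lambda>bs. \<phi> (a # bs)) (b # as) y"
      by (intro 3(2) multilinear_Cons) auto
    moreover have "\<phi> ((a \<star> b) # as) (x + y) = \<phi> ((a \<star> b) # as) x + \<phi> ((a \<star> b) # as) y"
      using 3 by (intro multilinear_add[OF 3(3)]) auto
    ultimately show ?case by (simp add: ac_simps)
  qed simp
  show ?thesis unfolding multilinear_def
    by (intro conjI allI impI; elim conjE; rule slot[OF assms] add[OF assms]; assumption)
qed

lemma concentrated_bdE:
  assumes "concentrated M t \<phi>"
  shows "concentrated M t (bdE M \<phi>)"
proof -
  have main: "int (sum_list ks) + n = t"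
    if "\<And>as ks x n. set as \<subseteq> A2 \<Longrightarrow> list_all2 st_homogeneous ks as \<Longrightarrow> x \<in> gr M n \<Longrightarrow> \<phi> as x \<noteq> 0 \<Longrightarrow> int (sum_list ks) + n = t"
      "set as \<subseteq> A2" "list_all2 st_homogeneous ks as" "x \<in> gr M n" "bdE M \<phi> as x \<noteq> 0" for \<phi> as ks x n t
    using that
  proof (induction as arbitrary: \<phi> ks t rule: induct_list012)
    case (2 a)
    then obtain k where k: "ks = [k]" "st_homogeneous k a" by (auto simp: list_all2_Cons2)
    have "int (sum_list []) + (int k + n) = t"
      by (rule 2(1)[of "[]" "[]" "act M a x"]) (use 2 k act_gr in auto)
    then show ?case by (simp add: k)
  next
    case (3 a b as)
    then obtain k l ks' where k: "ks = k # l # ks'" "st_homogeneous k a" "st_homogeneous l b" "list_all2 st_homogeneous ks' as"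
      by (auto simp: list_all2_Cons2)
    show ?case
    proof (cases "\<phi> ((a \<star> b) # as) x = 0")
      case False
      have "int (sum_list ((k + l) # ks')) + n = t"
        by (rule 3(3)[of "(a \<star> b) # as" _ x]) (use 3 k False st_homogeneous_mult in auto)
      then show ?thesis by (simp add: k)
    next
      case True
      then have nz: "bdE M (\<lambda>bs. \<phi> (a # bs)) (b # as) x \<noteq> 0" using 3 by simp
      \<comment> \<open>With \<open>a\<close> of degree \<open>k\<close> fixed, the remaining
        cochain is concentrated in internal degree \<open>t - k\<close>; this is why
        \<open>t\<close> is generalized in the induction.\<close>
      have "int (sum_list (l # ks')) + n = t - int k"
      proof (rule 3(2)[OF _ _ _ _ nz])
        fix as ks x n assume *: "set as \<subseteq> A2" "list_all2 st_homogeneous ks as" "x \<in> gr M n" "\<phi> (a # as) x \<noteq> 0"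
        have "int (sum_list (k # ks)) + n = t"
          by (rule 3(3)[of "a # as" _ x]) (use 3 k * in auto)
        then show "int (sum_list ks) + n = t - int k" by simp
      qed (use 3 k in auto)
      then show ?thesis by (simp add: k)
    qed
  qed simp
  show ?thesis
    unfolding concentrated_def
  proof (intro allI impI, elim conjE)
    fix as ks x n assume "set as \<subseteq> A2" "list_all2 st_homogeneous ks as" "x \<in> gr M n" "bdE M \<phi> as x \<noteq> 0"
    then show "int (sum_list ks) + n = t"
      by (rule main[rotated]) (use assms in \<open>auto simp: concentrated_def\<close>)
  qed
qed

end

lemma bit_mult_eq_1 [simp]: "(a :: bit) * b = 1 \<longleftrightarrow> a = 1 \<and> b = 1"
  by (cases a; cases b) simp_all

lemma augmentation_add: "augmentation (a + b) = augmentation a + augmentation b"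
  by (simp add: augmentation_def plus_fun_apply)

lemma augmentation_homogeneous: "st_homogeneous k a \<Longrightarrow> augmentation a \<noteq> 0 \<Longrightarrow> k = 0"
  by (force simp: augmentation_def st_homogeneous_def)

lemma bdE_length:
  assumes "\<And>as x. \<phi> as x \<noteq> 0 \<Longrightarrow> int (length as) = s" "bdE M \<phi> as x \<noteq> 0"
  shows "int (length as) = s + 1"
  using assms
proof (induction as arbitrary: \<phi> s rule: induct_list012)
  case (2 a) then show ?case using 2(1)[of "[]"] by simp
next
  case (3 a b as)
  show ?case
  proof (cases "\<phi> ((a \<star> b) # as) x = 0")
    case False then show ?thesis using 3(3)[OF False] by simp
  next
    case True
    then have "bdE M (\<lambda>bs. \<phi> (a # bs)) (b # as) x \<noteq> 0" using 3(4) by simp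
    then have "int (length (b # as)) = (s - 1) + 1"
      by (rule 3(2)[rotated]) (use 3(3) in fastforce)
    then show ?thesis by simp
  qed
qed simp

lemma cochains_add: "\<phi> \<in> cochains M s t \<Longrightarrow> \<psi> \<in> cochains M s t \<Longrightarrow> \<phi> + \<psi> \<in> cochains M s t"
proof -
  assume *: "\<phi> \<in> cochains M s t" "\<psi> \<in> cochains M s t"
  have nz: "\<phi> as x \<noteq> 0 \<or> \<psi> as x \<noteq> 0" if "(\<phi> + \<psi>) as x \<noteq> 0" for as x
    using that by (auto simp: plus_fun_apply)
  have "supported M s (\<phi> + \<psi>)" "concentrated M t (\<phi> + \<psi>)"
    using * nz unfolding cochains_iff supported_def concentrated_def by meson+
  moreover have "multilinear M (\<phi> + \<psi>)"
    using * unfolding cochains_iff multilinear_def plus_fun_apply by (simp add: ac_simps)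
  ultimately show ?thesis by (simp add: cochains_iff)
qed

lemma cochains_0 [simp]: "0 \<in> cochains M s t"
  by (simp add: cochains_iff supported_def multilinear_def concentrated_def zero_fun_apply)

lemma cochain_outside: "\<phi> \<in> cochains M s t \<Longrightarrow> \<not> (set as \<subseteq> A2 \<and> x \<in> total M) \<Longrightarrow> \<phi> as x = 0"
  unfolding cochains_iff supported_def by blast

lemma cochain_eqI: "\<phi> \<in> cochains M s t \<Longrightarrow> \<psi> \<in> cochains M s t' \<Longrightarrow>
    (\<And>as x. set as \<subseteq> A2 \<Longrightarrow> x \<in> total M \<Longrightarrow> \<phi> as x = \<psi> as x) \<Longrightarrow> \<phi> = \<psi>"
  by (intro ext) (metis cochain_outside)

lemma cochains_negative: "s < 0 \<Longrightarrow> \<phi> \<in> cochains M s t \<Longrightarrow> \<phi> = 0"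
  unfolding cochains_iff supported_def by (intro ext) (metis of_nat_0_le_iff not_less zero_fun_apply)

lemma coboundary_map_add: "coboundary_map M (\<phi> + \<psi>) = coboundary_map M \<phi> + coboundary_map M \<psi>"
proof -
  have "\<phi> + \<psi> = (\<lambda>as x. \<phi> as x + \<psi> as x)" by (intro ext) (simp add: plus_fun_apply)
  then show ?thesis
    by (intro ext) (simp add: coboundary_map_eq plus_fun_apply bdE_add distrib_left ac_simps)
qed

lemma coboundary_map_0 [simp]: "coboundary_map M 0 = 0"
  using coboundary_map_add[of M 0 0] by simp

lemma cochain_self [simp]: "(\<phi> :: 'a cochain) + \<phi> = 0"
  by (intro ext) (simp add: plus_fun_apply zero_fun_apply)

lemma cochain_cancel [simp]: "(\<phi> :: 'a cochain) + (\<phi> + \<psi>) = \<psi>"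
  by (simp flip: add.assoc)

lemma (in module) coboundary_cochains:
  assumes "\<phi> \<in> cochains M s t"
  shows "coboundary_map M \<phi> \<in> cochains M (s + 1) t"
  unfolding cochains_iff
proof (intro conjI)
  have s: "\<And>as x. \<phi> as x \<noteq> 0 \<Longrightarrow> int (length as) = s" and ml: "multilinear M \<phi>" and c: "concentrated M t \<phi>"
    using assms unfolding cochains_iff supported_def by blast+
  have nz: "as \<noteq> [] \<and> set as \<subseteq> A2 \<and> x \<in> total M \<and> (augmentation (hd as) \<noteq> 0 \<and> \<phi> (tl as) x \<noteq> 0 \<or> bdE M \<phi> as x \<noteq> 0)"
    if "coboundary_map M \<phi> as x \<noteq> 0" for as x
    using that by (auto simp: coboundary_map_eq split: if_splits)
  show "supported M (s + 1) (coboundary_map M \<phi>)"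
    unfolding supported_def
  proof (intro allI impI)
    fix as x assume "coboundary_map M \<phi> as x \<noteq> 0"
    note n = nz[OF this]
    then have "int (length as) = s + 1"
      using bdE_length[OF s, where as = as and x = x] s[of "tl as" x] by (cases as) auto
    with n show "int (length as) = s + 1 \<and> set as \<subseteq> A2 \<and> x \<in> total M" by blast
  qed
  show "concentrated M t (coboundary_map M \<phi>)"
    unfolding concentrated_def
  proof (intro allI impI, elim conjE)
    fix as ks x n assume *: "set as \<subseteq> A2" "list_all2 st_homogeneous ks as" "x \<in> gr M n" "coboundary_map M \<phi> as x \<noteq> 0"
    from nz[OF *(4)] consider "augmentation (hd as) \<noteq> 0" "\<phi> (tl as) x \<noteq> 0" "as \<noteq> []" | "bdE M \<phi> as x \<noteq> 0" by blast
    then show "int (sum_list ks) + n = t"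
    proof cases
      case 1
      then obtain a bs k ls where as: "as = a # bs" "ks = k # ls" using * by (cases as; cases ks) auto
      have "k = 0" using augmentation_homogeneous[of k a] 1 * as by simp
      moreover have "int (sum_list ls) + n = t"
        using c 1 * as unfolding concentrated_def by (metis list.sel(3) list.set_intros(2) list_all2_Cons subset_code(1))
      ultimately show ?thesis by (simp add: as)
    next
      case 2
      with concentrated_bdE[OF c] * show ?thesis unfolding concentrated_def by blast
    qed
  qed
  have mb: "multilinear M (bdE M \<phi>)" by (rule multilinear_bdE[OF ml])
  show "multilinear M (coboundary_map M \<phi>)"
    unfolding multilinear_def
  proof (intro conjI allI impI; elim conjE)
    fix as a b bs x assume *: "set as \<subseteq> A2" "a \<in> A2" "b \<in> A2" "set bs \<subseteq> A2" "x \<in> total M"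
    show "coboundary_map M \<phi> (as @ (a + b) # bs) x = coboundary_map M \<phi> (as @ a # bs) x + coboundary_map M \<phi> (as @ b # bs) x"
    proof (cases as)
      case Nil
      then show ?thesis using * multilinear_slot[OF mb *]
        by (simp add: coboundary_map_Cons augmentation_add distrib_right distrib_left ac_simps del: bdE.simps)
    next
      case (Cons d ds)
      then show ?thesis using * multilinear_slot[OF mb *] multilinear_slot[OF ml, of ds a b bs x]
        by (simp add: coboundary_map_Cons distrib_left ac_simps del: bdE.simps)
    qed
  next
    fix as x y assume *: "set as \<subseteq> A2" "x \<in> total M" "y \<in> total M"
    show "coboundary_map M \<phi> as (x + y) = coboundary_map M \<phi> as x + coboundary_map M \<phi> as y"
      using * multilinear_add[OF mb *] multilinear_add[OF ml, of "tl as" x y] total_add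
      by (cases as) (simp_all add: coboundary_map_eq distrib_left ac_simps del: bdE.simps)
  qed
qed

lemma cocycles_iff: "\<phi> \<in> cocycles M s t \<longleftrightarrow> \<phi> \<in> cochains M s t \<and> coboundary_map M \<phi> = 0"
  by (simp add: cocycles_def)

lemma coboundaries_iff: "\<phi> \<in> coboundaries M s t \<longleftrightarrow> (\<exists>\<eta>\<in>cochains M (s - 1) t. \<phi> = coboundary_map M \<eta>)"
  by (auto simp: coboundaries_def)

lemma cocycles_add: "\<phi> \<in> cocycles M s t \<Longrightarrow> \<psi> \<in> cocycles M s t \<Longrightarrow> \<phi> + \<psi> \<in> cocycles M s t"
  by (simp add: cocycles_iff cochains_add coboundary_map_add)

lemma cocycles_0 [simp]: "0 \<in> cocycles M s t"
  by (simp add: cocycles_iff)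

lemma coboundaries_add: "\<phi> \<in> coboundaries M s t \<Longrightarrow> \<psi> \<in> coboundaries M s t \<Longrightarrow> \<phi> + \<psi> \<in> coboundaries M s t"
  unfolding coboundaries_iff by (metis cochains_add coboundary_map_add)

lemma coboundaries_0 [simp]: "0 \<in> coboundaries M s t"
  unfolding coboundaries_iff by (intro bexI[of _ 0]) simp_all

lemma coboundaries_cong: "\<phi> + \<psi> \<in> coboundaries M s t \<Longrightarrow> \<phi> \<in> coboundaries M s t \<longleftrightarrow> \<psi> \<in> coboundaries M s t"
  by (metis coboundaries_add cochain_cancel add.commute)

lemma (in module) coboundaries_cocycles: "\<phi> \<in> coboundaries M s t \<Longrightarrow> \<phi> \<in> cocycles M s t"
  unfolding coboundaries_iff cocycles_iff
  using coboundary_cochains[of _ "s - 1" t] coboundary_coboundary by auto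

lemma coboundaries_nonpositive: "s \<le> 0 \<Longrightarrow> \<phi> \<in> coboundaries M s t \<Longrightarrow> \<phi> = 0"
  unfolding coboundaries_iff using cochains_negative[of "s - 1"] by fastforce

section \<open>Functoriality\<close>

text \<open>Meant for all graded additive maps, such as retractions and sections; compatibility with
  the coboundary needs \<open>A2\<close>-linearity.\<close>

definition pull :: "'a::ab_group_add gmod \<Rightarrow> ('a \<Rightarrow> 'b) \<Rightarrow> 'b cochain \<Rightarrow> 'a cochain" where
  "pull M f \<phi> = (\<lambda>as x. if x \<in> total M then \<phi> as (f x) else 0)"

lemma pull_eq: "x \<in> total M \<Longrightarrow> pull M f \<phi> as x = \<phi> as (f x)"
  by (simp add: pull_def)

lemma pull_add: "pull M f (\<phi> + \<psi>) = pull M f \<phi> + pull M f \<psi>"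
  by (intro ext) (simp add: pull_def plus_fun_apply)

lemma pull_0 [simp]: "pull M f 0 = 0"
  by (intro ext) (simp add: pull_def zero_fun_apply)

lemma pull_cochains:
  assumes M: "A2_module M" and N: "A2_module N" and f: "gadd M N f" and \<phi>: "\<phi> \<in> cochains N s t"
  shows "pull M f \<phi> \<in> cochains M s t"
proof -
  interpret M: module M by unfold_locales (fact M)
  note fT = gadd_total[OF M N f] and fA = gadd_add[OF M N f] and fG = gadd_gr[OF M N f]
  have ml: "multilinear N \<phi>" and s: "supported N s \<phi>" and c: "concentrated N t \<phi>" using \<phi> by (auto simp: cochains_iff)
  have nz: "\<phi> as (f x) \<noteq> 0 \<and> x \<in> total M" if "pull M f \<phi> as x \<noteq> 0" for as x
    using that by (auto simp: pull_def split: if_splits)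
  have "supported M s (pull M f \<phi>)"
    unfolding supported_def using nz s unfolding supported_def by blast
  moreover have "concentrated M t (pull M f \<phi>)"
    unfolding concentrated_def
  proof (intro allI impI, elim conjE)
    fix as ks x n assume *: "set as \<subseteq> A2" "list_all2 st_homogeneous ks as" "x \<in> gr M n" "pull M f \<phi> as x \<noteq> 0"
    show "int (sum_list ks) + n = t"
      using c[unfolded concentrated_def, rule_format, of as ks "f x" n] * fG nz[OF *(4)] by blast
  qed
  moreover have "multilinear M (pull M f \<phi>)"
    unfolding multilinear_def
    by (intro conjI allI impI; elim conjE; simp add: pull_eq M.total_add fA multilinear_slot[OF ml] multilinear_add[OF ml] fT)
  ultimately show ?thesis by (simp add: cochains_iff)
qed

lemma bdE_pull:
  assumes M: "A2_module M" and f: "A2_hom M N f" and "set as \<subseteq> A2" "x \<in> total M"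
  shows "bdE M (pull M f \<phi>) as x = bdE N \<phi> as (f x)"
  using assms(3-)
proof (induction as arbitrary: \<phi> rule: induct_list012)
  interpret M: module M by unfold_locales (fact M)
  case (2 a)
  then show ?case using f by (simp add: pull_eq M.act_total A2_hom_def)
next
  case (3 a b as)
  have "(\<lambda>bs. pull M f \<phi> (a # bs)) = pull M f (\<lambda>bs. \<phi> (a # bs))"
    by (intro ext) (simp add: pull_def)
  then show ?case using 3 by (simp add: pull_eq)
qed simp

lemma coboundary_map_pull:
  assumes M: "A2_module M" and N: "A2_module N" and f: "A2_hom M N f"
  shows "coboundary_map M (pull M f \<phi>) = pull M f (coboundary_map N \<phi>)"
proof (intro ext)
  fix as x show "coboundary_map M (pull M f \<phi>) as x = pull M f (coboundary_map N \<phi>) as x"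
    using gadd_total[OF M N A2_hom_gadd[OF f], of x]
    by (auto simp: coboundary_map_eq pull_def bdE_pull[OF M f, unfolded pull_def])
qed

lemma pull_cocycles:
  assumes M: "A2_module M" and N: "A2_module N" and f: "A2_hom M N f" and "\<phi> \<in> cocycles N s t"
  shows "pull M f \<phi> \<in> cocycles M s t"
  using assms(4) by (simp add: cocycles_iff coboundary_map_pull[OF M N f] pull_cochains[OF M N A2_hom_gadd[OF f]])

lemma pull_coboundaries:
  assumes M: "A2_module M" and N: "A2_module N" and f: "A2_hom M N f" and "\<phi> \<in> coboundaries N s t"
  shows "pull M f \<phi> \<in> coboundaries M s t"
  using assms(4) unfolding coboundaries_iff
  by (metis coboundary_map_pull[OF M N f] pull_cochains[OF M N A2_hom_gadd[OF f]])

section \<open>The long exact sequence\<close>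

locale ses =
  fixes L :: "'a::ab_group_add gmod" and i and M :: "'b::ab_group_add gmod" and p and N :: "'c::ab_group_add gmod"
  assumes L: "A2_module L" and M: "A2_module M" and N: "A2_module N"
    and exact: "short_exact L i M p N" and fin: "\<And>n. finite (gr M n)"
begin

sublocale L: module L by unfold_locales (fact L)
sublocale M: module M by unfold_locales (fact M)
sublocale N: module N by unfold_locales (fact N)

lemma i_hom: "A2_hom L M i" and p_hom: "A2_hom M N p" and i_inj: "inj_on i (total L)"
  and ker_p: "x \<in> total M \<Longrightarrow> p x = 0 \<Longrightarrow> \<exists>z\<in>total L. x = i z" and p_i: "z \<in> total L \<Longrightarrow> p (i z) = 0"
  using exact unfolding short_exact_def by blast+

lemma p_surj: "y \<in> total N \<Longrightarrow> \<exists>x\<in>total M. p x = y"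
  using exact unfolding short_exact_def by (metis imageE)

lemmas ig = A2_hom_gadd[OF i_hom] and pg = A2_hom_gadd[OF p_hom]
lemmas i_total = gadd_total[OF L M ig] and p_total = gadd_total[OF M N pg]
  and i_add = gadd_add[OF L M ig] and p_add = gadd_add[OF M N pg]

definition r where "r = (SOME r. gadd M L r \<and> (\<forall>x\<in>total L. r (i x) = x))"

lemma rg: "gadd M L r" and r_i: "x \<in> total L \<Longrightarrow> r (i x) = x"
  using someI_ex[OF retraction[OF L M i_hom i_inj fin]] unfolding r_def[symmetric] by blast+

lemmas r_total = gadd_total[OF M L rg] and r_add = gadd_add[OF M L rg]

text \<open>In characteristic 2 the element \<open>x + i (r x)\<close> is the component of
  \<open>x\<close> complementary to the image of \<open>i\<close>, so it depends only on
  \<open>p x\<close> and not on the chosen preimage.\<close>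

definition sec where "sec y = (let x = (SOME x. x \<in> total M \<and> p x = y) in x + i (r x))"

lemma sec_p: "x \<in> total M \<Longrightarrow> sec (p x) = x + i (r x)"
proof -
  assume x: "x \<in> total M"
  define x' where "x' = (SOME x'. x' \<in> total M \<and> p x' = p x)"
  have x': "x' \<in> total M" "p x' = p x"
    using someI[of "\<lambda>x'. x' \<in> total M \<and> p x' = p x" x] x unfolding x'_def by blast+
  have "p (x + x') = 0" using x x' N.total_self p_total by (simp add: p_add)
  then obtain z where z: "z \<in> total L" "x + x' = i z" using ker_p M.total_add x x' by blast
  then have x'z: "x' = x + i z" using M.cancel_self[OF x, of x'] by simp
  have "x' + i (r x') = x + i z + i (r x + z)" using z x by (simp add: x'z r_add i_total r_i)
  also have "\<dots> = x + i (r x) + (i z + i z)" using z x by (simp add: i_add r_total ac_simps)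
  also have "\<dots> = x + i (r x)" using M.total_self i_total z by simp
  finally show ?thesis by (simp add: sec_def x'_def Let_def)
qed

lemma secg: "gadd N M sec"
  unfolding gadd_def
proof (intro conjI ballI allI image_subsetI)
  fix y y' assume "y \<in> total N" "y' \<in> total N"
  then obtain x x' where x: "x \<in> total M" "y = p x" "x' \<in> total M" "y' = p x'" using p_surj by metis
  have "sec (y + y') = sec (p (x + x'))" by (simp add: x p_add)
  also have "\<dots> = sec y + sec y'" using x by (simp add: sec_p M.total_add r_add i_add r_total ac_simps)
  finally show "sec (y + y') = sec y + sec y'" .
next
  fix n y assume y: "y \<in> gr N n"
  then obtain x where x: "x \<in> total M" "y = p x" using p_surj gr_total by metis
  then have "y = p (M.comp n x)"
    using gadd_comp[OF M N pg x(1), of n] N.comp_homogeneous[OF y, of n] by simp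
  moreover have g: "M.comp n x \<in> gr M n" using M.comp_gr x by blast
  ultimately have "sec y = M.comp n x + i (r (M.comp n x))" using sec_p gr_total by metis
  also have "\<dots> \<in> gr M n" using g gadd_gr[OF M L rg] gadd_gr[OF L M ig] M.gr_add by blast
  finally show "sec y \<in> gr M n" .
qed

text \<open>Extend by the retraction, take the coboundary, and descend along \<open>p\<close> by
  restricting along the section. This is additive already on cochains, before passing to
  classes.\<close>

definition delta where "delta \<phi> = pull N sec (coboundary_map M (pull M r \<phi>))"

lemma descend:
  assumes \<phi>: "\<phi> \<in> cochains M s t" and 0: "pull L i \<phi> = 0"
  shows "pull N sec \<phi> \<in> cochains N s t" "pull M p (pull N sec \<phi>) = \<phi>"
proof -
  show "pull N sec \<phi> \<in> cochains N s t" by (rule pull_cochains[OF N M secg \<phi>])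
  then have "pull M p (pull N sec \<phi>) \<in> cochains M s t" by (rule pull_cochains[OF M N pg])
  then show "pull M p (pull N sec \<phi>) = \<phi>"
  proof (rule cochain_eqI[OF _ \<phi>])
    fix as x assume as: "set as \<subseteq> A2" and x: "x \<in> total M"
    have "\<phi> as (i (r x)) = pull L i \<phi> as (r x)" using r_total[OF x] by (simp add: pull_eq)
    also have "\<dots> = 0" by (simp add: 0 zero_fun_apply)
    finally have "\<phi> as (x + i (r x)) = \<phi> as x"
      using multilinear_add[of M \<phi> as x "i (r x)"] \<phi> as x r_total i_total by (simp add: cochains_iff)
    then show "pull M p (pull N sec \<phi>) as x = \<phi> as x" using x p_total by (simp add: pull_eq sec_p)
  qed
qed

lemma p_pull_inj:
  assumes "\<phi> \<in> cochains N s t" "\<psi> \<in> cochains N s t" "pull M p \<phi> = pull M p \<psi>"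
  shows "\<phi> = \<psi>"
proof (rule cochain_eqI[OF assms(1,2)])
  fix as y assume "y \<in> total N"
  then obtain x where "x \<in> total M" "p x = y" using p_surj by blast
  then show "\<phi> as y = \<psi> as y" using fun_cong[OF fun_cong[OF assms(3)], of as x] by (simp add: pull_eq)
qed

lemma i_pull_r: "\<phi> \<in> cochains L s t \<Longrightarrow> pull L i (pull M r \<phi>) = \<phi>"
proof -
  assume \<phi>: "\<phi> \<in> cochains L s t"
  have "pull L i (pull M r \<phi>) \<in> cochains L s t"
    by (intro pull_cochains[OF L M ig] pull_cochains[OF M L rg] \<phi>)
  then show ?thesis by (rule cochain_eqI[OF _ \<phi>]) (simp add: pull_eq i_total r_i)
qed

lemma i_pull_p: "pull L i (pull M p \<phi>) = 0" if "\<phi> \<in> cochains N s t"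
proof -
  have "pull L i (pull M p \<phi>) \<in> cochains L s t"
    by (intro pull_cochains[OF L M ig] pull_cochains[OF M N pg] that)
  then show ?thesis
  proof (rule cochain_eqI[OF _ cochains_0])
    fix as x assume "set as \<subseteq> A2" "x \<in> total L"
    then show "pull L i (pull M p \<phi>) as x = 0 as x"
      using that multilinear_0[of N \<phi> as] by (simp add: pull_eq i_total p_i cochains_iff zero_fun_apply)
  qed
qed

lemma delta_cocycles:
  assumes "\<phi> \<in> cocycles L s t"
  shows "delta \<phi> \<in> cocycles N (s + 1) t" "pull M p (delta \<phi>) = coboundary_map M (pull M r \<phi>)"
proof -
  have \<phi>: "\<phi> \<in> cochains L s t" "coboundary_map L \<phi> = 0" using assms by (auto simp: cocycles_iff)
  have d: "coboundary_map M (pull M r \<phi>) \<in> cochains M (s + 1) t"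
    by (intro M.coboundary_cochains pull_cochains[OF M L rg] \<phi>)
  have "pull L i (coboundary_map M (pull M r \<phi>)) = 0"
    by (simp add: coboundary_map_pull[OF L M i_hom, symmetric] i_pull_r[OF \<phi>(1)] \<phi>(2))
  note D = descend[OF d this, folded delta_def]
  show p: "pull M p (delta \<phi>) = coboundary_map M (pull M r \<phi>)" by (rule D)
  have "pull M p (coboundary_map N (delta \<phi>)) = pull M p 0"
    by (simp add: coboundary_map_pull[OF M N p_hom, symmetric] p M.coboundary_coboundary)
  then have "coboundary_map N (delta \<phi>) = 0"
    by (rule p_pull_inj[OF N.coboundary_cochains[OF D(1)] cochains_0])
  then show "delta \<phi> \<in> cocycles N (s + 1) t" using D(1) by (simp add: cocycles_iff)
qed

lemma delta_add: "delta (\<phi> + \<psi>) = delta \<phi> + delta \<psi>"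
  by (simp add: delta_def pull_add coboundary_map_add)

lemma lift_difference:
  assumes "\<psi> \<in> cochains M s t"
  shows "\<exists>\<omega>\<in>cochains N s t. pull M p \<omega> = \<psi> + pull M r (pull L i \<psi>)"
proof -
  let ?d = "\<psi> + pull M r (pull L i \<psi>)"
  have i: "pull L i \<psi> \<in> cochains L s t" by (rule pull_cochains[OF L M ig assms])
  have "?d \<in> cochains M s t" by (intro cochains_add assms pull_cochains[OF M L rg i])
  moreover have "pull L i ?d = 0" by (simp add: pull_add i_pull_r[OF i])
  ultimately show ?thesis using descend by blast
qed

text \<open>Independence of the extension: \<open>\<psi>\<close> may be any extension of the
  cocycle, since it differs from the one given by the retraction by a cochain that descends along
  \<open>p\<close>.\<close>

lemma delta_coboundary_eq:
  assumes "\<psi> \<in> cochains M s t" "pull L i \<psi> \<in> cocycles L s t" "\<chi> \<in> cochains N (s + 1) t"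
    "pull M p \<chi> = coboundary_map M \<psi>"
  shows "\<chi> + delta (pull L i \<psi>) \<in> coboundaries N (s + 1) t"
proof -
  obtain \<omega> where \<omega>: "\<omega> \<in> cochains N s t" "pull M p \<omega> = \<psi> + pull M r (pull L i \<psi>)"
    using lift_difference[OF assms(1)] by blast
  have d: "delta (pull L i \<psi>) \<in> cochains N (s + 1) t" using delta_cocycles[OF assms(2)] by (simp add: cocycles_iff)
  have "pull M p (\<chi> + delta (pull L i \<psi>)) = pull M p (coboundary_map N \<omega>)"
    by (simp add: pull_add assms(4) delta_cocycles[OF assms(2)] coboundary_map_pull[OF M N p_hom, symmetric] \<omega>(2) coboundary_map_add)
  then have "\<chi> + delta (pull L i \<psi>) = coboundary_map N \<omega>"
    by (rule p_pull_inj[OF cochains_add[OF assms(3) d] N.coboundary_cochains[OF \<omega>(1)]])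
  then show ?thesis using \<omega>(1) by (auto simp: coboundaries_iff)
qed

lemma delta_i: "\<psi> \<in> cocycles M s t \<Longrightarrow> delta (pull L i \<psi>) \<in> coboundaries N (s + 1) t"
  using delta_coboundary_eq[of \<psi> s t 0] pull_cocycles[OF L M i_hom, of \<psi> s t] by (simp add: cocycles_iff)

lemma p_delta: "\<phi> \<in> cocycles L s t \<Longrightarrow> pull M p (delta \<phi>) \<in> coboundaries M (s + 1) t"
  using pull_cochains[OF M L rg, of \<phi> s t] by (auto simp: delta_cocycles coboundaries_iff cocycles_iff)

lemma delta_coboundaries:
  assumes "\<phi> \<in> coboundaries L s t"
  shows "delta \<phi> \<in> coboundaries N (s + 1) t"
proof -
  obtain \<eta> where \<eta>: "\<eta> \<in> cochains L (s - 1) t" "\<phi> = coboundary_map L \<eta>" using assms by (auto simp: coboundaries_iff)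
  let ?\<psi> = "coboundary_map M (pull M r \<eta>)"
  have "?\<psi> \<in> coboundaries M s t"
    using pull_cochains[OF M L rg \<eta>(1)] unfolding coboundaries_iff by blast
  moreover have "pull L i ?\<psi> = \<phi>"
    by (simp add: coboundary_map_pull[OF L M i_hom, symmetric] i_pull_r[OF \<eta>(1)] \<eta>(2))
  ultimately show ?thesis using delta_i M.coboundaries_cocycles by metis
qed

lemma exact_M:
  assumes \<phi>: "\<phi> \<in> cocycles M s t" and b: "pull L i \<phi> \<in> coboundaries L s t"
  shows "\<exists>\<chi>\<in>cocycles N s t. \<phi> + pull M p \<chi> \<in> coboundaries M s t"
proof -
  obtain \<eta> where \<eta>: "\<eta> \<in> cochains L (s - 1) t" "pull L i \<phi> = coboundary_map L \<eta>" using b by (auto simp: coboundaries_iff)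
  let ?d = "coboundary_map M (pull M r \<eta>)"
  have r: "pull M r \<eta> \<in> cochains M (s - 1) t" by (rule pull_cochains[OF M L rg \<eta>(1)])
  then have db: "?d \<in> coboundaries M s t" unfolding coboundaries_iff by blast
  then have dz: "\<phi> + ?d \<in> cocycles M s t" using M.coboundaries_cocycles cocycles_add \<phi> by blast
  then have c: "\<phi> + ?d \<in> cochains M s t" by (simp add: cocycles_iff)
  have "pull L i (\<phi> + ?d) = 0"
    by (simp add: pull_add \<eta>(2) coboundary_map_pull[OF L M i_hom, symmetric] i_pull_r[OF \<eta>(1)])
  from descend[OF c this] obtain \<chi> where \<chi>: "\<chi> \<in> cochains N s t" "pull M p \<chi> = \<phi> + ?d" by blast
  have "pull M p (coboundary_map N \<chi>) = pull M p 0"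
    using dz by (simp add: coboundary_map_pull[OF M N p_hom, symmetric] \<chi>(2) cocycles_iff)
  then have "coboundary_map N \<chi> = 0" by (rule p_pull_inj[OF N.coboundary_cochains[OF \<chi>(1)] cochains_0])
  with \<chi> db show ?thesis by (intro bexI[of _ \<chi>]) (simp_all add: cocycles_iff)
qed

lemma exact_N:
  assumes \<chi>: "\<chi> \<in> cocycles N s t" and b: "pull M p \<chi> \<in> coboundaries M s t"
  shows "\<exists>\<phi>\<in>cocycles L (s - 1) t. \<chi> + delta \<phi> \<in> coboundaries N s t"
proof -
  obtain \<eta> where \<eta>: "\<eta> \<in> cochains M (s - 1) t" "pull M p \<chi> = coboundary_map M \<eta>" using b by (auto simp: coboundaries_iff)
  have "coboundary_map L (pull L i \<eta>) = pull L i (pull M p \<chi>)"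
    by (simp add: coboundary_map_pull[OF L M i_hom] \<eta>(2))
  also have "\<dots> = 0" using i_pull_p \<chi> by (auto simp: cocycles_iff)
  finally have z: "pull L i \<eta> \<in> cocycles L (s - 1) t"
    using pull_cochains[OF L M ig \<eta>(1)] by (simp add: cocycles_iff)
  show ?thesis
    using delta_coboundary_eq[OF \<eta>(1) z _ \<eta>(2)] \<chi> by (intro bexI[OF _ z]) (simp add: cocycles_iff)
qed

text \<open>A cochain bounding the connecting class corrects the extension by the retraction to a
  cocycle, so the restriction is \<open>\<phi>\<close> itself and not only \<open>\<phi>\<close> up
  to a coboundary.\<close>

lemma exact_L:
  assumes \<phi>: "\<phi> \<in> cocycles L s t" and b: "delta \<phi> \<in> coboundaries N (s + 1) t"
  shows "\<exists>\<psi>\<in>cocycles M s t. pull L i \<psi> = \<phi>"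
proof -
  obtain \<omega> where \<omega>: "\<omega> \<in> cochains N s t" "delta \<phi> = coboundary_map N \<omega>" using b by (auto simp: coboundaries_iff)
  have \<phi>c: "\<phi> \<in> cochains L s t" using \<phi> by (simp add: cocycles_iff)
  let ?\<psi> = "pull M r \<phi> + pull M p \<omega>"
  have "?\<psi> \<in> cochains M s t" by (intro cochains_add pull_cochains[OF M L rg \<phi>c] pull_cochains[OF M N pg \<omega>(1)])
  moreover have "coboundary_map M ?\<psi> = 0"
    using delta_cocycles(2)[OF \<phi>] by (simp add: coboundary_map_add coboundary_map_pull[OF M N p_hom] \<omega>(2))
  moreover have "pull L i ?\<psi> = \<phi>" by (simp add: pull_add i_pull_r[OF \<phi>c] i_pull_p[OF \<omega>(1)])
  ultimately show ?thesis by (intro bexI[of _ ?\<psi>]) (auto simp: cocycles_iff)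
qed

end

section \<open>Evaluation on powers of \<open>Sq\<^sup>1\<close> and the class \<open>h\<^sub>0\<close>\<close>

abbreviation Sq1s :: "nat \<Rightarrow> steenrod list" where "Sq1s n \<equiv> replicate n (Sq 1)"

lemma set_Sq1s: "set (Sq1s n) \<subseteq> A2" by auto

text \<open>Merging two neighbours produces \<open>Sq 1 \<star> Sq 1 = 0\<close>, so only the action
  on the module element remains.\<close>

lemma bdE_Sq1s:
  assumes "multilinear M \<phi>" "z \<in> total M"
  shows "bdE M \<phi> (Sq1s (Suc n)) z = \<phi> (Sq1s n) (act M (Sq 1) z)"
  using assms(1)
proof (induction n arbitrary: \<phi>)
  case (Suc n)
  have "\<phi> (0 # Sq1s n) z = 0" using multilinear_slot_0[OF Suc.prems, of "[]"] assms(2) set_Sq1s by simp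
  moreover have "bdE M (\<lambda>bs. \<phi> (Sq 1 # bs)) (Sq1s (Suc n)) z = \<phi> (Sq 1 # Sq1s n) (act M (Sq 1) z)"
    by (rule Suc.IH[OF multilinear_Cons[OF Suc.prems]]) simp
  ultimately show ?case by (simp add: Sq_relations(5))
qed simp

lemma augmentation_Sq: "augmentation (Sq n) = (if n = 0 then 1 else 0)"
  using xi_mono_eq_0[of 1 n] by (auto simp: augmentation_def Sq_def)

lemma coboundary_Sq1s:
  assumes "multilinear M \<phi>" "z \<in> total M"
  shows "coboundary_map M \<phi> (Sq1s (Suc n)) z = \<phi> (Sq1s n) (act M (Sq 1) z)"
  using bdE_Sq1s[OF assms] set_Sq1s assms(2) by (simp add: coboundary_map_Cons augmentation_Sq del: bdE.simps)

text \<open>Evaluation on a tuple of entries \<open>Sq 1\<close> and an element annihilated by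
  \<open>Sq 1\<close> is thus well-defined on Ext classes; it amounts to restriction to the exterior
  algebra on \<open>Sq 1\<close>.\<close>

lemma coboundaries_Sq1s:
  assumes "\<phi> \<in> coboundaries M (int n) t" "z \<in> total M" "act M (Sq 1) z = 0" "0 \<in> total M"
  shows "\<phi> (Sq1s n) z = 0"
proof (cases n)
  case 0 then show ?thesis using coboundaries_nonpositive[of 0 \<phi> M t] assms by (simp add: zero_fun_apply)
next
  case (Suc m)
  obtain \<eta> where \<eta>: "\<eta> \<in> cochains M (int n - 1) t" "\<phi> = coboundary_map M \<eta>" using assms by (auto simp: coboundaries_iff)
  then have "multilinear M \<eta>" by (simp add: cochains_iff)
  then show ?thesis using coboundary_Sq1s[OF _ assms(2)] multilinear_0[of M \<eta> "Sq1s m"] assms set_Sq1s by (simp add: \<eta> Suc)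
qed

text \<open>The connecting homomorphism shifts such evaluations by one entry \<open>Sq 1\<close>,
  along the zigzag from \<open>p x\<close> through \<open>x\<close> and
  \<open>act M (Sq 1) x\<close> to \<open>w\<close>.\<close>

lemma (in ses) delta_Sq1s:
  assumes "\<phi> \<in> cocycles L s t" "x \<in> total M" "w \<in> total L" "act M (Sq 1) x = i w"
  shows "delta \<phi> (Sq1s (Suc n)) (p x) = \<phi> (Sq1s n) w"
proof -
  have "delta \<phi> (Sq1s (Suc n)) (p x) = coboundary_map M (pull M r \<phi>) (Sq1s (Suc n)) x"
    unfolding delta_cocycles(2)[OF assms(1), symmetric] using assms(2) by (simp add: pull_eq)
  also have "\<dots> = pull M r \<phi> (Sq1s n) (act M (Sq 1) x)"
    using pull_cochains[OF M L rg, of \<phi> s t] assms by (intro coboundary_Sq1s) (auto simp: cochains_iff cocycles_iff)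
  also have "\<dots> = \<phi> (Sq1s n) w" using assms i_total by (simp add: pull_eq r_i)
  finally show ?thesis .
qed

definition xi1_coeff :: "steenrod \<Rightarrow> bit" where "xi1_coeff a = a (xi_mono 1 1)"

lemma h0_cochain_eq: "h0_cochain \<phi> as x = (if as \<noteq> [] \<and> hd as \<in> A2 then xi1_coeff (hd as) * \<phi> (tl as) x else 0)"
  by (simp add: h0_cochain_def xi1_coeff_def)

text \<open>\<open>xi 1\<close> is primitive, so its coefficient functional is a derivation over the
  augmentation, that is, a cocycle in filtration 1.\<close>

lemma xi1_coeff_mult: "xi1_coeff (a \<star> b) = augmentation a * xi1_coeff b + xi1_coeff a * augmentation b"
proof -
  have "psi_mono (xi_mono 1 1) = monom1 (xi_mono 1 1, 0) + monom1 (0, xi_mono 1 1)"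
    using psi_mono_xi_mono[of 1 1] psi_xi_split[of 1] by simp
  then show ?thesis
    by (simp add: xi1_coeff_def st_mult_eq lin_ext_add augmentation_def ac_simps)
qed

lemma xi1_coeff_add: "xi1_coeff (a + b) = xi1_coeff a + xi1_coeff b"
  by (simp add: xi1_coeff_def plus_fun_apply)

lemma xi1_coeff_Sq1: "xi1_coeff (Sq 1) = 1"
  by (simp add: xi1_coeff_def Sq_def)

lemma h0_cochain_add: "h0_cochain (\<phi> + \<psi>) = h0_cochain \<phi> + h0_cochain \<psi>"
  by (intro ext) (simp add: h0_cochain_eq plus_fun_apply distrib_left)

lemma h0_cochains:
  assumes "\<phi> \<in> cochains M s t"
  shows "h0_cochain \<phi> \<in> cochains M (s + 1) (t + 1)"
  unfolding cochains_iff
proof (intro conjI)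
  have s: "\<And>as x. \<phi> as x \<noteq> 0 \<Longrightarrow> int (length as) = s \<and> set as \<subseteq> A2 \<and> x \<in> total M" and ml: "multilinear M \<phi>" and c: "concentrated M t \<phi>"
    using assms unfolding cochains_iff supported_def by blast+
  have nz: "\<exists>a bs. as = a # bs \<and> a \<in> A2 \<and> xi1_coeff a \<noteq> 0 \<and> \<phi> bs x \<noteq> 0" if "h0_cochain \<phi> as x \<noteq> 0" for as x
    using that by (cases as) (auto simp: h0_cochain_eq split: if_splits)
  show "supported M (s + 1) (h0_cochain \<phi>)"
    unfolding supported_def using nz s by fastforce
  show "concentrated M (t + 1) (h0_cochain \<phi>)"
    unfolding concentrated_def
  proof (intro allI impI, elim conjE)
    fix as ks x n assume *: "set as \<subseteq> A2" "list_all2 st_homogeneous ks as" "x \<in> gr M n" "h0_cochain \<phi> as x \<noteq> 0"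
    obtain a bs where as: "as = a # bs" "xi1_coeff a \<noteq> 0" "\<phi> bs x \<noteq> 0" using nz[OF *(4)] by blast
    then obtain k ls where k: "ks = k # ls" "st_homogeneous k a" "list_all2 st_homogeneous ls bs" using * by (auto simp: list_all2_Cons2)
    have "k = 1" using k(2) as(2) by (auto simp: st_homogeneous_def xi1_coeff_def mdeg_xi_mono)
    moreover have "int (sum_list ls) + n = t"
      using c[unfolded concentrated_def, rule_format, of bs ls x n] as * k by simp
    ultimately show "int (sum_list ks) + n = t + 1" by (simp add: k)
  qed
  show "multilinear M (h0_cochain \<phi>)"
    unfolding multilinear_def
  proof (intro conjI allI impI; elim conjE)
    fix as a b bs x assume *: "set as \<subseteq> A2" "a \<in> A2" "b \<in> A2" "set bs \<subseteq> A2" "x \<in> total M"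
    show "h0_cochain \<phi> (as @ (a + b) # bs) x = h0_cochain \<phi> (as @ a # bs) x + h0_cochain \<phi> (as @ b # bs) x"
      using * multilinear_slot[OF ml, of "tl as" a b bs x]
      by (cases as) (simp_all add: h0_cochain_eq xi1_coeff_add distrib_right distrib_left)
  next
    fix as x y assume *: "set as \<subseteq> A2" "x \<in> total M" "y \<in> total M"
    show "h0_cochain \<phi> as (x + y) = h0_cochain \<phi> as x + h0_cochain \<phi> as y"
      using * multilinear_add[OF ml, of "tl as" x y] by (cases as) (simp_all add: h0_cochain_eq distrib_left)
  qed
qed

text \<open>Merging the first two entries \<open>a\<close> and \<open>b\<close> gives two terms by
  the derivation rule: one cancels the outer augmentation term, the other becomes the augmentation
  term in the coboundary of \<open>\<phi>\<close>.\<close>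

lemma (in module) coboundary_h0: "\<phi> \<in> cochains M s t \<Longrightarrow> coboundary_map M (h0_cochain \<phi>) = h0_cochain (coboundary_map M \<phi>)"
proof (rule cochain_eqI)
  assume \<phi>: "\<phi> \<in> cochains M s t"
  show "coboundary_map M (h0_cochain \<phi>) \<in> cochains M (s + 1 + 1) (t + 1)"
    by (intro coboundary_cochains h0_cochains \<phi>)
  show "h0_cochain (coboundary_map M \<phi>) \<in> cochains M (s + 1 + 1) (t + 1)"
    by (intro coboundary_cochains h0_cochains \<phi>)
  fix as x assume *: "set as \<subseteq> A2" "x \<in> total M"
  consider "as = []" | a where "as = [a]" | a b bs where "as = a # b # bs" by (cases as rule: remdups_adj.cases)
  then show "coboundary_map M (h0_cochain \<phi>) as x = h0_cochain (coboundary_map M \<phi>) as x"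
  proof cases
    case 3
    have "(\<lambda>bs. h0_cochain \<phi> (a # bs)) = (\<lambda>bs x. xi1_coeff a * \<phi> bs x)"
      using * 3 by (intro ext) (simp add: h0_cochain_eq)
    then have "bdE M (\<lambda>bs. h0_cochain \<phi> (a # bs)) (b # bs) x = xi1_coeff a * bdE M \<phi> (b # bs) x"
      by (simp only: bdE_scale)
    then show ?thesis using * 3
      by (simp add: coboundary_map_eq h0_cochain_eq xi1_coeff_mult distrib_left distrib_right mult.assoc del: bdE.simps(2))
  qed (use * in \<open>simp_all add: coboundary_map_eq h0_cochain_eq\<close>)
qed

section \<open>Left ideals as modules\<close>

definition hcomp :: "nat \<Rightarrow> steenrod \<Rightarrow> steenrod" where
  "hcomp d x = (\<lambda>m. if mdeg m = d then x m else 0)"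

definition lmod :: "steenrod set \<Rightarrow> steenrod gmod" where
  "lmod S = \<lparr>gr = (\<lambda>n. S \<inter> {c. \<forall>m. c m \<noteq> 0 \<longrightarrow> int (mdeg m) = n}), act = (\<star>)\<rparr>"

text \<open>Closure under \<open>hcomp\<close> says that the ideal is graded, so that
  \<open>lmod S\<close> has all of \<open>S\<close> as its total space.\<close>

definition left_ideal :: "steenrod set \<Rightarrow> bool" where
  "left_ideal S \<longleftrightarrow> S \<subseteq> A2 \<and> 0 \<in> S \<and> (\<forall>x\<in>S. \<forall>y\<in>S. x + y \<in> S) \<and> (\<forall>a\<in>A2. \<forall>x\<in>S. a \<star> x \<in> S) \<and> (\<forall>x\<in>S. \<forall>d. hcomp d x \<in> S)"

definition lid :: "steenrod \<Rightarrow> steenrod set" where "lid g = {a \<star> g |a. a \<in> A2}"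

lemma hcomp_homogeneous: "st_homogeneous d (hcomp d x)"
  by (simp add: st_homogeneous_def hcomp_def)

lemma hcomp_A2: "x \<in> A2 \<Longrightarrow> hcomp d x \<in> A2"
  by (auto simp: A2_Box Box_def hcomp_def)

lemma hcomp_add: "hcomp d (x + y) = hcomp d x + hcomp d y"
  by (intro ext) (simp add: hcomp_def plus_fun_apply)

lemma st_homogeneous_0 [simp]: "st_homogeneous d 0"
  by (simp add: st_homogeneous_def zero_fun_apply)

lemma hcomp_mult:
  assumes "st_homogeneous l g"
  shows "hcomp d (a \<star> g) = (if l \<le> d then hcomp (d - l) a \<star> g else 0)"
proof
  fix m
  show "hcomp d (a \<star> g) m = (if l \<le> d then hcomp (d - l) a \<star> g else 0) m"
  proof (cases "mdeg m = d")
    case True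
    show ?thesis
    proof (cases "l \<le> d")
      case l: True
      have "lin_ext (\<lambda>(p, q). a p * g q) (psi_mono m) = lin_ext (\<lambda>(p, q). hcomp (d - l) a p * g q) (psi_mono m)"
      proof (rule lin_ext_cong, clarify)
        fix p q assume "(p, q) \<in> Poly_Mapping.keys (psi_mono m)"
        then have "mdeg p + mdeg q = d" using psi_mono_homogeneous True by simp
        then show "a p * g q = hcomp (d - l) a p * g q"
          using assms l by (cases "g q = 0") (auto simp: hcomp_def st_homogeneous_def)
      qed
      then show ?thesis using True l by (simp add: hcomp_def[of d] st_mult_eq)
    next
      case l: False
      have "lin_ext (\<lambda>(p, q). a p * g q) (psi_mono m) = 0"
      proof (rule ccontr)
        assume "lin_ext (\<lambda>(p, q). a p * g q) (psi_mono m) \<noteq> 0"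
        then obtain p q where "(p, q) \<in> Poly_Mapping.keys (psi_mono m)" "a p * g q \<noteq> 0"
          using lin_ext_nonzero[of "\<lambda>(p, q). a p * g q"] by fastforce
        then have "mdeg p + mdeg q = d" "mdeg q = l" using psi_mono_homogeneous True assms
          by (auto simp: st_homogeneous_def)
        with l show False by simp
      qed
      then show ?thesis using True l by (simp add: hcomp_def[of d] st_mult_eq zero_fun_apply)
    qed
  next
    case False
    have "(hcomp (d - l) a \<star> g) m = 0" if "l \<le> d"
      using st_homogeneous_mult[OF hcomp_homogeneous[of "d - l" a] assms] False that
      by (auto simp: st_homogeneous_def)
    with False show ?thesis by (simp add: hcomp_def[of d] zero_fun_apply)
  qed
qed

lemma left_ideal_A2 [simp]: "left_ideal A2"
  unfolding left_ideal_def using hcomp_A2 by auto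

lemma left_ideal_lid:
  assumes "g \<in> A2" "st_homogeneous l g"
  shows "left_ideal (lid g)"
  unfolding left_ideal_def
proof (intro conjI ballI allI)
  show "lid g \<subseteq> A2" using assms by (auto simp: lid_def)
  have z: "0 \<star> g \<in> lid g" unfolding lid_def using A2_0 by blast
  then show "0 \<in> lid g" by simp
  fix x assume "x \<in> lid g"
  then obtain a where a: "x = a \<star> g" "a \<in> A2" by (auto simp: lid_def)
  show "x + y \<in> lid g" if "y \<in> lid g" for y
    using that a unfolding lid_def by (clarsimp simp flip: st_mult_add_left) auto
  show "b \<star> x \<in> lid g" if "b \<in> A2" for b
    using that a unfolding lid_def by (clarsimp simp flip: st_mult_assoc) auto
  show "hcomp d x \<in> lid g" for d
    using a z hcomp_A2 unfolding a(1) hcomp_mult[OF assms(2)] lid_def by auto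
qed

lemma left_ideal_sum:
  assumes "left_ideal S" "left_ideal T"
  shows "left_ideal {x + y |x y. x \<in> S \<and> y \<in> T}"
  unfolding left_ideal_def
proof (intro conjI ballI allI)
  let ?U = "{x + y |x y. x \<in> S \<and> y \<in> T}"
  have I: "x + y \<in> ?U" if "x \<in> S" "y \<in> T" for x y using that by blast
  have c: "0 \<in> S" "0 \<in> T" "\<And>x y. x \<in> S \<Longrightarrow> y \<in> S \<Longrightarrow> x + y \<in> S" "\<And>x y. x \<in> T \<Longrightarrow> y \<in> T \<Longrightarrow> x + y \<in> T"
    "\<And>a x. a \<in> A2 \<Longrightarrow> x \<in> S \<Longrightarrow> a \<star> x \<in> S" "\<And>a x. a \<in> A2 \<Longrightarrow> x \<in> T \<Longrightarrow> a \<star> x \<in> T"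
    "\<And>d x. x \<in> S \<Longrightarrow> hcomp d x \<in> S" "\<And>d x. x \<in> T \<Longrightarrow> hcomp d x \<in> T"
    "\<And>x. x \<in> S \<Longrightarrow> x \<in> A2" "\<And>x. x \<in> T \<Longrightarrow> x \<in> A2"
    using assms by (auto simp: left_ideal_def)
  show "?U \<subseteq> A2" using c(9,10) by auto
  show "0 \<in> ?U" using I[OF c(1,2)] by simp
  fix u assume "u \<in> ?U"
  then obtain x y where u: "u = x + y" "x \<in> S" "y \<in> T" by blast
  show "u + v \<in> ?U" if v: "v \<in> ?U" for v
  proof -
    obtain x' y' where v: "v = x' + y'" "x' \<in> S" "y' \<in> T" using v by blast
    have "u + v = (x + x') + (y + y')" by (simp add: u v ac_simps)
    then show ?thesis using I[OF c(3)[OF u(2) v(2)] c(4)[OF u(3) v(3)]] by simp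
  qed
  show "a \<star> u \<in> ?U" if "a \<in> A2" for a
    using I[OF c(5)[OF that u(2)] c(6)[OF that u(3)]] by (simp add: u(1) st_mult_add_right)
  show "hcomp d u \<in> ?U" for d
    using I[OF c(7)[OF u(2)] c(8)[OF u(3)]] by (simp add: u(1) hcomp_add)
qed

lemma sum_fun_apply: "(\<Sum>i\<in>I. f i) m = (\<Sum>i\<in>I. (f i m :: bit))"
  by (induction I rule: infinite_finite_induct) (simp_all add: plus_fun_apply zero_fun_apply)

lemma mdeg_box: "m \<in> box \<Longrightarrow> mdeg m < 32"
  using box_tri[of m] by (auto simp: mdeg_tri boxed_def tdeg_def)

lemma hcomp_decomp: "x \<in> A2 \<Longrightarrow> x = (\<Sum>d\<in>int ` {..<32}. hcomp (nat d) x)"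
proof
  fix m assume x: "x \<in> A2"
  have "(\<Sum>d\<in>int ` {..<32}. hcomp (nat d) x) m = (\<Sum>d<32. if d = mdeg m then x m else 0)"
    by (simp add: sum_fun_apply sum.reindex hcomp_def eq_commute)
  also have "\<dots> = x m"
    using x mdeg_box[of m] by (auto simp: A2_Box Box_def)
  finally show "x m = (\<Sum>d\<in>int ` {..<32}. hcomp (nat d) x) m" by simp
qed

lemma gr_lmod: "x \<in> gr (lmod S) n \<longleftrightarrow> x \<in> S \<and> (\<forall>m. x m \<noteq> 0 \<longrightarrow> int (mdeg m) = n)"
  by (simp add: lmod_def)

lemma gr_lmod_homogeneous: "x \<in> gr (lmod S) (int k) \<longleftrightarrow> x \<in> S \<and> st_homogeneous k x"
  by (auto simp: gr_lmod st_homogeneous_def)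

lemma act_lmod [simp]: "act (lmod S) = (\<star>)"
  by (simp add: lmod_def)

lemma total_lmod [simp]: "left_ideal S \<Longrightarrow> total (lmod S) = S"
proof (intro equalityI subsetI)
  assume S: "left_ideal S"
  {
    fix x assume "x \<in> total (lmod S)"
    then obtain N f where x: "x = (\<Sum>n\<in>N. f n)" and N: "finite N" "\<forall>n\<in>N. f n \<in> gr (lmod S) n" by (auto simp: total_def)
    have "(\<Sum>n\<in>N. f n) \<in> S" using N
    proof (induction N rule: finite_induct)
      case empty show ?case using S by (simp add: left_ideal_def)
    next
      case (insert n N) then show ?case using S by (simp add: left_ideal_def gr_lmod)
    qed
    then show "x \<in> S" by (simp add: x)
  next
    fix x assume x: "x \<in> S"
    then have xA: "x \<in> A2" using S by (auto simp: left_ideal_def)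
    have "(\<Sum>d\<in>int ` {..<32}. hcomp (nat d) x) \<in> total (lmod S)"
      by (rule sum_in_total) (use x S in \<open>auto simp: gr_lmod_homogeneous left_ideal_def hcomp_homogeneous\<close>)
    then show "x \<in> total (lmod S)" using hcomp_decomp[OF xA] by simp
  }
qed

lemma module_lmod:
  assumes S: "left_ideal S"
  shows "A2_module (lmod S)"
  unfolding A2_module_def total_lmod[OF S] act_lmod
proof (intro conjI allI ballI impI)
  note * = S[unfolded left_ideal_def]
  show "0 \<in> gr (lmod S) n" for n using * by (simp add: gr_lmod zero_fun_apply)
  show "x + y \<in> gr (lmod S) n" if "x \<in> gr (lmod S) n" "y \<in> gr (lmod S) n" for x y n
    using that * unfolding gr_lmod plus_fun_apply by (metis add_0)
  show "x + x = 0" for x :: steenrod by simp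
  show "f n = 0" if "finite N \<and> (\<forall>n\<in>N. f n \<in> gr (lmod S) n) \<and> (\<Sum>n\<in>N. f n) = 0" "n \<in> N" for N f n
  proof
    fix m
    show "f n m = 0 m"
    proof (cases "int (mdeg m) = n")
      case True
      have "0 = (\<Sum>k\<in>N. f k) m" using that by (simp add: zero_fun_apply)
      also have "\<dots> = (\<Sum>k\<in>{n}. f k m)"
        unfolding sum_fun_apply
        by (rule sum.mono_neutral_right) (use that True in \<open>auto simp: gr_lmod\<close>)
      finally show ?thesis by (simp add: zero_fun_apply)
    next
      case False
      moreover have "f n m \<noteq> 0 \<longrightarrow> int (mdeg m) = n" using that unfolding gr_lmod by blast
      ultimately show ?thesis unfolding zero_fun_apply by blast
    qed
  qed
  show "a \<star> x \<in> gr (lmod S) (int k + n)" if "a \<in> A2" "x \<in> gr (lmod S) n" "st_homogeneous k a" for k n a x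
  proof (cases "n \<ge> 0")
    case True
    then obtain l where l: "n = int l" by (metis nonneg_int_cases)
    then have "x \<in> S" "st_homogeneous l x" using that by (auto simp: gr_lmod_homogeneous)
    then have "a \<star> x \<in> gr (lmod S) (int (k + l))"
      using st_homogeneous_mult that * by (simp only: gr_lmod_homogeneous)
    then show ?thesis by (simp add: l)
  next
    case False
    then have "x = 0" using that(2) by (intro ext) (force simp: gr_lmod zero_fun_apply)
    then show ?thesis using * by (simp add: gr_lmod zero_fun_apply)
  qed
qed (simp_all add: st_mult_add_left st_mult_add_right st_mult_assoc)

text \<open>Provides the finiteness that the retractions behind the long exact sequences
  require.\<close>

lemma finite_Box: "finite Box"
proof -
  have "finite box"
  proof (rule finite_subset)
    show "box \<subseteq> tri ` ({..<8} \<times> {..<4} \<times> {..<2})" using box_tri by (fastforce simp: boxed_def)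
  qed simp
  moreover have "inj_on (\<lambda>x :: steenrod. {m. x m \<noteq> 0}) Box"
    by (rule inj_onI, rule ext) (metis (mono_tags, lifting) bit_not_zero_iff mem_Collect_eq)
  moreover have "(\<lambda>x :: steenrod. {m. x m \<noteq> 0}) ` Box \<subseteq> Pow box" by (auto simp: Box_def)
  ultimately show ?thesis by (meson finite_Pow_iff finite_subset inj_on_finite)
qed

lemma finite_gr_lmod: "left_ideal S \<Longrightarrow> finite (gr (lmod S) n)"
  by (rule finite_subset[OF _ finite_Box]) (auto simp: lmod_def left_ideal_def A2_Box)

lemma gr_susp [simp]: "gr (susp k M) n = gr M (n - k)" and act_susp [simp]: "act (susp k M) = act M"
  by (simp_all add: susp_def)

lemma total_susp [simp]: "total (susp k M) = total M"
proof -
  have *: "total (susp k M) \<subseteq> total M" for k and M :: "'b::ab_group_add gmod"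
  proof
    fix x assume "x \<in> total (susp k M)"
    then obtain N f where N: "x = (\<Sum>n\<in>N. f n)" "finite N" "\<forall>n\<in>N. f n \<in> gr M (n - k)" by (auto simp: total_def)
    have "x = (\<Sum>n\<in>(\<lambda>n. n - k) ` N. f (n + k))"
      by (simp add: N(1) sum.reindex inj_on_def)
    also have "\<dots> \<in> total M" using N by (intro sum_in_total) auto
    finally show "x \<in> total M" .
  qed
  have "susp (- k) (susp k M) = M" by (simp add: susp_def)
  with *[of "- k" "susp k M"] *[of k M] show ?thesis by auto
qed

lemma module_susp: "A2_module M \<Longrightarrow> A2_module (susp k M)"
proof -
  assume M: "A2_module M"
  interpret module M by unfold_locales (fact M)
  show ?thesis
    unfolding A2_module_def total_susp act_susp gr_susp
  proof (intro conjI allI ballI impI)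
    show "f n = 0" if fN: "finite N \<and> (\<forall>n\<in>N. f n \<in> gr M (n - k)) \<and> (\<Sum>n\<in>N. f n) = 0" "n \<in> N" for N f n
    proof -
      have "(\<Sum>n\<in>(\<lambda>n. n - k) ` N. f (n + k)) = 0" using fN by (simp add: sum.reindex inj_on_def)
      moreover have "f (j + k) \<in> gr M j" if "j \<in> (\<lambda>n. n - k) ` N" for j using that fN by auto
      ultimately show ?thesis
        using independent[of "(\<lambda>n. n - k) ` N" "\<lambda>n. f (n + k)" "n - k"] fN by auto
    qed
    show "act M a x \<in> gr M (int j + n - k)" if "a \<in> A2" "x \<in> gr M (n - k)" "st_homogeneous j a" for j n a x
      using act_gr[OF that] by (simp add: algebra_simps)
  qed (simp_all add: gr_add total_self act_add add_act act_act act_1)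
qed

lemma lmod_mult_hom:
  assumes S: "left_ideal S" and T: "left_ideal T" and g: "st_homogeneous l g"
    and im: "\<And>x. x \<in> S \<Longrightarrow> x \<star> g \<in> T" and k: "k = k' + int l"
  shows "A2_hom (susp k (lmod S)) (susp k' (lmod T)) (\<lambda>x. x \<star> g)"
  unfolding A2_hom_def total_susp total_lmod[OF S] act_susp act_lmod gr_susp
proof (intro conjI ballI allI image_subsetI)
  fix n x assume x: "x \<in> gr (lmod S) (n - k)"
  show "x \<star> g \<in> gr (lmod T) (n - k')"
  proof (cases "n - k \<ge> 0")
    case True
    then obtain j where j: "n - k = int j" by (metis nonneg_int_cases)
    with x have "x \<in> S" "st_homogeneous j x" by (auto simp: gr_lmod_homogeneous)
    then have "x \<star> g \<in> gr (lmod T) (int (j + l))"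
      using im st_homogeneous_mult[OF _ g] by (simp only: gr_lmod_homogeneous)
    moreover have "int (j + l) = n - k'" using j k by simp
    ultimately show ?thesis by simp
  next
    case False
    then have "x = 0" using x by (intro ext) (force simp: gr_lmod zero_fun_apply)
    then show ?thesis using T by (simp add: gr_lmod zero_fun_apply left_ideal_def)
  qed
qed (simp_all add: st_mult_add_left st_mult_assoc)

lemma lmod_incl_hom:
  assumes "left_ideal S" "left_ideal T" "S \<subseteq> T"
  shows "A2_hom (susp k (lmod S)) (susp k (lmod T)) (\<lambda>x. x)"
  using assms by (auto simp: A2_hom_def total_lmod gr_lmod)

lemma susp_0: "susp 0 M = M"
  by (simp add: susp_def)

section \<open>Vanishing for the free module\<close>

abbreviation free :: "int \<Rightarrow> steenrod gmod" where "free k \<equiv> susp k (lmod A2)"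

lemma total_free: "total (free k) = A2"
  by (simp add: total_lmod[OF left_ideal_A2])

lemma module_free: "A2_module (free k)"
  by (intro module_susp module_lmod left_ideal_A2)

text \<open>Reading the last slot as the module element turns merging with it into the action on it;
  the action of \<open>y\<close> on \<open>z\<close> is the one term left over.\<close>

lemma bdE_snoc:
  assumes "set as \<subseteq> A2" "y \<in> A2" "as \<noteq> []"
  shows "bdE (free k) \<phi> (as @ [y]) z = bdE (free k) (\<lambda>bs w. \<phi> (bs @ [w]) z) as y + \<phi> as (y \<star> z)"
  using assms
proof (induction as arbitrary: \<phi> rule: induct_list012)
  case (3 a b as)
  have "bdE (free k) (\<lambda>bs. \<phi> (a # bs)) ((b # as) @ [y]) z =
      bdE (free k) (\<lambda>bs w. \<phi> (a # bs @ [w]) z) (b # as) y + \<phi> (a # b # as) (y \<star> z)"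
    using 3 by simp
  then show ?case by (simp add: ac_simps)
qed simp_all

text \<open>Over a free module of rank one the bar complex has a contracting homotopy, which reads
  the module element as a further slot in front of the unit. For \<open>s = 0\<close> the class dual
  to the unit survives.\<close>

lemma free_vanishing:
  assumes \<phi>: "\<phi> \<in> cocycles (free k) s t" and s: "s \<ge> 1"
  shows "\<phi> \<in> coboundaries (free k) s t"
proof -
  have c: "\<phi> \<in> cochains (free k) s t" and d: "coboundary_map (free k) \<phi> = 0" using \<phi> by (auto simp: cocycles_iff)
  have ml: "multilinear (free k) \<phi>" and sup: "supported (free k) s \<phi>" and con: "concentrated (free k) t \<phi>"
    using c by (auto simp: cochains_iff)
  define \<eta> :: "steenrod cochain" where "\<eta> as x = \<phi> (as @ [x]) (Sq 0)" for as x
  have u: "Sq 0 \<in> A2" by simp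
  have eta: "\<eta> \<in> cochains (free k) (s - 1) t"
    unfolding cochains_iff
  proof (intro conjI)
    show "supported (free k) (s - 1) \<eta>"
      using sup unfolding supported_def \<eta>_def total_free by fastforce
    show "multilinear (free k) \<eta>"
      unfolding multilinear_def \<eta>_def total_free
    proof (intro conjI allI impI; elim conjE)
      fix as a b bs x assume "set as \<subseteq> A2" "a \<in> A2" "b \<in> A2" "set bs \<subseteq> A2" "x \<in> A2"
      then show "\<phi> ((as @ (a + b) # bs) @ [x]) (Sq 0) = \<phi> ((as @ a # bs) @ [x]) (Sq 0) + \<phi> ((as @ b # bs) @ [x]) (Sq 0)"
        using multilinear_slot[OF ml, of as a b "bs @ [x]" "Sq 0"] u by (simp add: total_lmod[OF left_ideal_A2])
    next
      fix as x y assume "set as \<subseteq> A2" "x \<in> A2" "y \<in> A2"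
      then show "\<phi> (as @ [x + y]) (Sq 0) = \<phi> (as @ [x]) (Sq 0) + \<phi> (as @ [y]) (Sq 0)"
        using multilinear_slot[OF ml, of as x y "[]" "Sq 0"] u by (simp add: total_lmod[OF left_ideal_A2])
    qed
    show "concentrated (free k) t \<eta>"
      unfolding concentrated_def \<eta>_def
    proof (intro allI impI, elim conjE)
      fix as ks x n assume *: "set as \<subseteq> A2" "list_all2 st_homogeneous ks as" "x \<in> gr (free k) n" "\<phi> (as @ [x]) (Sq 0) \<noteq> 0"
      have x: "x \<noteq> 0" "x \<in> A2"
        using multilinear_slot_0[OF ml *(1), of "[]" "Sq 0"] * u by (auto simp: total_free gr_lmod)
      have "n - k \<ge> 0"
      proof (rule ccontr)
        assume "\<not> n - k \<ge> 0"
        then have "x = 0" using *(3) by (intro ext) (force simp: gr_lmod zero_fun_apply)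
        with x show False by simp
      qed
      then obtain j where j: "n - k = int j" by (metis nonneg_int_cases)
      have "int (sum_list (ks @ [j])) + k = t"
      proof (rule con[unfolded concentrated_def, rule_format])
        show "set (as @ [x]) \<subseteq> A2 \<and> list_all2 st_homogeneous (ks @ [j]) (as @ [x]) \<and> Sq 0 \<in> gr (free k) k \<and> \<phi> (as @ [x]) (Sq 0) \<noteq> 0"
          using * x j Sq_homogeneous[of 0] gr_lmod_homogeneous[of x A2 j] gr_lmod_homogeneous[of "Sq 0" A2 0]
          by (simp add: list_all2_appendI)
      qed
      then show "int (sum_list ks) + n = t" using j by simp
    qed
  qed
  have "\<phi> = coboundary_map (free k) \<eta>"
  proof (rule cochain_eqI[OF c])
    interpret module "free k" by unfold_locales (rule module_free)
    show "coboundary_map (free k) \<eta> \<in> cochains (free k) s t"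
      using coboundary_cochains[OF eta] by simp
    fix as y assume *: "set as \<subseteq> A2" "y \<in> total (free k)"
    then have y: "y \<in> A2" by (simp add: total_free)
    show "\<phi> as y = coboundary_map (free k) \<eta> as y"
    proof (cases as)
      case Nil
      have "\<phi> [] y = 0" using sup s unfolding supported_def by (metis list.size(3) of_nat_0 not_one_le_zero)
      then show ?thesis by (simp add: Nil coboundary_map_eq)
    next
      case (Cons a bs)
      have "0 = coboundary_map (free k) \<phi> (as @ [y]) (Sq 0)" by (simp add: d zero_fun_apply)
      also have "\<dots> = augmentation a * \<phi> (bs @ [y]) (Sq 0) + bdE (free k) \<phi> (as @ [y]) (Sq 0)"
        using * y u by (simp add: coboundary_map_eq total_free Cons)
      also have "\<dots> = augmentation a * \<eta> bs y + bdE (free k) \<eta> as y + \<phi> as y"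
      proof -
        have "(\<lambda>bs w. \<phi> (bs @ [w]) (Sq 0)) = \<eta>" by (intro ext) (simp add: \<eta>_def)
        then have "bdE (free k) \<phi> (as @ [y]) (Sq 0) = bdE (free k) \<eta> as y + \<phi> as y"
          using bdE_snoc[OF *(1) y, of k \<phi> "Sq 0"] Cons by (simp only: Sq_0_right list.distinct not_False_eq_True)
        then show ?thesis by (simp only: \<eta>_def add.assoc)
      qed
      also have "\<dots> = coboundary_map (free k) \<eta> as y + \<phi> as y"
        using * by (simp add: coboundary_map_eq Cons)
      finally show ?thesis by (metis bit_eq_iff_add add.commute)
    qed
  qed
  with eta show ?thesis unfolding coboundaries_iff by blast
qed

section \<open>Presentations of the left ideals by free modules\<close>

abbreviation "P1 \<equiv> lid (Sq 1)"
abbreviation "N4 \<equiv> lid (Sq 4)"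
abbreviation "J7 \<equiv> lid (Sq 7)"

lemma ideals [simp]: "left_ideal P1" "left_ideal N4" "left_ideal J7"
  by (rule left_ideal_lid[OF _ Sq_homogeneous]; simp)+

lemma lid_A2: "g \<in> A2 \<Longrightarrow> x \<in> lid g \<Longrightarrow> x \<in> A2"
  by (auto simp: lid_def)

lemma lidI: "a \<in> A2 \<Longrightarrow> a \<star> g \<in> lid g"
  by (auto simp: lid_def)

lemma lid_0 [simp]: "0 \<in> lid g"
  using lidI[of 0 g] by simp

lemma lid_self: "g \<in> lid g"
  using lidI[of "Sq 0" g] by simp

text \<open>The kernel of the projection from the free module is the same ideal, one degree higher;
  this yields a periodic resolution.\<close>

lemma ses_P: "ses (susp (k + 1) (lmod P1)) (\<lambda>x. x) (free (k + 1)) (\<lambda>x. x \<star> Sq 1) (susp k (lmod P1))"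
proof
  show "A2_module (susp (k + 1) (lmod P1))" "A2_module (free (k + 1))" "A2_module (susp k (lmod P1))"
    by (intro module_susp module_lmod ideals left_ideal_A2)+
  show "finite (gr (free (k + 1)) n)" for n by (simp add: finite_gr_lmod left_ideal_A2)
  have "x \<in> P1 \<longleftrightarrow> x \<in> A2 \<and> x \<star> Sq 1 = 0" for x
    using ann_Sq1[of x] by (auto simp: lid_def st_mult_assoc Sq_relations)
  moreover have "(\<lambda>x. x \<star> Sq 1) ` A2 = P1" by (auto simp: lid_def)
  moreover have "A2_hom (free (k + 1)) (susp k (lmod P1)) (\<lambda>x. x \<star> Sq 1)"
    by (rule lmod_mult_hom[OF _ _ Sq_homogeneous]) (auto intro: left_ideal_A2 lidI)
  moreover have "A2_hom (susp (k + 1) (lmod P1)) (free (k + 1)) (\<lambda>x. x)"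
    by (rule lmod_incl_hom) (auto intro: left_ideal_A2 lid_A2[of "Sq 1"])
  ultimately show "short_exact (susp (k + 1) (lmod P1)) (\<lambda>x. x) (free (k + 1)) (\<lambda>x. x \<star> Sq 1) (susp k (lmod P1))"
    by (auto simp: short_exact_def total_lmod left_ideal_A2)
qed

lemma ses_N: "ses (susp 4 (lmod J7)) (\<lambda>x. x) (free 4) (\<lambda>x. x \<star> Sq 4) (lmod N4)"
proof
  show "A2_module (susp 4 (lmod J7))" "A2_module (free 4)" "A2_module (lmod N4)"
    by (intro module_susp module_lmod ideals left_ideal_A2)+
  show "finite (gr (free 4) n)" for n by (simp add: finite_gr_lmod left_ideal_A2)
  have "x \<in> J7 \<longleftrightarrow> x \<in> A2 \<and> x \<star> Sq 4 = 0" for x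
    using ann_Sq4[of x] by (auto simp: lid_def st_mult_assoc Sq_relations(6))
  moreover have "(\<lambda>x. x \<star> Sq 4) ` A2 = N4" by (auto simp: lid_def)
  moreover have "A2_hom (free 4) (susp 0 (lmod N4)) (\<lambda>x. x \<star> Sq 4)"
    by (rule lmod_mult_hom[OF _ _ Sq_homogeneous]) (auto intro: left_ideal_A2 lidI)
  moreover have "A2_hom (susp 4 (lmod J7)) (free 4) (\<lambda>x. x)"
    by (rule lmod_incl_hom) (auto intro: left_ideal_A2 lid_A2[of "Sq 7"])
  ultimately show "short_exact (susp 4 (lmod J7)) (\<lambda>x. x) (free 4) (\<lambda>x. x \<star> Sq 4) (lmod N4)"
    by (auto simp: short_exact_def total_lmod left_ideal_A2 susp_0)
qed

lemma cocycle0_act: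
  assumes "A2_module M" "\<phi> \<in> cocycles M 0 t" "a \<in> A2" "x \<in> total M"
  shows "\<phi> [] (act M a x) = augmentation a * \<phi> [] x"
proof -
  have "coboundary_map M \<phi> [a] x = 0" using assms by (simp add: cocycles_iff zero_fun_apply)
  then have "augmentation a * \<phi> [] x + \<phi> [] (act M a x) = 0" using assms by (simp add: coboundary_map_eq)
  then show ?thesis by (metis bit_eq_iff_add)
qed

lemma cocycle0_zeroI:
  assumes "\<phi> \<in> cocycles M 0 t" "\<And>x. x \<in> total M \<Longrightarrow> \<phi> [] x = 0"
  shows "\<phi> = 0"
proof (intro ext)
  fix as x
  have "\<phi> as x = 0"
  proof (cases "as = []")
    case True
    then show ?thesis using assms cochain_outside[of \<phi> M 0 t as x] by (cases "x \<in> total M") (auto simp: cocycles_iff)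
  next
    case False
    moreover have "supported M 0 \<phi>" using assms(1) by (simp add: cocycles_iff cochains_iff)
    ultimately show ?thesis unfolding supported_def by (metis length_0_conv of_nat_eq_0_iff)
  qed
  then show "\<phi> as x = 0 as x" by (simp add: zero_fun_apply)
qed

text \<open>The module \<open>P1\<close> has the free resolution with all differentials right multiplication by \<open>Sq\<^sup>1\<close>,
  so its Ext is a single \<open>h\<^sub>0\<close>-tower, detected on the tuples \<open>(Sq\<^sup>1, \<dots>, Sq\<^sup>1; Sq\<^sup>1)\<close>.\<close>

lemma tower_P:
  assumes "\<phi> \<in> cocycles (susp k (lmod P1)) (int n) t" "\<phi> (Sq1s n) (Sq 1) = 0"
  shows "\<phi> \<in> coboundaries (susp k (lmod P1)) (int n) t"
  using assms
proof (induction n arbitrary: k \<phi>)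
  case 0
  have M: "A2_module (susp k (lmod P1))" by (intro module_susp module_lmod ideals)
  have "\<phi> [] x = 0" if x: "x \<in> P1" for x
  proof -
    obtain a where a: "x = a \<star> Sq 1" "a \<in> A2" using x by (auto simp: lid_def)
    have "\<phi> [] (act (susp k (lmod P1)) a (Sq 1)) = augmentation a * \<phi> [] (Sq 1)"
      by (rule cocycle0_act[OF M _ a(2)]) (use 0 lid_self in \<open>auto simp: total_lmod\<close>)
    then show ?thesis using 0 by (simp add: a)
  qed
  then have "\<phi> = 0" using 0 by (intro cocycle0_zeroI[of \<phi> "susp k (lmod P1)" t]) (auto simp: total_lmod)
  then show ?case by simp
next
  case (Suc n)
  interpret ses "susp (k + 1) (lmod P1)" "\<lambda>x. x" "free (k + 1)" "\<lambda>x. x \<star> Sq 1" "susp k (lmod P1)"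
    by (rule ses_P)
  have "pull (free (k + 1)) (\<lambda>x. x \<star> Sq 1) \<phi> \<in> coboundaries (free (k + 1)) (int (Suc n)) t"
    by (rule free_vanishing[OF pull_cocycles[OF M N p_hom Suc.prems(1)]]) simp
  from exact_N[OF Suc.prems(1) this] obtain \<psi>
    where \<psi>: "\<psi> \<in> cocycles (susp (k + 1) (lmod P1)) (int n) t" "\<phi> + delta \<psi> \<in> coboundaries (susp k (lmod P1)) (int (Suc n)) t"
    by auto
  have S1: "Sq 1 \<in> P1" by (rule lid_self)
  \<comment> \<open>The unit is a preimage of \<open>Sq 1\<close>, and \<open>Sq 1\<close> times the
    unit lies in the submodule, so the evaluation loses one entry \<open>Sq 1\<close>.\<close>
  have "delta \<psi> (Sq1s (Suc n)) (Sq 0 \<star> Sq 1) = \<psi> (Sq1s n) (Sq 1)"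
    by (rule delta_Sq1s[OF \<psi>(1)]) (simp_all add: total_free total_lmod S1)
  moreover have "(\<phi> + delta \<psi>) (Sq1s (Suc n)) (Sq 1) = 0"
    by (rule coboundaries_Sq1s[OF \<psi>(2)]) (simp_all add: total_lmod S1 Sq_relations(5))
  ultimately have "\<psi> (Sq1s n) (Sq 1) = 0" using Suc.prems(2) by (simp add: plus_fun_apply)
  then have "\<psi> \<in> coboundaries (susp (k + 1) (lmod P1)) (int n) t" by (rule Suc.IH[OF \<psi>(1)])
  from delta_coboundaries[OF this] have "delta \<psi> \<in> coboundaries (susp k (lmod P1)) (int (Suc n)) t" by (simp add: add.commute)
  then show ?case using coboundaries_cong[OF \<psi>(2)] by simp
qed

section \<open>The module \<open>M\<^sub>7\<close> as a quotient of the ideal\<close>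

definition ideal :: "steenrod set" where "ideal = {x + y |x y. x \<in> N4 \<and> y \<in> lid (Sq 5 \<star> Sq 1)}"

lemma idealI: "x \<in> N4 \<Longrightarrow> y \<in> lid (Sq 5 \<star> Sq 1) \<Longrightarrow> x + y \<in> ideal"
  by (auto simp: ideal_def)

lemma Sq51_homogeneous: "st_homogeneous 6 (Sq 5 \<star> Sq 1)"
  using st_homogeneous_mult[OF Sq_homogeneous[of 5] Sq_homogeneous[of 1]] by simp

lemma left_ideal_ideal [simp]: "left_ideal ideal"
  unfolding ideal_def by (intro left_ideal_sum ideals left_ideal_lid[OF _ Sq51_homogeneous]) simp

lemma ideal_module_eq: "ideal_module = lmod ideal"
proof -
  have "{a \<star> Sq 4 + b \<star> (Sq 5 \<star> Sq 1) |a b. a \<in> A2 \<and> b \<in> A2} = ideal"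
    by (auto simp: ideal_def lid_def)
  then show ?thesis by (simp add: ideal_module_def lmod_def)
qed

lemma N4_ideal: "N4 \<subseteq> ideal"
proof
  fix x assume "x \<in> N4"
  then have "x + 0 \<in> ideal" by (intro idealI lid_0)
  then show "x \<in> ideal" by simp
qed

lemma idealE:
  assumes "y \<in> ideal"
  obtains a b where "a \<in> A2" "b \<in> A2" "y = a \<star> Sq 4 + b \<star> (Sq 5 \<star> Sq 1)"
  using assms by (auto simp: ideal_def lid_def)

lemma gr_lmodE:
  assumes "x \<in> gr (lmod S) n"
  obtains "x = 0" | k where "n = int k" "x \<in> S" "st_homogeneous k x"
proof (cases "x = 0")
  case False
  then obtain m where "x m \<noteq> 0" by (metis ext zero_fun_apply)
  then have "n = int (mdeg m)" using assms by (simp add: gr_lmod)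
  with assms show ?thesis using gr_lmod_homogeneous that(2) by blast
qed (use that in blast)

text \<open>As \<open>Sq 7 = Sq 1 \<star> Sq 2 \<star> Sq 4\<close>, a nonzero \<open>Sq 7\<close>
  forces the three successive operations to be nonzero; every other generator lands in a zero group.
  So the module structure is determined.\<close>

lemma M7_basis:
  assumes "is_M7 M"
  obtains e where "\<And>d. d \<in> {0, 4, 6, 7} \<Longrightarrow> gr M (int d) = {0, e d} \<and> e d \<noteq> 0"
    "\<And>n. n \<notin> {0, 4, 6, 7} \<Longrightarrow> gr M n = {0}"
    "\<And>d n. d \<in> {0, 4, 6, 7} \<Longrightarrow> n \<in> {1, 2, 4} \<Longrightarrow> act M (Sq n) (e d) = (if (n, d) \<in> set M7_tab then e (d + n) else 0)"
proof -
  interpret module M using assms by unfold_locales (simp add: is_M7_def)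
  obtain x where x: "x \<in> gr M 0" "act M (Sq 7) x \<noteq> 0" using assms by (auto simp: is_M7_def)
  have card: "card (gr M n) = 2" if "n \<in> {0, 4, 6, 7}" for n
    using assms that unfolding is_M7_def by (metis (full_types))
  have triv: "gr M n = {0}" if "n \<notin> {0, 4, 6, 7}" for n
    using assms that unfolding is_M7_def by (metis (full_types))
  define e where "e d = (if d = 0 then x else if d = 4 then act M (Sq 4) x else if d = 6 then act M (Sq 2) (act M (Sq 4) x)
      else act M (Sq 1) (act M (Sq 2) (act M (Sq 4) x)))" for d :: nat
  have xt: "x \<in> total M" using x gr_total by blast
  have Sq_gr: "act M (Sq n) y \<in> gr M (int n + k)" if "y \<in> gr M k" "n \<in> {1, 2, 4}" for n y k
    by (rule act_gr[OF _ that(1) Sq_homogeneous]) (use that in auto)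
  have e: "e d \<in> gr M (int d)" if "d \<in> {0, 4, 6, 7}" for d
    using that x(1) Sq_gr[OF x(1), of 4] Sq_gr[OF Sq_gr[OF x(1), of 4], of 2]
      Sq_gr[OF Sq_gr[OF Sq_gr[OF x(1), of 4], of 2], of 1] by (auto simp: e_def)
  have "e 7 \<noteq> 0"
    using x(2) xt by (simp add: e_def Sq_relations(1) st_mult_assoc act_act act_total)
  then have ne: "e d \<noteq> 0" if "d \<in> {0, 4, 6, 7}" for d
    using that act_0[of "Sq 1"] act_0[of "Sq 2"] act_0[of "Sq 4"] by (auto simp: e_def)
  have gr: "gr M (int d) = {0, e d}" if "d \<in> {0, 4, 6, 7}" for d
  proof (rule sym, rule card_subset_eq)
    have c: "card (gr M (int d)) = 2" using that by (intro card) auto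
    then show "finite (gr M (int d))" by (metis card.infinite zero_neq_numeral)
    show "{0, e d} \<subseteq> gr M (int d)" using e that by simp
    show "card {0, e d} = card (gr M (int d))" using c ne[OF that] by simp
  qed
  have "act M (Sq n) (e d) = (if (n, d) \<in> set M7_tab then e (d + n) else 0)" if d: "d \<in> {0, 4, 6, 7}" and n: "n \<in> {1, 2, 4}" for d n
  proof (cases "(n, d) \<in> set M7_tab")
    case True
    then show ?thesis by (auto simp: M7_tab_def e_def)
  next
    case False
    then have "int n + int d \<notin> {0, 4, 6, 7}" using d n by (auto simp: M7_tab_def)
    then show ?thesis using Sq_gr[OF e[OF d] n] triv False by simp
  qed
  with that[of e] gr ne triv show thesis by simp
qed

text \<open>The functionals \<open>fun7 d\<close> are the coordinates of the map onto
  \<open>M\<close>. Its kernel follows from the representatives in \<open>quot4\<close>, and it is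
  onto because \<open>M\<close> is generated by its bottom class.\<close>

lemma ses_M7:
  assumes M7: "is_M7 M"
  shows "\<exists>f. ses (lmod N4) (\<lambda>x. x) (lmod ideal) f (susp 6 M)"
proof -
  obtain e where grM: "\<And>d. d \<in> {0, 4, 6, 7} \<Longrightarrow> gr M (int d) = {0, e d} \<and> e d \<noteq> 0"
    and triv: "\<And>n. n \<notin> {0, 4, 6, 7} \<Longrightarrow> gr M n = {0}"
    and act: "\<And>d n. d \<in> {0, 4, 6, 7} \<Longrightarrow> n \<in> {1, 2, 4} \<Longrightarrow> act M (Sq n) (e d) = (if (n, d) \<in> set M7_tab then e (d + n) else 0)"
    using M7_basis[OF M7] by metis
  have M: "A2_module M" using M7 by (simp add: is_M7_def)
  interpret module M by unfold_locales (fact M)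
  have e: "e d \<in> gr M (int d)" "e d \<in> total M" "e d + e d = 0" if "d \<in> {0, 4, 6, 7}" for d
  proof -
    show "e d \<in> gr M (int d)" using grM[OF that] by simp
    then show "e d \<in> total M" by (rule gr_total)
    then show "e d + e d = 0" by (rule total_self)
  qed
  define f where "f y = (\<Sum>d\<in>D_I. if fun7 d y = 0 then 0 else e (d - 6))" for y
  have f4: "f y = (if fun7 6 y = 0 then 0 else e 0) + ((if fun7 10 y = 0 then 0 else e 4) +
      ((if fun7 12 y = 0 then 0 else e 6) + (if fun7 13 y = 0 then 0 else e 7)))" for y
    by (simp add: f_def)
  have fa: "f (x + y) = f x + f y" for x y
    unfolding f_def sum.distrib[symmetric] by (rule sum.cong) (auto simp: fun7_add e(3))
  have fg: "f x \<in> gr M (n - 6)" if x: "x \<in> gr (lmod ideal) n" for x n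
    using x
  proof (cases rule: gr_lmodE)
    case 1
    then show ?thesis by (simp add: f_def fun7_def)
  next
    case (2 k)
    show ?thesis
      unfolding f_def
    proof (rule gr_sum)
      fix d assume d: "d \<in> D_I"
      then have "fun7 d x \<noteq> 0 \<Longrightarrow> n - 6 = int (d - 6)" using fun7_degree[OF d _ 2(3)] 2(1) by auto
      moreover have "e (d - 6) \<in> gr M (int (d - 6))" using d by (intro e(1)) auto
      ultimately show "(if fun7 d x = 0 then 0 else e (d - 6)) \<in> gr M (n - 6)" by auto
    qed
  qed
  have gadd: "gadd (lmod ideal) (susp 6 M) f" using fa fg by (auto simp: gadd_def)
  have hom: "A2_hom (lmod ideal) (susp 6 M) f"
  proof (rule A2_homI[OF module_lmod module_susp[OF M] gadd])
    fix n x assume n: "n \<in> {1, 2, 4 :: nat}" and "x \<in> total (lmod ideal)"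
    then have "x \<in> ideal" by simp
    then obtain a b where x: "a \<in> A2" "b \<in> A2" "x = a \<star> Sq 4 + b \<star> (Sq 5 \<star> Sq 1)" by (rule idealE)
    have S: "Sq n \<in> A2" using n by auto
    note F = fun7_Sq[OF _ n x(1,2), folded x(3)]
    note A = act[OF _ n]
    have t: "(if P then 0 else e d) \<in> total M" if "d \<in> {0, 4, 6, 7}" for P d using e(2)[OF that] by simp
    have "act M (Sq n) (f x) = act M (Sq n) (if fun7 6 x = 0 then 0 else e 0) + (act M (Sq n) (if fun7 10 x = 0 then 0 else e 4) +
        (act M (Sq n) (if fun7 12 x = 0 then 0 else e 6) + act M (Sq n) (if fun7 13 x = 0 then 0 else e 7)))"
      unfolding f4 by (subst act_add[OF S]; (intro total_add t)?; simp add: act_add[OF S] total_add t)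
    also have "\<dots> = (if fun7 6 x = 0 then 0 else act M (Sq n) (e 0)) + ((if fun7 10 x = 0 then 0 else act M (Sq n) (e 4)) +
        ((if fun7 12 x = 0 then 0 else act M (Sq n) (e 6)) + (if fun7 13 x = 0 then 0 else act M (Sq n) (e 7))))"
      using act_0[OF S] by simp
    also have "\<dots> = f (Sq n \<star> x)"
      unfolding f4 using n A[of 0] A[of 4] A[of 6] A[of 7] F[of 6] F[of 10] F[of 12] F[of 13]
      by (elim insertE emptyE; hypsubst; simp add: M7_tab_def)
    finally have "f (Sq n \<star> x) = act M (Sq n) (f x)" by simp
    then show "f (act (lmod ideal) (Sq n) x) = act (susp 6 M) (Sq n) (f x)" by simp
  qed simp
  have ker: "x \<in> N4 \<longleftrightarrow> x \<in> ideal \<and> f x = 0" for x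
  proof
    assume "x \<in> N4"
    then obtain a where "x = a \<star> Sq 4" "a \<in> A2" by (auto simp: lid_def)
    then have "f x = 0" unfolding f_def by (intro sum.neutral ballI) (simp add: fun7_Sq4)
    then show "x \<in> ideal \<and> f x = 0" using \<open>x \<in> N4\<close> N4_ideal by blast
  next
    assume x: "x \<in> ideal \<and> f x = 0"
    then obtain a b where ab: "a \<in> A2" "b \<in> A2" "x = a \<star> Sq 4 + b \<star> (Sq 5 \<star> Sq 1)" using idealE by blast
    have z: "(if fun7 d x = 0 then 0 else e (d - 6)) = 0" if d: "d \<in> D_I" for d
    proof -
      \<comment> \<open>Indexed by degrees of \<open>M\<close>, the four summands lie in different
        groups \<open>gr M n\<close>, so each of them vanishes.\<close>
      let ?g = "\<lambda>n :: int. if fun7 (nat n) x = 0 then 0 else e (nat n - 6)"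
      have "(\<Sum>n\<in>(\<lambda>n. n - 6) ` int ` D_I. ?g (n + 6)) = f x"
        by (simp add: f_def)
      then have "(\<Sum>n\<in>(\<lambda>n. n - 6) ` int ` D_I. ?g (n + 6)) = 0" using x by simp
      moreover have "?g (n + 6) \<in> gr M n" if "n \<in> (\<lambda>n. n - 6) ` int ` D_I" for n
        using that e(1)[of 0] e(1)[of 4] e(1)[of 6] e(1)[of 7] by auto
      ultimately have "?g (int d - 6 + 6) = 0"
        using independent[of "(\<lambda>n. n - 6) ` int ` D_I" "\<lambda>n. ?g (n + 6)" "int d - 6"] d by blast
      moreover have "nat (int d - 6 + 6) = d" by simp
      ultimately show ?thesis by (simp only:)
    qed
    have "fun7 d (b \<star> (Sq 5 \<star> Sq 1)) = 0" if d: "d \<in> D_I" for d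
    proof -
      have "e (d - 6) \<noteq> 0" using grM[of "d - 6"] d by auto
      then have "fun7 d x = 0" using z[OF d] by (metis (full_types))
      then show ?thesis using fun7_Sq4[OF d ab(1)] by (simp add: ab(3) fun7_add)
    qed
    then have "(\<Sum>d\<in>D_I. if fun7 d (b \<star> (Sq 5 \<star> Sq 1)) = 0 then 0 else kel (d - 6)) = 0" by (intro sum.neutral) auto
    then obtain u where u: "u \<in> A2" "b \<star> (Sq 5 \<star> Sq 1) = u \<star> Sq 4" using quot4[OF ab(2)] by auto
    have "x = (a + u) \<star> Sq 4" by (simp add: ab(3) u(2) st_mult_add_left)
    then show "x \<in> N4" using ab(1) u(1) lidI A2_add by metis
  qed
  have kI: "kel 0 \<in> ideal"
  proof -
    have "0 + Sq 5 \<star> Sq 1 \<in> ideal" by (intro idealI lid_0 lid_self)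
    then show ?thesis by (simp add: Sq51_kel)
  qed
  have f0: "f (kel 0) = e 0"
  proof -
    have "fun7 d (kel 0) = 0" if "d \<in> D_I" "d \<noteq> 6" for d
      using fun7_degree[OF that(1), of "kel 0" 6] that(2) Sq51_homogeneous unfolding Sq51_kel by blast
    then show ?thesis using fun7_bot by (simp add: f4 Sq51_kel)
  qed
  have surj: "f ` ideal = total M"
  proof (intro equalityI subsetI)
    fix y assume "y \<in> f ` ideal"
    then show "y \<in> total M" using gadd_total[OF module_lmod module_susp[OF M] gadd] by auto
  next
    have cl: "act M a y \<in> f ` ideal" if ay: "a \<in> A2" "y \<in> f ` ideal" for a y
    proof -
      obtain x where x: "x \<in> ideal" "y = f x" using ay by blast
      have "f (a \<star> x) = act M a y" using hom x ay(1) by (simp add: A2_hom_def)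
      moreover have "a \<star> x \<in> ideal" using left_ideal_ideal x(1) ay(1) unfolding left_ideal_def by blast
      ultimately show ?thesis by (metis imageI)
    qed
    have E0: "e 0 \<in> f ` ideal" using f0 kI by (metis imageI)
    have E4: "e 4 \<in> f ` ideal" using cl[OF _ E0, of "Sq 4"] act[of 0 4] by (simp add: M7_tab_def)
    have E6: "e 6 \<in> f ` ideal" using cl[OF _ E4, of "Sq 2"] act[of 4 2] by (simp add: M7_tab_def)
    have E7: "e 7 \<in> f ` ideal" using cl[OF _ E6, of "Sq 1"] act[of 6 1] by (simp add: M7_tab_def)
    fix y assume "y \<in> total M"
    then show "y \<in> f ` ideal"
    proof (induction rule: total_induct)
      case (gr n x)
      have Z: "0 \<in> f ` ideal"
      proof
        show "0 = f 0" by (simp add: f_def fun7_def)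
        show "0 \<in> ideal" using left_ideal_ideal by (simp add: left_ideal_def)
      qed
      show ?case
      proof (cases "n \<in> {0, 4, 6, 7}")
        case True
        define d where "d = nat n"
        have d: "n = int d" "d \<in> {0, 4, 6, 7}" using True by (auto simp: d_def)
        have "e d \<in> f ` ideal" using d(2) E0 E4 E6 E7 by blast
        moreover have "x = 0 \<or> x = e d" using gr grM[OF d(2)] by (simp add: d(1))
        ultimately show ?thesis using Z by metis
      next
        case False
        then have "x = 0" using triv gr by blast
        then show ?thesis using Z by simp
      qed
    next
      case (add x y)
      then obtain u v where uv: "u \<in> ideal" "v \<in> ideal" "x = f u" "y = f v" by blast
      then have "u + v \<in> ideal" using left_ideal_ideal unfolding left_ideal_def by blast
      then show ?case using uv fa by (metis imageI)
    qed
  qed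
  have "ses (lmod N4) (\<lambda>x. x) (lmod ideal) f (susp 6 M)"
  proof
    show "A2_module (lmod N4)" "A2_module (lmod ideal)" "A2_module (susp 6 M)"
      by (intro module_lmod module_susp M; simp)+
    show "finite (gr (lmod ideal) n)" for n by (simp add: finite_gr_lmod)
    have "A2_hom (lmod N4) (lmod ideal) (\<lambda>x. x)"
      using lmod_incl_hom[of N4 ideal 0] N4_ideal by (simp add: susp_0)
    then show "short_exact (lmod N4) (\<lambda>x. x) (lmod ideal) f (susp 6 M)"
      unfolding short_exact_def using hom ker surj by auto
  qed
  then show ?thesis by blast
qed

section \<open>The cohomology of \<open>bo\<^sub>2\<close>\<close>

text \<open>The monomials of weight at most 8: in units of 4, \<open>zeta 1 ^ 4\<close>,
  \<open>zeta 2 ^ 2\<close> and \<open>zeta 3\<close> have weight 1 and \<open>zeta 4\<close> has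
  weight 2. Their eleven degrees are distinct, so the degree serves as index; the last branch is
  meant for 15.\<close>

definition zb :: "nat \<Rightarrow> dual_steenrod" where
  "zb d = (if d = 0 then 1 else if d = 4 then zeta 1 ^ 4 else if d = 6 then zeta 2 ^ 2 else if d = 7 then zeta 3
     else if d = 8 then zeta 1 ^ 8 else if d = 10 then zeta 1 ^ 4 * zeta 2 ^ 2 else if d = 11 then zeta 1 ^ 4 * zeta 3
     else if d = 12 then zeta 2 ^ 4 else if d = 13 then zeta 2 ^ 2 * zeta 3 else if d = 14 then zeta 3 ^ 2 else zeta 4)"

definition D_bo :: "nat set" where "D_bo = {0, 4, 6, 7, 8, 10, 11, 12, 13, 14, 15}"

definition zmono :: "mono \<Rightarrow> dual_steenrod" where
  "zmono e = (\<Prod>i\<in>Poly_Mapping.keys e. zeta (i + 1) ^ Poly_Mapping.lookup e i)"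

lemma zmono_superset:
  assumes "finite K" "Poly_Mapping.keys e \<subseteq> K"
  shows "zmono e = (\<Prod>i\<in>K. zeta (i + 1) ^ Poly_Mapping.lookup e i)"
  unfolding zmono_def by (rule prod.mono_neutral_left) (use assms in \<open>auto simp: in_keys_iff\<close>)

lemma zmono4: "(\<And>i. i \<ge> 4 \<Longrightarrow> Poly_Mapping.lookup e i = 0) \<Longrightarrow> zmono e =
    zeta 1 ^ Poly_Mapping.lookup e 0 * (zeta 2 ^ Poly_Mapping.lookup e 1 * (zeta 3 ^ Poly_Mapping.lookup e 2 * zeta 4 ^ Poly_Mapping.lookup e 3))"
proof -
  assume *: "\<And>i. i \<ge> 4 \<Longrightarrow> Poly_Mapping.lookup e i = 0"
  have "Poly_Mapping.keys e \<subseteq> {0, 1, 2, 3}"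
  proof
    fix i assume "i \<in> Poly_Mapping.keys e"
    then have "\<not> i \<ge> 4" using * by (auto simp: in_keys_iff)
    then show "i \<in> {0, 1, 2, 3}" by auto
  qed
  from zmono_superset[OF _ this] show ?thesis by (simp add: mult.assoc)
qed

definition small :: "mono \<Rightarrow> bool" where
  "small e \<longleftrightarrow> 4 dvd Poly_Mapping.lookup e 0 \<and> 2 dvd Poly_Mapping.lookup e 1 \<and>
        (\<Sum>i\<in>Poly_Mapping.keys e. Poly_Mapping.lookup e i * 2 ^ i) \<le> 8"

lemma zb_mono: "{zmono e |e. small e} = zb ` D_bo"
proof (intro equalityI subsetI)
  fix x assume "x \<in> {zmono e |e. small e}"
  then obtain e where e: "x = zmono e" "small e" by blast
  let ?l = "Poly_Mapping.lookup e"
  let ?K = "Poly_Mapping.keys e \<union> {0, 1, 2, 3}"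
  have w: "(\<Sum>i\<in>?K. ?l i * 2 ^ i) \<le> 8"
  proof -
    have "(\<Sum>i\<in>Poly_Mapping.keys e. ?l i * 2 ^ i) = (\<Sum>i\<in>?K. ?l i * 2 ^ i)"
      by (rule sum.mono_neutral_left) (auto simp: in_keys_iff)
    then show ?thesis using e(2) by (simp only: small_def)
  qed
  have hi: "?l i = 0" if "i \<ge> 4" for i
  proof (rule ccontr)
    assume nz: "?l i \<noteq> 0"
    have "(2::nat) ^ 4 \<le> 2 ^ i" by (rule power_increasing) (use that in auto)
    also have "1 * 2 ^ i \<le> ?l i * 2 ^ i" by (rule mult_right_mono) (use nz in auto)
    then have "2 ^ i \<le> ?l i * 2 ^ i" by (simp only: mult_1_left)
    also have "?l i * 2 ^ i \<le> (\<Sum>i\<in>?K. ?l i * 2 ^ i)"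
      by (rule member_le_sum) (use nz in \<open>auto simp: in_keys_iff\<close>)
    also note w
    finally show False by simp
  qed
  have "(\<Sum>i\<in>{0, 1, 2, 3}. ?l i * 2 ^ i) \<le> (\<Sum>i\<in>?K. ?l i * 2 ^ i)" by (intro sum_mono2) auto
  then have w4: "?l 0 + 2 * ?l 1 + 4 * ?l 2 + 8 * ?l 3 \<le> 8" using w by simp
  obtain a b where ab: "?l 0 = 4 * a" "?l 1 = 2 * b" using e(2) by (auto simp: small_def elim!: dvdE)
  define c d where "c = ?l 2" and "d = ?l 3"
  have x: "x = zeta 1 ^ (4 * a) * (zeta 2 ^ (2 * b) * (zeta 3 ^ c * zeta 4 ^ d))"
    using zmono4[OF hi] by (simp add: e ab c_def d_def)
  \<comment> \<open>The weight bound divided by 4.\<close>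
  have "a + b + c + 2 * d \<le> 2" using w4 by (simp add: ab c_def d_def)
  then consider "d = 1" "a = 0" "b = 0" "c = 0" | "d = 0" "a + b + c \<le> 2" by linarith
  then have "\<exists>k\<in>D_bo. x = zb k"
  proof cases
    case 1 then show ?thesis by (intro bexI[of _ 15]) (simp_all add: x zb_def D_bo_def)
  next
    case 2
    have "a = 0 \<or> a = 1 \<or> a = 2" "b = 0 \<or> b = 1 \<or> b = 2" "c = 0 \<or> c = 1 \<or> c = 2" using 2 by linarith+
    then consider "a = 0" "b = 0" "c = 0" | "a = 1" "b = 0" "c = 0" | "a = 0" "b = 1" "c = 0" | "a = 0" "b = 0" "c = 1"
      | "a = 2" "b = 0" "c = 0" | "a = 1" "b = 1" "c = 0" | "a = 1" "b = 0" "c = 1" | "a = 0" "b = 2" "c = 0"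
      | "a = 0" "b = 1" "c = 1" | "a = 0" "b = 0" "c = 2" using 2 by (elim disjE) simp_all
    then show ?thesis
    proof cases
      case 1 then show ?thesis using 2 by (intro bexI[of _ 0]) (simp_all add: x zb_def D_bo_def)
    next
      case 2 then show ?thesis using \<open>d = 0\<close> by (intro bexI[of _ 4]) (simp_all add: x zb_def D_bo_def)
    next
      case 3 then show ?thesis using \<open>d = 0\<close> by (intro bexI[of _ 6]) (simp_all add: x zb_def D_bo_def)
    next
      case 4 then show ?thesis using \<open>d = 0\<close> by (intro bexI[of _ 7]) (simp_all add: x zb_def D_bo_def)
    next
      case 5 then show ?thesis using \<open>d = 0\<close> by (intro bexI[of _ 8]) (simp_all add: x zb_def D_bo_def)
    next
      case 6 then show ?thesis using \<open>d = 0\<close> by (intro bexI[of _ 10]) (simp_all add: x zb_def D_bo_def)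
    next
      case 7 then show ?thesis using \<open>d = 0\<close> by (intro bexI[of _ 11]) (simp_all add: x zb_def D_bo_def)
    next
      case 8 then show ?thesis using \<open>d = 0\<close> by (intro bexI[of _ 12]) (simp_all add: x zb_def D_bo_def)
    next
      case 9 then show ?thesis using \<open>d = 0\<close> by (intro bexI[of _ 13]) (simp_all add: x zb_def D_bo_def)
    next
      case 10 then show ?thesis using \<open>d = 0\<close> by (intro bexI[of _ 14]) (simp_all add: x zb_def D_bo_def)
    qed
  qed
  then show "x \<in> zb ` D_bo" by blast
next
  fix x assume "x \<in> zb ` D_bo"
  then obtain k where k: "k \<in> D_bo" "x = zb k" by blast
  have *: "\<exists>e. small e \<and> zmono e = zeta 1 ^ a * (zeta 2 ^ b * (zeta 3 ^ c * zeta 4 ^ d))"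
    if abcd: "4 dvd a" "2 dvd b" "a + 2 * b + 4 * c + 8 * d \<le> 8" for a b c d
  proof -
    define e where "e = xi_mono 1 a + xi_mono 2 b + xi_mono 3 c + xi_mono 4 d"
    have l: "Poly_Mapping.lookup e i = (if i = 0 then a else if i = 1 then b else if i = 2 then c else if i = 3 then d else 0)" for i
      by (auto simp: e_def lookup_add xi_mono_def lookup_single when_def)
    have "(\<Sum>i\<in>Poly_Mapping.keys e. Poly_Mapping.lookup e i * 2 ^ i) \<le> (\<Sum>i\<in>{0, 1, 2, 3}. Poly_Mapping.lookup e i * 2 ^ i)"
      by (intro sum_mono2) (auto simp: in_keys_iff l split: if_splits)
    then have "small e" using abcd by (simp add: small_def l)
    moreover have "zmono e = zeta 1 ^ a * (zeta 2 ^ b * (zeta 3 ^ c * zeta 4 ^ d))"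
      by (subst zmono4) (simp_all add: l)
    ultimately show ?thesis by blast
  qed
  from k(1) have "\<exists>a b c d. 4 dvd a \<and> 2 dvd b \<and> a + 2 * b + 4 * c + 8 * d \<le> 8 \<and> x = zeta 1 ^ a * (zeta 2 ^ b * (zeta 3 ^ c * zeta 4 ^ d))"
    unfolding D_bo_def k(2)
    apply (elim insertE emptyE; hypsubst)
              apply (rule exI[of _ 0], rule exI[of _ 0], rule exI[of _ 0], rule exI[of _ 0], simp add: zb_def)
             apply (rule exI[of _ 4], rule exI[of _ 0], rule exI[of _ 0], rule exI[of _ 0], simp add: zb_def)
            apply (rule exI[of _ 0], rule exI[of _ 2], rule exI[of _ 0], rule exI[of _ 0], simp add: zb_def)
           apply (rule exI[of _ 0], rule exI[of _ 0], rule exI[of _ 1], rule exI[of _ 0], simp add: zb_def)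
          apply (rule exI[of _ 8], rule exI[of _ 0], rule exI[of _ 0], rule exI[of _ 0], simp add: zb_def)
         apply (rule exI[of _ 4], rule exI[of _ 2], rule exI[of _ 0], rule exI[of _ 0], simp add: zb_def)
        apply (rule exI[of _ 4], rule exI[of _ 0], rule exI[of _ 1], rule exI[of _ 0], simp add: zb_def)
       apply (rule exI[of _ 0], rule exI[of _ 4], rule exI[of _ 0], rule exI[of _ 0], simp add: zb_def)
      apply (rule exI[of _ 0], rule exI[of _ 2], rule exI[of _ 1], rule exI[of _ 0], simp add: zb_def)
     apply (rule exI[of _ 0], rule exI[of _ 0], rule exI[of _ 2], rule exI[of _ 0], simp add: zb_def)
    apply (rule exI[of _ 0], rule exI[of _ 0], rule exI[of _ 0], rule exI[of _ 1], simp add: zb_def)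
    done
  then obtain a b c d where abcd: "4 dvd a" "2 dvd b" "a + 2 * b + 4 * c + 8 * d \<le> 8"
      "x = zeta 1 ^ a * (zeta 2 ^ b * (zeta 3 ^ c * zeta 4 ^ d))" by (elim exE conjE)
  obtain e where e: "small e" "zmono e = zeta 1 ^ a * (zeta 2 ^ b * (zeta 3 ^ c * zeta 4 ^ d))"
    using *[OF abcd(1-3)] by (elim exE conjE)
  show "x \<in> {zmono e |e. small e}"
    by (rule CollectI, rule exI[of _ e]) (simp only: abcd(4) e simp_thms)
qed

lemma H_bo2_eq: "H_bo2 = {\<Sum>x\<in>S. x |S. S \<subseteq> zb ` D_bo}"
proof -
  have "finite (zb ` D_bo)" by (simp add: D_bo_def)
  then have "finite S" if "S \<subseteq> zb ` D_bo" for S using that finite_subset by blast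
  then have "finite S \<and> S \<subseteq> zb ` D_bo \<longleftrightarrow> S \<subseteq> zb ` D_bo" for S by metis
  then show ?thesis
    unfolding H_bo2_def zb_mono[symmetric] zmono_def small_def by (simp only:)
qed

lemma H_bo2I: "S \<subseteq> zb ` D_bo \<Longrightarrow> (\<Sum>y\<in>S. y) \<in> H_bo2"
  unfolding H_bo2_eq by (rule CollectI, rule exI, rule conjI[OF refl])

lemma H_bo2E:
  assumes "x \<in> H_bo2"
  obtains S where "x = (\<Sum>y\<in>S. y)" "S \<subseteq> zb ` D_bo"
  using assms unfolding H_bo2_eq by (elim CollectE exE conjE)

lemma finite_zb: "S \<subseteq> zb ` D_bo \<Longrightarrow> finite S"
  by (erule finite_subset) (simp add: D_bo_def)

lemma H_bo2_0 [simp]: "0 \<in> H_bo2"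
  using H_bo2I[of "{}"] by simp

lemma H_bo2_induct [consumes 1, case_names zero add]:
  assumes "x \<in> H_bo2" "P 0" "\<And>d x. d \<in> D_bo \<Longrightarrow> x \<in> H_bo2 \<Longrightarrow> P x \<Longrightarrow> P (zb d + x)"
  shows "P x"
proof -
  obtain S where S: "x = (\<Sum>y\<in>S. y)" "S \<subseteq> zb ` D_bo" using assms(1) by (rule H_bo2E)
  have "finite S" by (rule finite_zb[OF S(2)])
  then have "P (\<Sum>y\<in>S. y) \<and> (\<Sum>y\<in>S. y) \<in> H_bo2" using S(2)
  proof (induction S rule: finite_induct)
    case (insert y S)
    then obtain d where d: "d \<in> D_bo" "y = zb d" by auto
    have "(\<Sum>y\<in>insert y S. y) \<in> H_bo2" by (rule H_bo2I[OF insert.prems])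
    with insert d show ?case using assms(3)[OF d(1), of "\<Sum>y\<in>S. y"] by auto
  qed (simp add: assms(2))
  then show ?thesis by (simp add: S(1))
qed

text \<open>Elements are sums over sets, so adding a basis element that is already present removes
  it.\<close>

lemma zb_add_H_bo2: "d \<in> D_bo \<Longrightarrow> x \<in> H_bo2 \<Longrightarrow> zb d + x \<in> H_bo2"
proof -
  assume d: "d \<in> D_bo" and x: "x \<in> H_bo2"
  obtain S where S: "x = (\<Sum>y\<in>S. y)" "S \<subseteq> zb ` D_bo" using x by (rule H_bo2E)
  have fin: "finite S" by (rule finite_zb[OF S(2)])
  show ?thesis
  proof (cases "zb d \<in> S")
    case True
    then have "zb d + x = (\<Sum>y\<in>S - {zb d}. y)"
      using sum.remove[OF fin True, of "\<lambda>y. y"] by (simp add: S(1) flip: add.assoc)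
    moreover have "S - {zb d} \<subseteq> zb ` D_bo" using S(2) by blast
    ultimately show ?thesis using H_bo2I by simp
  next
    case False
    then have "zb d + x = (\<Sum>y\<in>insert (zb d) S. y)" using fin by (simp add: S(1))
    moreover have "insert (zb d) S \<subseteq> zb ` D_bo" using S(2) d by blast
    ultimately show ?thesis using H_bo2I by metis
  qed
qed

lemma H_bo2_add: "x \<in> H_bo2 \<Longrightarrow> y \<in> H_bo2 \<Longrightarrow> x + y \<in> H_bo2"
  by (induction rule: H_bo2_induct) (simp_all add: zb_add_H_bo2 add.assoc)

lemma zb_H_bo2: "d \<in> D_bo \<Longrightarrow> zb d \<in> H_bo2"
  using zb_add_H_bo2[of d 0] by simp

lemma zeta_rec: "zeta 1 = xi 1" "zeta 2 = xi 2 + xi 1 ^ 2 * zeta 1" "zeta 3 = xi 3 + xi 2 ^ 2 * zeta 1 + xi 1 ^ 4 * zeta 2"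
  "zeta 4 = xi 4 + xi 3 ^ 2 * zeta 1 + xi 2 ^ 4 * zeta 2 + xi 1 ^ 8 * zeta 3"
proof -
  have z: "zeta (Suc n) = (\<Sum>i\<le>n. xi (Suc n - i) ^ (2 ^ i) * zeta i)" for n by simp
  show "zeta 1 = xi 1" using z[of 0] by (simp add: One_nat_def)
  show "zeta 2 = xi 2 + xi 1 ^ 2 * zeta 1" using z[of 1] by (simp add: numeral_2_eq_2 One_nat_def)
  show "zeta 3 = xi 3 + xi 2 ^ 2 * zeta 1 + xi 1 ^ 4 * zeta 2" using z[of 2] by (simp add: numeral_eq_Suc One_nat_def)
  show "zeta 4 = xi 4 + xi 3 ^ 2 * zeta 1 + xi 2 ^ 4 * zeta 2 + xi 1 ^ 8 * zeta 3" using z[of 3] by (simp add: numeral_eq_Suc One_nat_def)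
qed

text \<open>\<open>total_cap\<close> is the ring homomorphism \<open>x \<mapsto> \<Sum> t\<^sup>n \<otimes> cap (Sq n) x\<close>, and \<open>const_t\<close> embeds the dual as
  the constant terms.\<close>

definition total_cap :: "dual_steenrod \<Rightarrow> (nat \<times> mono) \<Rightarrow>\<^sub>0 bit" where "total_cap x = lmap (psi x)"
definition const_t :: "dual_steenrod \<Rightarrow> (nat \<times> mono) \<Rightarrow>\<^sub>0 bit" where "const_t = lin_ext (\<lambda>m. monom1 (0, m))"
definition tt :: "(nat \<times> mono) \<Rightarrow>\<^sub>0 bit" where "tt = monom1 (1, 0)"
definition t_part :: "nat \<Rightarrow> ((nat \<times> mono) \<Rightarrow>\<^sub>0 bit) \<Rightarrow> dual_steenrod" where
  "t_part n = lin_ext (\<lambda>(k, q). if k = n then monom1 q else 0)"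

lemma cap_eq: "cap (Sq n) x = t_part n (total_cap x)"
proof -
  have "cap (Sq n) x = lin_ext (\<lambda>(p, q). Poly_Mapping.single q (Sq n p)) (psi x)"
    by (simp add: cap_def lin_ext_def)
  also have "\<dots> = t_part n (total_cap x)"
    unfolding t_part_def total_cap_def lmap_def lin_ext_comp[OF char2_self]
    by (rule lin_ext_cong) (auto simp: Sq_eq)
  finally show ?thesis .
qed

lemma psi_add: "psi (x + y) = psi x + psi y" and psi_mult: "psi (x * y) = psi x * psi y"
  by (simp_all add: psi_eq lin_ext_add lin_ext_mult psi_mono_add)

lemma total_cap_add: "total_cap (x + y) = total_cap x + total_cap y"
  by (simp add: total_cap_def psi_add lmap_def lin_ext_add)
lemma total_cap_mult: "total_cap (x * y) = total_cap x * total_cap y"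
  by (simp add: total_cap_def psi_mult lmap_mult)
lemma total_cap_1: "total_cap 1 = 1"
  using lin_ext_monom1[of psi_mono 0] by (simp add: total_cap_def psi_eq)
lemma total_cap_power: "total_cap (x ^ n) = total_cap x ^ n"
  by (induction n) (simp_all add: total_cap_mult total_cap_1)
lemma const_t_add: "const_t (x + y) = const_t x + const_t y"
  by (simp add: const_t_def lin_ext_add)
lemma const_t_mult: "const_t (x * y) = const_t x * const_t y"
  unfolding const_t_def by (rule lin_ext_mult) (simp_all add: mult_single)
lemma const_t_1: "const_t 1 = 1"
  using lin_ext_monom1[of "\<lambda>m. monom1 (0 :: nat, m)" "0 :: mono"] by (simp add: const_t_def zero_prod_def[symmetric])
lemma const_t_power: "const_t (x ^ n) = const_t x ^ n"
  by (induction n) (simp_all add: const_t_mult const_t_1)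

lemma total_cap_xi: "n > 0 \<Longrightarrow> total_cap (xi n) = const_t (xi n) + tt ^ (2 ^ (n - 1)) * const_t (xi (n - 1))"
proof -
  assume n: "n > 0"
  have "tt ^ k = monom1 (k, 0)" for k
    unfolding tt_def by (simp only: monom1_power sum_pair) simp
  then show ?thesis
    using lmap_psi_xi[OF n] psi_mono_xi_mono[of n 1]
    by (simp add: total_cap_def psi_eq xi_def const_t_def mult_single)
qed

lemma xi_0: "xi 0 = 1" by (simp add: xi_def)

lemma frob: "((x :: 'a::comm_monoid_add \<Rightarrow>\<^sub>0 bit) + y) ^ 2 = x ^ 2 + y ^ 2" "(x + y) ^ 4 = x ^ 4 + y ^ 4" "(x + y) ^ 8 = x ^ 8 + y ^ 8"
  using frobenius_add[of x y 1] frobenius_add[of x y 2] frobenius_add[of x y 3] by simp_all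

lemma char2_cancel: "(x :: 'a \<Rightarrow>\<^sub>0 bit) + (x + y) = y"
  by (simp flip: add.assoc)

lemma unroll:
  fixes x :: "'a::comm_monoid_add \<Rightarrow>\<^sub>0 bit"
  shows "x ^ 2 = x * x" "x ^ 3 = x * (x * x)" "x ^ 4 = x * (x * (x * x))" "x ^ 5 = x * (x * (x * (x * x)))"
    "x ^ 6 = x * (x * (x * (x * (x * x))))" "x ^ 7 = x * (x * (x * (x * (x * (x * x)))))" "x ^ 8 = x * (x * (x * (x * (x * (x * (x * x))))))"
proof -
  show 2: "x ^ 2 = x * x" by (rule power2_eq_square)
  have S: "x ^ Suc n = x * x ^ n" for n by (rule power_Suc)
  show 3: "x ^ 3 = x * (x * x)" using S[of 2] 2 by simp
  show 4: "x ^ 4 = x * (x * (x * x))" using S[of 3] 3 by simp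
  show 5: "x ^ 5 = x * (x * (x * (x * x)))" using S[of 4] 4 by simp
  show 6: "x ^ 6 = x * (x * (x * (x * (x * x))))" using S[of 5] 5 by simp
  show 7: "x ^ 7 = x * (x * (x * (x * (x * (x * x)))))" using S[of 6] 6 by simp
  show "x ^ 8 = x * (x * (x * (x * (x * (x * (x * x))))))" using S[of 7] 7 by simp
qed

lemma unroll':
  fixes x :: "'a::comm_monoid_add \<Rightarrow>\<^sub>0 bit"
  shows "x ^ 10 = x ^ 8 * x ^ 2" "x ^ 11 = x ^ 8 * x ^ 3" "x ^ 12 = x ^ 8 * x ^ 4" "x ^ 13 = x ^ 8 * x ^ 5" "x ^ 14 = x ^ 8 * x ^ 6" "x ^ 15 = x ^ 8 * x ^ 7"
  by (simp_all flip: power_add)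

lemmas char2_norm = unroll unroll' distrib_left distrib_right mult_ac add_ac char2_cancel char2_self add_0_left add_0_right mult_1_left mult_1_right

text \<open>The coproduct formula for the conjugates as polynomial identities over the field with
  two elements; with arbitrary elements in place of the \<open>xi n\<close> and \<open>tt\<close>
  they are settled by expanding and cancelling equal monomials.\<close>

lemma zeta_ring_identity:
  fixes a b c d t :: "'a::comm_monoid_add \<Rightarrow>\<^sub>0 bit"
  defines "z2 \<equiv> b + a ^ 2 * a"
  defines "z3 \<equiv> c + b ^ 2 * a + a ^ 4 * z2"
  defines "z4 \<equiv> d + c ^ 2 * a + b ^ 4 * z2 + a ^ 8 * z3"
  shows "(b + t ^ 2 * a) + (a + t) ^ 2 * (a + t) = z2 + t * a ^ 2 + t ^ 3"
    "(c + t ^ 4 * b) + (b + t ^ 2 * a) ^ 2 * (a + t) + (a + t) ^ 4 * (z2 + t * a ^ 2 + t ^ 3) =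
      z3 + t * z2 ^ 2 + t ^ 3 * a ^ 4 + t ^ 7"
    "(d + t ^ 8 * c) + (c + t ^ 4 * b) ^ 2 * (a + t) + (b + t ^ 2 * a) ^ 4 * (z2 + t * a ^ 2 + t ^ 3) +
      (a + t) ^ 8 * (z3 + t * z2 ^ 2 + t ^ 3 * a ^ 4 + t ^ 7) =
      z4 + t * z3 ^ 2 + t ^ 3 * z2 ^ 4 + t ^ 7 * a ^ 8 + t ^ 15"
proof -
  show "(b + t ^ 2 * a) + (a + t) ^ 2 * (a + t) = z2 + t * a ^ 2 + t ^ 3"
    by (simp only: z2_def frob power_mult_distrib) (simp only: char2_norm)
  show "(c + t ^ 4 * b) + (b + t ^ 2 * a) ^ 2 * (a + t) + (a + t) ^ 4 * (z2 + t * a ^ 2 + t ^ 3) =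
      z3 + t * z2 ^ 2 + t ^ 3 * a ^ 4 + t ^ 7"
    by (simp only: z3_def z2_def frob power_mult_distrib) (simp only: char2_norm)
  show "(d + t ^ 8 * c) + (c + t ^ 4 * b) ^ 2 * (a + t) + (b + t ^ 2 * a) ^ 4 * (z2 + t * a ^ 2 + t ^ 3) +
      (a + t) ^ 8 * (z3 + t * z2 ^ 2 + t ^ 3 * a ^ 4 + t ^ 7) =
      z4 + t * z3 ^ 2 + t ^ 3 * z2 ^ 4 + t ^ 7 * a ^ 8 + t ^ 15"
    by (simp only: z4_def z3_def z2_def frob power_mult_distrib) (simp only: char2_norm)
qed

text \<open>The coproduct of \<open>zeta n\<close> is the sum of the
  \<open>zeta i \<otimes> zeta (n - i) ^ (2 ^ i)\<close>, and modulo \<open>xi 2\<close>,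
  \<open>xi 3\<close>, ... the first factor is the power of \<open>xi 1\<close> with exponent
  \<open>2 ^ i - 1\<close>; hence the powers 1, 3, 7, 15 of \<open>tt\<close>.\<close>

lemma total_cap_zeta:
  "total_cap (zeta 1) = const_t (zeta 1) + tt"
  "total_cap (zeta 2) = const_t (zeta 2) + tt * const_t (zeta 1) ^ 2 + tt ^ 3"
  "total_cap (zeta 3) = const_t (zeta 3) + tt * const_t (zeta 2) ^ 2 + tt ^ 3 * const_t (zeta 1) ^ 4 + tt ^ 7"
  "total_cap (zeta 4) = const_t (zeta 4) + tt * const_t (zeta 3) ^ 2 + tt ^ 3 * const_t (zeta 2) ^ 4 + tt ^ 7 * const_t (zeta 1) ^ 8 + tt ^ 15"
proof -
  have xi: "total_cap (xi 1) = const_t (xi 1) + tt" "total_cap (xi 2) = const_t (xi 2) + tt ^ 2 * const_t (xi 1)"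
    "total_cap (xi 3) = const_t (xi 3) + tt ^ 4 * const_t (xi 2)" "total_cap (xi 4) = const_t (xi 4) + tt ^ 8 * const_t (xi 3)"
    using total_cap_xi[of 1] total_cap_xi[of 2] total_cap_xi[of 3] total_cap_xi[of 4]
    by (simp_all add: xi_0 const_t_1 flip: One_nat_def)
  note hom = total_cap_add total_cap_mult total_cap_power const_t_add const_t_mult const_t_power
  have z: "const_t (zeta 1) = const_t (xi 1)"
    "const_t (zeta 2) = const_t (xi 2) + const_t (xi 1) ^ 2 * const_t (xi 1)"
    "const_t (zeta 3) = const_t (xi 3) + const_t (xi 2) ^ 2 * const_t (xi 1) + const_t (xi 1) ^ 4 * const_t (zeta 2)"
    "const_t (zeta 4) = const_t (xi 4) + const_t (xi 3) ^ 2 * const_t (xi 1) + const_t (xi 2) ^ 4 * const_t (zeta 2) + const_t (xi 1) ^ 8 * const_t (zeta 3)"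
    by (simp_all only: zeta_rec hom)
  note Z = zeta_ring_identity(1)[where a = "const_t (xi 1)" and b = "const_t (xi 2)" and t = tt, folded z(2)]
    zeta_ring_identity(2)[where a = "const_t (xi 1)" and b = "const_t (xi 2)" and c = "const_t (xi 3)" and t = tt, folded z(2), folded z(3)]
    zeta_ring_identity(3)[where a = "const_t (xi 1)" and b = "const_t (xi 2)" and c = "const_t (xi 3)" and d = "const_t (xi 4)" and t = tt,
      folded z(2), folded z(3), folded z(4)]
  show 1: "total_cap (zeta 1) = const_t (zeta 1) + tt" by (simp only: zeta_rec(1) xi)
  show 2: "total_cap (zeta 2) = const_t (zeta 2) + tt * const_t (zeta 1) ^ 2 + tt ^ 3"
    using Z(1) by (subst zeta_rec(2)) (simp only: hom xi 1 z(1))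
  show 3: "total_cap (zeta 3) = const_t (zeta 3) + tt * const_t (zeta 2) ^ 2 + tt ^ 3 * const_t (zeta 1) ^ 4 + tt ^ 7"
    using Z(2) by (subst zeta_rec(3)) (simp only: hom xi 1 2 z(1))
  show "total_cap (zeta 4) = const_t (zeta 4) + tt * const_t (zeta 3) ^ 2 + tt ^ 3 * const_t (zeta 2) ^ 4 + tt ^ 7 * const_t (zeta 1) ^ 8 + tt ^ 15"
    using Z(3) by (subst zeta_rec(4)) (simp only: hom xi 1 2 3 z(1))
qed

text \<open>Read off from the coefficients of \<open>tt\<close>, \<open>tt ^ 2\<close> and
  \<open>tt ^ 4\<close> in the transforms of the basis: a term \<open>tt ^ n\<close> times the
  constant \<open>zb d\<close> in that of \<open>zb (d + n)\<close> gives the pair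
  \<open>(n, d)\<close>.\<close>

definition bo_tab :: "(nat \<times> nat) set" where
  "bo_tab = {(1, 6), (1, 10), (1, 12), (1, 14), (2, 4), (2, 8), (2, 11), (2, 12), (4, 0), (4, 6), (4, 7), (4, 8)}"

lemma total_cap_zb:
  fixes c :: "nat \<Rightarrow> (nat \<times> mono) \<Rightarrow>\<^sub>0 bit"
  defines "c \<equiv> \<lambda>d. const_t (zb d)"
  shows "total_cap (zb 0) = c 0" "total_cap (zb 4) = c 4 + tt ^ 4 * c 0" "total_cap (zb 6) = c 6 + tt ^ 2 * c 4 + tt ^ 6 * c 0"
    "total_cap (zb 7) = c 7 + tt * c 6 + tt ^ 3 * c 4 + tt ^ 7 * c 0" "total_cap (zb 8) = c 8 + tt ^ 8 * c 0"
    "total_cap (zb 10) = c 10 + tt ^ 2 * c 8 + tt ^ 4 * c 6 + tt ^ 10 * c 0"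
    "total_cap (zb 11) = c 11 + tt * c 10 + tt ^ 3 * c 8 + tt ^ 4 * c 7 + tt ^ 5 * c 6 + tt ^ 11 * c 0"
    "total_cap (zb 12) = c 12 + tt ^ 4 * c 8 + tt ^ 12 * c 0"
    "total_cap (zb 13) = c 13 + tt * c 12 + tt ^ 2 * c 11 + tt ^ 5 * c 8 + tt ^ 6 * c 7 + tt ^ 13 * c 0"
    "total_cap (zb 14) = c 14 + tt ^ 2 * c 12 + tt ^ 6 * c 8 + tt ^ 14 * c 0"
    "total_cap (zb 15) = c 15 + tt * c 14 + tt ^ 3 * c 12 + tt ^ 7 * c 8 + tt ^ 15 * c 0"
proof -
  have C: "c 0 = 1" "c 4 = const_t (zeta 1) ^ 4" "c 6 = const_t (zeta 2) ^ 2" "c 7 = const_t (zeta 3)" "c 8 = const_t (zeta 1) ^ 8"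
    "c 10 = const_t (zeta 1) ^ 4 * const_t (zeta 2) ^ 2" "c 11 = const_t (zeta 1) ^ 4 * const_t (zeta 3)" "c 12 = const_t (zeta 2) ^ 4"
    "c 13 = const_t (zeta 2) ^ 2 * const_t (zeta 3)" "c 14 = const_t (zeta 3) ^ 2" "c 15 = const_t (zeta 4)"
    by (simp_all add: c_def zb_def const_t_1 const_t_mult const_t_power)
  have Z: "zb 0 = 1" "zb 4 = zeta 1 ^ 4" "zb 6 = zeta 2 ^ 2" "zb 7 = zeta 3" "zb 8 = zeta 1 ^ 8"
    "zb 10 = zeta 1 ^ 4 * zeta 2 ^ 2" "zb 11 = zeta 1 ^ 4 * zeta 3" "zb 12 = zeta 2 ^ 4"
    "zb 13 = zeta 2 ^ 2 * zeta 3" "zb 14 = zeta 3 ^ 2" "zb 15 = zeta 4"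
    by (simp_all add: zb_def)
  note expand = C Z total_cap_1 total_cap_mult total_cap_power total_cap_zeta frob power_mult_distrib
  show "total_cap (zb 0) = c 0" "total_cap (zb 4) = c 4 + tt ^ 4 * c 0" "total_cap (zb 6) = c 6 + tt ^ 2 * c 4 + tt ^ 6 * c 0"
    "total_cap (zb 7) = c 7 + tt * c 6 + tt ^ 3 * c 4 + tt ^ 7 * c 0" "total_cap (zb 8) = c 8 + tt ^ 8 * c 0"
    "total_cap (zb 10) = c 10 + tt ^ 2 * c 8 + tt ^ 4 * c 6 + tt ^ 10 * c 0"
    "total_cap (zb 11) = c 11 + tt * c 10 + tt ^ 3 * c 8 + tt ^ 4 * c 7 + tt ^ 5 * c 6 + tt ^ 11 * c 0"
    "total_cap (zb 12) = c 12 + tt ^ 4 * c 8 + tt ^ 12 * c 0"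
    "total_cap (zb 13) = c 13 + tt * c 12 + tt ^ 2 * c 11 + tt ^ 5 * c 8 + tt ^ 6 * c 7 + tt ^ 13 * c 0"
    "total_cap (zb 14) = c 14 + tt ^ 2 * c 12 + tt ^ 6 * c 8 + tt ^ 14 * c 0"
    "total_cap (zb 15) = c 15 + tt * c 14 + tt ^ 3 * c 12 + tt ^ 7 * c 8 + tt ^ 15 * c 0"
    by (simp only: expand, simp only: char2_norm)+
qed

lemma t_part_add: "t_part n (x + y) = t_part n x + t_part n y"
  by (simp add: t_part_def lin_ext_add)

lemma t_part_power: "t_part n (tt ^ k * const_t x) = (if k = n then x else 0)"
proof -
  have tk: "tt ^ k = monom1 (k, 0)"
    unfolding tt_def by (simp only: monom1_power sum_pair) simp
  have "tt ^ k * const_t x = (\<Sum>q\<in>Poly_Mapping.keys x. monom1 (k, q))"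
    unfolding tk const_t_def lin_ext_def by (simp add: sum_distrib_left mult_single)
  then have "t_part n (tt ^ k * const_t x) = (\<Sum>q\<in>Poly_Mapping.keys x. if k = n then monom1 q else 0)"
    by (simp add: t_part_def lin_ext_sum)
  then show ?thesis by (simp add: monom1_expand)
qed

lemma t_part_0: "n > 0 \<Longrightarrow> t_part n (const_t x) = 0" and t_part_1: "t_part n (tt * const_t x) = (if n = 1 then x else 0)"
  using t_part_power[of n 0 x] t_part_power[of n 1 x] by auto

lemma cap_zb:
  assumes "d \<in> D_bo" "n \<in> {1, 2, 4}"
  shows "cap (Sq n) (zb d) = (if n \<le> d \<and> (n, d - n) \<in> bo_tab then zb (d - n) else 0)"
  unfolding cap_eq using assms unfolding D_bo_def
  by (elim insertE emptyE; hypsubst; simp add: total_cap_zb t_part_add t_part_power t_part_0 t_part_1 bo_tab_def)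

definition homog_dual :: "nat \<Rightarrow> dual_steenrod \<Rightarrow> bool" where
  "homog_dual k x \<longleftrightarrow> (\<forall>m\<in>Poly_Mapping.keys x. mdeg m = k)"

lemma homog_dual_mult: "homog_dual k x \<Longrightarrow> homog_dual l y \<Longrightarrow> homog_dual (k + l) (x * y)"
  unfolding homog_dual_def using keys_mult[of x y] by fastforce

lemma homog_dual_add: "homog_dual k x \<Longrightarrow> homog_dual k y \<Longrightarrow> homog_dual k (x + y)"
  unfolding homog_dual_def using Poly_Mapping.keys_add[of x y] by blast

lemma homog_dual_power: "homog_dual k x \<Longrightarrow> homog_dual (n * k) (x ^ n)"
proof (induction n)
  case 0 show ?case by (simp add: homog_dual_def)
next
  case (Suc n) then show ?case using homog_dual_mult[of k x "n * k" "x ^ n"] by simp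
qed

lemma homog_dual_xi: "homog_dual (2 ^ n - 1) (xi n)"
  by (simp add: homog_dual_def xi_def mdeg_xi_mono)

lemma homog_dual_zeta: "homog_dual 1 (zeta 1)" "homog_dual 3 (zeta 2)" "homog_dual 7 (zeta 3)" "homog_dual 15 (zeta 4)"
proof -
  have x: "homog_dual 1 (xi 1)" "homog_dual 3 (xi 2)" "homog_dual 7 (xi 3)" "homog_dual 15 (xi 4)"
    using homog_dual_xi[of 1] homog_dual_xi[of 2] homog_dual_xi[of 3] homog_dual_xi[of 4] by (simp_all flip: One_nat_def)
  show 1: "homog_dual 1 (zeta 1)" using x by (simp only: zeta_rec(1))
  have "homog_dual (2 * 1 + 1) (xi 1 ^ 2 * zeta 1)" by (intro homog_dual_mult homog_dual_power x 1)
  then show 2: "homog_dual 3 (zeta 2)" using x unfolding zeta_rec(2) by (intro homog_dual_add) simp_all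
  have "homog_dual (2 * 3 + 1) (xi 2 ^ 2 * zeta 1)" "homog_dual (4 * 1 + 3) (xi 1 ^ 4 * zeta 2)"
    by (intro homog_dual_mult homog_dual_power x 1 2)+
  then show 3: "homog_dual 7 (zeta 3)" using x unfolding zeta_rec(3) by (intro homog_dual_add) simp_all
  have "homog_dual (2 * 7 + 1) (xi 3 ^ 2 * zeta 1)" "homog_dual (4 * 3 + 3) (xi 2 ^ 4 * zeta 2)" "homog_dual (8 * 1 + 7) (xi 1 ^ 8 * zeta 3)"
    by (intro homog_dual_mult homog_dual_power x 1 2 3)+
  then show "homog_dual 15 (zeta 4)" using x unfolding zeta_rec(4) by (intro homog_dual_add) simp_all
qed

lemma homog_dual_zb: "d \<in> D_bo \<Longrightarrow> homog_dual d (zb d)"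
proof -
  note z = homog_dual_zeta
  have p: "homog_dual 4 (zeta 1 ^ 4)" "homog_dual 6 (zeta 2 ^ 2)" "homog_dual 8 (zeta 1 ^ 8)" "homog_dual 12 (zeta 2 ^ 4)" "homog_dual 14 (zeta 3 ^ 2)"
    using homog_dual_power[OF z(1), of 4] homog_dual_power[OF z(2), of 2] homog_dual_power[OF z(1), of 8]
      homog_dual_power[OF z(2), of 4] homog_dual_power[OF z(3), of 2] by (simp_all only: mult_1_right) simp_all
  have q: "homog_dual 10 (zeta 1 ^ 4 * zeta 2 ^ 2)" "homog_dual 11 (zeta 1 ^ 4 * zeta 3)" "homog_dual 13 (zeta 2 ^ 2 * zeta 3)"
    using homog_dual_mult[OF p(1,2)] homog_dual_mult[OF p(1) z(3)] homog_dual_mult[OF p(2) z(3)] by simp_all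
  have one: "homog_dual 0 1" by (simp add: homog_dual_def)
  assume "d \<in> D_bo"
  then show ?thesis unfolding D_bo_def
    by (elim insertE emptyE; hypsubst; simp add: zb_def p q z one)
qed

text \<open>The quotient by \<open>\<xi>\<^sub>2, \<xi>\<^sub>3, \<dots>\<close>. As \<open>\<zeta>\<^sub>n\<close> maps to \<open>\<xi>\<^sub>1\<close> to the power \<open>2\<^sup>n - 1\<close>, the functionals
  \<open>coefficient of \<xi>\<^sub>1\<^sup>d\<close> are a dual basis of the \<open>zb d\<close>.\<close>

definition xi1_part :: "dual_steenrod \<Rightarrow> nat \<Rightarrow>\<^sub>0 bit" where
  "xi1_part = lin_ext (\<lambda>m. if xi1_power m then monom1 (Poly_Mapping.lookup m 0) else 0)"

lemma xi1_part_add: "xi1_part (x + y) = xi1_part x + xi1_part y"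
  by (simp add: xi1_part_def lin_ext_add)

lemma xi1_part_mult: "xi1_part (x * y) = xi1_part x * xi1_part y"
  unfolding xi1_part_def by (rule lin_ext_mult) (auto simp: xi1_power_add mult_single lookup_add)

lemma xi1_part_1: "xi1_part 1 = 1"
  using lin_ext_monom1[of "\<lambda>m. if xi1_power m then monom1 (Poly_Mapping.lookup m 0) else 0" "0 :: mono"] by (simp add: xi1_part_def)

lemma xi1_part_power: "xi1_part (x ^ n) = xi1_part x ^ n"
  by (induction n) (simp_all add: xi1_part_mult xi1_part_1)

lemma lookup_xi1_part: "Poly_Mapping.lookup (xi1_part x) n = Poly_Mapping.lookup x (xi_mono 1 n)"
proof -
  have *: "Poly_Mapping.lookup (xi1_part (monom1 m)) n = Poly_Mapping.lookup (monom1 m) (xi_mono 1 n)" for m :: mono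
    by (auto simp: xi1_part_def lookup_single when_def xi1_power_def)
  have "xi1_part x = (\<Sum>m\<in>Poly_Mapping.keys x. xi1_part (monom1 m))"
    unfolding xi1_part_def lin_ext_monom1 by (rule lin_ext_def)
  then have "Poly_Mapping.lookup (xi1_part x) n = (\<Sum>m\<in>Poly_Mapping.keys x. Poly_Mapping.lookup (monom1 m) (xi_mono 1 n))"
    by (simp only: lookup_sum *)
  also have "\<dots> = Poly_Mapping.lookup (\<Sum>m\<in>Poly_Mapping.keys x. monom1 m) (xi_mono 1 n)" by (simp only: lookup_sum)
  finally show ?thesis by (simp only: monom1_expand)
qed

lemma xi1_part_xi: "xi1_part (xi n) = (if n \<le> 1 then monom1 n else 0)"
  by (auto simp: xi1_part_def xi_def le_Suc_eq One_nat_def)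

lemma monom1_nat: "monom1 (a :: nat) * monom1 b = monom1 (a + b)" "monom1 (a :: nat) ^ n = monom1 (n * a)"
  by (simp_all add: mult_single monom1_power)

lemma xi1_part_zeta: "xi1_part (zeta 1) = monom1 1" "xi1_part (zeta 2) = monom1 3" "xi1_part (zeta 3) = monom1 7" "xi1_part (zeta 4) = monom1 15"
proof -
  note hom = xi1_part_add xi1_part_mult xi1_part_power xi1_part_xi
  show 1: "xi1_part (zeta 1) = monom1 1" by (simp add: zeta_rec(1) hom)
  show 2: "xi1_part (zeta 2) = monom1 3" unfolding zeta_rec(2) hom 1 by (simp add: monom1_nat zero_power)
  show 3: "xi1_part (zeta 3) = monom1 7" unfolding zeta_rec(3) hom 1 2 by (simp add: monom1_nat zero_power)
  show "xi1_part (zeta 4) = monom1 15" unfolding zeta_rec(4) hom 1 2 3 by (simp add: monom1_nat zero_power)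
qed

lemma xi1_part_zb: "d \<in> D_bo \<Longrightarrow> xi1_part (zb d) = monom1 d"
  unfolding D_bo_def
  by (elim insertE emptyE; hypsubst; simp add: zb_def xi1_part_mult xi1_part_power xi1_part_zeta xi1_part_1 monom1_nat)

lemma lookup_zb: "d \<in> D_bo \<Longrightarrow> Poly_Mapping.lookup (zb d) (xi_mono 1 n) = (if n = d then 1 else 0)"
  using lookup_xi1_part[of "zb d" n] by (simp add: xi1_part_zb lookup_single when_def eq_commute)

definition cof :: "nat \<Rightarrow> dual_steenrod \<Rightarrow> bit" where
  "cof d x = (if x \<in> H_bo2 then Poly_Mapping.lookup x (xi_mono 1 d) else 0)"

lemma cof_zb: "k \<in> D_bo \<Longrightarrow> cof d (zb k) = (if d = k then 1 else 0)"
  by (simp add: cof_def zb_H_bo2 lookup_zb)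

lemma gr_coh: "f \<in> gr cohomology_bo2 n \<longleftrightarrow> (\<forall>x. f x \<noteq> 0 \<longrightarrow> x \<in> H_bo2) \<and> (\<forall>x\<in>H_bo2. \<forall>y\<in>H_bo2. f (x + y) = f x + f y) \<and>
    (\<forall>x k. homog_dual k x \<and> f x \<noteq> 0 \<longrightarrow> int k = n)"
  by (simp add: cohomology_bo2_def homog_dual_def)

lemma act_coh: "act cohomology_bo2 a f x = (if x \<in> H_bo2 then f (cap a x) else 0)"
  by (simp add: cohomology_bo2_def)

lemma fun_eq_H_bo2:
  fixes f g :: "dual_steenrod \<Rightarrow> bit"
  assumes "\<And>x. x \<notin> H_bo2 \<Longrightarrow> f x = 0" "\<And>x. x \<notin> H_bo2 \<Longrightarrow> g x = 0"
    "\<And>x y. x \<in> H_bo2 \<Longrightarrow> y \<in> H_bo2 \<Longrightarrow> f (x + y) = f x + f y" "\<And>x y. x \<in> H_bo2 \<Longrightarrow> y \<in> H_bo2 \<Longrightarrow> g (x + y) = g x + g y"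
    "\<And>d. d \<in> D_bo \<Longrightarrow> f (zb d) = g (zb d)"
  shows "f = g"
proof
  fix x
  show "f x = g x"
  proof (cases "x \<in> H_bo2")
    case True
    have "f 0 = 0" "g 0 = 0" using assms(3,4)[of 0 0] by simp_all
    then have "x \<in> H_bo2 \<and> f x = g x"
      by (intro H_bo2_induct[OF True, of "\<lambda>x. x \<in> H_bo2 \<and> f x = g x"]) (simp_all add: assms(3-5) zb_H_bo2 H_bo2_add H_bo2_0)
    then show ?thesis ..
  qed (simp add: assms(1,2))
qed

lemma cof_add: "x \<in> H_bo2 \<Longrightarrow> y \<in> H_bo2 \<Longrightarrow> cof d (x + y) = cof d x + cof d y"
  by (simp add: cof_def H_bo2_add lookup_add)

lemma cof_gr: "cof d \<in> gr cohomology_bo2 (int d)"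
  unfolding gr_coh
proof (intro conjI allI impI ballI)
  show "x \<in> H_bo2" if "cof d x \<noteq> 0" for x using that by (auto simp: cof_def split: if_splits)
  fix x k assume *: "homog_dual k x \<and> cof d x \<noteq> 0"
  then have "Poly_Mapping.lookup x (xi_mono 1 d) \<noteq> 0" by (auto simp: cof_def split: if_splits)
  then have "xi_mono 1 d \<in> Poly_Mapping.keys x" by (simp add: in_keys_iff)
  then show "int k = int d" using * by (auto simp: homog_dual_def mdeg_xi_mono)
qed (simp add: cof_add)

text \<open>The \<open>zb d\<close> have distinct degrees, so a homogeneous functional is determined
  by its value on at most one of them.\<close>

lemma gr_coh_eq: "gr cohomology_bo2 n = (if n \<in> int ` D_bo then {0, cof (nat n)} else {0})"
proof -
  have z: "0 \<in> gr cohomology_bo2 n" for n by (simp add: gr_coh zero_fun_apply)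
  have e: "f = (if n \<in> int ` D_bo \<and> f (zb (nat n)) \<noteq> 0 then cof (nat n) else 0)" if f: "f \<in> gr cohomology_bo2 n" for f
  proof (rule fun_eq_H_bo2)
    note f' = f[unfolded gr_coh]
    show "f x = 0" if "x \<notin> H_bo2" for x using f' that by blast
    show "f (x + y) = f x + f y" if "x \<in> H_bo2" "y \<in> H_bo2" for x y using f' that by blast
    fix d assume d: "d \<in> D_bo"
    have "int d = n" if "f (zb d) \<noteq> 0" using f' homog_dual_zb[OF d] that by blast
    then show "f (zb d) = (if n \<in> int ` D_bo \<and> f (zb (nat n)) \<noteq> 0 then cof (nat n) else 0) (zb d)"
    proof (cases "f (zb d) = 0")
      case True
      have "(if n \<in> int ` D_bo \<and> f (zb (nat n)) \<noteq> 0 then cof (nat n) else 0) (zb d) = 0"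
        using True cof_zb[OF d, of "nat n"] by (cases "nat n = d") (simp_all add: zero_fun_apply)
      then show ?thesis using True by simp
    next
      case False
      then have "f (zb d) = 1" "n = int d" using \<open>f (zb d) \<noteq> 0 \<Longrightarrow> int d = n\<close> by simp_all
      then show ?thesis using d cof_zb[OF d, of d] by simp
    qed
  qed (auto simp: zero_fun_apply cof_def H_bo2_add lookup_add)
  have "gr cohomology_bo2 n \<subseteq> (if n \<in> int ` D_bo then {0, cof (nat n)} else {0})"
  proof
    fix f assume f: "f \<in> gr cohomology_bo2 n"
    show "f \<in> (if n \<in> int ` D_bo then {0, cof (nat n)} else {0})"
    proof (cases "n \<in> int ` D_bo \<and> f (zb (nat n)) \<noteq> 0")
      case True
      then show ?thesis using trans[OF e[OF f] if_P[OF True]] by simp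
    next
      case False
      then show ?thesis using trans[OF e[OF f] if_not_P[OF False]] by simp
    qed
  qed
  moreover have "(if n \<in> int ` D_bo then {0, cof (nat n)} else {0}) \<subseteq> gr cohomology_bo2 n"
    using z cof_gr by auto
  ultimately show ?thesis by blast
qed

lemma cap_add: "cap (Sq n) (x + y) = cap (Sq n) x + cap (Sq n) y"
  by (simp add: cap_eq total_cap_add t_part_add)

lemma cap_H_bo2: "n \<in> {1, 2, 4} \<Longrightarrow> x \<in> H_bo2 \<Longrightarrow> cap (Sq n) x \<in> H_bo2"
proof -
  assume n: "n \<in> {1, 2, 4}" and "x \<in> H_bo2"
  from this(2) show ?thesis
  proof (induction rule: H_bo2_induct)
    case zero
    show ?case using cap_add[of n 0 0] by simp
  next
    case (add d x)
    have "d - n \<in> D_bo" if "n \<le> d" "(n, d - n) \<in> bo_tab" using that n add(1) by (auto simp: bo_tab_def D_bo_def)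
    then have "cap (Sq n) (zb d) \<in> H_bo2" using cap_zb[OF add(1) n] zb_H_bo2 by simp
    then show ?case using add by (simp add: cap_add H_bo2_add)
  qed
qed

lemma Sq_cof:
  assumes "n \<in> {1, 2, 4}" "d \<in> D_bo"
  shows "act cohomology_bo2 (Sq n) (cof d) = (if (n, d) \<in> bo_tab then cof (d + n) else 0)"
proof (rule fun_eq_H_bo2)
  show "act cohomology_bo2 (Sq n) (cof d) (x + y) = act cohomology_bo2 (Sq n) (cof d) x + act cohomology_bo2 (Sq n) (cof d) y"
    if "x \<in> H_bo2" "y \<in> H_bo2" for x y
    using that assms by (simp add: act_coh H_bo2_add cap_add cof_add cap_H_bo2)
  show "(if (n, d) \<in> bo_tab then cof (d + n) else 0) (x + y) = (if (n, d) \<in> bo_tab then cof (d + n) else 0) x + (if (n, d) \<in> bo_tab then cof (d + n) else 0) y"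
    if "x \<in> H_bo2" "y \<in> H_bo2" for x y using that by (simp add: cof_add zero_fun_apply)
  fix k assume k: "k \<in> D_bo"
  have c0: "cof d 0 = 0" by (simp add: cof_def)
  have "act cohomology_bo2 (Sq n) (cof d) (zb k) = cof d (cap (Sq n) (zb k))" by (simp add: act_coh zb_H_bo2 k)
  also have "\<dots> = (if n \<le> k \<and> (n, k - n) \<in> bo_tab then cof d (zb (k - n)) else 0)"
    by (simp add: cap_zb[OF k assms(1)] c0)
  also have "\<dots> = (if (n, d) \<in> bo_tab \<and> k = d + n then 1 else 0)"
  proof (cases "n \<le> k \<and> (n, k - n) \<in> bo_tab")
    case True
    then have "k - n \<in> D_bo" using k assms(1) by (auto simp: bo_tab_def D_bo_def)
    then show ?thesis using True by (auto simp: cof_zb)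
  qed auto
  also have "\<dots> = (if (n, d) \<in> bo_tab then cof (d + n) else 0) (zb k)"
    by (auto simp: cof_zb[OF k] zero_fun_apply)
  finally show "act cohomology_bo2 (Sq n) (cof d) (zb k) = (if (n, d) \<in> bo_tab then cof (d + n) else 0) (zb k)" .
qed (auto simp: act_coh cof_def zero_fun_apply)

section \<open>The module \<open>B\<close> as a submodule\<close>

lemma B_tab_eq: "set B_tab = {(4, 13), (2, 15)} \<union> bo_tab"
  unfolding B_tab_def bo_tab_def list.set by blast

lemma D_B_eq: "set D_B = insert 17 D_bo"
  by (auto simp: D_B_def D_bo_def)

text \<open>Below degree 17 the operations are those of the quotient, since the kernel of
  \<open>p\<close> sits in degree 17. The element of degree 13 must be \<open>Sq 6\<close> of
  \<open>Sq 7\<close> of the bottom class, so \<open>Sq 4\<close> sends it to the new class; the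
  relation for \<open>Sq 1 \<star> Sq 4\<close>, applied in degree 12, transfers this to
  \<open>Sq 2\<close> on degree 15.\<close>

lemma B_basis:
  assumes "is_B B"
  obtains b where "\<And>d. d \<in> set D_B \<Longrightarrow> gr B (int d) = {0, b d} \<and> b d \<noteq> 0"
    "\<And>n. n \<notin> int ` set D_B \<Longrightarrow> gr B n = {0}"
    "\<And>d n. d \<in> set D_B \<Longrightarrow> n \<in> {1, 2, 4} \<Longrightarrow> act B (Sq n) (b d) = (if (n, d) \<in> set B_tab then b (d + n) else 0)"
proof -
  interpret module B using assms by unfold_locales (simp add: is_B_def)
  obtain i p \<iota> where se: "short_exact (susp 17 trivial_module) i B p cohomology_bo2"
    and \<iota>: "\<iota> \<in> gr B 0" "i 1 = act B (Sq 4) (act B (Sq 6) (act B (Sq 7) \<iota>))"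
    using assms unfolding is_B_def by blast
  have tt: "total trivial_module = UNIV"
  proof -
    have "x \<in> total trivial_module" for x by (rule gr_total[of _ _ 0]) (simp add: trivial_module_def)
    then show ?thesis by blast
  qed
  have ph: "A2_hom B cohomology_bo2 p" and ih: "A2_hom (susp 17 trivial_module) B i" and ii: "inj_on i UNIV"
    and ker: "range i = {x \<in> total B. p x = 0}" and sur: "p ` total B = total cohomology_bo2"
    using se tt by (simp_all add: short_exact_def)
  have pa: "p (x + y) = p x + p y" if "x \<in> total B" "y \<in> total B" for x y using ph that by (simp add: A2_hom_def)
  have pg: "p x \<in> gr cohomology_bo2 n" if "x \<in> gr B n" for x n using ph that unfolding A2_hom_def by blast
  have pact: "p (act B a x) = act cohomology_bo2 a (p x)" if "a \<in> A2" "x \<in> total B" for a x using ph that by (simp add: A2_hom_def)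
  have p0: "p 0 = 0" using pa[of 0 0] by simp
  have i0: "i 0 = 0"
  proof -
    have "i (0 + 0) = i 0 + i 0" using ih[unfolded A2_hom_def total_susp tt] by blast
    then show ?thesis by simp
  qed
  have i1: "i 1 \<in> gr B 17" "i 1 \<noteq> 0"
  proof -
    have "i ` gr (susp 17 trivial_module) 17 \<subseteq> gr B 17" using ih unfolding A2_hom_def by blast
    then show "i 1 \<in> gr B 17" by (auto simp: trivial_module_def)
    show "i 1 \<noteq> 0" using ii i0 by (metis UNIV_I inj_onD zero_neq_one)
  qed
  have ker': "x = 0 \<or> x = i 1" if "x \<in> total B" "p x = 0" for x
  proof -
    have "x \<in> range i" using ker that by blast
    then obtain c where "x = i c" by blast
    then show ?thesis using i0 by (cases c) auto
  qed
  have comp17: "comp 17 (i 1) = i 1" "\<And>n. n \<noteq> 17 \<Longrightarrow> comp n (i 1) = 0" using comp_homogeneous[OF i1(1)] by auto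
  have pinj: "x = 0" if "x \<in> gr B n" "n \<noteq> 17" "p x = 0" for x n
    using ker'[OF gr_total[OF that(1)] that(3)] comp_homogeneous[OF that(1), of n] comp17(2)[OF that(2)] i1(2) by auto
  have ex: "\<exists>x\<in>gr B (int d). p x = cof d" if d: "d \<in> D_bo" for d
  proof -
    have "cof d \<in> total cohomology_bo2" by (rule gr_total[OF cof_gr])
    then obtain x where x: "x \<in> total B" "p x = cof d" using sur by (metis imageE)
    have "p x (zb d) = p (comp (int d) x) (zb d)" if "x \<in> total B" for x using that
    proof (induction rule: total_induct)
      case (gr n x)
      show ?case
      proof (cases "n = int d")
        case True then show ?thesis using comp_homogeneous[OF gr] by simp
      next
        case False
        have "p x (zb d) = 0"
          using pg[OF gr] homog_dual_zb[OF d] False unfolding gr_coh by blast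
        then show ?thesis using comp_homogeneous[OF gr] False by (simp add: p0 zero_fun_apply)
      qed
    next
      case (add x y)
      then show ?case using gr_total[OF comp_gr[OF add(1), of "int d"]] gr_total[OF comp_gr[OF add(2), of "int d"]]
        by (simp add: comp_add pa plus_fun_apply)
    qed
    from this[OF x(1)] have "p (comp (int d) x) (zb d) = 1" using x(2) cof_zb[OF d] by simp
    moreover have "p (comp (int d) x) \<in> {0, cof d}" using pg[OF comp_gr[OF x(1)], of "int d"] d by (simp add: gr_coh_eq)
    ultimately have "p (comp (int d) x) = cof d" by (auto simp: zero_fun_apply)
    then show ?thesis using comp_gr[OF x(1)] by blast
  qed
  define b where "b d = (if d = 17 then i 1 else SOME x. x \<in> gr B (int d) \<and> p x = cof d)" for d
  have b17: "b 17 = i 1" by (simp add: b_def)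
  have b: "b d \<in> gr B (int d)" "p (b d) = cof d" if "d \<in> D_bo" for d
    using someI_ex[of "\<lambda>x. x \<in> gr B (int d) \<and> p x = cof d"] ex[OF that] that by (auto simp: b_def D_bo_def)
  have cne: "cof d \<noteq> 0" if "d \<in> D_bo" for d using cof_zb[OF that, of d] by (auto simp: zero_fun_apply)
  have bne: "b d \<noteq> 0" if "d \<in> D_bo" for d using b(2)[OF that] cne[OF that] p0 by auto
  have grd: "y = 0 \<or> y = b d" if d: "d \<in> D_bo" and y: "y \<in> gr B (int d)" for d y
  proof -
    have n17: "int d \<noteq> 17" using d by (auto simp: D_bo_def)
    have "p y = 0 \<or> p y = cof d" using pg[OF y] d by (simp add: gr_coh_eq)
    then show ?thesis
    proof
      assume "p y = 0" then show ?thesis using pinj[OF y n17] by blast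
    next
      assume "p y = cof d"
      moreover have "cof d + cof d = 0" by (intro ext) (simp add: plus_fun_apply zero_fun_apply)
      ultimately have "p (y + b d) = 0" using b(2)[OF d] pa[OF gr_total[OF y] gr_total[OF b(1)[OF d]]] by simp
      then have "y + b d = 0" using pinj[OF gr_add[OF y b(1)[OF d]] n17] by blast
      then show ?thesis using add_eq_0 gr_total y b(1)[OF d] by blast
    qed
  qed
  have gr17: "y = 0 \<or> y = b 17" if "y \<in> gr B 17" for y
  proof -
    have "p y \<in> gr cohomology_bo2 17" by (rule pg[OF that])
    then have "p y = 0" by (auto simp: gr_coh_eq D_bo_def split: if_splits)
    then show ?thesis using ker'[OF gr_total[OF that]] by (simp add: b17)
  qed
  have triv: "gr B n = {0}" if n: "n \<notin> int ` set D_B" for n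
  proof -
    have "y = 0" if y: "y \<in> gr B n" for y
    proof (rule pinj[OF y])
      show "n \<noteq> 17" using n by (auto simp: D_B_eq)
      show "p y = 0" using pg[OF y] n by (auto simp: gr_coh_eq D_B_eq)
    qed
    then show ?thesis by auto
  qed
  have grB: "gr B (int d) = {0, b d} \<and> b d \<noteq> 0" if "d \<in> set D_B" for d
  proof (cases "d = 17")
    case True
    have "b 17 \<in> gr B 17" "b 17 \<noteq> 0" using i1 b17 by simp_all
    then show ?thesis using gr17 True by auto
  next
    case False
    then have "d \<in> D_bo" using that D_B_eq by auto
    then show ?thesis using grd b(1) bne by auto
  qed
  have Sq_gr: "act B (Sq n) y \<in> gr B (int (n + d))" if "y \<in> gr B (int d)" "Sq n \<in> A2" for n d y
    using act_gr[OF that(2,1) Sq_homogeneous] by simp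
  have low: "act B (Sq n) (b d) = (if (n, d) \<in> bo_tab then b (d + n) else 0)" if d: "d \<in> D_bo" and n: "n \<in> {1, 2, 4}" and dn: "d + n \<noteq> 17" for d n
  proof -
    have S: "Sq n \<in> A2" using n by auto
    let ?y = "act B (Sq n) (b d)"
    have y: "?y \<in> gr B (int (n + d))" by (rule Sq_gr[OF b(1)[OF d] S])
    have py: "p ?y = (if (n, d) \<in> bo_tab then cof (d + n) else 0)"
      using pact[OF S gr_total[OF b(1)[OF d]]] Sq_cof[OF n d] b(2)[OF d] by simp
    show ?thesis
    proof (cases "(n, d) \<in> bo_tab")
      case True
      then have dn': "d + n \<in> D_bo" by (auto simp: bo_tab_def D_bo_def)
      then have "?y \<noteq> 0" using py True cne p0 by auto
      then show ?thesis using grd[OF dn', of ?y] y True by (simp add: add.commute)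
    next
      case False
      then show ?thesis using pinj[OF y] py dn by simp
    qed
  qed
  have top: "act B (Sq 4) (b 13) = b 17"
  proof -
    let ?v = "act B (Sq 6) (act B (Sq 7) \<iota>)"
    have "act B (Sq 7) \<iota> \<in> gr B (int (7 + 0))" by (rule Sq_gr) (use \<iota>(1) in auto)
    then have "?v \<in> gr B (int (6 + (7 + 0)))" by (rule Sq_gr) auto
    then have "?v = 0 \<or> ?v = b 13" using grd[of 13 ?v] by (simp add: D_bo_def)
    moreover have "?v \<noteq> 0" using \<iota>(2) i1(2) act_0[of "Sq 4"] by auto
    ultimately show ?thesis using \<iota>(2) b17 by auto
  qed
  have top2: "act B (Sq 2) (b 15) = b 17"
  proof -
    have bt: "b d \<in> total B" if "d \<in> D_bo" for d using b(1)[OF that] gr_total by blast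
    have D: "12 \<in> D_bo" "14 \<in> D_bo" "13 \<in> D_bo" by (auto simp: D_bo_def)
    have 14: "act B (Sq 2) (b 12) = b 14" and 15: "act B (Sq 1) (b 14) = b 15" and 13: "act B (Sq 1) (b 12) = b 13"
      using low[of 12 2] low[of 14 1] low[of 12 1] D by (auto simp: bo_tab_def)
    \<comment> \<open>The product lies in degree 16, a zero group.\<close>
    have 16: "act B (Sq 4) (b 12) = 0"
      using low[of 12 4] D by (simp add: bo_tab_def)
    have eq: "Sq 2 \<star> Sq 1 \<star> Sq 2 = Sq 1 \<star> Sq 4 + Sq 4 \<star> Sq 1"
      using Sq_relations(4) by (simp add: add.assoc)
    have "act B (Sq 2) (b 15) = act B (Sq 2 \<star> Sq 1 \<star> Sq 2) (b 12)"
      using bt[OF D(1)] bt[OF D(2)] by (simp add: act_act act_total 14 15)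
    also have "\<dots> = act B (Sq 1) (act B (Sq 4) (b 12)) + act B (Sq 4) (act B (Sq 1) (b 12))"
      unfolding eq using bt[OF D(1)] by (simp add: add_act act_act)
    finally show ?thesis using act_0[of "Sq 1"] by (simp add: 16 13 top)
  qed
  have act: "act B (Sq n) (b d) = (if (n, d) \<in> set B_tab then b (d + n) else 0)" if d: "d \<in> set D_B" and n: "n \<in> {1, 2, 4}" for d n
  proof (cases "d = 17")
    case True
    have "act B (Sq n) (b 17) \<in> gr B (int (n + 17))" by (rule Sq_gr) (use grB[of 17] n in \<open>auto simp: D_B_def\<close>)
    moreover have "gr B (int (n + 17)) = {0}" using n by (intro triv) (auto simp: D_B_def)
    moreover have "(n, 17) \<notin> set B_tab" by (simp add: B_tab_def)
    ultimately show ?thesis using True by simp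
  next
    case False
    then have db: "d \<in> D_bo" using d D_B_eq by auto
    have "d = 13 \<or> d = 15 \<or> d + n \<noteq> 17" "d \<noteq> 16" using db n by (auto simp: D_bo_def)
    then consider "d = 13" "n = 4" | "d = 15" "n = 2" | "d + n \<noteq> 17" by fastforce
    then show ?thesis
    proof cases
      case 1
      have "(4, 13) \<in> set B_tab" by (simp add: B_tab_def)
      then show ?thesis using top 1 by simp
    next
      case 2
      have "(2, 15) \<in> set B_tab" by (simp add: B_tab_def)
      then show ?thesis using top2 2 by simp
    next
      case 3
      then have "(n, d) \<in> set B_tab \<longleftrightarrow> (n, d) \<in> bo_tab" unfolding B_tab_eq by auto
      then show ?thesis using low[OF db n 3] by simp
    qed
  qed
  show thesis by (rule that[OF grB triv act])
qed

lemma kel_P1: "d \<in> set D_B \<Longrightarrow> kel d \<in> P1"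
  using ann_Sq1[OF kel_props(1) kel_right(1)] by (auto simp: lid_def)

text \<open>\<open>Sq n\<close> acts on the \<open>kel d\<close> by \<open>B_tab\<close>, so sending
  basis elements to the \<open>kel d\<close> is linear. The image is the kernel by
  \<open>k_span\<close>, and injectivity holds because the \<open>kel d\<close> are nonzero in
  distinct degrees. The suspensions match as \<open>16 + d = 10 + (d + 6)\<close>.\<close>

lemma ses_B:
  assumes "is_B B"
  shows "\<exists>i. ses (susp 16 B) i (susp 10 (lmod P1)) (\<lambda>x. x \<star> Sq 6) (susp 4 (lmod J7))"
proof -
  obtain b where grB: "\<And>d. d \<in> set D_B \<Longrightarrow> gr B (int d) = {0, b d} \<and> b d \<noteq> 0"
    and triv: "\<And>n. n \<notin> int ` set D_B \<Longrightarrow> gr B n = {0}"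
    and act: "\<And>d n. d \<in> set D_B \<Longrightarrow> n \<in> {1, 2, 4} \<Longrightarrow> act B (Sq n) (b d) = (if (n, d) \<in> set B_tab then b (d + n) else 0)"
    using B_basis[OF assms] by metis
  have MB: "A2_module B" using assms by (simp add: is_B_def)
  interpret module B by unfold_locales (fact MB)
  have bg: "b d \<in> gr B (int d)" "b d \<in> total B" if "d \<in> set D_B" for d
  proof -
    show "b d \<in> gr B (int d)" using grB[OF that] by simp
    then show "b d \<in> total B" by (rule gr_total)
  qed
  define i where "i x = (\<Sum>d\<in>set D_B. if comp (int d) x = 0 then 0 else kel d)" for x
  have ia: "i (x + y) = i x + i y" if xy: "x \<in> total B" "y \<in> total B" for x y
    unfolding i_def sum.distrib[symmetric]
  proof (rule sum.cong[OF refl])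
    fix d assume d: "d \<in> set D_B"
    have "comp (int d) x \<in> {0, b d}" "comp (int d) y \<in> {0, b d}" using comp_gr xy grB[OF d] by blast+
    moreover have "b d + b d = 0" "b d \<noteq> 0" using total_self bg(2)[OF d] grB[OF d] by auto
    ultimately show "(if comp (int d) (x + y) = 0 then 0 else kel d) =
        (if comp (int d) x = 0 then 0 else kel d) + (if comp (int d) y = 0 then 0 else kel d)"
      by (auto simp: comp_add[OF xy])
  qed
  have ib: "i (b d) = kel d" if d: "d \<in> set D_B" for d
  proof -
    have "i (b d) = (\<Sum>k\<in>set D_B. if k = d then kel d else 0)"
      unfolding i_def by (rule sum.cong) (use grB[OF d] in \<open>auto simp: comp_homogeneous[OF bg(1)[OF d]]\<close>)
    also have "\<dots> = kel d" using d by simp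
    finally show ?thesis .
  qed
  have i0: "i 0 = 0" using ia[of 0 0] by simp
  have ig: "i x \<in> gr (lmod P1) (n + 6)" if x: "x \<in> gr B n" for x n
  proof (cases "n \<in> int ` set D_B")
    case True
    then obtain d where d: "n = int d" "d \<in> set D_B" by blast
    then have "x = 0 \<or> x = b d" using x grB by auto
    moreover have "kel d \<in> gr (lmod P1) (int (d + 6))"
      using kel_P1[OF d(2)] kel_props(2)[OF d(2)] by (simp only: gr_lmod_homogeneous)
    moreover have "0 \<in> gr (lmod P1) (int (d + 6))" by (simp only: gr_lmod_homogeneous) simp
    ultimately show ?thesis using ib[OF d(2)] i0 d by auto
  next
    case False
    then have "x = 0" using triv x by blast
    then show ?thesis by (simp add: i0 gr_lmod zero_fun_apply)
  qed
  have iP: "i x \<in> P1" if "x \<in> total B" for x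
    using that
  proof (induction rule: total_induct)
    case (gr n x) then show ?case using ig by (auto simp: gr_lmod)
  next
    case (add x y)
    have "left_ideal P1" by simp
    then show ?case using add unfolding left_ideal_def ia[OF add(1,2)] by blast
  qed
  have gadd: "gadd (susp 16 B) (susp 10 (lmod P1)) i"
    unfolding gadd_def
  proof (intro conjI ballI allI image_subsetI)
    fix x n assume "x \<in> gr (susp 16 B) n"
    then have "i x \<in> gr (lmod P1) ((n - 16) + 6)" by (intro ig) (simp add: gr_susp)
    then show "i x \<in> gr (susp 10 (lmod P1)) n" by (simp add: gr_susp)
  qed (simp add: ia)
  have hom: "A2_hom (susp 16 B) (susp 10 (lmod P1)) i"
  proof (rule A2_homI[OF module_susp[OF MB] module_susp[OF module_lmod] gadd])
    fix n x assume n: "n \<in> {1, 2, 4 :: nat}" and "x \<in> total (susp 16 B)"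
    then have x: "x \<in> total B" by simp
    have S: "Sq n \<in> A2" using n by auto
    from x have "i (act B (Sq n) x) = Sq n \<star> i x"
    proof (induction rule: total_induct)
      case (gr k x)
      show ?case
      proof (cases "k \<in> int ` set D_B")
        case True
        then obtain d where d: "k = int d" "d \<in> set D_B" by blast
        then have "x = 0 \<or> x = b d" using gr grB by auto
        moreover have "i (act B (Sq n) (b d)) = Sq n \<star> i (b d)"
        proof (cases "(n, d) \<in> set B_tab")
          case True
          then have "d + n \<in> set D_B" by (auto simp: B_tab_def D_B_def)
          then show ?thesis using True by (simp add: act[OF d(2) n] kel_Sq[OF d(2) n] ib d(2))
        next
          case False
          then show ?thesis by (simp add: act[OF d(2) n] kel_Sq[OF d(2) n] ib d(2) i0)
        qed
        ultimately show ?thesis using i0 act_0[OF S] by auto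
      next
        case False
        then have "x = 0" using triv gr by blast
        then show ?thesis using i0 act_0[OF S] by simp
      qed
    next
      case (add x y)
      then show ?case by (simp add: act_add[OF S] ia act_total S st_mult_add_right)
    qed
    then show "i (act (susp 16 B) (Sq n) x) = act (susp 10 (lmod P1)) (Sq n) (i x)" by simp
  qed simp
  have inj: "x = 0" if x: "x \<in> total B" and z: "i x = 0" for x
  proof -
    have "comp (int d) x = 0" if d: "d \<in> set D_B" for d
    proof (rule ccontr)
      assume nz: "comp (int d) x \<noteq> 0"
      obtain m where m: "kel d m \<noteq> 0" using kel_props(3)[OF d] by (metis ext zero_fun_apply)
      then have md: "mdeg m = d + 6" using kel_props(2)[OF d] by (simp add: st_homogeneous_def)
      have "0 = i x m" using z by (simp add: zero_fun_apply)
      also have "\<dots> = (\<Sum>k\<in>set D_B. (if comp (int k) x = 0 then 0 else kel k) m)" unfolding i_def by (rule sum_fun_apply)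
      also have "\<dots> = (\<Sum>k\<in>{d}. (if comp (int k) x = 0 then 0 else kel k) m)"
      proof (rule sum.mono_neutral_right)
        show "\<forall>k\<in>set D_B - {d}. (if comp (int k) x = 0 then 0 else kel k) m = 0"
        proof
          fix k assume k: "k \<in> set D_B - {d}"
          then have "kel k m = 0" using kel_props(2)[of k] md unfolding st_homogeneous_def by fastforce
          then show "(if comp (int k) x = 0 then 0 else kel k) m = 0" by (simp add: zero_fun_apply)
        qed
      qed (use d in auto)
      also have "\<dots> = kel d m" using nz by simp
      finally show False using m by simp
    qed
    moreover have "comp n x = 0" if "n \<notin> int ` set D_B" for n using comp_gr[OF x, of n] triv[OF that] by simp
    ultimately have c: "comp n x = 0" for n by (cases "n \<in> int ` set D_B") auto
    obtain N where "x = (\<Sum>n\<in>N. comp n x)" using comp_decomp[OF x] by blast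
    also have "\<dots> = 0" by (simp add: c)
    finally show "x = 0" .
  qed
  have ker: "x \<in> P1 \<and> x \<star> Sq 6 = 0 \<longleftrightarrow> x \<in> i ` total B" for x
  proof
    assume x: "x \<in> P1 \<and> x \<star> Sq 6 = 0"
    then obtain y where y: "y \<in> A2" "x = y \<star> Sq 1" by (auto simp: lid_def)
    then have "y \<star> Sq 7 = 0" using x by (simp add: st_mult_assoc Sq_relations(7))
    from k_span[OF y(1) this] have xs: "x = (\<Sum>d\<in>set D_B. if kappa d y = 0 then 0 else kel d)" by (simp add: y(2))
    have S: "i (\<Sum>d\<in>E. if kappa d y = 0 then 0 else b d) = (\<Sum>d\<in>E. if kappa d y = 0 then 0 else kel d) \<and>
        (\<Sum>d\<in>E. if kappa d y = 0 then 0 else b d) \<in> total B" if "finite E" "E \<subseteq> set D_B" for E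
      using that
    proof (induction E rule: finite_induct)
      case (insert d E)
      have t: "(if kappa d y = 0 then 0 else b d) \<in> total B" using bg(2) insert.prems by auto
      have "i (if kappa d y = 0 then 0 else b d) = (if kappa d y = 0 then 0 else kel d)" using ib i0 insert.prems by auto
      then show ?case using insert t by (simp add: ia total_add)
    qed (simp add: i0)
    have "x = i (\<Sum>d\<in>set D_B. if kappa d y = 0 then 0 else b d)" "(\<Sum>d\<in>set D_B. if kappa d y = 0 then 0 else b d) \<in> total B"
      using S[of "set D_B"] xs by simp_all
    then show "x \<in> i ` total B" by blast
  next
    assume "x \<in> i ` total B"
    then obtain z where z: "z \<in> total B" "x = i z" by blast
    have "x \<star> Sq 6 = 0"
    proof -
      have k6: "(if P then 0 else kel d) \<star> Sq 6 = 0" if "d \<in> set D_B" for P d using kel_right(2)[OF that] by simp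
      have "(\<Sum>d\<in>E. if comp (int d) z = 0 then 0 else kel d) \<star> Sq 6 = 0" if "finite E" "E \<subseteq> set D_B" for E
        using that by (induction E rule: finite_induct) (simp_all add: st_mult_add_left k6)
      from this[of "set D_B"] show ?thesis by (simp add: z(2) i_def)
    qed
    then show "x \<in> P1 \<and> x \<star> Sq 6 = 0" using iP z by blast
  qed
  have im: "x \<star> Sq 6 \<in> J7" if x: "x \<in> P1" for x
  proof -
    obtain a where "x = a \<star> Sq 1" "a \<in> A2" using x by (auto simp: lid_def)
    then show ?thesis using lidI[of a "Sq 7"] by (simp add: st_mult_assoc Sq_relations(7))
  qed
  have onto: "(\<lambda>x. x \<star> Sq 6) ` P1 = J7"
  proof (intro equalityI subsetI)
    fix y assume "y \<in> J7"
    then obtain a where a: "y = a \<star> Sq 7" "a \<in> A2" by (auto simp: lid_def)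
    then have "y = (a \<star> Sq 1) \<star> Sq 6" by (simp add: st_mult_assoc Sq_relations(7))
    then show "y \<in> (\<lambda>x. x \<star> Sq 6) ` P1" using lidI[OF a(2)] by blast
  qed (use im in blast)
  have "ses (susp 16 B) i (susp 10 (lmod P1)) (\<lambda>x. x \<star> Sq 6) (susp 4 (lmod J7))"
  proof
    show "A2_module (susp 16 B)" "A2_module (susp 10 (lmod P1))" "A2_module (susp 4 (lmod J7))"
      by (intro module_susp module_lmod MB ideals)+
    show "finite (gr (susp 10 (lmod P1)) n)" for n by (simp add: finite_gr_lmod)
    have ph: "A2_hom (susp 10 (lmod P1)) (susp 4 (lmod J7)) (\<lambda>x. x \<star> Sq 6)"
      by (rule lmod_mult_hom[OF _ _ Sq_homogeneous im]) simp_all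
    have "inj_on i (total B)"
    proof (rule inj_onI)
      fix x y assume xy: "x \<in> total B" "y \<in> total B" "i x = i y"
      then have "i (x + y) = 0" by (simp add: ia)
      then show "x = y" using inj[OF total_add] xy add_eq_0 by blast
    qed
    then show "short_exact (susp 16 B) i (susp 10 (lmod P1)) (\<lambda>x. x \<star> Sq 6) (susp 4 (lmod J7))"
      unfolding short_exact_def using hom ph ker onto by auto
  qed
  then show ?thesis by blast
qed

section \<open>The tower on the ideal\<close>

definition low :: "nat \<Rightarrow> steenrod \<Rightarrow> bool" where
  "low n w \<longleftrightarrow> (\<forall>m. mdeg m < n \<longrightarrow> w m = 0)"

lemma low_0 [simp]: "low n 0"
  by (simp add: low_def zero_fun_apply)

lemma low_add: "low n v \<Longrightarrow> low n w \<Longrightarrow> low n (v + w)"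
  by (simp add: low_def plus_fun_apply)

lemma low_Sq [simp]: "n \<le> k \<Longrightarrow> low n (Sq k)"
  by (auto simp: low_def Sq_def mdeg_xi_mono)

lemma low_homogeneous: "st_homogeneous k w \<Longrightarrow> n \<le> k \<Longrightarrow> low n w"
  unfolding low_def st_homogeneous_def by (metis leD)

lemma low_mult: "low n w \<Longrightarrow> low n (c \<star> w)"
  unfolding low_def
proof (intro allI impI)
  fix m assume w: "\<forall>m. mdeg m < n \<longrightarrow> w m = 0" and m: "mdeg m < n"
  have "c p * w q = 0" if "(p, q) \<in> Poly_Mapping.keys (psi_mono m)" for p q
    using psi_mono_homogeneous[OF that] w m by simp
  then show "(c \<star> w) m = 0" unfolding st_mult_def by (intro sum.neutral) auto
qed

text \<open>In the lowest degree of \<open>w\<close> only the unit component of \<open>a\<close> can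
  contribute.\<close>

lemma low_top: "low n w \<Longrightarrow> mdeg m = n \<Longrightarrow> (a \<star> w) m = augmentation a * w m"
proof -
  assume w: "low n w" and m: "mdeg m = n"
  have *: "(a \<star> w) m = 0" if "augmentation a = 0" for a
  proof -
    have "a p * w q = 0" if pq: "(p, q) \<in> Poly_Mapping.keys (psi_mono m)" for p q
    proof (cases "mdeg q < n")
      case True then show ?thesis using w by (simp add: low_def)
    next
      case False
      then have "p = 0" using psi_mono_homogeneous[OF pq] m by (simp flip: mdeg_eq_0)
      then show ?thesis using \<open>augmentation a = 0\<close> by (simp add: augmentation_def)
    qed
    then show ?thesis unfolding st_mult_def by (intro sum.neutral) auto
  qed
  show ?thesis
  proof (cases "augmentation a = 0")
    case True then show ?thesis using * by simp
  next
    case False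
    then have "augmentation (a + Sq 0) = 0" using augmentation_Sq[of 0] by (simp add: augmentation_def plus_fun_apply)
    then have "((a + Sq 0) \<star> w) m = 0" by (rule *)
    then have "(a \<star> w) m + w m = 0" by (simp add: st_mult_add_left plus_fun_apply)
    then have "(a \<star> w) m = w m" by (metis bit_eq_iff_add)
    then show ?thesis using False by simp
  qed
qed

lemma low_ideal: "y \<in> ideal \<Longrightarrow> low 4 y"
  by (erule idealE) (auto intro!: low_add low_mult low_homogeneous[OF Sq51_homogeneous])

text \<open>Extracts the components of degree below 7 of a coefficient \<open>a\<close> in
  \<open>a \<star> Sq 4 + b \<star> (Sq 5 \<star> Sq 1)\<close>; these are well-defined by
  \<open>trunc_check\<close>, although \<open>a\<close> is not.\<close>

definition lift7 :: "steenrod \<Rightarrow> steenrod" where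
  "lift7 = apply_rows (\<lambda>t. if tdeg t < 7 then row trunc_tab t else [])"

lemma lift7_A2 [simp]: "lift7 y \<in> A2"
  by (simp add: lift7_def apply_rows_A2)

lemma lift7_tri: "boxed t \<Longrightarrow> lift7 y (tri t) = (if tdeg t < 7 then ev y (row trunc_tab t) else 0)"
  by (simp add: lift7_def apply_rows_tri)

lemma A2_outside: "x \<in> A2 \<Longrightarrow> m \<notin> box \<Longrightarrow> x m = 0"
  unfolding A2_Box Box_def by blast

lemma A2_fun_eqI: "x \<in> A2 \<Longrightarrow> y \<in> A2 \<Longrightarrow> (\<And>t. boxed t \<Longrightarrow> x (tri t) = y (tri t)) \<Longrightarrow> x = y"
  using Box_eqI unfolding A2_Box by blast

lemma lift7_add: "lift7 (x + y) = lift7 x + lift7 y"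
  by (rule A2_fun_eqI) (simp_all add: lift7_tri ev_add plus_fun_apply)

lemma lift7_low:
  assumes "a \<in> A2" "b \<in> A2"
  shows "low 7 (lift7 (a \<star> Sq 4 + b \<star> (Sq 5 \<star> Sq 1)) + a)"
  unfolding low_def
proof (intro allI impI)
  fix m assume m: "mdeg m < 7"
  let ?y = "a \<star> Sq 4 + b \<star> (Sq 5 \<star> Sq 1)"
  show "(lift7 ?y + a) m = 0"
  proof (cases "m \<in> box")
    case True
    then obtain t where t: "boxed t" "m = tri t" using box_tri by blast
    then show ?thesis using m trunc[OF assms t(1)] by (simp add: plus_fun_apply lift7_tri mdeg_tri)
  next
    case False
    then show ?thesis using A2_outside[OF lift7_A2] A2_outside[OF assms(1)] by (simp add: plus_fun_apply)
  qed
qed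

text \<open>\<open>c \<star> a\<close> is a coefficient for \<open>c \<star> y\<close>, so the
  truncation respects the action below degree 7; the first possible defect is in degree 7, where the
  cocycle is read off.\<close>

lemma lift7_act:
  assumes "c \<in> A2" "y \<in> ideal"
  shows "low 7 (c \<star> lift7 y + lift7 (c \<star> y))"
proof -
  obtain a b where ab: "a \<in> A2" "b \<in> A2" and y: "y = a \<star> Sq 4 + b \<star> (Sq 5 \<star> Sq 1)" using assms(2) by (rule idealE)
  have cy: "c \<star> y = (c \<star> a) \<star> Sq 4 + (c \<star> b) \<star> (Sq 5 \<star> Sq 1)" by (simp add: y st_mult_add_right st_mult_assoc)
  have "low 7 (c \<star> (lift7 y + a) + (lift7 (c \<star> y) + c \<star> a))"
    unfolding cy unfolding y by (intro low_add low_mult lift7_low ab A2_mult assms(1))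
  moreover have "c \<star> (lift7 y + a) + (lift7 (c \<star> y) + c \<star> a) = c \<star> lift7 y + lift7 (c \<star> y)"
  proof
    fix m
    show "(c \<star> (lift7 y + a) + (lift7 (c \<star> y) + c \<star> a)) m = (c \<star> lift7 y + lift7 (c \<star> y)) m"
      by (cases "(c \<star> a) m") (simp_all add: st_mult_add_right plus_fun_apply)
  qed
  ultimately show ?thesis by simp
qed

lemma trunc_deg_check: "list_all (\<lambda>(t, l). list_all (\<lambda>s. tdeg s = tdeg t + 4) l) trunc_tab"
  by code_simp

lemma trunc_deg: "s \<in> set (row trunc_tab t) \<Longrightarrow> tdeg s = tdeg t + 4"
proof -
  assume s: "s \<in> set (row trunc_tab t)"
  then obtain l where l: "map_of trunc_tab t = Some l" "s \<in> set l" unfolding row_def by (cases "map_of trunc_tab t") auto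
  then have "(t, l) \<in> set trunc_tab" by (simp add: map_of_SomeD)
  then show ?thesis using trunc_deg_check l(2) unfolding list_all_iff by fastforce
qed

lemma lift7_degree: "st_homogeneous d y \<Longrightarrow> lift7 y m \<noteq> 0 \<Longrightarrow> mdeg m + 4 = d"
proof -
  assume y: "st_homogeneous d y" and nz: "lift7 y m \<noteq> 0"
  then have "m \<in> box" using A2_outside[OF lift7_A2] by blast
  then obtain t where t: "boxed t" "m = tri t" using box_tri by blast
  have "ev y l = 0" if "\<forall>s\<in>set l. y (tri s) = 0" for l using that by (induction l) auto
  then obtain s where "s \<in> set (row trunc_tab t)" "y (tri s) \<noteq> 0"
    using nz t lift7_tri[OF t(1), of y] by (metis (full_types))
  then show ?thesis using trunc_deg[of s t] y t by (auto simp: st_homogeneous_def mdeg_tri)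
qed

abbreviation "x7 \<equiv> xi_mono 1 7"

lemma lift7_x7: "lift7 y x7 = 0"
proof -
  have "x7 = tri (7, 0, 0)" "boxed (7, 0, 0)" by (simp_all add: tri_def boxed_def xi_mono_def)
  then show ?thesis using lift7_tri[of "(7, 0, 0)"] by (simp add: tdeg_def)
qed

text \<open>Measures how \<open>lift7\<close> fails to be linear: \<open>lift7 (a \<star> y)\<close>
  has no component in degree 7, while \<open>a \<star> lift7 y\<close> may have one. The coefficient
  of \<open>Sq 7\<close> is taken because \<open>Sq 7\<close> generates the annihilator of
  \<open>Sq 4\<close>; the internal degree is 7 + 4 = 11.\<close>

definition tower0 :: "steenrod cochain" where
  "tower0 as y = (case as of [a] \<Rightarrow> if a \<in> A2 \<and> y \<in> ideal then (a \<star> lift7 y) x7 else 0 | _ \<Rightarrow> 0)"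

lemma tower0_simps: "tower0 [] y = 0" "tower0 (a # b # as) y = 0"
  "a \<in> A2 \<Longrightarrow> y \<in> ideal \<Longrightarrow> tower0 [a] y = (a \<star> lift7 y) x7"
  by (simp_all add: tower0_def)

lemma tower0_nonzero: "tower0 as y \<noteq> 0 \<Longrightarrow> \<exists>a. as = [a] \<and> a \<in> A2 \<and> y \<in> ideal \<and> tower0 as y = (a \<star> lift7 y) x7"
  by (auto simp: tower0_def split: list.splits if_splits)

lemma ideal_act: "a \<in> A2 \<Longrightarrow> y \<in> ideal \<Longrightarrow> a \<star> y \<in> ideal"
  and ideal_add: "x \<in> ideal \<Longrightarrow> y \<in> ideal \<Longrightarrow> x + y \<in> ideal"
  using left_ideal_ideal unfolding left_ideal_def by blast+

lemma tower0_cochain: "tower0 \<in> cochains (lmod ideal) 1 11"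
  unfolding cochains_iff
proof (intro conjI)
  show "supported (lmod ideal) 1 tower0"
    unfolding supported_def using tower0_nonzero by fastforce
  have slot: "tower0 (as @ (a + b) # bs) x = tower0 (as @ a # bs) x + tower0 (as @ b # bs) x"
    if "a \<in> A2" "b \<in> A2" "x \<in> ideal" for as a b bs x
  proof -
    consider "as = [] \<and> bs = []" | c cs where "as = c # cs" | c cs where "as = []" "bs = c # cs" by (cases as; cases bs) auto
    then show ?thesis
    proof cases
      case 1 then show ?thesis using that by (simp add: tower0_simps st_mult_add_left plus_fun_apply)
    next
      case 2 then show ?thesis by (cases cs) (simp_all add: tower0_simps)
    next
      case 3 then show ?thesis by (simp add: tower0_simps)
    qed
  qed
  have add: "tower0 as (x + y) = tower0 as x + tower0 as y" if "set as \<subseteq> A2" "x \<in> ideal" "y \<in> ideal" for as x y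
  proof -
    consider "as = []" | a where "as = [a]" | a b bs where "as = a # b # bs" by (cases as rule: remdups_adj.cases)
    then show ?thesis
    proof cases
      case 2
      then show ?thesis using that ideal_add[of x y] by (simp add: tower0_simps lift7_add st_mult_add_right plus_fun_apply)
    qed (simp_all add: tower0_simps)
  qed
  show "multilinear (lmod ideal) tower0"
    unfolding multilinear_def total_lmod[OF left_ideal_ideal] using slot add by blast
  show "concentrated (lmod ideal) 11 tower0"
    unfolding concentrated_def
  proof (intro allI impI)
    fix as ks x n assume *: "set as \<subseteq> A2 \<and> list_all2 st_homogeneous ks as \<and> x \<in> gr (lmod ideal) n \<and> tower0 as x \<noteq> 0"
    then obtain a where a: "as = [a]" "tower0 as x = (a \<star> lift7 x) x7" using tower0_nonzero by blast
    then obtain k where k: "ks = [k]" "st_homogeneous k a" using * by (auto simp: list_all2_Cons2)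
    have nz: "(a \<star> lift7 x) x7 \<noteq> 0" using * a by simp
    have nz': "lift7 x \<noteq> 0"
    proof
      assume "lift7 x = 0"
      then have "a \<star> lift7 x = 0" using st_mult_add_right[of a 0 0] by simp
      then show False using nz by (simp add: zero_fun_apply)
    qed
    then obtain m where m: "lift7 x m \<noteq> 0" by (metis ext zero_fun_apply)
    have "x \<noteq> 0"
    proof
      assume "x = 0"
      then have "lift7 x = 0" using lift7_add[of 0 0] by simp
      then show False using nz' by simp
    qed
    then obtain d where d: "n = int d" "st_homogeneous d x" using * by (metis gr_lmodE)
    have "st_homogeneous (d - 4) (lift7 x)" unfolding st_homogeneous_def using lift7_degree[OF d(2)] by fastforce
    from st_homogeneous_mult[OF k(2) this] have "mdeg x7 = k + (d - 4)" using nz unfolding st_homogeneous_def by blast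
    then show "int (sum_list ks) + n = 11" using lift7_degree[OF d(2) m] by (simp add: k d mdeg_xi_mono)
  qed
qed

lemma module_ideal: "module (lmod ideal)"
  by unfold_locales (simp add: module_lmod)

lemma tower0_cocycle: "tower0 \<in> cocycles (lmod ideal) 1 11"
  unfolding cocycles_iff
proof
  show "tower0 \<in> cochains (lmod ideal) 1 11" by (rule tower0_cochain)
  show "coboundary_map (lmod ideal) tower0 = 0"
  proof (rule cochain_eqI[OF module.coboundary_cochains[OF module_ideal tower0_cochain] cochains_0])
    fix as y assume as: "set as \<subseteq> A2" and y: "y \<in> total (lmod ideal)"
    then have y: "y \<in> ideal" by simp
    consider "as = []" | a where "as = [a]" | a b where "as = [a, b]" | a b c cs where "as = a # b # c # cs"
      by (metis neq_Nil_conv)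
    then have "coboundary_map (lmod ideal) tower0 as y = 0"
    proof cases
      case 1 then show ?thesis by (simp add: coboundary_map_eq)
    next
      case 2 then show ?thesis using as y by (simp add: coboundary_map_Cons tower0_simps)
    next
      case (3 a b)
      have ab: "a \<in> A2" "b \<in> A2" using as 3 by auto
      \<comment> \<open>The defect of \<open>lift7\<close> starts in degree 7, so there
        \<open>a\<close> acts on it through its augmentation; with \<open>lift7_x7\<close> this is
        the cocycle identity.\<close>
      have "(a \<star> (b \<star> lift7 y + lift7 (b \<star> y))) x7 = augmentation a * (b \<star> lift7 y + lift7 (b \<star> y)) x7"
        by (rule low_top[OF lift7_act[OF ab(2) y]]) (simp add: mdeg_xi_mono)
      then have "(a \<star> b \<star> lift7 y) x7 + (a \<star> lift7 (b \<star> y)) x7 = augmentation a * (b \<star> lift7 y) x7"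
        by (simp add: st_mult_add_right plus_fun_apply lift7_x7 st_mult_assoc)
      moreover have "coboundary_map (lmod ideal) tower0 as y =
          augmentation a * (b \<star> lift7 y) x7 + ((a \<star> b \<star> lift7 y) x7 + (a \<star> lift7 (b \<star> y)) x7)"
        using ab y ideal_act[OF ab(2) y] by (simp add: 3 coboundary_map_Cons tower0_simps)
      ultimately show ?thesis by simp
    next
      case (4 a b c cs)
      have "(\<lambda>bs. tower0 (a # b # c # bs)) = (\<lambda>bs x. 0)" by (intro ext) (simp add: tower0_simps)
      then show ?thesis using as y by (cases cs) (simp_all add: 4 coboundary_map_Cons tower0_simps bdE_zero)
    qed
    then show "coboundary_map (lmod ideal) tower0 as y = 0 as y" by (simp add: zero_fun_apply)
  qed
qed

primrec tower :: "nat \<Rightarrow> steenrod cochain" where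
  "tower 0 = tower0"
| "tower (Suc j) = h0_cochain (tower j)"

lemma h0_0 [simp]: "h0_cochain 0 = 0"
  by (intro ext) (simp add: h0_cochain_eq zero_fun_apply)

lemma h0_cocycles: "A2_module M \<Longrightarrow> \<phi> \<in> cocycles M s t \<Longrightarrow> h0_cochain \<phi> \<in> cocycles M (s + 1) (t + 1)"
  unfolding cocycles_iff using module.coboundary_h0[of M \<phi> s t] h0_cochains[of \<phi> M s t] by (auto simp: module_def)

lemma h0_coboundaries: "A2_module M \<Longrightarrow> \<phi> \<in> coboundaries M s t \<Longrightarrow> h0_cochain \<phi> \<in> coboundaries M (s + 1) (t + 1)"
proof -
  assume M: "A2_module M" and "\<phi> \<in> coboundaries M s t"
  then obtain \<eta> where \<eta>: "\<eta> \<in> cochains M (s - 1) t" "\<phi> = coboundary_map M \<eta>" by (auto simp: coboundaries_iff)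
  interpret module M by unfold_locales (fact M)
  have "h0_cochain \<eta> \<in> cochains M (s + 1 - 1) (t + 1)" using h0_cochains[OF \<eta>(1)] by simp
  then show ?thesis using coboundary_h0[OF \<eta>(1)] \<eta>(2) unfolding coboundaries_iff by metis
qed

lemma tower_cocycles: "tower j \<in> cocycles (lmod ideal) (1 + int j) (11 + int j)"
proof (induction j)
  case 0 show ?case using tower0_cocycle by simp
next
  case (Suc j)
  from h0_cocycles[OF module_lmod[OF left_ideal_ideal] this] show ?case by (simp add: ac_simps)
qed

abbreviation "z10 \<equiv> Sq 6 \<star> Sq 4"

text \<open>\<open>Sq 1 \<star> Sq 6 \<star> Sq 4 = Sq 7 \<star> Sq 4 = 0\<close>, so evaluation at
  \<open>z10\<close> depends on classes only. Its preimage \<open>Sq 6\<close> in the free module is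
  sent by \<open>Sq 1\<close> to the generator \<open>Sq 7\<close> of J.\<close>

lemma z10: "z10 \<in> N4" "z10 \<in> ideal" "Sq 1 \<star> z10 = 0"
proof -
  show "z10 \<in> N4" by (rule lidI) simp
  then show "z10 \<in> ideal" using N4_ideal by blast
  show "Sq 1 \<star> z10 = 0" by (simp add: Sq_relations(6,7) flip: st_mult_assoc)
qed

lemma h0_Sq1s: "h0_cochain \<phi> (Sq1s (Suc n)) x = \<phi> (Sq1s n) x"
  by (simp add: h0_cochain_eq xi1_coeff_Sq1)

text \<open>\<open>lift7 z10\<close> agrees with \<open>Sq 6\<close> below degree 7, and
  \<open>Sq 1 \<star> Sq 6 = Sq 7\<close> has coefficient 1; each \<open>h0_cochain\<close> then
  absorbs one more entry \<open>Sq 1\<close>.\<close>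

lemma tower_z: "tower j (Sq1s (Suc j)) z10 = 1"
proof (induction j)
  case 0
  have "low 7 (lift7 (Sq 6 \<star> Sq 4 + 0 \<star> (Sq 5 \<star> Sq 1)) + Sq 6)" by (rule lift7_low) (simp_all add: left_ideal_A2[unfolded left_ideal_def])
  moreover have "0 \<star> (Sq 5 \<star> Sq 1) = 0" using st_mult_add_left[of 0 0 "Sq 5 \<star> Sq 1"] by simp
  ultimately have "low 7 (lift7 z10 + Sq 6)" by simp
  from low_top[OF this, of x7 "Sq 1"] have "(Sq 1 \<star> lift7 z10 + Sq 1 \<star> Sq 6) x7 = 0"
    by (simp add: mdeg_xi_mono st_mult_add_right augmentation_Sq)
  then have "(Sq 1 \<star> lift7 z10) x7 + 1 = 0" by (simp add: Sq_relations(7) plus_fun_apply Sq_def[of 7])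
  then have "(Sq 1 \<star> lift7 z10) x7 = 1" by (metis bit_eq_iff_add)
  then show ?case using z10(2) by (simp add: tower0_simps)
next
  case (Suc j)
  then show ?case unfolding tower.simps h0_Sq1s .
qed

text \<open>The coefficient of \<open>Sq 4\<close>. The ideal starts in degree 4, so this is a
  cocycle by \<open>low_top\<close>.\<close>

definition e4 :: "steenrod cochain" where
  "e4 as y = (if as = [] \<and> y \<in> ideal then y (xi_mono 1 4) else 0)"

lemma e4_cochain: "e4 \<in> cochains (lmod ideal) 0 4"
  unfolding cochains_iff
proof (intro conjI)
  show "supported (lmod ideal) 0 e4" unfolding supported_def e4_def by simp
  have slot: "e4 (as @ (a + b) # bs) x = e4 (as @ a # bs) x + e4 (as @ b # bs) x" for as a b bs x by (simp add: e4_def)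
  have add: "e4 as (x + y) = e4 as x + e4 as y" if "x \<in> ideal" "y \<in> ideal" for as x y
    using that ideal_add[OF that] by (simp add: e4_def plus_fun_apply)
  show "multilinear (lmod ideal) e4"
    unfolding multilinear_def total_lmod[OF left_ideal_ideal] using slot add by blast
  show "concentrated (lmod ideal) 4 e4"
    unfolding concentrated_def
  proof (intro allI impI)
    fix as ks x n assume *: "set as \<subseteq> A2 \<and> list_all2 st_homogeneous ks as \<and> x \<in> gr (lmod ideal) n \<and> e4 as x \<noteq> 0"
    then have as: "as = []" and x: "x (xi_mono 1 4) \<noteq> 0" by (auto simp: e4_def split: if_splits)
    then have "int (mdeg (xi_mono 1 4)) = n" using * unfolding gr_lmod by blast
    moreover have "ks = []" using * as by simp
    ultimately show "int (sum_list ks) + n = 4" by (simp add: mdeg_xi_mono)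
  qed
qed

lemma e4_cocycle: "e4 \<in> cocycles (lmod ideal) 0 4"
  unfolding cocycles_iff
proof
  show "e4 \<in> cochains (lmod ideal) 0 4" by (rule e4_cochain)
  show "coboundary_map (lmod ideal) e4 = 0"
  proof (rule cochain_eqI[OF module.coboundary_cochains[OF module_ideal e4_cochain] cochains_0])
    fix as y assume as: "set as \<subseteq> A2" and y: "y \<in> total (lmod ideal)"
    then have y: "y \<in> ideal" by simp
    consider "as = []" | a where "as = [a]" | a b bs where "as = a # b # bs" by (cases as rule: remdups_adj.cases)
    then have "coboundary_map (lmod ideal) e4 as y = 0"
    proof cases
      case 1 then show ?thesis by (simp add: coboundary_map_eq)
    next
      case (2 a)
      have "(a \<star> y) (xi_mono 1 4) = augmentation a * y (xi_mono 1 4)"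
        by (rule low_top[OF low_ideal[OF y]]) (simp add: mdeg_xi_mono)
      then show ?thesis using as y ideal_act[of a y] by (simp add: 2 coboundary_map_Cons e4_def)
    next
      case (3 a b bs)
      have "(\<lambda>cs. e4 (a # cs)) = (\<lambda>cs x. 0)" by (intro ext) (simp add: e4_def)
      moreover have "e4 (c # cs) x = 0" for c cs x by (simp add: e4_def)
      ultimately show ?thesis using as y by (simp add: 3 coboundary_map_Cons bdE_zero)
    qed
    then show "coboundary_map (lmod ideal) e4 as y = 0 as y" by (simp add: zero_fun_apply)
  qed
qed

lemma e4_Sq4: "e4 [] (Sq 4) = 1"
  using N4_ideal lid_self[of "Sq 4"] by (auto simp: e4_def Sq_def)

text \<open>The functional detecting the tower (and the class in bidegree \<open>(0, 4)\<close>).\<close>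

definition det :: "nat \<Rightarrow> steenrod cochain \<Rightarrow> bit" where
  "det n \<phi> = \<phi> (Sq1s n) (if n = 0 then Sq 4 else z10)"

lemma det_add: "det n (\<phi> + \<psi>) = det n \<phi> + det n \<psi>" and det_0 [simp]: "det n 0 = 0"
  by (simp_all add: det_def plus_fun_apply zero_fun_apply)

lemma det_coboundary:
  assumes "left_ideal S" "z10 \<in> S" "\<phi> \<in> coboundaries (lmod S) (int n) t"
  shows "det n \<phi> = 0"
proof (cases n)
  case 0 then show ?thesis using coboundaries_nonpositive[of 0 \<phi> "lmod S" t] assms by simp
next
  case (Suc m)
  have "0 \<in> S" using assms(1) by (simp add: left_ideal_def)
  then show ?thesis using coboundaries_Sq1s[OF assms(3), of z10] assms(1,2) z10(3) by (simp add: det_def Suc)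
qed

lemma det_tower: "det (Suc j) (tower j) = 1"
  unfolding det_def using tower_z[of j] by simp

text \<open>A cochain concentrated in one internal degree can be nonzero on the test tuple only in
  the bidegrees of the class dual to \<open>Sq 4\<close> and of the tower.\<close>

lemma det_degree:
  assumes "left_ideal S" "z10 \<in> S" "Sq 4 \<in> S" "\<phi> \<in> cochains (lmod S) (int n) t" "det n \<phi> \<noteq> 0"
  shows "t = (if n = 0 then 4 else int n + 10)"
proof -
  have c: "concentrated (lmod S) t \<phi>" using assms(4) by (simp add: cochains_iff)
  define g where "g = (if n = 0 then Sq 4 else z10)"
  define d where "d = (if n = 0 then 4 else 10 :: nat)"
  have "st_homogeneous (6 + 4) z10" by (intro st_homogeneous_mult Sq_homogeneous)
  then have "st_homogeneous d g" by (simp add: g_def d_def Sq_homogeneous)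
  then have "g \<in> gr (lmod S) (int d)" using assms(2,3) by (simp add: gr_lmod_homogeneous g_def)
  moreover have "list_all2 st_homogeneous (replicate n 1) (Sq1s n)" by (simp add: list_all2_conv_all_nth Sq_homogeneous)
  moreover have "\<phi> (Sq1s n) g \<noteq> 0" using assms(5) by (simp add: det_def g_def)
  ultimately have "int (sum_list (replicate n (1::nat))) + int d = t"
    using c set_Sq1s unfolding concentrated_def by blast
  then show ?thesis by (auto simp: d_def sum_list_replicate split: if_splits)
qed

section \<open>Splicing the three long exact sequences\<close>

locale three = s1: ses "lmod N4" "\<lambda>x. x" "lmod ideal" f "susp 6 M" +
  s2: ses "susp 4 (lmod J7)" "\<lambda>x. x" "free 4" "\<lambda>x. x \<star> Sq 4" "lmod N4" +
  s3: ses "susp 16 B" i "susp 10 (lmod P1)" "\<lambda>x. x \<star> Sq 6" "susp 4 (lmod J7)"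
  for f and M :: "'m::ab_group_add gmod" and B :: "'b::ab_group_add gmod" and i
begin

abbreviation "res \<equiv> pull (lmod N4) (\<lambda>x. x)"

lemma res_cocycles: "\<phi> \<in> cocycles (lmod ideal) s t \<Longrightarrow> res \<phi> \<in> cocycles (lmod N4) s t"
  by (rule pull_cocycles[OF s1.L s1.M s1.i_hom])

lemma res_coboundaries: "\<phi> \<in> coboundaries (lmod ideal) s t \<Longrightarrow> res \<phi> \<in> coboundaries (lmod N4) s t"
  by (rule pull_coboundaries[OF s1.L s1.M s1.i_hom])

definition "inc \<kappa> = s2.delta (s3.delta \<kappa>)"

lemma inc_add: "inc (\<kappa> + \<kappa>') = inc \<kappa> + inc \<kappa>'"
  by (simp add: inc_def s2.delta_add s3.delta_add)

lemma inc_0 [simp]: "inc 0 = 0"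
  using inc_add[of 0 0] by simp

lemma inc_cocycles: "\<kappa> \<in> cocycles (susp 16 B) s t \<Longrightarrow> inc \<kappa> \<in> cocycles (lmod N4) (s + 2) t"
  using s2.delta_cocycles(1)[OF s3.delta_cocycles(1), of \<kappa> s t] by (simp add: inc_def add.assoc)

lemma inc_coboundaries: "\<kappa> \<in> coboundaries (susp 16 B) s t \<Longrightarrow> inc \<kappa> \<in> coboundaries (lmod N4) (s + 2) t"
  using s2.delta_coboundaries[OF s3.delta_coboundaries, of \<kappa> s t] by (simp add: inc_def add.assoc)

lemma cocycles_negative: "s < 0 \<Longrightarrow> \<phi> \<in> cocycles K s t \<Longrightarrow> \<phi> = 0"
  unfolding cocycles_iff using cochains_negative by blast

lemma det_delta2: "\<psi> \<in> cocycles (susp 4 (lmod J7)) s t \<Longrightarrow> det (Suc n) (s2.delta \<psi>) = \<psi> (Sq1s n) (Sq 7)"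
  using s2.delta_Sq1s[of \<psi> s t "Sq 6" "Sq 7" n] lid_self[of "Sq 7"] by (simp add: det_def total_free Sq_relations(7))

lemma pull_Sq6: "pull (susp 10 (lmod P1)) (\<lambda>x. x \<star> Sq 6) \<psi> (Sq1s n) (Sq 1) = \<psi> (Sq1s n) (Sq 7)"
  using lid_self[of "Sq 1"] by (simp add: pull_eq Sq_relations(7))

lemma P1_coboundary: "\<psi> \<in> coboundaries (susp 10 (lmod P1)) (int n) t \<Longrightarrow> \<psi> (Sq1s n) (Sq 1) = 0"
  using coboundaries_Sq1s[of \<psi> "susp 10 (lmod P1)" n t "Sq 1"] lid_self[of "Sq 1"] by (simp add: Sq_relations(5))

text \<open>Through \<open>s2.delta\<close> the functional becomes evaluation at
  \<open>Sq 7\<close>, that is, evaluation at \<open>Sq 1\<close> after pulling back to P, where the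
  image of \<open>s3.delta\<close> consists of coboundaries. For \<open>n < 2\<close> the cochain
  \<open>\<kappa>\<close> has negative filtration.\<close>

lemma det_inc: "\<kappa> \<in> cocycles (susp 16 B) (int n - 2) t \<Longrightarrow> det n (inc \<kappa>) = 0"
proof (cases "n < 2")
  case True
  moreover assume "\<kappa> \<in> cocycles (susp 16 B) (int n - 2) t"
  ultimately have "\<kappa> = 0" by (intro cocycles_negative) auto
  then show ?thesis by simp
next
  case False
  then obtain k where n: "n = Suc (Suc k)" by (metis One_nat_def Suc_1 add_2_eq_Suc le_Suc_ex not_less)
  assume "\<kappa> \<in> cocycles (susp 16 B) (int n - 2) t"
  then have \<kappa>: "\<kappa> \<in> cocycles (susp 16 B) (int k) t" by (simp add: n)
  have \<psi>: "s3.delta \<kappa> \<in> cocycles (susp 4 (lmod J7)) (int (Suc k)) t" using s3.delta_cocycles(1)[OF \<kappa>] by (simp add: add.commute)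
  have "det n (inc \<kappa>) = s3.delta \<kappa> (Sq1s (Suc k)) (Sq 7)" unfolding inc_def n by (rule det_delta2[OF \<psi>])
  also have "\<dots> = pull (susp 10 (lmod P1)) (\<lambda>x. x \<star> Sq 6) (s3.delta \<kappa>) (Sq1s (Suc k)) (Sq 1)" by (rule pull_Sq6[symmetric])
  also have "\<dots> = 0"
    by (rule P1_coboundary[of _ _ t]) (use s3.p_delta[OF \<kappa>] in \<open>simp add: add.commute\<close>)
  finally show ?thesis .
qed

text \<open>Vanishing for the free module makes \<open>s2.delta\<close> surjective on classes in
  positive filtration; the value at \<open>Sq 7\<close> is recorded because it decides whether the
  tower is involved.\<close>

lemma lift2:
  assumes \<phi>: "\<phi> \<in> cocycles (lmod N4) (int (Suc m)) t"
  shows "\<exists>\<psi>\<in>cocycles (susp 4 (lmod J7)) (int m) t. \<phi> + s2.delta \<psi> \<in> coboundaries (lmod N4) (int (Suc m)) t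
    \<and> \<psi> (Sq1s m) (Sq 7) = det (Suc m) \<phi>"
proof -
  have "pull (free 4) (\<lambda>x. x \<star> Sq 4) \<phi> \<in> coboundaries (free 4) (int (Suc m)) t"
    by (rule free_vanishing[OF pull_cocycles[OF s2.M s2.N s2.p_hom \<phi>]]) simp
  from s2.exact_N[OF \<phi> this] obtain \<psi> where \<psi>: "\<psi> \<in> cocycles (susp 4 (lmod J7)) (int m) t"
    and b: "\<phi> + s2.delta \<psi> \<in> coboundaries (lmod N4) (int (Suc m)) t" by auto
  have "det (Suc m) \<phi> + det (Suc m) (s2.delta \<psi>) = 0"
    unfolding det_add[symmetric] by (rule det_coboundary[OF _ _ b]) (simp_all add: z10)
  then have "\<psi> (Sq1s m) (Sq 7) = det (Suc m) \<phi>" unfolding det_delta2[OF \<psi>] by (metis bit_eq_iff_add)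
  then show ?thesis using \<psi> b by blast
qed

text \<open>A cocycle with \<open>det\<close> equal to 0 comes from J with value 0 at
  \<open>Sq 7\<close>; pulled back to P it is a coboundary by \<open>tower_P\<close>, hence it comes
  from B. In filtration 0 a cocycle is determined by its value on the generator
  \<open>Sq 4\<close>.\<close>

lemma split:
  assumes \<phi>: "\<phi> \<in> cocycles (lmod N4) (int n) t" and 0: "det n \<phi> = 0"
  shows "\<exists>\<kappa>\<in>cocycles (susp 16 B) (int n - 2) t. \<phi> + inc \<kappa> \<in> coboundaries (lmod N4) (int n) t"
proof (cases n)
  case 0
  have "\<phi> = 0"
  proof (rule cocycle0_zeroI)
    show \<phi>0: "\<phi> \<in> cocycles (lmod N4) 0 t" using \<phi> 0 by simp
    fix x assume "x \<in> total (lmod N4)"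
    then have "x \<in> N4" by simp
    then obtain a where "a \<in> A2" "x = a \<star> Sq 4" unfolding lid_def by blast
    then show "\<phi> [] x = 0"
      using cocycle0_act[OF s1.L \<phi>0, of a "Sq 4"] lid_self[of "Sq 4"] assms(2) by (simp add: det_def 0)
  qed
  then show ?thesis by (intro bexI[of _ 0]) simp_all
next
  case (Suc m)
  obtain \<psi> where \<psi>: "\<psi> \<in> cocycles (susp 4 (lmod J7)) (int m) t"
    and b: "\<phi> + s2.delta \<psi> \<in> coboundaries (lmod N4) (int n) t" and z: "\<psi> (Sq1s m) (Sq 7) = 0"
    using lift2[of \<phi> m t] assms unfolding Suc by auto
  have "pull (susp 10 (lmod P1)) (\<lambda>x. x \<star> Sq 6) \<psi> \<in> coboundaries (susp 10 (lmod P1)) (int m) t"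
    by (rule tower_P[OF pull_cocycles[OF s3.M s3.N s3.p_hom \<psi>]]) (simp only: pull_Sq6 z)
  from s3.exact_N[OF \<psi> this] obtain \<kappa> where \<kappa>: "\<kappa> \<in> cocycles (susp 16 B) (int m - 1) t"
    and b': "\<psi> + s3.delta \<kappa> \<in> coboundaries (susp 4 (lmod J7)) (int m) t" by blast
  have "s2.delta (\<psi> + s3.delta \<kappa>) \<in> coboundaries (lmod N4) (int n) t"
    using s2.delta_coboundaries[OF b'] by (simp add: Suc add.commute)
  from coboundaries_add[OF b this] have "\<phi> + inc \<kappa> \<in> coboundaries (lmod N4) (int n) t"
    by (simp add: s2.delta_add inc_def add.assoc)
  then show ?thesis using \<kappa> by (intro bexI[of _ \<kappa>]) (simp_all add: Suc)
qed

text \<open>A class killed by the composite is restricted from P. The Ext of P is a tower, and its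
  classes are pulled back from J, because the explicit tower on the ideal restricts to N with
  nonzero \<open>det\<close>; classes pulled back from J restrict to 0 on B.\<close>

lemma inc_inj:
  assumes \<kappa>: "\<kappa> \<in> cocycles (susp 16 B) s t" and b: "inc \<kappa> \<in> coboundaries (lmod N4) (s + 2) t"
  shows "\<kappa> \<in> coboundaries (susp 16 B) s t"
proof (cases "s < 0")
  case True then show ?thesis using cocycles_negative[OF True \<kappa>] by simp
next
  case False
  then obtain n where s: "s = int n" by (metis nonneg_int_cases not_less)
  have \<psi>: "s3.delta \<kappa> \<in> cocycles (susp 4 (lmod J7)) (s + 1) t" by (rule s3.delta_cocycles(1)[OF \<kappa>])
  have "s2.delta (s3.delta \<kappa>) \<in> coboundaries (lmod N4) (s + 1 + 1) t" using b by (simp add: inc_def add.assoc)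
  from s2.exact_L[OF \<psi> this] obtain \<theta> where \<theta>: "\<theta> \<in> cocycles (free 4) (s + 1) t" "pull (susp 4 (lmod J7)) (\<lambda>x. x) \<theta> = s3.delta \<kappa>"
    by blast
  have "\<theta> \<in> coboundaries (free 4) (s + 1) t" by (rule free_vanishing[OF \<theta>(1)]) (simp add: s)
  from pull_coboundaries[OF s2.L s2.M s2.i_hom this] have "s3.delta \<kappa> \<in> coboundaries (susp 4 (lmod J7)) (s + 1) t" by (simp only: \<theta>(2))
  from s3.exact_L[OF \<kappa> this] obtain \<eta> where \<eta>: "\<eta> \<in> cocycles (susp 10 (lmod P1)) s t" "pull (susp 16 B) i \<eta> = \<kappa>" by blast
  \<comment> \<open>\<open>\<eta>'\<close> has the same tower component as \<open>\<eta>\<close> but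
    restricts to 0 on B; so \<open>\<eta> + \<eta>'\<close> still restricts to
    \<open>\<kappa>\<close>, and it is a coboundary by \<open>tower_P\<close>.\<close>
  have "\<exists>\<eta>'\<in>cocycles (susp 10 (lmod P1)) s t. pull (susp 16 B) i \<eta>' = 0 \<and> \<eta>' (Sq1s n) (Sq 1) = \<eta> (Sq1s n) (Sq 1)"
  proof (cases "\<eta> (Sq1s n) (Sq 1) = 0")
    case True then show ?thesis by (intro bexI[of _ 0]) (simp_all add: zero_fun_apply)
  next
    case False
    have c: "concentrated (susp 10 (lmod P1)) t \<eta>" using \<eta>(1) by (simp add: cocycles_iff cochains_iff)
    have "Sq 1 \<in> gr (lmod P1) (int 1)" unfolding gr_lmod_homogeneous by (simp add: lid_self Sq_homogeneous)
    then have "Sq 1 \<in> gr (susp 10 (lmod P1)) 11" by simp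
    moreover have "list_all2 st_homogeneous (replicate n 1) (Sq1s n)" by (simp add: list_all2_conv_all_nth Sq_homogeneous)
    ultimately have "int (sum_list (replicate n (1::nat))) + 11 = t"
      using c set_Sq1s False unfolding concentrated_def by blast
    then have t: "t = 11 + int n" by (simp add: sum_list_replicate)
    have "res (tower n) \<in> cocycles (lmod N4) (int (Suc n)) t"
      using res_cocycles[OF tower_cocycles[of n]] by (simp add: t)
    from lift2[OF this] obtain \<psi> where \<psi>: "\<psi> \<in> cocycles (susp 4 (lmod J7)) (int n) t" "\<psi> (Sq1s n) (Sq 7) = det (Suc n) (res (tower n))"
      by blast
    moreover have "det (Suc n) (res (tower n)) = 1" using det_tower[of n] z10(1) by (simp add: det_def pull_eq)
    ultimately have v: "pull (susp 10 (lmod P1)) (\<lambda>x. x \<star> Sq 6) \<psi> (Sq1s n) (Sq 1) = 1" by (simp only: pull_Sq6)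
    have "pull (susp 16 B) i (pull (susp 10 (lmod P1)) (\<lambda>x. x \<star> Sq 6) \<psi>) = 0"
      by (rule s3.i_pull_p[of _ s t]) (use \<psi>(1) in \<open>simp add: cocycles_iff s\<close>)
    moreover have "pull (susp 10 (lmod P1)) (\<lambda>x. x \<star> Sq 6) \<psi> \<in> cocycles (susp 10 (lmod P1)) s t"
      unfolding s by (rule pull_cocycles[OF s3.M s3.N s3.p_hom \<psi>(1)])
    moreover have "\<eta> (Sq1s n) (Sq 1) = 1" using False by (cases "\<eta> (Sq1s n) (Sq 1)") auto
    ultimately show ?thesis using v by (metis (no_types, lifting))
  qed
  then obtain \<eta>' where \<eta>': "\<eta>' \<in> cocycles (susp 10 (lmod P1)) s t" "pull (susp 16 B) i \<eta>' = 0"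
    "\<eta>' (Sq1s n) (Sq 1) = \<eta> (Sq1s n) (Sq 1)" by blast
  have "\<eta> + \<eta>' \<in> coboundaries (susp 10 (lmod P1)) s t"
    unfolding s by (rule tower_P) (use \<eta> \<eta>' s in \<open>simp_all add: cocycles_add plus_fun_apply\<close>)
  from pull_coboundaries[OF s3.L s3.M s3.i_hom this] show ?thesis by (simp add: pull_add \<eta>(2) \<eta>'(2))
qed

lemma det_res: "det n (res \<phi>) = det n \<phi>"
  using z10(1) lid_self[of "Sq 4"] by (simp add: det_def pull_eq)

text \<open>In filtration 1 a contribution of B would have filtration -1, so \<open>det\<close>
  decides the restriction to N, and the assumption on M leaves nothing beyond this
  restriction.\<close>

lemma ideal_1_11:
  assumes X: "cocycles (susp 6 M) 1 11 = {0}" and \<phi>: "\<phi> \<in> cocycles (lmod ideal) 1 11" and 0: "det 1 \<phi> = 0"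
  shows "\<phi> \<in> coboundaries (lmod ideal) 1 11"
proof -
  obtain \<kappa> where \<kappa>: "\<kappa> \<in> cocycles (susp 16 B) (int 1 - 2) 11" "res \<phi> + inc \<kappa> \<in> coboundaries (lmod N4) (int 1) 11"
    using split[of "res \<phi>" 1 11] res_cocycles[OF \<phi>] 0 det_res by auto
  have "\<kappa> = 0" by (rule cocycles_negative[OF _ \<kappa>(1)]) simp
  then have "res \<phi> \<in> coboundaries (lmod N4) 1 11" using \<kappa>(2) by simp
  from s1.exact_M[OF \<phi> this] show ?thesis using X by auto
qed

lemma ideal_0_4:
  assumes \<phi>: "\<phi> \<in> cocycles (lmod ideal) 0 4" and 0: "\<phi> [] (Sq 4) = 0"
  shows "\<phi> = 0"
proof (rule cocycle0_zeroI[OF \<phi>])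
  fix y assume "y \<in> total (lmod ideal)"
  then have "y \<in> ideal" by simp
  then obtain a b where ab: "a \<in> A2" "b \<in> A2" "y = a \<star> Sq 4 + b \<star> (Sq 5 \<star> Sq 1)" by (rule idealE)
  have 4: "Sq 4 \<in> ideal" using N4_ideal lid_self[of "Sq 4"] by blast
  have 6: "Sq 5 \<star> Sq 1 \<in> ideal" using idealI[of 0 "Sq 5 \<star> Sq 1"] lid_self[of "Sq 5 \<star> Sq 1"] by simp
  have c: "concentrated (lmod ideal) 4 \<phi>" and ml: "multilinear (lmod ideal) \<phi>" using \<phi> by (simp_all add: cocycles_iff cochains_iff)
  have "\<phi> [] (Sq 5 \<star> Sq 1) = 0"
  proof (rule ccontr)
    assume nz: "\<phi> [] (Sq 5 \<star> Sq 1) \<noteq> 0"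
    have "Sq 5 \<star> Sq 1 \<in> gr (lmod ideal) (int 6)" unfolding gr_lmod_homogeneous using 6 Sq51_homogeneous by simp
    then have "int (sum_list []) + int 6 = 4" using c nz unfolding concentrated_def by (metis empty_set empty_subsetI list.rel_intros(1))
    then show False by simp
  qed
  then have "\<phi> [] (b \<star> (Sq 5 \<star> Sq 1)) = 0" using cocycle0_act[OF s1.M \<phi> ab(2), of "Sq 5 \<star> Sq 1"] 6 by simp
  moreover have "\<phi> [] (a \<star> Sq 4) = 0" using cocycle0_act[OF s1.M \<phi> ab(1), of "Sq 4"] 4 0 by simp
  ultimately show "\<phi> [] y = 0"
    using multilinear_add[OF ml, of "[]" "a \<star> Sq 4" "b \<star> (Sq 5 \<star> Sq 1)"] ideal_act[OF ab(1) 4] ideal_act[OF ab(2) 6] by (simp add: ab(3))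
qed

end

text \<open>\<open>W\<close> abstracts the cocycles to be divided out: the coboundaries together
  with representatives of the class in bidegree (0, 4) and of the tower. \<open>W_det\<close> and
  \<open>W_ex\<close> make its restriction to N a complement of the image of \<open>inc\<close>,
  modulo coboundaries.\<close>

locale three_mod = three f M B i
  for f and M :: "'m::ab_group_add gmod" and B :: "'b::ab_group_add gmod" and i +
  fixes W :: "int \<Rightarrow> int \<Rightarrow> steenrod cochain set"
  assumes W_sub: "W s t \<subseteq> cocycles (lmod ideal) s t" and W_B: "coboundaries (lmod ideal) s t \<subseteq> W s t"
    and W_add: "\<phi> \<in> W s t \<Longrightarrow> \<psi> \<in> W s t \<Longrightarrow> \<phi> + \<psi> \<in> W s t"
    and W_det: "\<phi> \<in> W (int n) t \<Longrightarrow> det n \<phi> = 0 \<Longrightarrow> \<phi> \<in> coboundaries (lmod ideal) (int n) t"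
    and W_ex: "\<phi> \<in> cocycles (lmod N4) (int n) t \<Longrightarrow> det n \<phi> = 1 \<Longrightarrow> \<exists>\<tau>\<in>W (int n) t. det n \<tau> = 1"
begin

lemma W_0 [simp]: "0 \<in> W s t"
  using W_B coboundaries_0 by blast

definition Q1 where "Q1 \<chi> \<phi> \<longleftrightarrow> \<phi> = pull (lmod ideal) f \<chi>"
text \<open>The map to the Ext of B runs against \<open>inc\<close> and exists only modulo
  \<open>W\<close>, hence a relation; \<open>\<kappa>\<close> is determined up to a coboundary by
  \<open>W_inc\<close>.\<close>

definition Q2 where "Q2 s t \<phi> \<kappa> \<longleftrightarrow> (\<exists>\<tau>\<in>W (s + 2) t. res (\<phi> + \<tau>) + inc \<kappa> \<in> coboundaries (lmod N4) (s + 2) t)"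
definition Q3 where "Q3 \<kappa> \<chi> \<longleftrightarrow> \<chi> = s1.delta (inc \<kappa>)"

text \<open>A \<open>\<tau>\<close> in \<open>W\<close> with the same \<open>det\<close> is added,
  and the rest comes from B by \<open>split\<close>.\<close>

lemma decompose:
  assumes \<phi>: "\<phi> \<in> cocycles (lmod N4) (s + 2) t"
  shows "\<exists>\<tau>\<in>W (s + 2) t. \<exists>\<kappa>\<in>cocycles (susp 16 B) s t. \<phi> + res \<tau> + inc \<kappa> \<in> coboundaries (lmod N4) (s + 2) t"
proof (cases "s + 2 < 0")
  case True
  then have "\<phi> = 0" using cocycles_negative[OF True \<phi>] by simp
  then show ?thesis by (intro bexI[of _ 0] bexI[of _ 0]) simp_all
next
  case False
  then obtain n where s: "s + 2 = int n" by (metis nonneg_int_cases not_less)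
  have \<phi>: "\<phi> \<in> cocycles (lmod N4) (int n) t" using assms by (simp add: s)
  obtain \<tau> where \<tau>: "\<tau> \<in> W (int n) t" "det n \<tau> = det n \<phi>"
  proof (cases "det n \<phi> = 0")
    case True then show ?thesis using that[of 0] by simp
  next
    case False
    then have "det n \<phi> = 1" by (cases "det n \<phi>") auto
    then show ?thesis using that W_ex[OF \<phi>] by metis
  qed
  have "\<phi> + res \<tau> \<in> cocycles (lmod N4) (int n) t" using \<phi> \<tau> W_sub by (intro cocycles_add res_cocycles) auto
  moreover have "det n (\<phi> + res \<tau>) = 0" by (simp add: det_add det_res \<tau>(2))
  ultimately obtain \<kappa> where "\<kappa> \<in> cocycles (susp 16 B) (int n - 2) t" "\<phi> + res \<tau> + inc \<kappa> \<in> coboundaries (lmod N4) (int n) t"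
    using split by blast
  moreover have "int n - 2 = s" using s by simp
  ultimately show ?thesis unfolding s using \<tau> by auto
qed

text \<open>\<open>det\<close> vanishes on coboundaries and on the image of \<open>inc\<close>,
  hence on \<open>\<tau>\<close>; so the two parts of a decomposition of 0 are trivial
  separately.\<close>

lemma W_inc:
  assumes \<tau>: "\<tau> \<in> W (s + 2) t" and \<kappa>: "\<kappa> \<in> cocycles (susp 16 B) s t"
    and b: "res \<tau> + inc \<kappa> \<in> coboundaries (lmod N4) (s + 2) t"
  shows "\<tau> \<in> coboundaries (lmod ideal) (s + 2) t" "\<kappa> \<in> coboundaries (susp 16 B) s t"
proof -
  show \<tau>B: "\<tau> \<in> coboundaries (lmod ideal) (s + 2) t"
  proof (cases "s + 2 < 0")
    case True
    have "\<tau> \<in> cocycles (lmod ideal) (s + 2) t" using \<tau> W_sub by blast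
    then have "\<tau> = 0" by (rule cocycles_negative[OF True])
    then show ?thesis by simp
  next
    case False
    then obtain n where s: "s + 2 = int n" by (metis nonneg_int_cases not_less)
    then have \<kappa>': "\<kappa> \<in> cocycles (susp 16 B) (int n - 2) t" using \<kappa> by (simp flip: s)
    have "det n (res \<tau> + inc \<kappa>) = 0"
      by (rule det_coboundary[of N4 _ _ t]) (use b s z10 in simp_all)
    then have "det n \<tau> = 0" by (simp add: det_add det_res det_inc[OF \<kappa>'])
    then show ?thesis using W_det \<tau> unfolding s by blast
  qed
  then have "res \<tau> \<in> coboundaries (lmod N4) (s + 2) t" by (rule res_coboundaries)
  then have "inc \<kappa> \<in> coboundaries (lmod N4) (s + 2) t" using coboundaries_cong[OF b] by blast
  then show "\<kappa> \<in> coboundaries (susp 16 B) s t" by (rule inc_inj[OF \<kappa>])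
qed

lemma Q1_total: "\<chi> \<in> cocycles (susp 6 M) s t \<Longrightarrow> \<exists>\<phi>\<in>cocycles (lmod ideal) s t. Q1 \<chi> \<phi>"
  using pull_cocycles[OF s1.M s1.N s1.p_hom] by (auto simp: Q1_def)

lemma Q1_add: "Q1 \<chi> \<phi> \<Longrightarrow> Q1 \<chi>' \<phi>' \<Longrightarrow> Q1 (\<chi> + \<chi>') (\<phi> + \<phi>')"
  by (simp add: Q1_def pull_add)

lemma Q1_ker: "\<chi> \<in> coboundaries (susp 6 M) s t \<Longrightarrow> Q1 \<chi> \<phi> \<Longrightarrow> \<phi> \<in> W s t"
  using pull_coboundaries[OF s1.M s1.N s1.p_hom, of \<chi> s t] W_B by (auto simp: Q1_def)

lemma Q2_total: "\<phi> \<in> cocycles (lmod ideal) (s + 2) t \<Longrightarrow> \<exists>\<kappa>\<in>cocycles (susp 16 B) s t. Q2 s t \<phi> \<kappa>"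
  using decompose[OF res_cocycles] unfolding Q2_def pull_add by blast

lemma Q2_add: "Q2 s t \<phi> \<kappa> \<Longrightarrow> Q2 s t \<phi>' \<kappa>' \<Longrightarrow> Q2 s t (\<phi> + \<phi>') (\<kappa> + \<kappa>')"
proof -
  assume "Q2 s t \<phi> \<kappa>" "Q2 s t \<phi>' \<kappa>'"
  then obtain \<tau> \<tau>' where t: "\<tau> \<in> W (s + 2) t" "\<tau>' \<in> W (s + 2) t" and b: "res (\<phi> + \<tau>) + inc \<kappa> \<in> coboundaries (lmod N4) (s + 2) t"
    "res (\<phi>' + \<tau>') + inc \<kappa>' \<in> coboundaries (lmod N4) (s + 2) t" unfolding Q2_def by blast
  have "res (\<phi> + \<phi>' + (\<tau> + \<tau>')) + inc (\<kappa> + \<kappa>') = (res (\<phi> + \<tau>) + inc \<kappa>) + (res (\<phi>' + \<tau>') + inc \<kappa>')"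
    by (simp add: pull_add inc_add ac_simps)
  then show ?thesis unfolding Q2_def using coboundaries_add[OF b] W_add[OF t] by metis
qed

lemma Q2_ker: "\<phi> \<in> W (s + 2) t \<Longrightarrow> \<kappa> \<in> cocycles (susp 16 B) s t \<Longrightarrow> Q2 s t \<phi> \<kappa> \<Longrightarrow> \<kappa> \<in> coboundaries (susp 16 B) s t"
  unfolding Q2_def using W_inc(2) W_add by blast

lemma Q3_total: "\<kappa> \<in> cocycles (susp 16 B) s t \<Longrightarrow> \<exists>\<chi>\<in>cocycles (susp 6 M) (s + 3) t. Q3 \<kappa> \<chi>"
  using s1.delta_cocycles(1)[OF inc_cocycles, of \<kappa> s t] by (simp add: Q3_def add.assoc)

lemma Q3_add: "Q3 \<kappa> \<chi> \<Longrightarrow> Q3 \<kappa>' \<chi>' \<Longrightarrow> Q3 (\<kappa> + \<kappa>') (\<chi> + \<chi>')"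
  by (simp add: Q3_def inc_add s1.delta_add)

lemma Q3_ker: "\<kappa> \<in> coboundaries (susp 16 B) s t \<Longrightarrow> Q3 \<kappa> \<chi> \<Longrightarrow> \<chi> \<in> coboundaries (susp 6 M) (s + 3) t"
  using s1.delta_coboundaries[OF inc_coboundaries, of \<kappa> s t] by (simp add: Q3_def add.assoc)

lemma res_f: "\<chi> \<in> cocycles (susp 6 M) s t \<Longrightarrow> res (pull (lmod ideal) f \<chi>) = 0"
  by (rule s1.i_pull_p[of _ s t]) (simp add: cocycles_iff)

lemma comp12: "\<chi> \<in> cocycles (susp 6 M) (s + 2) t \<Longrightarrow> \<kappa> \<in> cocycles (susp 16 B) s t \<Longrightarrow> Q1 \<chi> \<phi> \<Longrightarrow> Q2 s t \<phi> \<kappa> \<Longrightarrow>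
    \<kappa> \<in> coboundaries (susp 16 B) s t"
  unfolding Q1_def Q2_def using res_f W_inc(2) by (auto simp: pull_add)

lemma exact12:
  assumes \<phi>: "\<phi> \<in> cocycles (lmod ideal) (s + 2) t" and Q: "Q2 s t \<phi> \<kappa>" and \<kappa>: "\<kappa> \<in> coboundaries (susp 16 B) s t"
  shows "\<exists>\<chi>\<in>cocycles (susp 6 M) (s + 2) t. \<exists>\<phi>'\<in>cocycles (lmod ideal) (s + 2) t. Q1 \<chi> \<phi>' \<and> \<phi> + \<phi>' \<in> W (s + 2) t"
proof -
  obtain \<tau> where \<tau>: "\<tau> \<in> W (s + 2) t" and b: "res (\<phi> + \<tau>) + inc \<kappa> \<in> coboundaries (lmod N4) (s + 2) t" using Q unfolding Q2_def by blast
  have "res (\<phi> + \<tau>) \<in> coboundaries (lmod N4) (s + 2) t" using coboundaries_cong[OF b] inc_coboundaries[OF \<kappa>] by blast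
  moreover have "\<phi> + \<tau> \<in> cocycles (lmod ideal) (s + 2) t" using \<phi> \<tau> W_sub by (intro cocycles_add) auto
  ultimately obtain \<chi> where \<chi>: "\<chi> \<in> cocycles (susp 6 M) (s + 2) t" "\<phi> + \<tau> + pull (lmod ideal) f \<chi> \<in> coboundaries (lmod ideal) (s + 2) t"
    using s1.exact_M by blast
  have "\<tau> + (\<phi> + \<tau> + pull (lmod ideal) f \<chi>) \<in> W (s + 2) t" by (rule W_add[OF \<tau> subsetD[OF W_B \<chi>(2)]])
  moreover have "\<tau> + (\<phi> + \<tau> + pull (lmod ideal) f \<chi>) = \<phi> + pull (lmod ideal) f \<chi>" by (simp add: add.left_commute[of \<tau>] add.assoc)
  ultimately show ?thesis using \<chi>(1) pull_cocycles[OF s1.M s1.N s1.p_hom \<chi>(1)] unfolding Q1_def by auto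
qed

lemma comp23:
  assumes \<phi>: "\<phi> \<in> cocycles (lmod ideal) (s + 2) t" and Q: "Q2 s t \<phi> \<kappa>" and Q': "Q3 \<kappa> \<chi>"
  shows "\<chi> \<in> coboundaries (susp 6 M) (s + 3) t"
proof -
  obtain \<tau> where \<tau>: "\<tau> \<in> W (s + 2) t" and b: "res (\<phi> + \<tau>) + inc \<kappa> \<in> coboundaries (lmod N4) (s + 2) t" using Q unfolding Q2_def by blast
  have "\<phi> + \<tau> \<in> cocycles (lmod ideal) (s + 2) t" using \<phi> \<tau> W_sub by (intro cocycles_add) auto
  then have "s1.delta (res (\<phi> + \<tau>)) \<in> coboundaries (susp 6 M) (s + 3) t" using s1.delta_i by (force simp: add.assoc)
  moreover have "s1.delta (res (\<phi> + \<tau>)) + s1.delta (inc \<kappa>) \<in> coboundaries (susp 6 M) (s + 3) t"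
    using s1.delta_coboundaries[OF b] by (simp add: s1.delta_add add.assoc)
  ultimately show ?thesis unfolding Q'[unfolded Q3_def] using coboundaries_cong by blast
qed

lemma exact23:
  assumes \<kappa>: "\<kappa> \<in> cocycles (susp 16 B) s t" and Q: "Q3 \<kappa> \<chi>" and \<chi>: "\<chi> \<in> coboundaries (susp 6 M) (s + 3) t"
  shows "\<exists>\<phi>\<in>cocycles (lmod ideal) (s + 2) t. \<exists>\<kappa>'\<in>cocycles (susp 16 B) s t. Q2 s t \<phi> \<kappa>' \<and> \<kappa> + \<kappa>' \<in> coboundaries (susp 16 B) s t"
proof -
  have "s1.delta (inc \<kappa>) \<in> coboundaries (susp 6 M) (s + 2 + 1) t" using Q \<chi> by (simp add: Q3_def add.assoc)
  from s1.exact_L[OF inc_cocycles[OF \<kappa>] this] obtain \<phi> where \<phi>: "\<phi> \<in> cocycles (lmod ideal) (s + 2) t" "res \<phi> = inc \<kappa>" by blast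
  have "Q2 s t \<phi> \<kappa>" unfolding Q2_def by (intro bexI[of _ 0]) (simp_all add: \<phi>(2))
  then show ?thesis using \<phi>(1) \<kappa> by (intro bexI[of _ \<phi>] bexI[of _ \<kappa>]) simp_all
qed

lemma comp31: "\<kappa> \<in> cocycles (susp 16 B) s t \<Longrightarrow> Q3 \<kappa> \<chi> \<Longrightarrow> Q1 \<chi> \<phi> \<Longrightarrow> \<phi> \<in> W (s + 3) t"
  using s1.p_delta[OF inc_cocycles, of \<kappa> s t] W_B by (auto simp: Q1_def Q3_def add.assoc)

lemma exact31:
  assumes \<chi>: "\<chi> \<in> cocycles (susp 6 M) (s + 3) t" and Q: "Q1 \<chi> \<phi>" and \<phi>: "\<phi> \<in> W (s + 3) t"
  shows "\<exists>\<kappa>\<in>cocycles (susp 16 B) s t. \<exists>\<chi>'\<in>cocycles (susp 6 M) (s + 3) t. Q3 \<kappa> \<chi>' \<and> \<chi> + \<chi>' \<in> coboundaries (susp 6 M) (s + 3) t"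
proof -
  \<comment> \<open>An element of \<open>W\<close> that restricts to 0 on N is a coboundary, by
    \<open>W_inc\<close> with \<open>\<kappa> = 0\<close>; so dividing by \<open>W\<close> adds
    nothing to the kernel of the map from the Ext of M.\<close>
  have "pull (lmod ideal) f \<chi> \<in> coboundaries (lmod ideal) (s + 1 + 2) t"
    by (rule W_inc(1)[of _ "s + 1" t 0]) (use \<phi> Q res_f[OF \<chi>] in \<open>simp_all add: Q1_def add.assoc\<close>)
  then have "pull (lmod ideal) f \<chi> \<in> coboundaries (lmod ideal) (s + 3) t" by (simp add: add.assoc)
  from s1.exact_N[OF \<chi> this] obtain \<psi> where \<psi>: "\<psi> \<in> cocycles (lmod N4) (s + 2) t"
    and b: "\<chi> + s1.delta \<psi> \<in> coboundaries (susp 6 M) (s + 3) t" by (auto simp: algebra_simps)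
  obtain \<tau> \<kappa> where \<tau>: "\<tau> \<in> W (s + 2) t" and \<kappa>: "\<kappa> \<in> cocycles (susp 16 B) s t"
    and d: "\<psi> + res \<tau> + inc \<kappa> \<in> coboundaries (lmod N4) (s + 2) t" using decompose[OF \<psi>] by blast
  have "s1.delta (\<psi> + res \<tau> + inc \<kappa>) \<in> coboundaries (susp 6 M) (s + 3) t"
    using s1.delta_coboundaries[OF d] by (simp add: add.assoc)
  \<comment> \<open>\<open>\<tau>\<close> lives on the ideal, so the connecting class of its
    restriction is trivial.\<close>
  moreover have "s1.delta (res \<tau>) \<in> coboundaries (susp 6 M) (s + 3) t"
    using s1.delta_i[of \<tau> "s + 2" t] \<tau> W_sub by (auto simp: add.assoc)
  ultimately have "\<chi> + s1.delta \<psi> + s1.delta (res \<tau>) + s1.delta (\<psi> + res \<tau> + inc \<kappa>) \<in> coboundaries (susp 6 M) (s + 3) t"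
    using coboundaries_add[OF coboundaries_add[OF b]] by blast
  moreover have "\<chi> + s1.delta \<psi> + s1.delta (res \<tau>) + s1.delta (\<psi> + res \<tau> + inc \<kappa>) = \<chi> + s1.delta (inc \<kappa>)"
    by (simp add: s1.delta_add add.assoc add.left_commute[of "s1.delta (res \<tau>)" "s1.delta \<psi>"])
  ultimately have "\<chi> + s1.delta (inc \<kappa>) \<in> coboundaries (susp 6 M) (s + 3) t" by simp
  moreover have "s1.delta (inc \<kappa>) \<in> cocycles (susp 6 M) (s + 3) t" using Q3_total[OF \<kappa>] by (auto simp: Q3_def)
  ultimately show ?thesis using \<kappa> unfolding Q3_def by blast
qed

end

section \<open>Groups of classes of cochains\<close>

text \<open>Homomorphisms between groups of classes are given by additive relations of representatives.\<close>

definition pres :: "('g, 'x) monoid_scheme \<Rightarrow> 'a cochain set \<Rightarrow> 'a cochain set \<Rightarrow> ('a cochain \<Rightarrow> 'g) \<Rightarrow> bool" where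
  "pres G Z R c \<longleftrightarrow> group G \<and> carrier G = c ` Z \<and>
     (\<forall>\<phi>\<in>Z. \<forall>\<psi>\<in>Z. \<phi> + \<psi> \<in> Z \<and> c (\<phi> + \<psi>) = c \<phi> \<otimes>\<^bsub>G\<^esub> c \<psi>) \<and> (\<forall>\<phi>\<in>Z. c \<phi> = \<one>\<^bsub>G\<^esub> \<longleftrightarrow> \<phi> \<in> R)"

lemma presD:
  assumes "pres G Z R c"
  shows "group G" "carrier G = c ` Z" "\<phi> \<in> Z \<Longrightarrow> c \<phi> \<in> carrier G" "\<phi> \<in> Z \<Longrightarrow> \<psi> \<in> Z \<Longrightarrow> \<phi> + \<psi> \<in> Z"
    "\<phi> \<in> Z \<Longrightarrow> \<psi> \<in> Z \<Longrightarrow> c (\<phi> + \<psi>) = c \<phi> \<otimes>\<^bsub>G\<^esub> c \<psi>" "\<phi> \<in> Z \<Longrightarrow> c \<phi> = \<one>\<^bsub>G\<^esub> \<longleftrightarrow> \<phi> \<in> R"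
  using assms unfolding pres_def by blast+

lemma pres_self:
  assumes p: "pres G Z R c" and "\<phi> \<in> Z"
  shows "c \<phi> \<otimes>\<^bsub>G\<^esub> c \<phi> = \<one>\<^bsub>G\<^esub>" "c 0 = \<one>\<^bsub>G\<^esub>" "0 \<in> Z" "0 \<in> R"
proof -
  interpret group G by (rule presD(1)[OF p])
  show z: "0 \<in> Z" using presD(4)[OF p assms(2) assms(2)] by simp
  have "c 0 \<otimes>\<^bsub>G\<^esub> c 0 = c 0" using presD(5)[OF p z z] by simp
  then show 1: "c 0 = \<one>\<^bsub>G\<^esub>" using presD(3)[OF p z] by (metis r_cancel_one')
  then show "0 \<in> R" using presD(6)[OF p z] by simp
  show "c \<phi> \<otimes>\<^bsub>G\<^esub> c \<phi> = \<one>\<^bsub>G\<^esub>" using presD(5)[OF p assms(2) assms(2)] 1 by simp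
qed

lemma pres_eq:
  assumes p: "pres G Z R c" and Z: "\<phi> \<in> Z" "\<psi> \<in> Z"
  shows "c \<phi> = c \<psi> \<longleftrightarrow> \<phi> + \<psi> \<in> R"
proof -
  interpret group G by (rule presD(1)[OF p])
  have "\<phi> + \<psi> \<in> R \<longleftrightarrow> c \<phi> \<otimes>\<^bsub>G\<^esub> c \<psi> = c \<psi> \<otimes>\<^bsub>G\<^esub> c \<psi>"
    unfolding presD(6)[OF p presD(4)[OF p Z], symmetric] presD(5)[OF p Z] pres_self(1)[OF p Z(2)] ..
  also have "\<dots> \<longleftrightarrow> c \<phi> = c \<psi>" using presD(3)[OF p] Z by (intro right_cancel) auto
  finally show ?thesis by blast
qed

lemma pres_comm:
  assumes p: "pres G Z R c"
  shows "comm_group G"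
proof (rule group.group_comm_groupI[OF presD(1)[OF p]])
  fix x y assume "x \<in> carrier G" "y \<in> carrier G"
  then obtain \<phi> \<psi> where "\<phi> \<in> Z" "x = c \<phi>" "\<psi> \<in> Z" "y = c \<psi>" using presD(2)[OF p] by blast
  then show "x \<otimes>\<^bsub>G\<^esub> y = y \<otimes>\<^bsub>G\<^esub> x" using presD(5)[OF p] by (metis add.commute)
qed

lemma pres_quot:
  assumes p: "pres G Z R c" and W: "subgroup W G"
  shows "pres (G Mod W) Z {\<phi> \<in> Z. c \<phi> \<in> W} (\<lambda>\<phi>. W #>\<^bsub>G\<^esub> c \<phi>)"
proof -
  interpret comm_group G by (rule pres_comm[OF p])
  have "W \<lhd> G"
    unfolding normal_inv_iff
  proof (intro conjI ballI W)
    fix x h assume x: "x \<in> carrier G" and h: "h \<in> W"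
    have hG: "h \<in> carrier G" using subgroup.mem_carrier[OF W h] .
    have "x \<otimes>\<^bsub>G\<^esub> h \<otimes>\<^bsub>G\<^esub> inv\<^bsub>G\<^esub> x = h \<otimes>\<^bsub>G\<^esub> (x \<otimes>\<^bsub>G\<^esub> inv\<^bsub>G\<^esub> x)" using x hG by (simp add: m_comm[of x h] m_assoc)
    then show "x \<otimes>\<^bsub>G\<^esub> h \<otimes>\<^bsub>G\<^esub> inv\<^bsub>G\<^esub> x \<in> W" using x hG h by simp
  qed
  then interpret W: normal W G .
  note cc = presD(3)[OF p]
  show ?thesis
    unfolding pres_def
  proof (intro conjI ballI)
    show "group (G Mod W)" by (rule W.factorgroup_is_group)
    show "carrier (G Mod W) = (\<lambda>\<phi>. W #>\<^bsub>G\<^esub> c \<phi>) ` Z"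
      using presD(2)[OF p] by (auto simp: FactGroup_def RCOSETS_def)
    fix \<phi> assume \<phi>: "\<phi> \<in> Z"
    show "(W #>\<^bsub>G\<^esub> c \<phi> = \<one>\<^bsub>G Mod W\<^esub>) = (\<phi> \<in> {\<phi> \<in> Z. c \<phi> \<in> W})"
      using coset_join1[of W "c \<phi>"] coset_join2[of "c \<phi>" W] W cc[OF \<phi>] \<phi> subgroup.subset[OF W] by (auto simp: FactGroup_def)
    fix \<psi> assume \<psi>: "\<psi> \<in> Z"
    show "\<phi> + \<psi> \<in> Z" by (rule presD(4)[OF p \<phi> \<psi>])
    show "W #>\<^bsub>G\<^esub> c (\<phi> + \<psi>) = (W #>\<^bsub>G\<^esub> c \<phi>) \<otimes>\<^bsub>G Mod W\<^esub> (W #>\<^bsub>G\<^esub> c \<psi>)"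
      using presD(5)[OF p \<phi> \<psi>] W.rcos_sum[OF cc[OF \<phi>] cc[OF \<psi>]] by (simp add: FactGroup_def)
  qed
qed

lemma pres_cocycle_group: "pres (cocycle_group M s t) (cocycles M s t) {0} (\<lambda>\<phi>. \<phi>)"
proof -
  have "group (cocycle_group M s t)"
  proof (rule groupI)
    fix \<phi> assume "\<phi> \<in> carrier (cocycle_group M s t)"
    then show "\<exists>\<psi>\<in>carrier (cocycle_group M s t). \<psi> \<otimes>\<^bsub>cocycle_group M s t\<^esub> \<phi> = \<one>\<^bsub>cocycle_group M s t\<^esub>"
      by (intro bexI[of _ \<phi>]) (simp_all add: cocycle_group_def)
  qed (simp_all add: cocycle_group_def cocycles_add add.assoc)
  then show ?thesis by (simp add: pres_def cocycles_add) (simp add: cocycle_group_def)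
qed

abbreviation cls :: "'a::ab_group_add gmod \<Rightarrow> int \<Rightarrow> int \<Rightarrow> 'a cochain \<Rightarrow> 'a cochain set" where
  "cls M s t \<phi> \<equiv> coboundaries M s t #>\<^bsub>cocycle_group M s t\<^esub> \<phi>"

lemma pres_Ext:
  assumes "A2_module M"
  shows "pres (Ext M s t) (cocycles M s t) (coboundaries M s t) (cls M s t)"
proof -
  interpret module M by unfold_locales (fact assms)
  note p = pres_cocycle_group[of M s t]
  interpret group "cocycle_group M s t" by (rule presD(1)[OF p])
  have inv: "inv\<^bsub>cocycle_group M s t\<^esub> \<phi> = \<phi>" if "\<phi> \<in> cocycles M s t" for \<phi>
    by (rule inv_equality) (use that in \<open>simp_all add: cocycle_group_def\<close>)
  have "subgroup (coboundaries M s t) (cocycle_group M s t)"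
  proof (rule subgroupI)
    show "coboundaries M s t \<subseteq> carrier (cocycle_group M s t)" using coboundaries_cocycles by (auto simp: cocycle_group_def)
    show "coboundaries M s t \<noteq> {}" using coboundaries_0 by blast
    show "inv\<^bsub>cocycle_group M s t\<^esub> \<phi> \<in> coboundaries M s t" if "\<phi> \<in> coboundaries M s t" for \<phi>
      using that inv[OF coboundaries_cocycles[OF that]] by simp
    show "\<phi> \<otimes>\<^bsub>cocycle_group M s t\<^esub> \<psi> \<in> coboundaries M s t" if "\<phi> \<in> coboundaries M s t" "\<psi> \<in> coboundaries M s t" for \<phi> \<psi>
      using coboundaries_add[OF that] by (simp add: cocycle_group_def)
  qed
  from pres_quot[OF p this] have "pres (Ext M s t) (cocycles M s t) {\<phi> \<in> cocycles M s t. \<phi> \<in> coboundaries M s t} (cls M s t)"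
    unfolding Ext_def .
  moreover have "{\<phi> \<in> cocycles M s t. \<phi> \<in> coboundaries M s t} = coboundaries M s t" using coboundaries_cocycles by blast
  ultimately show ?thesis by simp
qed

lemma h0_cls:
  assumes M: "A2_module M" and \<phi>: "\<phi> \<in> cocycles M s t"
    and h0Z: "\<And>\<psi>. \<psi> \<in> cocycles M s t \<Longrightarrow> h0_cochain \<psi> \<in> cocycles M (s + 1) (t + 1)"
    and h0B: "\<And>\<psi>. \<psi> \<in> coboundaries M s t \<Longrightarrow> h0_cochain \<psi> \<in> coboundaries M (s + 1) (t + 1)"
  shows "h0 M s t (cls M s t \<phi>) = cls M (s + 1) (t + 1) (h0_cochain \<phi>)"
proof -
  interpret module M by unfold_locales (fact M)
  note p = pres_Ext[OF M, of "s + 1" "t + 1"]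
  have "cls M (s + 1) (t + 1) (h0_cochain (\<beta> + \<phi>)) = cls M (s + 1) (t + 1) (h0_cochain \<phi>)" if \<beta>: "\<beta> \<in> coboundaries M s t" for \<beta>
  proof -
    have "\<beta> + \<phi> \<in> cocycles M s t" using cocycles_add[OF coboundaries_cocycles[OF \<beta>] \<phi>] .
    moreover have "h0_cochain (\<beta> + \<phi>) + h0_cochain \<phi> \<in> coboundaries M (s + 1) (t + 1)"
      using h0B[OF \<beta>] by (simp add: h0_cochain_add add.assoc)
    ultimately show ?thesis using pres_eq[OF p h0Z h0Z[OF \<phi>]] by blast
  qed
  moreover have "cls M s t \<phi> = (\<lambda>\<beta>. \<beta> + \<phi>) ` coboundaries M s t"
    by (auto simp: r_coset_def cocycle_group_def)
  moreover have "coboundaries M s t \<noteq> {}" using coboundaries_0 by blast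
  ultimately show ?thesis unfolding h0_def by auto
qed

definition realizes where
  "realizes Q G Z c G' Z' c' h \<longleftrightarrow> h \<in> hom G G' \<and> (\<forall>\<phi>\<in>Z. \<forall>\<psi>\<in>Z'. Q \<phi> \<psi> \<longrightarrow> h (c \<phi>) = c' \<psi>)"

lemma realizesD: "realizes Q G Z c G' Z' c' h \<Longrightarrow> \<phi> \<in> Z \<Longrightarrow> \<psi> \<in> Z' \<Longrightarrow> Q \<phi> \<psi> \<Longrightarrow> h (c \<phi>) = c' \<psi>"
  by (simp add: realizes_def)

lemma realizes_some: "\<exists>h. realizes Q G Z c G' Z' c' h \<Longrightarrow> realizes Q G Z c G' Z' c' (SOME h. realizes Q G Z c G' Z' c' h)"
  by (rule someI_ex[where P = "realizes Q G Z c G' Z' c'"])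

text \<open>Two representatives of one class have their sum in \<open>R\<close>, so additivity and
  \<open>ker\<close> place the sum of the related elements in \<open>R'\<close>: the choice does not
  matter.\<close>

lemma pres_hom:
  assumes p: "pres G Z R c" and p': "pres G' Z' R' c'"
    and tot: "\<And>\<phi>. \<phi> \<in> Z \<Longrightarrow> \<exists>\<psi>\<in>Z'. Q \<phi> \<psi>"
    and add: "\<And>\<phi> \<phi>' \<psi> \<psi>'. \<phi> \<in> Z \<Longrightarrow> \<phi>' \<in> Z \<Longrightarrow> \<psi> \<in> Z' \<Longrightarrow> \<psi>' \<in> Z' \<Longrightarrow> Q \<phi> \<psi> \<Longrightarrow> Q \<phi>' \<psi>' \<Longrightarrow> Q (\<phi> + \<phi>') (\<psi> + \<psi>')"
    and ker: "\<And>\<phi> \<psi>. \<phi> \<in> Z \<Longrightarrow> \<psi> \<in> Z' \<Longrightarrow> \<phi> \<in> R \<Longrightarrow> Q \<phi> \<psi> \<Longrightarrow> \<psi> \<in> R'"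
  shows "\<exists>h. realizes Q G Z c G' Z' c' h"
proof -
  have wd: "c' \<psi> = c' \<psi>'" if "\<phi> \<in> Z" "\<phi>' \<in> Z" "\<psi> \<in> Z'" "\<psi>' \<in> Z'" "Q \<phi> \<psi>" "Q \<phi>' \<psi>'" "c \<phi> = c \<phi>'" for \<phi> \<phi>' \<psi> \<psi>'
  proof -
    have "\<phi> + \<phi>' \<in> R" using pres_eq[OF p that(1,2)] that(7) by blast
    then have "\<psi> + \<psi>' \<in> R'" using ker add that presD(4)[OF p] presD(4)[OF p'] by metis
    then show ?thesis using pres_eq[OF p' that(3,4)] by blast
  qed
  define h where "h x = c' (SOME \<psi>. \<psi> \<in> Z' \<and> (\<exists>\<phi>\<in>Z. c \<phi> = x \<and> Q \<phi> \<psi>))" for x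
  have h: "h (c \<phi>) = c' \<psi>" if "\<phi> \<in> Z" "\<psi> \<in> Z'" "Q \<phi> \<psi>" for \<phi> \<psi>
  proof -
    have "\<exists>\<psi>. \<psi> \<in> Z' \<and> (\<exists>\<phi>'\<in>Z. c \<phi>' = c \<phi> \<and> Q \<phi>' \<psi>)" using that by blast
    from someI_ex[OF this] obtain \<phi>' where s: "\<phi>' \<in> Z" "c \<phi>' = c \<phi>"
      "Q \<phi>' (SOME \<psi>. \<psi> \<in> Z' \<and> (\<exists>\<phi>'\<in>Z. c \<phi>' = c \<phi> \<and> Q \<phi>' \<psi>))" "(SOME \<psi>. \<psi> \<in> Z' \<and> (\<exists>\<phi>'\<in>Z. c \<phi>' = c \<phi> \<and> Q \<phi>' \<psi>)) \<in> Z'" by blast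
    show ?thesis unfolding h_def by (rule wd[OF s(1) that(1) s(4) that(2) s(3) that(3) s(2)])
  qed
  have "h \<in> hom G G'"
  proof (rule homI)
    fix x assume "x \<in> carrier G"
    then obtain \<phi> \<psi> where "\<phi> \<in> Z" "x = c \<phi>" "\<psi> \<in> Z'" "Q \<phi> \<psi>" using presD(2)[OF p] tot by blast
    then show "h x \<in> carrier G'" using h presD(3)[OF p'] by metis
  next
    fix x y assume "x \<in> carrier G" "y \<in> carrier G"
    then obtain \<phi> \<psi> \<phi>' \<psi>' where *: "\<phi> \<in> Z" "x = c \<phi>" "\<psi> \<in> Z'" "Q \<phi> \<psi>" "\<phi>' \<in> Z" "y = c \<phi>'" "\<psi>' \<in> Z'" "Q \<phi>' \<psi>'"
      using presD(2)[OF p] tot by blast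
    then have "h (c (\<phi> + \<phi>')) = c' (\<psi> + \<psi>')" by (intro h add presD(4)[OF p] presD(4)[OF p'])
    then show "h (x \<otimes>\<^bsub>G\<^esub> y) = h x \<otimes>\<^bsub>G'\<^esub> h y" using * presD(5)[OF p] presD(5)[OF p'] h by metis
  qed
  then show ?thesis using h unfolding realizes_def by blast
qed

lemma exactI:
  assumes p1: "pres G1 Z1 R1 c1" and p2: "pres G2 Z2 R2 c2" and p3: "pres G3 Z3 R3 c3"
    and h1: "realizes Q1 G1 Z1 c1 G2 Z2 c2 h1" and h2: "realizes Q2 G2 Z2 c2 G3 Z3 c3 h2"
    and t1: "\<And>\<phi>. \<phi> \<in> Z1 \<Longrightarrow> \<exists>\<psi>\<in>Z2. Q1 \<phi> \<psi>" and t2: "\<And>\<phi>. \<phi> \<in> Z2 \<Longrightarrow> \<exists>\<psi>\<in>Z3. Q2 \<phi> \<psi>"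
    and cmp: "\<And>\<chi> \<phi> \<psi>. \<chi> \<in> Z1 \<Longrightarrow> \<phi> \<in> Z2 \<Longrightarrow> \<psi> \<in> Z3 \<Longrightarrow> Q1 \<chi> \<phi> \<Longrightarrow> Q2 \<phi> \<psi> \<Longrightarrow> \<psi> \<in> R3"
    and exa: "\<And>\<phi> \<psi>. \<phi> \<in> Z2 \<Longrightarrow> \<psi> \<in> Z3 \<Longrightarrow> Q2 \<phi> \<psi> \<Longrightarrow> \<psi> \<in> R3 \<Longrightarrow> \<exists>\<chi>\<in>Z1. \<exists>\<phi>'\<in>Z2. Q1 \<chi> \<phi>' \<and> \<phi> + \<phi>' \<in> R2"
  shows "h1 ` carrier G1 = kernel G2 G3 h2"
proof (intro equalityI subsetI)
  fix y assume "y \<in> h1 ` carrier G1"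
  then obtain \<chi> where \<chi>: "\<chi> \<in> Z1" "y = h1 (c1 \<chi>)" unfolding presD(2)[OF p1] by (elim imageE) simp
  obtain \<phi> where \<phi>: "\<phi> \<in> Z2" "Q1 \<chi> \<phi>" using t1[OF \<chi>(1)] by blast
  obtain \<psi> where \<psi>: "\<psi> \<in> Z3" "Q2 \<phi> \<psi>" using t2[OF \<phi>(1)] by blast
  have "y = c2 \<phi>" using realizesD[OF h1, OF \<chi>(1) \<phi>] \<chi>(2) by simp
  moreover have "h2 (c2 \<phi>) = c3 \<psi>" by (rule realizesD[OF h2, OF \<phi>(1) \<psi>])
  moreover have "c3 \<psi> = \<one>\<^bsub>G3\<^esub>" using cmp[OF \<chi>(1) \<phi>(1) \<psi>(1) \<phi>(2) \<psi>(2)] presD(6)[OF p3 \<psi>(1)] by simp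
  ultimately show "y \<in> kernel G2 G3 h2" using presD(3)[OF p2 \<phi>(1)] by (simp add: kernel_def)
next
  fix y assume "y \<in> kernel G2 G3 h2"
  then have "y \<in> c2 ` Z2" "h2 y = \<one>\<^bsub>G3\<^esub>" by (simp_all add: kernel_def presD(2)[OF p2])
  then obtain \<phi> where \<phi>: "\<phi> \<in> Z2" "y = c2 \<phi>" "h2 (c2 \<phi>) = \<one>\<^bsub>G3\<^esub>" by (elim imageE) simp
  obtain \<psi> where \<psi>: "\<psi> \<in> Z3" "Q2 \<phi> \<psi>" using t2[OF \<phi>(1)] by blast
  have "h2 (c2 \<phi>) = c3 \<psi>" by (rule realizesD[OF h2, OF \<phi>(1) \<psi>])
  then have "\<psi> \<in> R3" using presD(6)[OF p3 \<psi>(1)] \<phi>(3) by simp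
  from exa[OF \<phi>(1) \<psi> this] obtain \<chi> \<phi>' where *: "\<chi> \<in> Z1" "\<phi>' \<in> Z2" "Q1 \<chi> \<phi>'" "\<phi> + \<phi>' \<in> R2" by (elim bexE conjE)
  have "y = c2 \<phi>'" using pres_eq[OF p2 \<phi>(1) *(2)] *(4) \<phi>(2) by simp
  also have "\<dots> = h1 (c1 \<chi>)" by (rule realizesD[OF h1, OF *(1-3), symmetric])
  finally show "y \<in> h1 ` carrier G1" by (rule image_eqI[OF _ presD(3)[OF p1 *(1)]])
qed

lemma pres_two:
  assumes p: "pres G Z R c" and \<tau>: "\<tau> \<in> Z" "\<tau> \<notin> R" and d: "\<And>\<phi>. \<phi> \<in> Z \<Longrightarrow> \<phi> \<in> R \<or> \<phi> + \<tau> \<in> R"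
  shows "carrier G = {\<one>\<^bsub>G\<^esub>, c \<tau>}"
proof -
  interpret group G by (rule presD(1)[OF p])
  have "c \<phi> = \<one>\<^bsub>G\<^esub> \<or> c \<phi> = c \<tau>" if "\<phi> \<in> Z" for \<phi>
    using d[OF that] presD(6)[OF p that] pres_eq[OF p that \<tau>(1)] by blast
  then show ?thesis using presD(2)[OF p] presD(3)[OF p \<tau>(1)] by auto
qed

lemma pres_subgroup2:
  assumes p: "pres G Z R c" and \<tau>: "\<tau> \<in> Z" "\<tau> \<notin> R"
  shows "subgroup {\<one>\<^bsub>G\<^esub>, c \<tau>} G" "card {\<one>\<^bsub>G\<^esub>, c \<tau>} = 2"
proof -
  interpret group G by (rule presD(1)[OF p])
  have c: "c \<tau> \<in> carrier G" and s: "c \<tau> \<otimes>\<^bsub>G\<^esub> c \<tau> = \<one>\<^bsub>G\<^esub>" using presD(3)[OF p \<tau>(1)] pres_self(1)[OF p \<tau>(1)] .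
  have i: "inv\<^bsub>G\<^esub> (c \<tau>) = c \<tau>" by (rule inv_equality[OF s c c])
  show "subgroup {\<one>\<^bsub>G\<^esub>, c \<tau>} G" by (rule subgroupI) (use c s i in auto)
  have "c \<tau> \<noteq> \<one>\<^bsub>G\<^esub>" using presD(6)[OF p \<tau>(1)] \<tau>(2) by blast
  then show "card {\<one>\<^bsub>G\<^esub>, c \<tau>} = 2" by simp
qed

text \<open>By degrees the values on \<open>Sq 2\<close> and \<open>Sq 4\<close> vanish, and
  \<open>Sq 1\<close> can contribute only on the class of degree 4. This class is
  \<open>Sq 4\<close> of the bottom one, and the relation \<open>Sq 1 \<star> Sq 4 = Sq 2 \<star> Sq
  1 \<star> Sq 2 + Sq 4 \<star> Sq 1\<close> expresses the value through those on
  \<open>Sq 2\<close> and \<open>Sq 4\<close>.\<close>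

lemma M7_cocycles_1_11:
  assumes "is_M7 M"
  shows "cocycles (susp 6 M) 1 11 = {0}"
proof -
  obtain e where grM: "\<And>d. d \<in> {0, 4, 6, 7} \<Longrightarrow> gr M (int d) = {0, e d} \<and> e d \<noteq> 0"
    and triv: "\<And>n. n \<notin> {0, 4, 6, 7} \<Longrightarrow> gr M n = {0}"
    and act: "\<And>d n. d \<in> {0, 4, 6, 7} \<Longrightarrow> n \<in> {1, 2, 4} \<Longrightarrow> act M (Sq n) (e d) = (if (n, d) \<in> set M7_tab then e (d + n) else 0)"
    using M7_basis[OF assms] by metis
  interpret module M by unfold_locales (use assms in \<open>simp add: is_M7_def\<close>)
  have e0: "e 0 \<in> total M" using grM[of 0] by (intro gr_total[of _ _ 0]) auto
  have "\<chi> = 0" if \<chi>: "\<chi> \<in> cocycles (susp 6 M) 1 11" for \<chi>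
  proof -
    have co: "\<chi> \<in> cochains (susp 6 M) 1 11" and bd: "coboundary_map (susp 6 M) \<chi> = 0" using \<chi> by (simp_all add: cocycles_iff)
    have ml: "multilinear (susp 6 M) \<chi>" and c: "concentrated (susp 6 M) 11 \<chi>" and s: "supported (susp 6 M) 1 \<chi>"
      using co by (simp_all add: cochains_iff)
    have R: "\<chi> [a \<star> b] x = augmentation a * \<chi> [b] x + \<chi> [a] (act M b x)" if "a \<in> A2" "b \<in> A2" "x \<in> total M" for a b x
    proof -
      have "coboundary_map (susp 6 M) \<chi> [a, b] x = augmentation a * \<chi> [b] x + (\<chi> [a \<star> b] x + \<chi> [a] (act M b x))"
        using that by (simp add: coboundary_map_Cons)
      then have "\<chi> [a \<star> b] x + (augmentation a * \<chi> [b] x + \<chi> [a] (act M b x)) = 0" using bd by (simp add: zero_fun_apply ac_simps)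
      then show ?thesis by (metis bit_eq_iff_add)
    qed
    have add: "\<chi> [a] (x + y) = \<chi> [a] x + \<chi> [a] y" if "a \<in> A2" "x \<in> total M" "y \<in> total M" for a x y
      using multilinear_add[OF ml, of "[a]" x y] that by simp
    have slot: "\<chi> [a + b] x = \<chi> [a] x + \<chi> [b] x" if "a \<in> A2" "b \<in> A2" "x \<in> total M" for a b x
      using multilinear_slot[OF ml, of "[]" a b "[]" x] that by simp
    have z: "\<chi> [a] 0 = 0" if "a \<in> A2" for a using multilinear_0[OF ml, of "[a]"] that by simp
    have deg: "\<chi> [Sq k] y = 0 \<or> int k + n = 5" if "Sq k \<in> A2" "y \<in> gr M n" for k y n
    proof -
      have "y \<in> gr (susp 6 M) (n + 6)" using that by simp
      moreover have "list_all2 st_homogeneous [k] [Sq k]" by (simp add: Sq_homogeneous)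
      moreover have "set [Sq k] \<subseteq> A2" using that by simp
      ultimately have "\<not> \<chi> [Sq k] y \<noteq> 0 \<or> int (sum_list [k]) + (n + 6) = 11" using c unfolding concentrated_def by blast
      then show ?thesis by auto
    qed
    have g24: "\<chi> [Sq k] y = 0" if k: "k = 2 \<or> k = 4" and y: "y \<in> total M" for k y
    proof -
      have S: "Sq k \<in> A2" using k by auto
      from y show ?thesis
      proof (induction rule: total_induct)
        case (gr n y)
        show ?case
        proof (cases "int k + n = 5")
          case True
          then have "gr M n = {0}" using k by (intro triv) auto
          then show ?thesis using gr z[OF S] by simp
        next
          case False then show ?thesis using deg[OF S gr] by blast
        qed
      qed (simp add: add[OF S])
    qed
    have e4: "\<chi> [Sq 1] (e 4) = 0"
    proof -
      have "act M (Sq 4) (e 0) = e 4" using act[of 0 4] by (simp add: M7_tab_def)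
      then have "\<chi> [Sq 1] (e 4) = \<chi> [Sq 1 \<star> Sq 4] (e 0)" using R[of "Sq 1" "Sq 4" "e 0"] e0 by (simp add: augmentation_Sq)
      also have "\<dots> = \<chi> [Sq 2 \<star> (Sq 1 \<star> Sq 2)] (e 0) + \<chi> [Sq 4 \<star> Sq 1] (e 0)"
        unfolding Sq_relations(4) st_mult_assoc using e0 by (intro slot) auto
      also have "\<dots> = \<chi> [Sq 2] (act M (Sq 1 \<star> Sq 2) (e 0)) + \<chi> [Sq 4] (act M (Sq 1) (e 0))"
        using R[of "Sq 2" "Sq 1 \<star> Sq 2" "e 0"] R[of "Sq 4" "Sq 1" "e 0"] e0 by (simp add: augmentation_Sq)
      also have "\<dots> = 0" using g24 e0 by (simp add: act_total)
      finally show ?thesis .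
    qed
    have g1: "\<chi> [Sq 1] y = 0" if y: "y \<in> total M" for y
      using y
    proof (induction rule: total_induct)
      case (gr n y)
      show ?case
      proof (cases "n = 4")
        case True
        then have "y = 0 \<or> y = e 4" using gr grM[of 4] by simp
        then show ?thesis using e4 z[of "Sq 1"] by auto
      next
        case False then show ?thesis using deg[of 1 y n] gr by simp
      qed
    qed (simp add: add)
    have all: "\<chi> [a] x = 0" if "a \<in> A2" "x \<in> total M" for a x
      using that
    proof (induction arbitrary: x rule: A2_induct)
      case zero
      then show ?case using multilinear_slot_0[OF ml, of "[]" "[]" x] by simp
    next
      case unit
      then show ?case using R[of "Sq 0" "Sq 0" x] by (simp add: augmentation_Sq act_1)
    next
      case (Sq_mult n a)
      have "Sq n \<in> A2" "augmentation (Sq n) = 0" using Sq_mult(1) by (auto simp: augmentation_Sq)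
      moreover have "\<chi> [Sq n] (act M a x) = 0"
        using Sq_mult(1) g1 g24 act_total[OF Sq_mult(2) Sq_mult.prems] by auto
      ultimately show ?case using R[of "Sq n" a x] Sq_mult by simp
    next
      case (add a b)
      then show ?case by (simp add: slot)
    qed
    show "\<chi> = 0"
    proof (rule cochain_eqI[OF co cochains_0])
      fix as x assume as: "set as \<subseteq> A2" "x \<in> total (susp 6 M)"
      have "\<chi> as x = 0"
      proof (rule ccontr)
        assume nz: "\<chi> as x \<noteq> 0"
        then have "int (length as) = 1" using s unfolding supported_def by blast
        then obtain a where "as = [a]" by (auto simp: length_Suc_conv One_nat_def)
        then show False using nz all[of a x] as by simp
      qed
      then show "\<chi> as x = 0 as x" by (simp add: zero_fun_apply)
    qed
  qed
  then show ?thesis by auto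
qed

section \<open>The tower and the exact sequence\<close>

abbreviation "I_mod \<equiv> lmod ideal"

lemma I_mod: "A2_module I_mod"
  by (simp add: module_lmod)

lemmas pres_I = pres_Ext[OF I_mod]

lemma order_Ext_0_4: "order (Ext I_mod 0 4) = 2"
  if "\<And>\<phi>. \<phi> \<in> cocycles I_mod 0 4 \<Longrightarrow> \<phi> [] (Sq 4) = 0 \<Longrightarrow> \<phi> = 0"
proof -
  have nb: "e4 \<notin> coboundaries I_mod 0 4"
    using coboundaries_nonpositive[of 0 e4 I_mod 4] e4_Sq4 by (auto simp: zero_fun_apply)
  have "carrier (Ext I_mod 0 4) = {\<one>\<^bsub>Ext I_mod 0 4\<^esub>, cls I_mod 0 4 e4}"
  proof (rule pres_two[OF pres_I e4_cocycle nb])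
    fix \<phi> assume \<phi>: "\<phi> \<in> cocycles I_mod 0 4"
    have "\<phi> [] (Sq 4) = 0 \<or> (\<phi> + e4) [] (Sq 4) = 0" by (cases "\<phi> [] (Sq 4)") (simp_all add: plus_fun_apply e4_Sq4)
    then show "\<phi> \<in> coboundaries I_mod 0 4 \<or> \<phi> + e4 \<in> coboundaries I_mod 0 4"
      using that[OF \<phi>] that[OF cocycles_add[OF \<phi> e4_cocycle]] by auto
  qed
  then show ?thesis using pres_subgroup2(2)[OF pres_I e4_cocycle nb] by (simp add: order_def)
qed

definition T0 :: "nat \<Rightarrow> steenrod cochain set set" where
  "T0 j = {\<one>\<^bsub>Ext I_mod (1 + int j) (11 + int j)\<^esub>, cls I_mod (1 + int j) (11 + int j) (tower j)}"

lemma tower_not_coboundary: "tower j \<notin> coboundaries I_mod (1 + int j) (11 + int j)"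
  using det_coboundary[of ideal "tower j" "Suc j" "11 + int j"] det_tower[of j] z10(2) by auto

lemmas T0_subgroup = pres_subgroup2[OF pres_I tower_cocycles tower_not_coboundary, folded T0_def]

lemma T0_Suc: "T0 (Suc j) = h0 I_mod (1 + int j) (11 + int j) ` T0 j"
proof -
  let ?s = "1 + int j" and ?t = "11 + int j"
  note h = h0_cls[OF I_mod _ h0_cocycles[OF I_mod] h0_coboundaries[OF I_mod]]
  have st: "1 + int (Suc j) = ?s + 1" "11 + int (Suc j) = ?t + 1" by simp_all
  have "\<one>\<^bsub>Ext I_mod ?s ?t\<^esub> = cls I_mod ?s ?t 0" by (rule pres_self(2)[OF pres_I tower_cocycles, symmetric])
  moreover have "\<one>\<^bsub>Ext I_mod (?s + 1) (?t + 1)\<^esub> = cls I_mod (?s + 1) (?t + 1) 0"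
    by (rule pres_self(2)[OF pres_I h0_cocycles[OF I_mod tower_cocycles], symmetric])
  ultimately show ?thesis
    unfolding T0_def st by (simp only: image_insert image_empty h[OF cocycles_0] h[OF tower_cocycles] h0_0 tower.simps)
qed

lemma tower_T0: "h0_tower I_mod 1 11 T0"
  unfolding h0_tower_def using T0_subgroup T0_Suc by blast

text \<open>Each stage of a tower is the image of the preceding one under \<open>h0\<close>, so a
  tower is determined by its bottom group, which here must be the whole Ext group of order
  2.\<close>

lemma tower_unique:
  assumes c: "carrier (Ext I_mod 1 11) = T0 0" and T: "h0_tower I_mod 1 11 T"
  shows "T = T0"
proof
  fix j show "T j = T0 j"
  proof (induction j)
    case 0
    have "subgroup (T 0) (Ext I_mod (1 + int 0) (11 + int 0))" "card (T 0) = 2" using T unfolding h0_tower_def by blast+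
    then have "T 0 \<subseteq> T0 0" using subgroup.subset c by fastforce
    moreover have "card (T0 0) = 2" using T0_subgroup(2) .
    moreover have "finite (T0 0)" by (simp add: T0_def)
    ultimately show ?case using card_subset_eq \<open>card (T 0) = 2\<close> by metis
  next
    case (Suc j)
    have "T (Suc j) = h0 I_mod (1 + int j) (11 + int j) ` T j" using T unfolding h0_tower_def by blast
    then show ?case by (simp only: Suc T0_Suc)
  qed
qed

definition Wg :: "int \<Rightarrow> int \<Rightarrow> steenrod cochain set set" where
  "Wg s t = (if s = 0 \<and> t = 4 then carrier (Ext I_mod 0 4)
      else if 1 \<le> s \<and> t = s + 10 then T0 (nat (s - 1)) else {\<one>\<^bsub>Ext I_mod s t\<^esub>})"

lemma Wg_subgroup: "subgroup (Wg s t) (Ext I_mod s t)"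
proof -
  interpret group "Ext I_mod s t" by (rule presD(1)[OF pres_I])
  consider "s = 0 \<and> t = 4" | "1 \<le> s \<and> t = s + 10" | "\<not> (s = 0 \<and> t = 4)" "\<not> (1 \<le> s \<and> t = s + 10)" by blast
  then show ?thesis
  proof cases
    case 1 then show ?thesis using subgroup_self by (simp add: Wg_def)
  next
    case 2
    then have "s = 1 + int (nat (s - 1))" "t = 11 + int (nat (s - 1))" by simp_all
    then have "subgroup (T0 (nat (s - 1))) (Ext I_mod s t)" using T0_subgroup(1)[of "nat (s - 1)"] by simp
    then show ?thesis using 2 by (simp add: Wg_def)
  next
    case 3 show ?thesis unfolding Wg_def if_not_P[OF 3(1)] if_not_P[OF 3(2)] by (rule triv_subgroup)
  qed
qed

definition Wz :: "int \<Rightarrow> int \<Rightarrow> steenrod cochain set" where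
  "Wz s t = {\<phi> \<in> cocycles I_mod s t. cls I_mod s t \<phi> \<in> Wg s t}"

lemma Wz_trivial: "\<not> (s = 0 \<and> t = 4) \<Longrightarrow> \<not> (1 \<le> s \<and> t = s + 10) \<Longrightarrow> \<phi> \<in> Wz s t \<Longrightarrow> \<phi> \<in> coboundaries I_mod s t"
  using presD(6)[OF pres_I, of \<phi> s t] by (simp add: Wz_def Wg_def split: if_splits)

lemma Wz_tower:
  assumes "\<phi> \<in> Wz (1 + int j) (11 + int j)"
  shows "\<phi> \<in> coboundaries I_mod (1 + int j) (11 + int j) \<or> \<phi> + tower j \<in> coboundaries I_mod (1 + int j) (11 + int j)"
proof -
  have "Wg (1 + int j) (11 + int j) = T0 j" by (simp add: Wg_def)
  then have "\<phi> \<in> cocycles I_mod (1 + int j) (11 + int j)" "cls I_mod (1 + int j) (11 + int j) \<phi> \<in> T0 j" using assms by (simp_all add: Wz_def)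
  then show ?thesis using presD(6)[OF pres_I, of \<phi>] pres_eq[OF pres_I _ tower_cocycles, of \<phi> j] unfolding T0_def by blast
qed

lemma three_mod_Wz:
  assumes "three f M B i"
  shows "three_mod f M B i Wz"
proof -
  interpret three f M B i by (rule assms)
  show ?thesis
  proof
    fix s t \<phi> \<psi>
    interpret S: subgroup "Wg s t" "Ext I_mod s t" by (rule Wg_subgroup)
    show "Wz s t \<subseteq> cocycles I_mod s t" by (auto simp: Wz_def)
    show "coboundaries I_mod s t \<subseteq> Wz s t"
    proof
      fix \<phi> assume \<phi>: "\<phi> \<in> coboundaries I_mod s t"
      then have "\<phi> \<in> cocycles I_mod s t" by (rule module.coboundaries_cocycles[OF module_ideal])
      moreover from this have "cls I_mod s t \<phi> = \<one>\<^bsub>Ext I_mod s t\<^esub>" using presD(6)[OF pres_I, of \<phi> s t] \<phi> by blast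
      ultimately show "\<phi> \<in> Wz s t" using S.one_closed by (simp add: Wz_def)
    qed
    assume "\<phi> \<in> Wz s t" "\<psi> \<in> Wz s t"
    then show "\<phi> + \<psi> \<in> Wz s t" using presD(4,5)[OF pres_I, of \<phi> s t \<psi>] S.m_closed by (simp add: Wz_def)
  next
    fix \<phi> n t assume \<phi>: "\<phi> \<in> Wz (int n) t" and d: "det n \<phi> = 0"
    have Z: "\<phi> \<in> cocycles I_mod (int n) t" using \<phi> by (simp add: Wz_def)
    consider "n = 0" "t = 4" | m where "n = Suc m" "t = int n + 10" | "\<not> (int n = 0 \<and> t = 4)" "\<not> (1 \<le> int n \<and> t = int n + 10)"
      by (cases n) auto
    then show "\<phi> \<in> coboundaries I_mod (int n) t"
    proof cases
      case 1
      then have "\<phi> = 0" using ideal_0_4[of \<phi>] Z d by (simp add: det_def)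
      then show ?thesis by simp
    next
      case (2 m)
      then have st: "int n = 1 + int m" "t = 11 + int m" by simp_all
      \<comment> \<open>\<open>tower m\<close> has \<open>det\<close> 1, so a cocycle with
        \<open>det\<close> 0 cannot represent its class.\<close>
      have "\<phi> + tower m \<notin> coboundaries I_mod (int n) t"
      proof
        assume "\<phi> + tower m \<in> coboundaries I_mod (int n) t"
        then have "det n (\<phi> + tower m) = 0" by (intro det_coboundary[of ideal]) (simp_all add: z10(2))
        then show False using det_tower[of m] d by (simp add: det_add 2)
      qed
      then show ?thesis using Wz_tower[of \<phi> m] \<phi> unfolding st by blast
    next
      case 3 then show ?thesis using Wz_trivial \<phi> by blast
    qed
  next
    fix \<phi> n t assume \<phi>: "\<phi> \<in> cocycles (lmod N4) (int n) t" and d: "det n \<phi> = 1"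
    have t: "t = (if n = 0 then 4 else int n + 10)"
      by (rule det_degree[of N4 \<phi>]) (use \<phi> d z10(1) lid_self[of "Sq 4"] in \<open>simp_all add: cocycles_iff\<close>)
    show "\<exists>\<tau>\<in>Wz (int n) t. det n \<tau> = 1"
    proof (cases n)
      case 0
      have "cls I_mod 0 4 e4 \<in> carrier (Ext I_mod 0 4)" by (rule presD(3)[OF pres_I e4_cocycle])
      then have "e4 \<in> Wz 0 4" using e4_cocycle by (simp add: Wz_def Wg_def)
      then show ?thesis using e4_Sq4 by (intro bexI[of _ e4]) (simp_all add: det_def 0 t)
    next
      case (Suc m)
      then have st: "int n = 1 + int m" "t = 11 + int m" using t by simp_all
      have "Wg (1 + int m) (11 + int m) = T0 m" by (simp add: Wg_def)
      then have "tower m \<in> Wz (int n) t" unfolding st using tower_cocycles[of m] by (simp add: Wz_def T0_def)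
      then show ?thesis using det_tower[of m] Suc by blast
    qed
  qed
qed

text \<open>The order of the group in bidegree (0, 4) and the uniqueness of the tower justify
  speaking of the group and of the tower that are removed. The last equality joins the pieces for
  consecutive \<open>s\<close>, hence \<open>\<alpha> (s + 1) t\<close> in it.\<close>

theorem theorem4p9:
  fixes M7 :: "'m::ab_group_add gmod" and B :: "'b::ab_group_add gmod"
  assumes M7: "is_M7 M7" and B: "is_B B"
  shows "order (Ext ideal_module 0 4) = 2 \<and>
    (\<exists>!T. h0_tower ideal_module 1 11 T) \<and>
    (\<forall>T. h0_tower ideal_module 1 11 T \<longrightarrow>
      (\<exists>\<alpha> \<beta> \<gamma>. \<forall>s t :: int.
         \<alpha> s t \<in> hom (Ext (susp 6 M7) (s + 2) t) (Ext_tilde T (s + 2) t) \<and>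
         \<beta> s t \<in> hom (Ext_tilde T (s + 2) t) (Ext (susp 16 B) s t) \<and>
         \<gamma> s t \<in> hom (Ext (susp 16 B) s t) (Ext (susp 6 M7) (s + 3) t) \<and>
         \<alpha> s t ` carrier (Ext (susp 6 M7) (s + 2) t)
           = kernel (Ext_tilde T (s + 2) t) (Ext (susp 16 B) s t) (\<beta> s t) \<and>
         \<beta> s t ` carrier (Ext_tilde T (s + 2) t)
           = kernel (Ext (susp 16 B) s t) (Ext (susp 6 M7) (s + 3) t) (\<gamma> s t) \<and>
         \<gamma> s t ` carrier (Ext (susp 16 B) s t)
           = kernel (Ext (susp 6 M7) (s + 3) t) (Ext_tilde T (s + 3) t) (\<alpha> (s + 1) t)))"
proof -
  obtain f where f: "ses (lmod N4) (\<lambda>x. x) I_mod f (susp 6 M7)" using ses_M7[OF M7] by blast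
  obtain i where i: "ses (susp 16 B) i (susp 10 (lmod P1)) (\<lambda>x. x \<star> Sq 6) (susp 4 (lmod J7))" using ses_B[OF B] by blast
  have three: "three f M7 B i" by (intro three.intro f i ses_N)
  interpret three_mod f M7 B i Wz by (rule three_mod_Wz[OF three])
  have "carrier (Ext I_mod 1 11) = {\<one>\<^bsub>Ext I_mod 1 11\<^esub>, cls I_mod 1 11 (tower 0)}"
  proof (rule pres_two[OF pres_I])
    show "tower 0 \<in> cocycles I_mod 1 11" "tower 0 \<notin> coboundaries I_mod 1 11"
      using tower_cocycles[of 0] tower_not_coboundary[of 0] by simp_all
    fix \<phi> assume \<phi>: "\<phi> \<in> cocycles I_mod 1 11"
    have 1: "det 1 (tower 0) = 1" using det_tower[of 0] by (simp flip: One_nat_def)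
    \<comment> \<open>Adding the bottom class changes \<open>det\<close>, so one of the two cocycles
      has \<open>det\<close> 0 and is a coboundary.\<close>
    have "det 1 \<phi> = 0 \<or> det 1 (\<phi> + tower 0) = 0" unfolding det_add 1 by (cases "det 1 \<phi>") simp_all
    then show "\<phi> \<in> coboundaries I_mod 1 11 \<or> \<phi> + tower 0 \<in> coboundaries I_mod 1 11"
      using ideal_1_11[OF M7_cocycles_1_11[OF M7]] \<phi> cocycles_add[OF \<phi>] tower_cocycles[of 0] by auto
  qed
  then have c: "carrier (Ext I_mod 1 11) = T0 0" by (simp add: T0_def)
  have uniq: "T = T0" if "h0_tower ideal_module 1 11 T" for T
    using tower_unique[OF c] that by (simp add: ideal_module_eq)
  let ?X = "susp 6 M7" and ?K = "susp 16 B" and ?E = "Ext_tilde T0" and ?c = "\<lambda>s t \<phi>. Wg s t #>\<^bsub>Ext I_mod s t\<^esub> cls I_mod s t \<phi>"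
  have pE: "pres (?E s t) (cocycles I_mod s t) (Wz s t) (?c s t)" for s t
    using pres_quot[OF pres_I Wg_subgroup, of s t] by (simp only: Ext_tilde_def ideal_module_eq Wg_def Wz_def)
  have pX: "pres (Ext ?X s t) (cocycles ?X s t) (coboundaries ?X s t) (cls ?X s t)" for s t by (rule pres_Ext[OF s1.N])
  have pK: "pres (Ext ?K s t) (cocycles ?K s t) (coboundaries ?K s t) (cls ?K s t)" for s t by (rule pres_Ext[OF s3.L])
  define \<alpha> where "\<alpha> s t = (SOME h. realizes Q1 (Ext ?X s t) (cocycles ?X s t) (cls ?X s t) (?E s t) (cocycles I_mod s t) (?c s t) h)" for s t
  define \<beta> where "\<beta> s t = (SOME h. realizes (Q2 s t) (?E (s + 2) t) (cocycles I_mod (s + 2) t) (?c (s + 2) t) (Ext ?K s t) (cocycles ?K s t) (cls ?K s t) h)" for s t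
  define \<gamma> where "\<gamma> s t = (SOME h. realizes Q3 (Ext ?K s t) (cocycles ?K s t) (cls ?K s t) (Ext ?X (s + 3) t) (cocycles ?X (s + 3) t) (cls ?X (s + 3) t) h)" for s t
  have \<alpha>: "realizes Q1 (Ext ?X s t) (cocycles ?X s t) (cls ?X s t) (?E s t) (cocycles I_mod s t) (?c s t) (\<alpha> s t)" for s t
    unfolding \<alpha>_def by (rule realizes_some, rule pres_hom[OF pX pE]) (blast intro: Q1_total Q1_add Q1_ker)+
  have \<beta>: "realizes (Q2 s t) (?E (s + 2) t) (cocycles I_mod (s + 2) t) (?c (s + 2) t) (Ext ?K s t) (cocycles ?K s t) (cls ?K s t) (\<beta> s t)" for s t
    unfolding \<beta>_def by (rule realizes_some, rule pres_hom[OF pE pK]) (blast intro: Q2_total Q2_add Q2_ker)+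
  have \<gamma>: "realizes Q3 (Ext ?K s t) (cocycles ?K s t) (cls ?K s t) (Ext ?X (s + 3) t) (cocycles ?X (s + 3) t) (cls ?X (s + 3) t) (\<gamma> s t)" for s t
    unfolding \<gamma>_def by (rule realizes_some, rule pres_hom[OF pK pX]) (blast intro: Q3_total Q3_add Q3_ker)+
  have 12: "\<alpha> (s + 2) t ` carrier (Ext ?X (s + 2) t) = kernel (?E (s + 2) t) (Ext ?K s t) (\<beta> s t)" for s t
    by (rule exactI[OF pX pE pK \<alpha> \<beta> Q1_total Q2_total]) (use comp12 exact12 in blast)+
  have 23: "\<beta> s t ` carrier (?E (s + 2) t) = kernel (Ext ?K s t) (Ext ?X (s + 3) t) (\<gamma> s t)" for s t
    by (rule exactI[OF pE pK pX \<beta> \<gamma> Q2_total Q3_total]) (use comp23 exact23 in blast)+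
  have 31: "\<gamma> s t ` carrier (Ext ?K s t) = kernel (Ext ?X (s + 3) t) (?E (s + 3) t) (\<alpha> (s + 3) t)" for s t
    by (rule exactI[OF pK pX pE \<gamma> \<alpha> Q3_total Q1_total]) (use comp31 exact31 in blast)+
  have hom: "\<alpha> (s + 2) t \<in> hom (Ext ?X (s + 2) t) (?E (s + 2) t)" "\<beta> s t \<in> hom (?E (s + 2) t) (Ext ?K s t)"
    "\<gamma> s t \<in> hom (Ext ?K s t) (Ext ?X (s + 3) t)" for s t
    using \<alpha>[of "s + 2" t] \<beta>[of s t] \<gamma>[of s t] unfolding realizes_def by blast+
  have s3: "s + 1 + 2 = s + 3" for s :: int by simp
  have "order (Ext ideal_module 0 4) = 2"
    unfolding ideal_module_eq by (rule order_Ext_0_4[OF ideal_0_4])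
  moreover have "\<exists>!T. h0_tower ideal_module 1 11 T"
    using tower_T0 uniq unfolding ideal_module_eq by blast
  moreover have "\<exists>\<alpha> \<beta> \<gamma>. \<forall>s t :: int.
         \<alpha> s t \<in> hom (Ext ?X (s + 2) t) (?E (s + 2) t) \<and>
         \<beta> s t \<in> hom (?E (s + 2) t) (Ext ?K s t) \<and>
         \<gamma> s t \<in> hom (Ext ?K s t) (Ext ?X (s + 3) t) \<and>
         \<alpha> s t ` carrier (Ext ?X (s + 2) t) = kernel (?E (s + 2) t) (Ext ?K s t) (\<beta> s t) \<and>
         \<beta> s t ` carrier (?E (s + 2) t) = kernel (Ext ?K s t) (Ext ?X (s + 3) t) (\<gamma> s t) \<and>
         \<gamma> s t ` carrier (Ext ?K s t) = kernel (Ext ?X (s + 3) t) (?E (s + 3) t) (\<alpha> (s + 1) t)"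
    \<comment> \<open>So far \<open>\<alpha>\<close> has been indexed by the filtration of its own
      source; the statement indexes all maps by that of the Ext of B, hence the shift by 2.\<close>
    by (rule exI[of _ "\<lambda>s t. \<alpha> (s + 2) t"], rule exI[of _ \<beta>], rule exI[of _ \<gamma>]) (simp only: s3 hom 12 23 31 simp_thms)
  ultimately show ?thesis using uniq by (metis (no_types, lifting))
qed

end
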